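(* Let $(M^n,g)$ be an oriented Riemannian manifold of dimension $n\ge 3$, let $k\ge 1$, let $EM\to M$ be the Euclidean vector bundle associated to an $\mathrm{SO}(n)$-representation $E$ with invariant scalar product, and let $\nabla^E$ be any metric connection on $EM$. Then the following identity of operators holds on sections of $\mathrm{Sym}^k_0\,\mathrm{T}M\otimes EM$: $$q(R)^E=-\frac{k}{k+1}\,\mathrm{D}_0^*\mathrm{D}_0+\frac{(n+k-2)(n+2k-4)}{(n+2k-2)(n+k-3)}\,\mathrm{D}_0\mathrm{D}_0^*+(P_3^E)^*P_3^E .$$ Here, in the first term on the right, $\mathrm{D}_0:C^\infty(M,\mathrm{Sym}^k_0\mathrm{T}M\otimes EM)\to C^\infty(M,\mathrm{Sym}^{k+1}_0\mathrm{T}M\otimes EM)$ and $\mathrm{D}_0^*$ is its formal adjoint; in the second term, $\mathrm{D}_0:C^\infty(M,\mathrm{Sym}^{k-1}_0\mathrm{T}M\otimes EM)\to C^\infty(M,\mathrm{Sym}^{k}_0\mathrm{T}M\otimes EM)$ and $\mathrm{D}_0^*$ is its formal adjoint.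
   Context: Symmetric tensors. $\mathrm{T}=\mathbb{R}^n$ with standard scalar product $g$; $\mathrm{Sym}^k\mathrm{T}\subset \mathrm{T}^{\otimes k}$ is spanned by $v_1\cdot\ldots\cdot v_k:=\sum_{\sigma\in S_k}v_{\sigma(1)}\otimes\ldots\otimes v_{\sigma(k)}$ (no factor $1/k!$), which makes $\bigoplus_k\mathrm{Sym}^k\mathrm{T}$ a commutative graded algebra. The scalar product on $\mathrm{Sym}^k\mathrm{T}$ is $g(v_1\cdot\ldots\cdot v_k,w_1\cdot\ldots\cdot w_k)=\sum_{\sigma\in S_k}g(v_1,w_{\sigma(1)})\cdots g(v_k,w_{\sigma(k)})$. For $v\in\mathrm{T}$, $v\lrcorner:\mathrm{Sym}^{k+1}\mathrm{T}\to\mathrm{Sym}^k\mathrm{T}$ is the metric adjoint of $K\mapsto v\cdot K$ (so $v\lrcorner u^k=k\,g(v,u)u^{k-1}$). With $(\mathbf{e}_i)$ an orthonormal basis, $\mathrm{L}:=\sum_i\mathbf{e}_i\cdot\mathbf{e}_i$ also denotes multiplication by this tensor, and $\Lambda K:=\sum_i\mathbf{e}_i\lrcorner\mathbf{e}_i\lrcorner K$. $\mathrm{Sym}^k_0\mathrm{T}:=\ker(\Lambda:\mathrm{Sym}^k\mathrm{T}\to\mathrm{Sym}^{k-2}\mathrm{T})$ are the trace-free tensors, and $(\cdot)_0$ is the orthogonal projection $\mathrm{Sym}^k\mathrm{T}\to\mathrm{Sym}^k_0\mathrm{T}$; for $K\in\mathrm{Sym}^k_0\mathrm{T}$, $(v\cdot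 K)_0=v\cdot K-\frac{1}{n+2k-2}\mathrm{L}(v\lrcorner K)$. All these notions extend fibrewise to bundles over $M$; $\nabla$ is the Levi-Civita connection and $(\mathbf{e}_i)$ a local orthonormal frame. Operators. $\nabla^E$ also denotes the tensor product connection on $\mathrm{Sym}^k_0\mathrm{T}M\otimes EM$ built from $\nabla$ and $\nabla^E$. For $K$ a section of $\mathrm{Sym}^k_0\mathrm{T}M$ and $\xi$ a section of $EM$, $\mathrm{D}_0(K\otimes\xi):=\sum_i(\mathbf{e}_i\cdot\nabla_{\mathbf{e}_i}K)_0\otimes\xi+\sum_i(\mathbf{e}_i\cdot K)_0\otimes\nabla^E_{\mathbf{e}_i}\xi$. Projections. For $V=\mathrm{Sym}^k_0\mathrm{T}$ define $\mathrm{q}_1:\mathrm{T}\otimes\mathrm{Sym}^k_0\mathrm{T}\to\mathrm{Sym}^{k+1}_0\mathrm{T}$, $\mathrm{q}_1(v\otimes K)=(v\cdot K)_0$, and $\mathrm{q}_2:\mathrm{T}\otimes\mathrm{Sym}^k_0\mathrm{T}\to\mathrm{Sym}^{k-1}_0\mathrm{T}$, $\mathrm{q}_2(v\otimes K)=v\lrcorner K$. With metric adjoints $\mathrm{q}_1^*,\mathrm{q}_2^*$, the maps $\mathrm{p}_1=\frac1{k+1}\mathrm{q}_1^*\mathrm{q}_1$ and $\mathrm{p}_2=\frac{n+2k-4}{(n+2k-2)(n+k-3)}\mathrm{q}_2^*\mathrm{q}_2$ are the orthogonal projections of $\mathrm{T}\otimes\mathrm{Sym}^k_0\mathrm{T}$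 onto its subspaces isomorphic to $\mathrm{Sym}^{k+1}_0\mathrm{T}$ and $\mathrm{Sym}^{k-1}_0\mathrm{T}$, and $\mathrm{p}_3:=\mathrm{id}-\mathrm{p}_1-\mathrm{p}_2$. The operator $P_3^E:C^\infty(M,\mathrm{Sym}^k_0\mathrm{T}M\otimes EM)\to C^\infty(M,\mathrm{T}M\otimes\mathrm{Sym}^k_0\mathrm{T}M\otimes EM)$ is $P_3^E:=(\mathrm{p}_3\otimes\mathrm{id}_E)\nabla^E$, and $(P_3^E)^*$ is its formal adjoint. Curvature. $R_{X,Y}=\nabla^2_{X,Y}-\nabla^2_{Y,X}$, where $\nabla^2_{X,Y}=\nabla_X\nabla_Y-\nabla_{\nabla_XY}$, and $R^E_{X,Y}$ is the curvature of $\nabla^E$ with the same sign convention. $(X\wedge Y)_*$ is the action of $X\wedge Y\in\Lambda^2\mathrm{T}M\cong\mathfrak{so}(\mathrm{T}M)$: on $\mathrm{T}M$, $(X\wedge Y)_*Z=g(X,Z)Y-g(Y,Z)X$, extended as a derivation to $\mathrm{Sym}^k\mathrm{T}M$, i.e. $(X\wedge Y)_*K=Y\cdot(X\lrcorner K)-X\cdot(Y\lrcorner K)$. The curvature endomorphism on $\mathrm{Sym}^k\mathrm{T}M$ is $q(R)K=\frac12\sum_{i,j}(\mathbf{e}_i\wedge\mathbf{e}_j)_*R_{\mathbf{e}_i,\mathbf{e}_j}K$, where $R_{\mathbf{e}_i,\mathbf{e}_j}$ acts on $\mathrm{Sym}^k\mathrm{T}M$ as a derivation (the curvature operator $\Lambda^2\mathrm{T}M\to\Lambda^2\mathrm{T}M$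 is normalized so that it equals $-\mathrm{id}$ on the standard sphere). The twisted curvature endomorphism $q(R)^E$ on $\mathrm{Sym}^k_0\mathrm{T}M\otimes EM$ is defined on decomposable elements by $$q(R)^E(K\otimes\xi):=(q(R)K)\otimes\xi+\frac12\sum_{i,j}(\mathbf{e}_i\wedge\mathbf{e}_j)_*K\otimes R^E_{\mathbf{e}_i,\mathbf{e}_j}\xi .$$ *)

theory Defs
  imports "HOL-Analysis.Analysis" "HOL-Combinatorics.Combinatorics"
begin

section \<open>Smooth functions and oriented smooth manifolds\<close>

primrec C_on :: "nat \<Rightarrow> 'a::real_normed_vector set \<Rightarrow> ('a \<Rightarrow> 'b::real_normed_vector) \<Rightarrow> bool" where
  "C_on 0 S f \<longleftrightarrow> continuous_on S f"
| "C_on (Suc r) S f \<longleftrightarrow>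
     (\<forall>x\<in>S. f differentiable (at x)) \<and> (\<forall>v. C_on r S (\<lambda>x. frechet_derivative f (at x) v))"

text \<open>Only used for open sets in finite-dimensional spaces.\<close>
definition smooth_on :: "'a::real_normed_vector set \<Rightarrow> ('a \<Rightarrow> 'b::real_normed_vector) \<Rightarrow> bool" where
  "smooth_on S f \<longleftrightarrow> (\<forall>r. C_on r S f)"

text \<open>The manifold \<open>M\<close> is the whole type \<open>'m\<close>; its dimension is \<open>CARD('n)\<close>.\<close>
type_synonym ('m, 'n) chart = "'m set \<times> ('m \<Rightarrow> real ^ 'n)"

definition oriented_atlas :: "('m::{t2_space, second_countable_topology}, 'n::finite) chart set \<Rightarrow> bool" where
  "oriented_atlas A \<longleftrightarrow>
     (\<Union>(U, \<phi>)\<in>A. U) = UNIV \<and>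
     (\<forall>(U, \<phi>)\<in>A. open U \<and> open (\<phi> ` U) \<and> homeomorphism U (\<phi> ` U) \<phi> (inv_into U \<phi>)) \<and>
     (\<forall>(U, \<phi>)\<in>A. \<forall>(V, \<psi>)\<in>A.
        smooth_on (\<phi> ` (U \<inter> V)) (\<psi> \<circ> inv_into U \<phi>) \<and>
        (\<forall>x\<in>\<phi> ` (U \<inter> V). det (matrix (frechet_derivative (\<psi> \<circ> inv_into U \<phi>) (at x))) > 0))"

definition smooth_fun :: "('m::topological_space, 'n::finite) chart set \<Rightarrow> 'm set
    \<Rightarrow> ('m \<Rightarrow> 'b::real_normed_vector) \<Rightarrow> bool" where
  "smooth_fun A U h \<longleftrightarrow> open U \<and> (\<forall>(V, \<phi>)\<in>A. smooth_on (\<phi> ` (U \<inter> V)) (h \<circ> inv_into V \<phi>))"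

definition smooth_near :: "('m::topological_space, 'n::finite) chart set \<Rightarrow> 'm
    \<Rightarrow> ('m \<Rightarrow> real) \<Rightarrow> bool" where
  "smooth_near A p h \<longleftrightarrow> (\<exists>U. p \<in> U \<and> smooth_fun A U h)"

text \<open>A tangent vector at \<open>p\<close> is the directional derivative it defines on the functions that are
  smooth near \<open>p\<close>; it is set to \<open>0\<close> on all other functions, so that tangent vectors are equal iff
  they agree as functionals. Linear combinations of tangent vectors are taken pointwise.\<close>
type_synonym 'm tvec = "('m \<Rightarrow> real) \<Rightarrow> real"

fun chart_tvec :: "('m::topological_space, 'n::finite) chart set \<Rightarrow> ('m, 'n) chart \<Rightarrow> 'm
    \<Rightarrow> real ^ 'n \<Rightarrow> 'm tvec" where
  "chart_tvec A (U, \<phi>) p w = (\<lambda>h. if smooth_near A p h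
      then frechet_derivative (h \<circ> inv_into U \<phi>) (at (\<phi> p)) w else 0)"

definition tangent_space :: "('m::topological_space, 'n::finite) chart set \<Rightarrow> 'm \<Rightarrow> 'm tvec set" where
  "tangent_space A p = {chart_tvec A c p w | c w. c \<in> A \<and> p \<in> fst c}"

text \<open>Fields and sections over an open set \<open>U\<close> are total functions whose values outside \<open>U\<close> are
  irrelevant.\<close>
definition smooth_vfield :: "('m::topological_space, 'n::finite) chart set \<Rightarrow> 'm set
    \<Rightarrow> ('m \<Rightarrow> 'm tvec) \<Rightarrow> bool" where
  "smooth_vfield A U X \<longleftrightarrow> open U \<and> (\<forall>p\<in>U. X p \<in> tangent_space A p) \<and>
     (\<forall>V h. V \<subseteq> U \<longrightarrow> smooth_fun A V h \<longrightarrow> smooth_fun A V (\<lambda>q. X q h))"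


section \<open>Riemannian metric, volume, Levi-Civita connection\<close>

definition riemannian_metric :: "('m::topological_space, 'n::finite) chart set
    \<Rightarrow> ('m \<Rightarrow> 'm tvec \<Rightarrow> 'm tvec \<Rightarrow> real) \<Rightarrow> bool" where
  "riemannian_metric A g \<longleftrightarrow>
     (\<forall>p. \<forall>u\<in>tangent_space A p. \<forall>v\<in>tangent_space A p.
        g p u v = g p v u \<and> (u \<noteq> (\<lambda>h. 0) \<longrightarrow> g p u u > 0) \<and>
        (\<forall>w\<in>tangent_space A p. \<forall>a b. g p (\<lambda>h. a * u h + b * v h) w = a * g p u w + b * g p v w)) \<and>
     (\<forall>U X Y. smooth_vfield A U X \<longrightarrow> smooth_vfield A U Y \<longrightarrow>
        smooth_fun A U (\<lambda>q. g q (X q) (Y q)))"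

definition gram_matrix :: "('m::topological_space, 'n::finite) chart set
    \<Rightarrow> ('m \<Rightarrow> 'm tvec \<Rightarrow> 'm tvec \<Rightarrow> real) \<Rightarrow> ('m, 'n) chart \<Rightarrow> 'm \<Rightarrow> real ^ 'n ^ 'n" where
  "gram_matrix A g c p = (\<chi> i j. g p (chart_tvec A c p (axis i 1)) (chart_tvec A c p (axis j 1)))"

definition riemannian_volume :: "('m::topological_space, 'n::finite) chart set
    \<Rightarrow> ('m \<Rightarrow> 'm tvec \<Rightarrow> 'm tvec \<Rightarrow> real) \<Rightarrow> 'm measure \<Rightarrow> bool" where
  "riemannian_volume A g \<mu> \<longleftrightarrow> sets \<mu> = sets borel \<and>
     (\<forall>(U, \<phi>)\<in>A. \<forall>B\<in>sets borel. B \<subseteq> U \<longrightarrow>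
        emeasure \<mu> B = (\<integral>\<^sup>+ x \<in> \<phi> ` B.
          ennreal (sqrt (det (gram_matrix A g (U, \<phi>) (inv_into U \<phi> x)))) \<partial>lborel))"

text \<open>Metric connection on a Euclidean vector bundle whose fibre elements are functions
  \<open>'x \<Rightarrow> 'r\<close> (with pointwise linear structure), with fibre scalar products \<open>ip p\<close> and smooth local
  sections \<open>Sec U\<close>. The value \<open>nab p v \<xi>\<close> is \<open>\<nabla>\<^sub>v \<xi>\<close>, for \<open>v\<close> tangent at \<open>p\<close> and \<open>\<xi>\<close> a smooth section
  over a neighbourhood of \<open>p\<close>. Locality in \<open>\<xi>\<close> is a consequence of the Leibniz rule.\<close>
definition metric_connection :: "('m::topological_space, 'n::finite) chart set
    \<Rightarrow> ('m set \<Rightarrow> ('m \<Rightarrow> 'x \<Rightarrow> 'r::real_vector) \<Rightarrow> bool)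
    \<Rightarrow> ('m \<Rightarrow> ('x \<Rightarrow> 'r) \<Rightarrow> ('x \<Rightarrow> 'r) \<Rightarrow> real)
    \<Rightarrow> ('m \<Rightarrow> 'm tvec \<Rightarrow> ('m \<Rightarrow> 'x \<Rightarrow> 'r) \<Rightarrow> 'x \<Rightarrow> 'r) \<Rightarrow> bool" where
  "metric_connection A Sec ip nab \<longleftrightarrow>
     (\<forall>U p \<xi> \<eta> h u v a b. open U \<longrightarrow> p \<in> U \<longrightarrow> Sec U \<xi> \<longrightarrow> Sec U \<eta> \<longrightarrow> smooth_fun A U h \<longrightarrow>
        u \<in> tangent_space A p \<longrightarrow> v \<in> tangent_space A p \<longrightarrow>
          nab p (\<lambda>k. a * u k + b * v k) \<xi> = (\<lambda>x. a *\<^sub>R nab p u \<xi> x + b *\<^sub>R nab p v \<xi> x) \<and>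
          nab p v (\<lambda>q x. \<xi> q x + \<eta> q x) = (\<lambda>x. nab p v \<xi> x + nab p v \<eta> x) \<and>
          nab p v (\<lambda>q x. h q *\<^sub>R \<xi> q x) = (\<lambda>x. v h *\<^sub>R \<xi> p x + h p *\<^sub>R nab p v \<xi> x) \<and>
          v (\<lambda>q. ip q (\<xi> q) (\<eta> q)) = ip p (nab p v \<xi>) (\<eta> p) + ip p (\<xi> p) (nab p v \<eta>)) \<and>
     (\<forall>U X \<xi>. smooth_vfield A U X \<longrightarrow> Sec U \<xi> \<longrightarrow> Sec U (\<lambda>q. nab q (X q) \<xi>))"

definition levi_civita :: "('m::topological_space, 'n::finite) chart set
    \<Rightarrow> ('m \<Rightarrow> 'm tvec \<Rightarrow> 'm tvec \<Rightarrow> real) \<Rightarrow> ('m \<Rightarrow> 'm tvec \<Rightarrow> ('m \<Rightarrow> 'm tvec) \<Rightarrow> 'm tvec) \<Rightarrow> bool" where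
  "levi_civita A g nab \<longleftrightarrow>
     metric_connection A (smooth_vfield A) g nab \<and>
     (\<forall>U X Y p h. smooth_vfield A U X \<longrightarrow> smooth_vfield A U Y \<longrightarrow> p \<in> U \<longrightarrow> smooth_fun A U h \<longrightarrow>
        nab p (X p) Y h - nab p (Y p) X h = X p (\<lambda>q. Y q h) - Y p (\<lambda>q. X q h))"

record ('m, 'n) oriented_riemannian_data =
  charts :: "('m, 'n) chart set"
  metric :: "'m \<Rightarrow> 'm tvec \<Rightarrow> 'm tvec \<Rightarrow> real"
  volume :: "'m measure"
  nabla :: "'m \<Rightarrow> 'm tvec \<Rightarrow> ('m \<Rightarrow> 'm tvec) \<Rightarrow> 'm tvec"

definition oriented_riemannian_manifold ::
    "('m::{t2_space, second_countable_topology}, 'n::finite) oriented_riemannian_data \<Rightarrow> bool" where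
  "oriented_riemannian_manifold M \<longleftrightarrow>
     oriented_atlas (charts M) \<and> riemannian_metric (charts M) (metric M) \<and>
     riemannian_volume (charts M) (metric M) (volume M) \<and>
     levi_civita (charts M) (metric M) (nabla M)"


section \<open>The bundle of oriented orthonormal frames\<close>

type_synonym ('m, 'n) frame = "'n \<Rightarrow> 'm tvec"

definition SO_frames :: "('m::topological_space, 'n::finite) oriented_riemannian_data \<Rightarrow> 'm
    \<Rightarrow> ('m, 'n) frame set" where
  "SO_frames M p = {f. (\<forall>i. f i \<in> tangent_space (charts M) p) \<and>
     (\<forall>i j. metric M p (f i) (f j) = (if i = j then 1 else 0)) \<and>
     (\<forall>(U, \<phi>)\<in>charts M. p \<in> U \<longrightarrow> det (\<chi> i j. f j (\<lambda>q. \<phi> q $ i)) > 0)}"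

text \<open>The right action of \<open>SO(n)\<close> on frames.\<close>
definition frame_act :: "('m, 'n::finite) frame \<Rightarrow> real ^ 'n ^ 'n \<Rightarrow> ('m, 'n) frame" where
  "frame_act f a = (\<lambda>j h. \<Sum>i\<in>UNIV. a $ i $ j * f i h)"

definition local_frame :: "('m::topological_space, 'n::finite) oriented_riemannian_data \<Rightarrow> 'm set
    \<Rightarrow> ('m \<Rightarrow> ('m, 'n) frame) \<Rightarrow> bool" where
  "local_frame M U e \<longleftrightarrow>
     (\<forall>q\<in>U. e q \<in> SO_frames M q) \<and> (\<forall>i. smooth_vfield (charts M) U (\<lambda>q. e q i))"

text \<open>Some local oriented orthonormal frame through \<open>f\<close>; everything below is independent of the
  choice.\<close>
definition frame_ext :: "('m::topological_space, 'n::finite) oriented_riemannian_data \<Rightarrow> 'm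
    \<Rightarrow> ('m, 'n) frame \<Rightarrow> 'm \<Rightarrow> ('m, 'n) frame" where
  "frame_ext M p f = (SOME e. e p = f \<and> (\<exists>U. p \<in> U \<and> local_frame M U e))"


section \<open>The associated bundle \<open>EM\<close>\<close>

text \<open>Smoothness of \<open>\<rho>\<close> on the submanifold \<open>SO(n)\<close> of the space of matrices is expressed by smooth
  extensions to a neighbourhood.\<close>
definition SO_representation :: "(real ^ 'n::finite ^ 'n \<Rightarrow> 'e::euclidean_space \<Rightarrow> 'e) \<Rightarrow> bool" where
  "SO_representation \<rho> \<longleftrightarrow>
     (\<forall>a. rotation_matrix a \<longrightarrow> orthogonal_transformation (\<rho> a)) \<and>
     \<rho> (mat 1) = id \<and>
     (\<forall>a b. rotation_matrix a \<longrightarrow> rotation_matrix b \<longrightarrow> \<rho> (a ** b) = \<rho> a \<circ> \<rho> b) \<and>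
     (\<forall>x. \<exists>W F. open W \<and> Collect rotation_matrix \<subseteq> W \<and> smooth_on W F \<and>
        (\<forall>a. rotation_matrix a \<longrightarrow> F a = \<rho> a x))"

text \<open>The fibre of \<open>EM = SO(M) \<times>\<^sub>\<rho> E\<close> at \<open>p\<close>: the class \<open>[f, x]\<close> is encoded as the equivariant function
  \<open>f \<cdot> a \<mapsto> \<rho>(a\<^sup>-\<^sup>1) x\<close> on the frames at \<open>p\<close>, extended by \<open>0\<close>.\<close>
definition E_fibre :: "('m::topological_space, 'n::finite) oriented_riemannian_data
    \<Rightarrow> (real ^ 'n ^ 'n \<Rightarrow> 'e::euclidean_space \<Rightarrow> 'e) \<Rightarrow> 'm \<Rightarrow> (('m, 'n) frame \<Rightarrow> 'e) set" where
  "E_fibre M \<rho> p = {u.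
     (\<forall>f\<in>SO_frames M p. \<forall>a. rotation_matrix a \<longrightarrow> u (frame_act f a) = \<rho> (transpose a) (u f)) \<and>
     (\<forall>f. f \<notin> SO_frames M p \<longrightarrow> u f = 0)}"

definition frame_class :: "(real ^ 'n::finite ^ 'n \<Rightarrow> 'e::euclidean_space \<Rightarrow> 'e) \<Rightarrow> ('m, 'n) frame \<Rightarrow> 'e
    \<Rightarrow> ('m, 'n) frame \<Rightarrow> 'e" where
  "frame_class \<rho> f x = (\<lambda>f'. if \<exists>a. rotation_matrix a \<and> f' = frame_act f a
     then \<rho> (transpose (THE a. rotation_matrix a \<and> f' = frame_act f a)) x else 0)"

definition E_inner :: "('m::topological_space, 'n::finite) oriented_riemannian_data \<Rightarrow> 'm
    \<Rightarrow> (('m, 'n) frame \<Rightarrow> 'e::euclidean_space) \<Rightarrow> (('m, 'n) frame \<Rightarrow> 'e) \<Rightarrow> real" where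
  "E_inner M p u w = (let f = (SOME f. f \<in> SO_frames M p) in u f \<bullet> w f)"

definition smooth_E_section :: "('m::topological_space, 'n::finite) oriented_riemannian_data
    \<Rightarrow> (real ^ 'n ^ 'n \<Rightarrow> 'e::euclidean_space \<Rightarrow> 'e) \<Rightarrow> 'm set
    \<Rightarrow> ('m \<Rightarrow> ('m, 'n) frame \<Rightarrow> 'e) \<Rightarrow> bool" where
  "smooth_E_section M \<rho> U \<xi> \<longleftrightarrow> open U \<and> (\<forall>p\<in>U. \<xi> p \<in> E_fibre M \<rho> p) \<and>
     (\<forall>V e. V \<subseteq> U \<longrightarrow> local_frame M V e \<longrightarrow> smooth_fun (charts M) V (\<lambda>q. \<xi> q (e q)))"

record ('m, 'n, 'e) associated_bundle_data =
  rep :: "real ^ 'n ^ 'n \<Rightarrow> 'e \<Rightarrow> 'e"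
  conn :: "'m \<Rightarrow> 'm tvec \<Rightarrow> ('m \<Rightarrow> ('m, 'n) frame \<Rightarrow> 'e) \<Rightarrow> ('m, 'n) frame \<Rightarrow> 'e"

definition associated_bundle_with_connection ::
    "('m::{t2_space, second_countable_topology}, 'n::finite) oriented_riemannian_data
    \<Rightarrow> ('m, 'n, 'e::euclidean_space) associated_bundle_data \<Rightarrow> bool" where
  "associated_bundle_with_connection M E \<longleftrightarrow>
     SO_representation (rep E) \<and>
     metric_connection (charts M) (smooth_E_section M (rep E)) (E_inner M) (conn E)"


section \<open>Symmetric tensors with values in \<open>E\<close>\<close>

text \<open>An element of \<open>T\<^sup>\<otimes>\<^sup>k \<otimes> E\<close>, with \<open>T = \<real>\<^sup>n\<close>, is given by its components: a function on lists of \<open>k\<close>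
  indices, extended by \<open>0\<close> to all lists. Scalar tensors are the case \<open>E = \<real>\<close>, and operators on
  scalar tensors are tensored with the identity of \<open>E\<close>.\<close>
type_synonym ('n, 'e) tensor = "'n list \<Rightarrow> 'e"

definition sym_prod :: "(real ^ 'n) list \<Rightarrow> ('n, real) tensor" where
  "sym_prod vs l = (if length l = length vs
     then \<Sum>\<sigma> | \<sigma> permutes {..<length vs}. \<Prod>r<length vs. (vs ! \<sigma> r) $ (l ! r) else 0)"

definition Sym :: "nat \<Rightarrow> ('n::finite, 'e::real_vector) tensor set" where
  "Sym k = {\<lambda>l. \<Sum>c<N. sym_prod (vs c) l *\<^sub>R x c | (N::nat) vs x. \<forall>c<N. length (vs c) = k}"

text \<open>The factor \<open>1 / k!\<close> accounts for \<open>v\<^sub>1 \<cdot> \<dots> \<cdot> v\<^sub>k\<close> being defined without one, see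
  \<open>sym_inner_sym_prod\<close> below.\<close>
definition sym_inner :: "nat \<Rightarrow> ('n::finite, 'e::real_inner) tensor \<Rightarrow> ('n, 'e) tensor \<Rightarrow> real" where
  "sym_inner k K L = (\<Sum>l | length l = k. K l \<bullet> L l) / fact k"

text \<open>The linear extension in \<open>K\<close> of \<open>v \<cdot> (v\<^sub>1 \<cdot> \<dots> \<cdot> v\<^sub>k)\<close>, see \<open>sym_mult_sym_prod\<close> below.\<close>
definition sym_mult :: "real ^ 'n \<Rightarrow> ('n, 'e::real_vector) tensor \<Rightarrow> ('n, 'e) tensor" where
  "sym_mult v K l = (\<Sum>i<length l. v $ (l ! i) *\<^sub>R K (take i l @ drop (Suc i) l))"

lemma sym_prod_inverse:
  assumes "length l = length vs"
  shows "sym_prod vs l = (\<Sum>\<sigma> | \<sigma> permutes {..<length vs}. \<Prod>r<length vs. (vs ! r) $ (l ! \<sigma> r))"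
proof -
  have "(\<Prod>r<length vs. (vs ! inv \<sigma> r) $ (l ! r)) = (\<Prod>r<length vs. (vs ! r) $ (l ! \<sigma> r))"
    if s: "\<sigma> permutes {..<length vs}" for \<sigma>
    using prod.permute[OF s, of "\<lambda>r. (vs ! inv \<sigma> r) $ (l ! r)"] permutes_inverses[OF s]
    by (simp add: o_def)
  then show ?thesis
    using assms unfolding sym_prod_def
    by (subst sum_permutations_inverse) auto
qed

lemma sym_prod_permute:
  assumes "mset vs = mset ws"
  shows "sym_prod vs = sym_prod ws"
proof
  fix l
  have len: "length vs = length ws" using assms by (rule mset_eq_length)
  obtain p where p: "p permutes {..<length ws}" "permute_list p ws = vs"
    using mset_eq_permutation[OF assms] by blast
  have nth: "vs ! j = ws ! p j" if "j < length ws" for j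
    using p that by (auto simp: permute_list_nth)
  have "(\<Prod>r<length ws. (vs ! \<sigma> r) $ (l ! r)) = (\<Prod>r<length ws. (ws ! ((p \<circ> \<sigma>) r)) $ (l ! r))"
    if "\<sigma> permutes {..<length ws}" for \<sigma>
    using that permutes_in_image[OF that] by (intro prod.cong) (auto simp: nth)
  then have "(\<Sum>\<sigma> | \<sigma> permutes {..<length ws}. \<Prod>r<length ws. (vs ! \<sigma> r) $ (l ! r))
      = (\<Sum>\<sigma> | \<sigma> permutes {..<length ws}. \<Prod>r<length ws. (ws ! ((p \<circ> \<sigma>) r)) $ (l ! r))"
    by (intro sum.cong) auto
  also have "\<dots> = (\<Sum>\<sigma> | \<sigma> permutes {..<length ws}. \<Prod>r<length ws. (ws ! \<sigma> r) $ (l ! r))"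
    using p by (intro setum_permutations_compose_left[symmetric]) auto
  finally show "sym_prod vs l = sym_prod ws l" by (simp add: sym_prod_def len)
qed

lemma sym_prod_permute_indices:
  assumes "mset l = mset l'"
  shows "sym_prod vs l = sym_prod vs l'"
proof (cases "length l' = length vs")
  case True
  have len: "length l = length l'" using assms by (rule mset_eq_length)
  obtain p where p: "p permutes {..<length l'}" "permute_list p l' = l"
    using mset_eq_permutation[OF assms] by blast
  have nth: "l ! j = l' ! p j" if "j < length l'" for j
    using p that by (auto simp: permute_list_nth)
  have "(\<Prod>r<length vs. (vs ! r) $ (l ! \<sigma> r)) = (\<Prod>r<length vs. (vs ! r) $ (l' ! ((p \<circ> \<sigma>) r)))"
    if "\<sigma> permutes {..<length vs}" for \<sigma>
    using that permutes_in_image[OF that] True by (intro prod.cong) (auto simp: nth)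
  then have "(\<Sum>\<sigma> | \<sigma> permutes {..<length vs}. \<Prod>r<length vs. (vs ! r) $ (l ! \<sigma> r))
      = (\<Sum>\<sigma> | \<sigma> permutes {..<length vs}. \<Prod>r<length vs. (vs ! r) $ (l' ! ((p \<circ> \<sigma>) r)))"
    by (intro sum.cong) auto
  also have "\<dots> = (\<Sum>\<sigma> | \<sigma> permutes {..<length vs}. \<Prod>r<length vs. (vs ! r) $ (l' ! \<sigma> r))"
    using p True by (intro setum_permutations_compose_left[symmetric]) auto
  finally show ?thesis using True len by (simp add: sym_prod_inverse)
next
  case False
  then show ?thesis using mset_eq_length[OF assms] by (simp add: sym_prod_def)
qed

lemma sym_mult_sym_prod: "sym_mult v (sym_prod vs) = sym_prod (v # vs)"
proof
  fix l :: "'a list"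
  let ?k = "length vs"
  show "sym_mult v (sym_prod vs) l = sym_prod (v # vs) l"
  proof (cases "length l = Suc ?k")
    case False
    then show ?thesis by (auto simp: sym_mult_def sym_prod_def intro!: sum.neutral)
  next
    case True
    have *: "(\<Sum>\<sigma> | \<sigma> permutes {..<?k}. \<Prod>r<?k. (vs ! r) $ (l ! Transposition.transpose ?k b (\<sigma> r)))
        = sym_prod vs (take b l @ drop (Suc b) l)" if b: "b < Suc ?k" for b
    proof -
      let ?t = "Transposition.transpose ?k b"
      define lb where "lb = map (\<lambda>j. l ! ?t j) [0..<?k]"
      have t: "?t permutes {..<length l}" using b True by (intro permutes_swap_id) auto
      have "mset (permute_list ?t l) = mset l" using t by simp
      moreover have "permute_list ?t l = lb @ [l ! b]"
        by (simp add: permute_list_def True lb_def)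
      ultimately have "add_mset (l ! b) (mset lb) = mset l" by simp
      also have "mset l = mset (take b l @ l ! b # drop (Suc b) l)"
        using b True by (simp add: id_take_nth_drop[symmetric])
      finally have m: "mset lb = mset (take b l @ drop (Suc b) l)" by simp
      have "(\<Sum>\<sigma> | \<sigma> permutes {..<?k}. \<Prod>r<?k. (vs ! r) $ (l ! ?t (\<sigma> r)))
         = (\<Sum>\<sigma> | \<sigma> permutes {..<?k}. \<Prod>r<?k. (vs ! r) $ (lb ! \<sigma> r))"
      proof (intro sum.cong prod.cong refl)
        fix \<sigma> r assume "\<sigma> \<in> {\<sigma>. \<sigma> permutes {..<?k}}" "r \<in> {..<?k}"
        then have "\<sigma> r < ?k" using permutes_in_image by fastforce
        then show "(vs ! r) $ (l ! ?t (\<sigma> r)) = (vs ! r) $ (lb ! \<sigma> r)" by (simp add: lb_def)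
      qed
      also have "\<dots> = sym_prod vs lb" by (subst sym_prod_inverse) (auto simp: lb_def)
      finally show ?thesis using sym_prod_permute_indices[OF m] by simp
    qed
    have "sym_prod (v # vs) l = sym_prod (vs @ [v]) l"
      by (rule fun_cong[OF sym_prod_permute]) simp
    also have "\<dots> = (\<Sum>\<sigma> | \<sigma> permutes insert ?k {..<?k}. \<Prod>r<Suc ?k. ((vs @ [v]) ! r) $ (l ! \<sigma> r))"
      using True by (simp add: sym_prod_inverse lessThan_Suc)
    also have "\<dots> = (\<Sum>b\<in>insert ?k {..<?k}. \<Sum>\<sigma> | \<sigma> permutes {..<?k}. \<Prod>r<Suc ?k.
        ((vs @ [v]) ! r) $ (l ! (Transposition.transpose ?k b \<circ> \<sigma>) r))"
      by (rule sum_over_permutations_insert) auto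
    also have "\<dots> = (\<Sum>b<Suc ?k. v $ (l ! b) * sym_prod vs (take b l @ drop (Suc b) l))"
    proof (intro sum.cong)
      fix b assume b: "b \<in> {..<Suc ?k}"
      have "(\<Prod>r<Suc ?k. ((vs @ [v]) ! r) $ (l ! (Transposition.transpose ?k b \<circ> \<sigma>) r))
          = v $ (l ! b) * (\<Prod>r<?k. (vs ! r) $ (l ! Transposition.transpose ?k b (\<sigma> r)))"
        if "\<sigma> permutes {..<?k}" for \<sigma>
        using permutes_not_in[OF that, of ?k] by (simp add: nth_append)
      then have "(\<Sum>\<sigma> | \<sigma> permutes {..<?k}. \<Prod>r<Suc ?k.
            ((vs @ [v]) ! r) $ (l ! (Transposition.transpose ?k b \<circ> \<sigma>) r))
          = v $ (l ! b) * (\<Sum>\<sigma> | \<sigma> permutes {..<?k}. \<Prod>r<?k.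
              (vs ! r) $ (l ! Transposition.transpose ?k b (\<sigma> r)))"
        by (simp add: sum_distrib_left)
      also have "\<dots> = v $ (l ! b) * sym_prod vs (take b l @ drop (Suc b) l)"
        using * b by simp
      finally show "(\<Sum>\<sigma> | \<sigma> permutes {..<?k}. \<Prod>r<Suc ?k.
            ((vs @ [v]) ! r) $ (l ! (Transposition.transpose ?k b \<circ> \<sigma>) r))
          = v $ (l ! b) * sym_prod vs (take b l @ drop (Suc b) l)" .
    qed (simp add: lessThan_Suc)
    finally show ?thesis by (simp add: sym_mult_def True)
  qed
qed

lemma sum_lists_prod:
  fixes F :: "nat \<Rightarrow> 'n::finite \<Rightarrow> real"
  shows "(\<Sum>l | length l = k. \<Prod>r<k. F r (l ! r)) = (\<Prod>r<k. \<Sum>j\<in>UNIV. F r j)"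
proof (induction k arbitrary: F)
  case 0
  then show ?case by simp
next
  case (Suc k)
  have eq: "{l :: 'n list. length l = Suc k} = (\<lambda>(j, l). j # l) ` (UNIV \<times> {l. length l = k})"
    by (auto simp: image_iff length_Suc_conv)
  have "(\<Sum>l | length l = Suc k. \<Prod>r<Suc k. F r (l ! r))
      = (\<Sum>(j, l)\<in>UNIV \<times> {l. length l = k}. F 0 j * (\<Prod>r<k. F (Suc r) (l ! r)))"
    unfolding eq by (subst sum.reindex) (auto simp: inj_on_def prod.lessThan_Suc_shift case_prod_beta simp del: prod.lessThan_Suc)
  also have "\<dots> = (\<Sum>j\<in>UNIV. F 0 j) * (\<Prod>r<k. \<Sum>j\<in>UNIV. F (Suc r) j)"
    by (simp add: sum.cartesian_product[symmetric] sum_distrib_left[symmetric] sum_distrib_right[symmetric] Suc.IH[of "\<lambda>r. F (Suc r)"])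
  finally show ?case by (simp add: prod.lessThan_Suc_shift del: prod.lessThan_Suc)
qed

lemma sym_inner_sym_prod:
  fixes vs ws :: "(real ^ 'n::finite) list"
  assumes "length vs = k" "length ws = k"
  shows "sym_inner k (sym_prod vs) (sym_prod ws) =
    (\<Sum>\<sigma> | \<sigma> permutes {..<k}. \<Prod>r<k. (vs ! r) \<bullet> (ws ! \<sigma> r))"
proof -
  let ?S = "{\<sigma>. \<sigma> permutes {..<k}}"
  have "(\<Sum>l | length l = k. sym_prod vs l * sym_prod ws l)
      = (\<Sum>l | length l = k. \<Sum>\<sigma>\<in>?S. \<Sum>\<tau>\<in>?S. \<Prod>r<k. (vs ! \<sigma> r) $ (l ! r) * (ws ! \<tau> r) $ (l ! r))"
    using assms by (intro sum.cong) (auto simp: sym_prod_def sum_product prod.distrib)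
  also have "\<dots> = (\<Sum>\<sigma>\<in>?S. \<Sum>\<tau>\<in>?S. \<Sum>l | length l = k. \<Prod>r<k. (vs ! \<sigma> r) $ (l ! r) * (ws ! \<tau> r) $ (l ! r))"
    by (subst sum.swap, rule sum.cong[OF refl], rule sum.swap)
  also have "\<dots> = (\<Sum>\<sigma>\<in>?S. \<Sum>\<tau>\<in>?S. \<Prod>r<k. (vs ! \<sigma> r) \<bullet> (ws ! \<tau> r))"
    by (simp add: sum_lists_prod[where F = "\<lambda>r j. (vs ! \<sigma> r) $ j * (ws ! \<tau> r) $ j" for \<sigma> \<tau>] inner_vec_def)
  also have "\<dots> = (\<Sum>\<sigma>\<in>?S. \<Sum>\<tau>\<in>?S. \<Prod>r<k. (vs ! r) \<bullet> (ws ! \<tau> r))"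
  proof (rule sum.cong[OF refl])
    fix \<sigma> assume "\<sigma> \<in> ?S"
    then have s: "\<sigma> permutes {..<k}" by simp
    have "(\<Sum>\<tau>\<in>?S. \<Prod>r<k. (vs ! \<sigma> r) \<bullet> (ws ! \<tau> r))
        = (\<Sum>\<tau>\<in>?S. \<Prod>r<k. (vs ! \<sigma> r) \<bullet> (ws ! (\<tau> \<circ> \<sigma>) r))"
      by (rule sum_permutations_compose_right[OF s])
    also have "\<dots> = (\<Sum>\<tau>\<in>?S. \<Prod>r<k. (vs ! r) \<bullet> (ws ! \<tau> r))"
      by (intro sum.cong refl, subst (2) prod.permute[OF s]) (simp add: o_def)
    finally show "(\<Sum>\<tau>\<in>?S. \<Prod>r<k. (vs ! \<sigma> r) \<bullet> (ws ! \<tau> r)) = (\<Sum>\<tau>\<in>?S. \<Prod>r<k. (vs ! r) \<bullet> (ws ! \<tau> r))" .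
  qed
  also have "\<dots> = fact k * (\<Sum>\<tau>\<in>?S. \<Prod>r<k. (vs ! r) \<bullet> (ws ! \<tau> r))"
    by (simp add: card_permutations)
  finally show ?thesis by (simp add: sym_inner_def)
qed

text \<open>The adjoint of \<open>F\<close> with values in \<open>V\<close>, tested against the elements of \<open>T\<close>: for \<open>T = V\<close> finite-dimensional
  this is the metric adjoint; for \<open>V\<close> the smooth sections and \<open>T\<close> those with compact support it is
  the formal adjoint.\<close>
definition adjoint_wrt :: "'x set \<Rightarrow> 'x set \<Rightarrow> ('x \<Rightarrow> 'x \<Rightarrow> real) \<Rightarrow> ('y \<Rightarrow> 'y \<Rightarrow> real) \<Rightarrow> ('x \<Rightarrow> 'y) \<Rightarrow> 'y \<Rightarrow> 'x" where
  "adjoint_wrt T V ip ip' F y = (THE x. x \<in> V \<and> (\<forall>z\<in>T. ip' (F z) y = ip z x))"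

text \<open>\<open>contract k v\<close> is \<open>v \<lrcorner>\<close> on \<open>Sym k\<close>.\<close>
fun contract :: "nat \<Rightarrow> real ^ 'n::finite \<Rightarrow> ('n, 'e::real_inner) tensor \<Rightarrow> ('n, 'e) tensor" where
  "contract 0 v K = (\<lambda>l. 0)"
| "contract (Suc k) v K = adjoint_wrt (Sym k) (Sym k) (sym_inner k) (sym_inner (Suc k)) (sym_mult v) K"

abbreviation std_basis :: "'n::finite \<Rightarrow> real ^ 'n" where
  "std_basis i \<equiv> axis i 1"

text \<open>The trace \<open>\<Lambda>\<close> on \<open>Sym k\<close>.\<close>
definition sym_trace :: "nat \<Rightarrow> ('n::finite, 'e::real_inner) tensor \<Rightarrow> ('n, 'e) tensor" where
  "sym_trace k K = (\<lambda>l. \<Sum>i\<in>UNIV. contract (k - 1) (std_basis i) (contract k (std_basis i) K) l)"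

definition Sym0 :: "nat \<Rightarrow> ('n::finite, 'e::real_inner) tensor set" where
  "Sym0 k = {K \<in> Sym k. sym_trace k K = (\<lambda>l. 0)}"

definition tracefree :: "nat \<Rightarrow> ('n::finite, 'e::real_inner) tensor \<Rightarrow> ('n, 'e) tensor" where
  "tracefree k K = (THE K0. K0 \<in> Sym0 k \<and> (\<forall>L\<in>Sym0 k. sym_inner k (\<lambda>l. K l - K0 l) L = 0))"

text \<open>\<open>T \<otimes> Sym\<^sup>k\<^sub>0 T \<otimes> E\<close>; the first index is the one in \<open>T\<close>, and \<open>slot i t\<close> is the \<open>t\<^sub>i\<close> in
  \<open>t = \<Sum>\<^sub>i e\<^sub>i \<otimes> t\<^sub>i\<close>.\<close>
abbreviation slot :: "'n \<Rightarrow> ('n, 'e) tensor \<Rightarrow> ('n, 'e) tensor" where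
  "slot i t \<equiv> (\<lambda>l. t (i # l))"

definition T_Sym0 :: "nat \<Rightarrow> ('n::finite, 'e::real_inner) tensor set" where
  "T_Sym0 k = {t. t [] = 0 \<and> (\<forall>i. slot i t \<in> Sym0 k)}"

definition T_Sym_inner :: "nat \<Rightarrow> ('n::finite, 'e::real_inner) tensor \<Rightarrow> ('n, 'e) tensor \<Rightarrow> real" where
  "T_Sym_inner k s t = (\<Sum>i\<in>UNIV. sym_inner k (slot i s) (slot i t))"

definition q1 :: "nat \<Rightarrow> ('n::finite, 'e::real_inner) tensor \<Rightarrow> ('n, 'e) tensor" where
  "q1 k t = (\<lambda>l. \<Sum>i\<in>UNIV. tracefree (Suc k) (sym_mult (std_basis i) (slot i t)) l)"

definition q2 :: "nat \<Rightarrow> ('n::finite, 'e::real_inner) tensor \<Rightarrow> ('n, 'e) tensor" where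
  "q2 k t = (\<lambda>l. \<Sum>i\<in>UNIV. contract k (std_basis i) (slot i t) l)"

definition p1 :: "nat \<Rightarrow> ('n::finite, 'e::real_inner) tensor \<Rightarrow> ('n, 'e) tensor" where
  "p1 k t = (\<lambda>l. (1 / (real k + 1)) *\<^sub>R
     adjoint_wrt (T_Sym0 k) (T_Sym0 k) (T_Sym_inner k) (sym_inner (Suc k)) (q1 k) (q1 k t) l)"

definition p2 :: "nat \<Rightarrow> ('n::finite, 'e::real_inner) tensor \<Rightarrow> ('n, 'e) tensor" where
  "p2 k t = (let n = real CARD('n) in (\<lambda>l.
     ((n + 2 * real k - 4) / ((n + 2 * real k - 2) * (n + real k - 3))) *\<^sub>R
     adjoint_wrt (T_Sym0 k) (T_Sym0 k) (T_Sym_inner k) (sym_inner (k - 1)) (q2 k) (q2 k t) l))"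

definition p3 :: "nat \<Rightarrow> ('n::finite, 'e::real_inner) tensor \<Rightarrow> ('n, 'e) tensor" where
  "p3 k t = (\<lambda>l. t l - p1 k t l - p2 k t l)"

text \<open>The derivation of the tensor algebra extending the endomorphism of \<open>T\<close> with matrix \<open>B\<close>,
  tensored with the identity of \<open>E\<close>.\<close>
definition derivation_ext :: "('n::finite \<Rightarrow> 'n \<Rightarrow> real) \<Rightarrow> ('n, 'e::real_vector) tensor \<Rightarrow> ('n, 'e) tensor" where
  "derivation_ext B K l = (\<Sum>r<length l. \<Sum>b\<in>UNIV. B (l ! r) b *\<^sub>R K (l[r := b]))"

text \<open>\<open>(x \<and> y)\<^sub>*\<close> on \<open>Sym k\<close>.\<close>
definition wedge_act :: "nat \<Rightarrow> real ^ 'n::finite \<Rightarrow> real ^ 'n \<Rightarrow> ('n, 'e::real_inner) tensor \<Rightarrow> ('n, 'e) tensor" where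
  "wedge_act k x y K = (\<lambda>l. sym_mult y (contract k x K) l - sym_mult x (contract k y K) l)"


section \<open>Tensor bundles twisted with \<open>EM\<close>\<close>

definition tensor_act :: "(real ^ 'n::finite ^ 'n \<Rightarrow> 'e::real_vector \<Rightarrow> 'e) \<Rightarrow> real ^ 'n ^ 'n
    \<Rightarrow> ('n, 'e) tensor \<Rightarrow> ('n, 'e) tensor" where
  "tensor_act \<rho> a K l =
     (\<Sum>l' | length l' = length l. (\<Prod>r<length l. a $ (l ! r) $ (l' ! r)) *\<^sub>R \<rho> a (K l'))"

text \<open>Smooth sections over \<open>M\<close> of the subbundle \<open>SO(M) \<times> V\<close> (mod \<open>SO(n)\<close>) of \<open>TM\<^sup>\<otimes>\<^sup>m \<otimes> EM\<close> with
  \<open>SO(n)\<close>-invariant fibre model \<open>V \<subseteq> T\<^sup>\<otimes>\<^sup>m \<otimes> E\<close>. As for \<open>EM\<close>, \<open>s p f\<close> is the tensor representing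
  \<open>s p\<close> with respect to the frame \<open>f\<close> at \<open>p\<close>.\<close>
definition sections :: "('m::topological_space, 'n::finite) oriented_riemannian_data
    \<Rightarrow> ('m, 'n, 'e::euclidean_space) associated_bundle_data \<Rightarrow> ('n, 'e) tensor set
    \<Rightarrow> ('m \<Rightarrow> ('m, 'n) frame \<Rightarrow> ('n, 'e) tensor) set" where
  "sections M E V = {s.
     (\<forall>p. \<forall>f\<in>SO_frames M p. s p f \<in> V \<and>
        (\<forall>a. rotation_matrix a \<longrightarrow> s p (frame_act f a) = tensor_act (rep E) (transpose a) (s p f))) \<and>
     (\<forall>p f. f \<notin> SO_frames M p \<longrightarrow> s p f = (\<lambda>l. 0)) \<and>
     (\<forall>U e l. local_frame M U e \<longrightarrow> smooth_fun (charts M) U (\<lambda>q. s q (e q) l))}"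

definition compact_sections :: "('m::topological_space, 'n::finite) oriented_riemannian_data
    \<Rightarrow> ('m, 'n, 'e::euclidean_space) associated_bundle_data \<Rightarrow> ('n, 'e) tensor set
    \<Rightarrow> ('m \<Rightarrow> ('m, 'n) frame \<Rightarrow> ('n, 'e) tensor) set" where
  "compact_sections M E V = {s \<in> sections M E V. compact (closure {p. s p \<noteq> (\<lambda>f l. 0)})}"

definition L2_inner :: "('m::topological_space, 'n::finite) oriented_riemannian_data
    \<Rightarrow> (('n, 'e::euclidean_space) tensor \<Rightarrow> ('n, 'e) tensor \<Rightarrow> real)
    \<Rightarrow> ('m \<Rightarrow> ('m, 'n) frame \<Rightarrow> ('n, 'e) tensor) \<Rightarrow> ('m \<Rightarrow> ('m, 'n) frame \<Rightarrow> ('n, 'e) tensor) \<Rightarrow> real" where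
  "L2_inner M ip s t =
     (\<integral>p. (let f = (SOME f. f \<in> SO_frames M p) in ip (s p f) (t p f)) \<partial>volume M)"

text \<open>The tensor product connection \<open>\<nabla>\<^sup>E\<close>: write \<open>s = \<Sum>\<^sub>l e\<^sub>l\<^sub>1 \<otimes> \<dots> \<otimes> e\<^sub>l\<^sub>m \<otimes> s\<^sub>l\<close> with a local frame \<open>e\<close>
  and local sections \<open>s\<^sub>l\<close> of \<open>EM\<close>, and differentiate by the product rule. The result is the tensor
  representing \<open>\<nabla>\<^sup>E\<^sub>v s\<close> with respect to the frame \<open>f\<close> at \<open>p\<close>.\<close>
definition nablaE :: "('m::topological_space, 'n::finite) oriented_riemannian_data
    \<Rightarrow> ('m, 'n, 'e::euclidean_space) associated_bundle_data
    \<Rightarrow> ('m \<Rightarrow> ('m, 'n) frame \<Rightarrow> ('n, 'e) tensor) \<Rightarrow> 'm \<Rightarrow> ('m, 'n) frame \<Rightarrow> 'm tvec \<Rightarrow> ('n, 'e) tensor" where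
  "nablaE M E s p f v = (let e = frame_ext M p f in (\<lambda>l.
     conn E p v (\<lambda>q. frame_class (rep E) (e q) (s q (e q) l)) f +
     derivation_ext (\<lambda>a b. metric M p (nabla M p v (\<lambda>q. e q b)) (f a)) (s p f) l))"

text \<open>On \<open>K \<otimes> \<xi>\<close> this is the defining formula of \<open>D\<^sub>0\<close>, by the product rule for \<open>\<nabla>\<^sup>E\<close>.\<close>
definition D0 :: "('m::topological_space, 'n::finite) oriented_riemannian_data
    \<Rightarrow> ('m, 'n, 'e::euclidean_space) associated_bundle_data \<Rightarrow> nat
    \<Rightarrow> ('m \<Rightarrow> ('m, 'n) frame \<Rightarrow> ('n, 'e) tensor) \<Rightarrow> 'm \<Rightarrow> ('m, 'n) frame \<Rightarrow> ('n, 'e) tensor" where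
  "D0 M E k s p f = (if f \<in> SO_frames M p
     then (\<lambda>l. \<Sum>i\<in>UNIV. tracefree (Suc k) (sym_mult (std_basis i) (nablaE M E s p f (f i))) l)
     else (\<lambda>l. 0))"

definition D0_adj :: "('m::topological_space, 'n::finite) oriented_riemannian_data
    \<Rightarrow> ('m, 'n, 'e::euclidean_space) associated_bundle_data \<Rightarrow> nat
    \<Rightarrow> ('m \<Rightarrow> ('m, 'n) frame \<Rightarrow> ('n, 'e) tensor) \<Rightarrow> 'm \<Rightarrow> ('m, 'n) frame \<Rightarrow> ('n, 'e) tensor" where
  "D0_adj M E k = adjoint_wrt (compact_sections M E (Sym0 k)) (sections M E (Sym0 k))
     (L2_inner M (sym_inner k)) (L2_inner M (sym_inner (Suc k))) (D0 M E k)"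

definition P3 :: "('m::topological_space, 'n::finite) oriented_riemannian_data
    \<Rightarrow> ('m, 'n, 'e::euclidean_space) associated_bundle_data \<Rightarrow> nat
    \<Rightarrow> ('m \<Rightarrow> ('m, 'n) frame \<Rightarrow> ('n, 'e) tensor) \<Rightarrow> 'm \<Rightarrow> ('m, 'n) frame \<Rightarrow> ('n, 'e) tensor" where
  "P3 M E k s p f = (if f \<in> SO_frames M p
     then p3 k (\<lambda>l. case l of [] \<Rightarrow> 0 | i # l' \<Rightarrow> nablaE M E s p f (f i) l')
     else (\<lambda>l. 0))"

definition P3_adj :: "('m::topological_space, 'n::finite) oriented_riemannian_data
    \<Rightarrow> ('m, 'n, 'e::euclidean_space) associated_bundle_data \<Rightarrow> nat
    \<Rightarrow> ('m \<Rightarrow> ('m, 'n) frame \<Rightarrow> ('n, 'e) tensor) \<Rightarrow> 'm \<Rightarrow> ('m, 'n) frame \<Rightarrow> ('n, 'e) tensor" where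
  "P3_adj M E k = adjoint_wrt (compact_sections M E (Sym0 k)) (sections M E (Sym0 k))
     (L2_inner M (sym_inner k)) (L2_inner M (T_Sym_inner k)) (P3 M E k)"


section \<open>Curvature\<close>

text \<open>\<open>\<nabla>\<^sup>2\<^bsub>X,Y\<^esub> \<xi>\<close> at \<open>p\<close> and the resulting curvature, for a connection \<open>nab\<close> on any bundle as in
  \<open>metric_connection\<close>.\<close>
definition nabla2 :: "('m, 'n) oriented_riemannian_data
    \<Rightarrow> ('m \<Rightarrow> 'm tvec \<Rightarrow> ('m \<Rightarrow> 'x \<Rightarrow> 'r::real_vector) \<Rightarrow> 'x \<Rightarrow> 'r)
    \<Rightarrow> ('m \<Rightarrow> 'm tvec) \<Rightarrow> ('m \<Rightarrow> 'm tvec) \<Rightarrow> ('m \<Rightarrow> 'x \<Rightarrow> 'r) \<Rightarrow> 'm \<Rightarrow> 'x \<Rightarrow> 'r" where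
  "nabla2 M nab X Y \<xi> p = (\<lambda>x. nab p (X p) (\<lambda>q. nab q (Y q) \<xi>) x - nab p (nabla M p (X p) Y) \<xi> x)"

definition curvature :: "('m, 'n) oriented_riemannian_data
    \<Rightarrow> ('m \<Rightarrow> 'm tvec \<Rightarrow> ('m \<Rightarrow> 'x \<Rightarrow> 'r::real_vector) \<Rightarrow> 'x \<Rightarrow> 'r)
    \<Rightarrow> ('m \<Rightarrow> 'm tvec) \<Rightarrow> ('m \<Rightarrow> 'm tvec) \<Rightarrow> ('m \<Rightarrow> 'x \<Rightarrow> 'r) \<Rightarrow> 'm \<Rightarrow> 'x \<Rightarrow> 'r" where
  "curvature M nab X Y \<xi> p = (\<lambda>x. nabla2 M nab X Y \<xi> p x - nabla2 M nab Y X \<xi> p x)"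

text \<open>Matrix of \<open>R\<^bsub>f\<^sub>i,f\<^sub>j\<^esub>\<close> on \<open>T\<^sub>pM\<close> with respect to the frame \<open>f\<close>.\<close>
definition riem_matrix :: "('m::topological_space, 'n::finite) oriented_riemannian_data \<Rightarrow> 'm
    \<Rightarrow> ('m, 'n) frame \<Rightarrow> 'n \<Rightarrow> 'n \<Rightarrow> 'n \<Rightarrow> 'n \<Rightarrow> real" where
  "riem_matrix M p f i j a b = (let e = frame_ext M p f in
     metric M p (curvature M (nabla M) (\<lambda>q. e q i) (\<lambda>q. e q j) (\<lambda>q. e q b) p) (f a))"

text \<open>\<open>R\<^sup>E\<^bsub>f\<^sub>i,f\<^sub>j\<^esub>\<close> as an endomorphism of \<open>E\<close>, by means of the isomorphism \<open>x \<mapsto> [f, x]\<close>.\<close>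
definition curv_E :: "('m::topological_space, 'n::finite) oriented_riemannian_data
    \<Rightarrow> ('m, 'n, 'e::euclidean_space) associated_bundle_data \<Rightarrow> 'm
    \<Rightarrow> ('m, 'n) frame \<Rightarrow> 'n \<Rightarrow> 'n \<Rightarrow> 'e \<Rightarrow> 'e" where
  "curv_E M E p f i j x = (let e = frame_ext M p f in
     curvature M (conn E) (\<lambda>q. e q i) (\<lambda>q. e q j) (\<lambda>q. frame_class (rep E) (e q) x) p f)"

definition qR :: "('m::topological_space, 'n::finite) oriented_riemannian_data
    \<Rightarrow> nat \<Rightarrow> 'm \<Rightarrow> ('m, 'n) frame \<Rightarrow> ('n, 'e::real_inner) tensor \<Rightarrow> ('n, 'e) tensor" where
  "qR M k p f K = (\<lambda>l. (1/2) *\<^sub>R (\<Sum>i\<in>UNIV. \<Sum>j\<in>UNIV.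
     wedge_act k (std_basis i) (std_basis j) (derivation_ext (riem_matrix M p f i j) K) l))"

definition qR_E :: "('m::topological_space, 'n::finite) oriented_riemannian_data
    \<Rightarrow> ('m, 'n, 'e::euclidean_space) associated_bundle_data \<Rightarrow> nat
    \<Rightarrow> ('m \<Rightarrow> ('m, 'n) frame \<Rightarrow> ('n, 'e) tensor) \<Rightarrow> 'm \<Rightarrow> ('m, 'n) frame \<Rightarrow> ('n, 'e) tensor" where
  "qR_E M E k s p f = (if f \<in> SO_frames M p
     then (\<lambda>l. qR M k p f (s p f) l + (1/2) *\<^sub>R (\<Sum>i\<in>UNIV. \<Sum>j\<in>UNIV.
       wedge_act k (std_basis i) (std_basis j) (\<lambda>l'. curv_E M E p f i j (s p f l')) l))
     else (\<lambda>l. 0))"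

end

theory Submission
  imports Defs
begin

text \<open>The differential operators on the right-hand side combine a covariant derivative with pointwise
  operations on tensors that have constant coefficients and commute with rotations. Such an operation \<open>\<Phi>\<close>
  is parallel, \<open>\<nabla> (\<Phi> s) = \<Phi> (\<nabla> s)\<close> (\<open>grad_parallel\<close>), so that a composition of two of these operators
  is a pointwise operation applied to the second covariant derivative \<open>H = \<nabla>\<^sup>2 s\<close>, with components
  \<open>H\<^sub>i\<^sub>j = \<nabla>\<^sup>2\<^bsub>e\<^sub>i,e\<^sub>j\<^esub> s\<close>, and the theorem becomes linear algebra in a single fibre.

  On \<open>Sym\<^sup>k\<^sub>0\<close>, \<open>D\<^sub>0 = q\<^sub>1 \<nabla>\<close> and \<open>P\<^sub>3 = p\<^sub>3 \<nabla>\<close>. The divergence theorem gives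
  \<open>\<nabla>\<^sup>* = - tr \<nabla>\<close>, where \<open>tr\<close> contracts the first two indices (\<open>integration_by_parts\<close>). The adjoint of \<open>q\<^sub>1\<close>
  is the inclusion of \<open>Sym\<^sup>k\<^sup>+\<^sup>1\<^sub>0\<close> into \<open>T \<otimes> Sym\<^sup>k\<^sub>0\<close> (\<open>Q1_adjoint\<close>), and \<open>p\<^sub>3\<close> is an orthogonal
  projection (\<open>P3_proj_adjoint\<close>); therefore \<open>D\<^sub>0\<^sup>* = - tr \<nabla>\<close> and \<open>P\<^sub>3\<^sup>* P\<^sub>3 = - tr \<nabla> p\<^sub>3 \<nabla>\<close>
  (\<open>D0_adj_grad\<close>, \<open>P3_adj_P3_grad\<close>). A formal adjoint is here the unique section with the adjoint
  property; uniqueness comes from testing with sections cut off by bump functions (\<open>formal_adjointI\<close>).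

  After these substitutions the right-hand side is an expression in \<open>H\<close>, which
  \<open>weitzenboeck_algebra\<close> evaluates: the coefficients are such that the rough Laplacian
  \<open>\<Sum>\<^sub>i H\<^sub>i\<^sub>i\<close> and the terms in the image of \<open>L\<close> cancel, and what remains is
  \<open>\<Sum>\<^sub>i\<^sub>j (e\<^sub>i \<and> e\<^sub>j)\<^sub>* H\<^sub>i\<^sub>j\<close>. As \<open>e\<^sub>i \<and> e\<^sub>j\<close> is skew, only \<open>H\<^sub>i\<^sub>j - H\<^sub>j\<^sub>i\<close> contributes, which is the curvature
  acting on both factors of \<open>Sym\<^sup>k\<^sub>0 TM \<otimes> EM\<close> (\<open>ricci_identity\<close>), and the sum is \<open>q(R)\<^sup>E s\<close> (\<open>qR_E_grad\<close>).

  Sections are given by their components in all oriented orthonormal frames. Smooth local frames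
  through every given frame come from the Gram-Schmidt process; in such a frame a
  covariant derivative is computed by the Christoffel symbols and the connection of \<open>EM\<close>
  (\<open>tensor_deriv\<close>), independently of the frame (\<open>tensor_deriv_change\<close>).\<close>

section \<open>Calculus of smooth functions on open sets\<close>

lemma C_on_subset: "C_on r S f \<Longrightarrow> T \<subseteq> S \<Longrightarrow> C_on r T f"
  by (induction r arbitrary: f) (auto intro: continuous_on_subset)

lemma C_on_SucD: "C_on (Suc r) S f \<Longrightarrow> C_on r S f"
proof (induction r arbitrary: f)
  case 0
  then show ?case
    by (auto intro!: differentiable_imp_continuous_on differentiable_at_imp_differentiable_on)
next
  case (Suc r)
  then show ?case by (metis C_on.simps(2))
qed

lemma frechet_derivative_cong_open:
  assumes "open S" "x \<in> S" "\<And>y. y \<in> S \<Longrightarrow> f y = g y" "f differentiable (at x)"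
  shows "g differentiable (at x)" "frechet_derivative g (at x) = frechet_derivative f (at x)"
proof -
  have "(f has_derivative frechet_derivative f (at x)) (at x)"
    using assms(4) frechet_derivative_works by blast
  then have "(g has_derivative frechet_derivative f (at x)) (at x)"
    using has_derivative_transform_within_open[OF _ assms(1,2)] assms(3) by blast
  then show "g differentiable (at x)" "frechet_derivative g (at x) = frechet_derivative f (at x)"
    by (auto simp: differentiable_def frechet_derivative_at[symmetric])
qed

lemma C_on_cong:
  assumes "open S" "\<And>x. x \<in> S \<Longrightarrow> f x = g x" "C_on r S f"
  shows "C_on r S g"
  using assms(2,3)
proof (induction r arbitrary: f g)
  case 0
  then show ?case by (simp cong: continuous_on_cong)
next
  case (Suc r)
  have d: "g differentiable (at x)" "frechet_derivative g (at x) = frechet_derivative f (at x)" if "x \<in> S" for x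
    using frechet_derivative_cong_open[OF assms(1) that, of f g] Suc.prems that by auto
  then show ?case
    using Suc.IH[of "\<lambda>x. frechet_derivative f (at x) v" "\<lambda>x. frechet_derivative g (at x) v" for v] Suc.prems by auto
qed

lemma C_on_local:
  assumes "\<And>x. x \<in> S \<Longrightarrow> \<exists>T. open T \<and> x \<in> T \<and> C_on r T f"
  shows "C_on r S f"
  using assms
proof (induction r arbitrary: f)
  case 0
  have "isCont f x" if "x \<in> S" for x
    using 0[OF that] by (auto simp: continuous_on_eq_continuous_at)
  then show ?case by (simp add: continuous_at_imp_continuous_on)
next
  case (Suc r)
  show ?case
  proof (simp, intro conjI ballI allI)
    show "f differentiable (at x)" if "x \<in> S" for x using Suc.prems[OF that] by auto
    show "C_on r S (\<lambda>x. frechet_derivative f (at x) v)" for v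
      by (rule Suc.IH) (use Suc.prems in fastforce)
  qed
qed

lemma C_on_const: "C_on r S (\<lambda>x. c)"
  by (induction r arbitrary: c) auto

lemma C_on_bounded_linear:
  assumes "bounded_linear L" "open S" "C_on r S f"
  shows "C_on r S (\<lambda>x. L (f x))"
  using assms(3)
proof (induction r arbitrary: f)
  case 0
  then show ?case using bounded_linear.continuous_on[OF assms(1)] by auto
next
  case (Suc r)
  have h: "((\<lambda>x. L (f x)) has_derivative (\<lambda>v. L (frechet_derivative f (at x) v))) (at x)" if "x \<in> S" for x
    using bounded_linear.has_derivative[OF assms(1) frechet_derivative_works[THEN iffD1]] Suc.prems that by auto
  have "C_on r S (\<lambda>x. frechet_derivative (\<lambda>x. L (f x)) (at x) v)" for v
    by (rule C_on_cong[OF assms(2) _ Suc.IH[of "\<lambda>x. frechet_derivative f (at x) v"]])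
      (use Suc.prems frechet_derivative_at[OF h] in \<open>auto simp: fun_eq_iff\<close>)
  then show ?case using h by (auto simp: differentiable_def)
qed

lemma C_on_add:
  assumes "open S" "C_on r S f" "C_on r S g"
  shows "C_on r S (\<lambda>x. f x + g x)"
  using assms(2,3)
proof (induction r arbitrary: f g)
  case 0
  then show ?case by (auto intro: continuous_intros)
next
  case (Suc r)
  have h: "((\<lambda>x. f x + g x) has_derivative (\<lambda>v. frechet_derivative f (at x) v + frechet_derivative g (at x) v)) (at x)" if "x \<in> S" for x
    by (intro has_derivative_add frechet_derivative_works[THEN iffD1]) (use Suc.prems that in auto)
  have "C_on r S (\<lambda>x. frechet_derivative (\<lambda>x. f x + g x) (at x) v)" for v
    by (rule C_on_cong[OF assms(1) _ Suc.IH[of "\<lambda>x. frechet_derivative f (at x) v" "\<lambda>x. frechet_derivative g (at x) v"]])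
      (use Suc.prems frechet_derivative_at[OF h] in \<open>auto simp: fun_eq_iff\<close>)
  then show ?case using h by (auto simp: differentiable_def)
qed

lemma C_on_bilinear:
  assumes B: "bounded_bilinear B" and "open S" "C_on r S f" "C_on r S g"
  shows "C_on r S (\<lambda>x. B (f x) (g x))"
  using assms(3,4)
proof (induction r arbitrary: f g)
  case 0
  then show ?case using bounded_bilinear.continuous_on[OF B] by auto
next
  case (Suc r)
  have h: "((\<lambda>x. B (f x) (g x)) has_derivative
      (\<lambda>v. B (f x) (frechet_derivative g (at x) v) + B (frechet_derivative f (at x) v) (g x))) (at x)" if "x \<in> S" for x
    by (intro bounded_bilinear.FDERIV[OF B] frechet_derivative_works[THEN iffD1]) (use Suc.prems that in auto)
  have "C_on r S (\<lambda>x. frechet_derivative (\<lambda>x. B (f x) (g x)) (at x) v)" for v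
  proof (rule C_on_cong[OF assms(2)])
    show "C_on r S (\<lambda>x. B (f x) (frechet_derivative g (at x) v) + B (frechet_derivative f (at x) v) (g x))"
      using Suc.prems C_on_SucD[OF Suc.prems(1)] C_on_SucD[OF Suc.prems(2)]
      by (intro C_on_add assms(2) Suc.IH) auto
  qed (use Suc.prems frechet_derivative_at[OF h] in \<open>auto simp: fun_eq_iff\<close>)
  then show ?case using h by (auto simp: differentiable_def)
qed

lemma C_on_sum:
  assumes "open S" "\<And>i. i \<in> I \<Longrightarrow> C_on r S (f i)"
  shows "C_on r S (\<lambda>x. \<Sum>i\<in>I. f i x)"
proof (cases "finite I")
  case True
  then show ?thesis using assms(2)
    by (induction I) (auto intro!: C_on_const C_on_add assms(1))
next
  case False
  then show ?thesis by (simp add: C_on_const)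
qed

lemma C_on_id: "open S \<Longrightarrow> C_on r S (\<lambda>x. x)"
  by (cases r) (auto simp: C_on_const frechet_derivative_id[unfolded id_def])

lemma linear_euclidean_expansion:
  fixes L :: "'a::euclidean_space \<Rightarrow> 'b::real_vector"
  assumes "linear L"
  shows "L v = (\<Sum>b\<in>Basis. (v \<bullet> b) *\<^sub>R L b)"
proof -
  have "L v = L (\<Sum>b\<in>Basis. (v \<bullet> b) *\<^sub>R b)" by (simp add: euclidean_representation)
  also have "\<dots> = (\<Sum>b\<in>Basis. (v \<bullet> b) *\<^sub>R L b)"
    by (simp add: linear_sum[OF assms] linear_cmul[OF assms] o_def)
  finally show ?thesis .
qed

text \<open>The chain rule expresses the derivative of \<open>g \<circ> f\<close> by the functions \<open>g'(f x) b\<close> for basis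
  vectors \<open>b\<close> and components of \<open>f'\<close>, which have one order of differentiability less, so that the
  induction on the order applies.\<close>
lemma C_on_compose:
  fixes f :: "'a::real_normed_vector \<Rightarrow> 'b::euclidean_space" and g :: "'b \<Rightarrow> 'c::real_normed_vector"
  assumes "open S" "C_on r S f" "C_on r T g" "f ` S \<subseteq> T"
  shows "C_on r S (\<lambda>x. g (f x))"
  using assms(2,3)
proof (induction r arbitrary: g)
  case 0
  then show ?case using continuous_on_compose2 assms(4) by auto
next
  case (Suc r)
  have h: "((\<lambda>x. g (f x)) has_derivative
      (\<lambda>v. frechet_derivative g (at (f x)) (frechet_derivative f (at x) v))) (at x)" if "x \<in> S" for x
    by (rule has_derivative_compose[of f _ _ _ g]; rule frechet_derivative_works[THEN iffD1])
      (use Suc.prems that assms(4) in auto)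
  have "C_on r S (\<lambda>x. frechet_derivative (\<lambda>x. g (f x)) (at x) v)" for v
  proof (rule C_on_cong[OF assms(1)])
    show "C_on r S (\<lambda>x. \<Sum>b\<in>Basis. (frechet_derivative f (at x) v \<bullet> b) *\<^sub>R frechet_derivative g (at (f x)) b)"
      using Suc.prems C_on_SucD[OF Suc.prems(1)] assms(1)
      by (intro C_on_sum C_on_bilinear[OF bounded_bilinear_scaleR] C_on_bounded_linear[OF bounded_linear_inner_left]
          Suc.IH) auto
    fix x assume x: "x \<in> S"
    have "linear (frechet_derivative g (at (f x)))"
      by (rule linear_frechet_derivative) (use Suc.prems x assms(4) in auto)
    then show "(\<Sum>b\<in>Basis. (frechet_derivative f (at x) v \<bullet> b) *\<^sub>R frechet_derivative g (at (f x)) b)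
        = frechet_derivative (\<lambda>x. g (f x)) (at x) v"
      by (simp add: frechet_derivative_at[OF h[OF x], symmetric] linear_euclidean_expansion[symmetric])
  qed
  then show ?case using h by (auto simp: differentiable_def)
qed

lemma smooth_on_subset: "smooth_on S f \<Longrightarrow> T \<subseteq> S \<Longrightarrow> smooth_on T f"
  unfolding smooth_on_def using C_on_subset by blast

lemma smooth_on_cong: "open S \<Longrightarrow> (\<And>x. x \<in> S \<Longrightarrow> f x = g x) \<Longrightarrow> smooth_on S f \<Longrightarrow> smooth_on S g"
  unfolding smooth_on_def using C_on_cong by blast

lemma smooth_on_local:
  assumes "\<And>x. x \<in> S \<Longrightarrow> \<exists>T. open T \<and> x \<in> T \<and> smooth_on T f"
  shows "smooth_on S f"
  unfolding smooth_on_def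
proof (intro allI C_on_local)
  fix r x assume "x \<in> S"
  from assms[OF this] show "\<exists>T. open T \<and> x \<in> T \<and> C_on r T f" by (auto simp: smooth_on_def)
qed

lemma smooth_on_const: "smooth_on S (\<lambda>x. c)"
  by (simp add: smooth_on_def C_on_const)

lemma smooth_on_id: "open S \<Longrightarrow> smooth_on S (\<lambda>x. x)"
  by (simp add: smooth_on_def C_on_id)

lemma smooth_on_bounded_linear:
  "bounded_linear L \<Longrightarrow> open S \<Longrightarrow> smooth_on S f \<Longrightarrow> smooth_on S (\<lambda>x. L (f x))"
  unfolding smooth_on_def using C_on_bounded_linear by blast

lemma smooth_on_add: "open S \<Longrightarrow> smooth_on S f \<Longrightarrow> smooth_on S g \<Longrightarrow> smooth_on S (\<lambda>x. f x + g x)"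
  unfolding smooth_on_def using C_on_add by blast

lemma smooth_on_sum: "open S \<Longrightarrow> (\<And>i. i \<in> I \<Longrightarrow> smooth_on S (f i)) \<Longrightarrow> smooth_on S (\<lambda>x. \<Sum>i\<in>I. f i x)"
  unfolding smooth_on_def using C_on_sum[of S I] by blast

lemma smooth_on_bilinear:
  "bounded_bilinear B \<Longrightarrow> open S \<Longrightarrow> smooth_on S f \<Longrightarrow> smooth_on S g \<Longrightarrow> smooth_on S (\<lambda>x. B (f x) (g x))"
  unfolding smooth_on_def using C_on_bilinear by blast

lemmas smooth_on_scaleR = smooth_on_bilinear[OF bounded_bilinear_scaleR]
lemmas smooth_on_mult = smooth_on_bilinear[OF bounded_bilinear_mult]
lemmas smooth_on_inner = smooth_on_bilinear[OF bounded_bilinear_inner]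

lemma smooth_on_compose:
  fixes f :: "'a::real_normed_vector \<Rightarrow> 'b::euclidean_space" and g :: "'b \<Rightarrow> 'c::real_normed_vector"
  shows "open S \<Longrightarrow> smooth_on S f \<Longrightarrow> smooth_on T g \<Longrightarrow> f ` S \<subseteq> T \<Longrightarrow> smooth_on S (\<lambda>x. g (f x))"
  unfolding smooth_on_def using C_on_compose by blast

lemma smooth_on_differentiable: "smooth_on S f \<Longrightarrow> x \<in> S \<Longrightarrow> f differentiable (at x)"
  unfolding smooth_on_def by (metis C_on.simps(2))

lemma smooth_on_frechet_derivative:
  "smooth_on S f \<Longrightarrow> smooth_on S (\<lambda>x. frechet_derivative f (at x) v)"
  unfolding smooth_on_def by (metis C_on.simps(2))

lemma smooth_on_continuous_on: "smooth_on S f \<Longrightarrow> continuous_on S f"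
  unfolding smooth_on_def by (metis C_on.simps(1))

lemma smooth_on_componentwise:
  fixes f :: "'a::real_normed_vector \<Rightarrow> 'b::euclidean_space"
  assumes "open S" "\<And>b. b \<in> Basis \<Longrightarrow> smooth_on S (\<lambda>x. f x \<bullet> b)"
  shows "smooth_on S f"
proof (rule smooth_on_cong[OF assms(1)])
  show "smooth_on S (\<lambda>x. \<Sum>b\<in>Basis. (f x \<bullet> b) *\<^sub>R b)"
    using assms by (intro smooth_on_sum smooth_on_scaleR smooth_on_const)
qed (simp add: euclidean_representation)

text \<open>The function \<open>x\<^bsup>-1/2\<^esup>\<close> normalizes vectors, and its square replaces division by positive functions.\<close>
definition rsqrt :: "real \<Rightarrow> real" where "rsqrt x = inverse (sqrt x)"

lemma rsqrt_square: "x > 0 \<Longrightarrow> rsqrt x * rsqrt x * x = 1"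
  by (auto simp: rsqrt_def field_simps)

lemma has_derivative_rsqrt:
  assumes "x > 0"
  shows "(rsqrt has_derivative (\<lambda>v. v * ((-1/2) * (rsqrt x * (rsqrt x * rsqrt x))))) (at x)"
proof -
  have "(rsqrt has_real_derivative ((-1/2) * (rsqrt x * (rsqrt x * rsqrt x)))) (at x)"
    unfolding rsqrt_def[abs_def]
    by (rule derivative_eq_intros refl | use assms in \<open>simp add: field_simps\<close>)+
  then show ?thesis
    unfolding has_field_derivative_def by (rule has_derivative_eq_rhs) (simp add: fun_eq_iff)
qed

text \<open>The derivative of \<open>rsqrt\<close> is a polynomial in \<open>rsqrt\<close> itself, so that one order of
  differentiability implies the next.\<close>
lemma smooth_on_rsqrt: "smooth_on {0<..} rsqrt"
proof -
  have "C_on r {0<..} rsqrt" for r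
  proof (induction r)
    case 0
    show ?case unfolding rsqrt_def[abs_def] by (auto intro!: continuous_intros)
  next
    case (Suc r)
    have "C_on r {0<..} (\<lambda>x. frechet_derivative rsqrt (at x) v)" for v
    proof (rule C_on_cong)
      show "C_on r {0<..} (\<lambda>x. v * ((-1/2) * (rsqrt x * (rsqrt x * rsqrt x))))"
        by (intro C_on_bilinear[OF bounded_bilinear_mult] C_on_const Suc.IH) auto
    qed (use frechet_derivative_at[OF has_derivative_rsqrt] in \<open>auto simp: fun_eq_iff\<close>)
    then show ?case using has_derivative_rsqrt by (auto simp: differentiable_def)
  qed
  then show ?thesis by (simp add: smooth_on_def)
qed

text \<open>The derivatives of \<open>e\<^bsup>-1/x\<^esup>\<close> are of the form \<open>p(1/x) e\<^bsup>-1/x\<^esup>\<close> with a polynomial \<open>p\<close>; this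
  family is closed under differentiation, also at \<open>0\<close>.\<close>
definition flat_exp :: "real poly \<Rightarrow> real \<Rightarrow> real" where
  "flat_exp p x = (if x > 0 then poly p (inverse x) * exp (- inverse x) else 0)"

lemma poly_exp_tendsto_0: "((\<lambda>y. poly p y * exp (- y)) \<longlongrightarrow> (0::real)) at_top"
proof -
  have "((\<lambda>y. \<Sum>i\<le>degree p. coeff p i * (y ^ i / exp y)) \<longlongrightarrow> (\<Sum>i\<le>degree p. coeff p i * 0)) at_top"
    by (intro tendsto_sum tendsto_mult tendsto_const tendsto_power_div_exp_0)
  then show ?thesis by (simp add: poly_altdef sum_distrib_right exp_minus divide_inverse mult.assoc)
qed

lemma DERIV_flat_exp:
  "(flat_exp p has_real_derivative flat_exp (monom 1 2 * (p - pderiv p)) x) (at x)"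
proof -
  consider "x > 0" | "x < 0" | "x = 0" by linarith
  then show ?thesis
  proof cases
    case 1
    have i: "(inverse has_real_derivative - (inverse x * inverse x)) (at x)"
      using DERIV_inverse[of x] 1 by (simp add: power2_eq_square)
    have "((\<lambda>x. poly p (inverse x) * exp (- inverse x)) has_real_derivative
        poly (pderiv p) (inverse x) * (- (inverse x * inverse x)) * exp (- inverse x)
        + (exp (- inverse x) * (- (- (inverse x * inverse x)))) * poly p (inverse x)) (at x)"
      by (intro DERIV_mult DERIV_chain2[OF poly_DERIV] DERIV_chain2[OF DERIV_exp] DERIV_minus i)
    then have "((\<lambda>x. poly p (inverse x) * exp (- inverse x)) has_real_derivative
        flat_exp (monom 1 2 * (p - pderiv p)) x) (at x)"
      using 1 by (simp add: flat_exp_def poly_monom power2_eq_square algebra_simps)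
    then show ?thesis
      by (rule has_field_derivative_transform_within_open[where S = "{0<..}"]) (use 1 in \<open>auto simp: flat_exp_def\<close>)
  next
    case 2
    have "((\<lambda>x. 0) has_real_derivative flat_exp (monom 1 2 * (p - pderiv p)) x) (at x)"
      using 2 by (simp add: flat_exp_def)
    then show ?thesis
      by (rule has_field_derivative_transform_within_open[where S = "{..<0}"]) (use 2 in \<open>auto simp: flat_exp_def\<close>)
  next
    case 3
    have l: "((\<lambda>h. flat_exp p h / h) \<longlongrightarrow> 0) (at_left 0)"
      by (rule tendsto_eventually) (auto simp: flat_exp_def eventually_at_filter)
    have "((\<lambda>h. poly (pCons 0 p) (inverse h) * exp (- inverse h)) \<longlongrightarrow> 0) (at_right 0)"
      by (rule filterlim_compose[OF poly_exp_tendsto_0 filterlim_inverse_at_top_right])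
    then have r: "((\<lambda>h. flat_exp p h / h) \<longlongrightarrow> 0) (at_right 0)"
      by (rule Lim_transform_eventually) (auto simp: flat_exp_def eventually_at_filter field_simps)
    show ?thesis using l r 3 by (simp add: DERIV_def flat_exp_def filterlim_split_at)
  qed
qed

lemma smooth_on_flat_exp: "smooth_on UNIV (flat_exp p)"
proof -
  have "C_on r UNIV (flat_exp p)" for r
  proof (induction r arbitrary: p)
    case 0
    show ?case using DERIV_flat_exp[of p] by (auto simp: continuous_on_eq_continuous_at intro: DERIV_isCont)
  next
    case (Suc r)
    have h: "(flat_exp p has_derivative (\<lambda>v. flat_exp (monom 1 2 * (p - pderiv p)) x * v)) (at x)" for x
      using DERIV_flat_exp[of p x] by (simp add: has_field_derivative_def)
    have "C_on r UNIV (\<lambda>x. frechet_derivative (flat_exp p) (at x) v)" for v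
      by (subst frechet_derivative_at[OF h, symmetric])
        (intro C_on_bilinear[OF bounded_bilinear_mult] Suc.IH C_on_const open_UNIV)
    then show ?case using h by (auto simp: differentiable_def)
  qed
  then show ?thesis by (simp add: smooth_on_def)
qed

text \<open>The quotient \<open>a t / (a t + a (1 - t))\<close> for \<open>a t = e\<^bsup>-1/t\<^esup>\<close>, \<open>t > 0\<close>, and \<open>a t = 0\<close>, \<open>t \<le> 0\<close>.\<close>
definition smooth_step :: "real \<Rightarrow> real" where
  "smooth_step t = flat_exp 1 t * (rsqrt (flat_exp 1 t + flat_exp 1 (1 - t)) * rsqrt (flat_exp 1 t + flat_exp 1 (1 - t)))"

lemma flat_exp_sum_pos: "flat_exp 1 t + flat_exp 1 (1 - t) > 0"
  by (cases "t > 0"; cases "t < 1") (auto simp: flat_exp_def intro: add_pos_pos)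

lemma smooth_on_smooth_step: "smooth_on UNIV smooth_step"
proof -
  have m: "smooth_on UNIV (\<lambda>t. flat_exp 1 t + flat_exp 1 (1 - t))"
  proof (intro smooth_on_add smooth_on_flat_exp open_UNIV)
    have "smooth_on UNIV (\<lambda>t. 1 + (-1) * t :: real)"
      by (intro smooth_on_add smooth_on_mult smooth_on_const smooth_on_id open_UNIV)
    then have "smooth_on UNIV (\<lambda>t. 1 - t :: real)" by simp
    then show "smooth_on UNIV (\<lambda>t. flat_exp 1 (1 - t))"
      by (rule smooth_on_compose[OF open_UNIV _ smooth_on_flat_exp]) simp
  qed
  have "smooth_on UNIV (\<lambda>t. rsqrt (flat_exp 1 t + flat_exp 1 (1 - t)))"
    by (rule smooth_on_compose[OF open_UNIV m smooth_on_rsqrt]) (auto intro: flat_exp_sum_pos)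
  then show ?thesis unfolding smooth_step_def[abs_def]
    by (intro smooth_on_mult smooth_on_flat_exp open_UNIV)
qed

lemma smooth_step_le_0: "t \<le> 0 \<Longrightarrow> smooth_step t = 0"
  by (simp add: smooth_step_def flat_exp_def)

lemma smooth_step_ge_1: "t \<ge> 1 \<Longrightarrow> smooth_step t = 1"
  using rsqrt_square[OF flat_exp_sum_pos[of t]] by (simp add: smooth_step_def flat_exp_def mult.commute)

lemma smooth_step_nonneg: "smooth_step t \<ge> 0"
  unfolding smooth_step_def by (intro mult_nonneg_nonneg) (auto simp: flat_exp_def rsqrt_def)

section \<open>Smooth functions and tangent vectors on a manifold\<close>

locale oriented_manifold =
  fixes A :: "('m::{t2_space, second_countable_topology}, 'n::finite) chart set"
  assumes atlas: "oriented_atlas A"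
begin

lemma ex_chart: "\<exists>U \<phi>. (U, \<phi>) \<in> A \<and> p \<in> U"
proof -
  have "p \<in> (\<Union>(U, \<phi>)\<in>A. U)" using atlas by (simp add: oriented_atlas_def)
  then show ?thesis by auto
qed

lemma chart_open: "(U, \<phi>) \<in> A \<Longrightarrow> open U"
  and chart_image_open: "(U, \<phi>) \<in> A \<Longrightarrow> open (\<phi> ` U)"
  and chart_homeo: "(U, \<phi>) \<in> A \<Longrightarrow> homeomorphism U (\<phi> ` U) \<phi> (inv_into U \<phi>)"
  using atlas unfolding oriented_atlas_def by fast+

lemma chart_transition: "(U, \<phi>) \<in> A \<Longrightarrow> (V, \<psi>) \<in> A \<Longrightarrow> smooth_on (\<phi> ` (U \<inter> V)) (\<lambda>x. \<psi> (inv_into U \<phi> x))"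
  using atlas unfolding oriented_atlas_def o_def by fast

lemma chart_transition_det: "(U, \<phi>) \<in> A \<Longrightarrow> (V, \<psi>) \<in> A \<Longrightarrow> x \<in> \<phi> ` (U \<inter> V) \<Longrightarrow>
    det (matrix (frechet_derivative (\<lambda>x. \<psi> (inv_into U \<phi> x)) (at x))) > 0"
  using atlas unfolding oriented_atlas_def o_def by fast

lemma chart_inv: "(U, \<phi>) \<in> A \<Longrightarrow> q \<in> U \<Longrightarrow> inv_into U \<phi> (\<phi> q) = q"
  using homeomorphism_apply1[OF chart_homeo] by fast

lemma chart_inv_in: "x \<in> \<phi> ` U \<Longrightarrow> inv_into U \<phi> x \<in> U"
  by (rule inv_into_into)

lemma chart_continuous: "(U, \<phi>) \<in> A \<Longrightarrow> continuous_on U \<phi>"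
  and chart_inv_continuous: "(U, \<phi>) \<in> A \<Longrightarrow> continuous_on (\<phi> ` U) (inv_into U \<phi>)"
  using chart_homeo by (auto simp: homeomorphism_def)

lemma chart_image_eq:
  assumes "(U, \<phi>) \<in> A" "W \<subseteq> U"
  shows "\<phi> ` W = inv_into U \<phi> -` W \<inter> \<phi> ` U"
proof -
  have "\<phi> (inv_into U \<phi> x) = x" if "x \<in> \<phi> ` U" for x using that by (rule f_inv_into_f)
  then show ?thesis using assms chart_inv[OF assms(1)] by (force simp: subset_iff image_iff)
qed

lemma chart_open_image:
  assumes "(U, \<phi>) \<in> A" "open W" "W \<subseteq> U"
  shows "open (\<phi> ` W)"
  using chart_inv_continuous[OF assms(1)] assms(2)
  by (simp add: chart_image_eq[OF assms(1,3)] continuous_on_open_vimage[OF chart_image_open[OF assms(1)]])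

lemma smooth_fun_open: "smooth_fun A U h \<Longrightarrow> open U"
  by (simp add: smooth_fun_def)

lemma smooth_funI:
  "open U \<Longrightarrow> (\<And>V \<phi>. (V, \<phi>) \<in> A \<Longrightarrow> open (\<phi> ` (U \<inter> V)) \<Longrightarrow> smooth_on (\<phi> ` (U \<inter> V)) (\<lambda>x. h (inv_into V \<phi> x)))
    \<Longrightarrow> smooth_fun A U h"
  unfolding smooth_fun_def o_def
proof (intro conjI ballI, simp, clarify)
  fix V \<phi> assume h: "open U" "(V, \<phi>) \<in> A"
    "\<And>V \<phi>. (V, \<phi>) \<in> A \<Longrightarrow> open (\<phi> ` (U \<inter> V)) \<Longrightarrow> smooth_on (\<phi> ` (U \<inter> V)) (\<lambda>x. h (inv_into V \<phi> x))"
  have "open (U \<inter> V)" using h(1) chart_open[OF h(2)] by auto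
  then have "open (\<phi> ` (U \<inter> V))" by (rule chart_open_image[OF h(2)]) simp
  then show "smooth_on (\<phi> ` (U \<inter> V)) (\<lambda>x. h (inv_into V \<phi> x))" by (rule h(3)[OF h(2)])
qed

lemma smooth_funD:
  "smooth_fun A U h \<Longrightarrow> (V, \<phi>) \<in> A \<Longrightarrow> smooth_on (\<phi> ` (U \<inter> V)) (\<lambda>x. h (inv_into V \<phi> x))"
  by (auto simp: smooth_fun_def o_def)

lemma smooth_fun_const: "open U \<Longrightarrow> smooth_fun A U (\<lambda>q. c)"
  by (intro smooth_funI smooth_on_const)

lemma smooth_fun_add: "smooth_fun A U f \<Longrightarrow> smooth_fun A U h \<Longrightarrow> smooth_fun A U (\<lambda>q. f q + h q)"
  by (intro smooth_funI smooth_on_add) (auto intro: smooth_funD smooth_fun_open)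

lemma smooth_fun_sum:
  "open U \<Longrightarrow> (\<And>i. i \<in> I \<Longrightarrow> smooth_fun A U (f i)) \<Longrightarrow> smooth_fun A U (\<lambda>q. \<Sum>i\<in>I. f i q)"
  by (intro smooth_funI smooth_on_sum) (auto intro: smooth_funD)

lemma smooth_fun_bilinear: "bounded_bilinear B \<Longrightarrow> smooth_fun A U f \<Longrightarrow> smooth_fun A U h \<Longrightarrow>
    smooth_fun A U (\<lambda>q. B (f q) (h q))"
  by (rule smooth_funI, erule smooth_fun_open, rule smooth_on_bilinear) (auto intro: smooth_funD)

lemmas smooth_fun_scaleR = smooth_fun_bilinear[OF bounded_bilinear_scaleR]
lemmas smooth_fun_mult = smooth_fun_bilinear[OF bounded_bilinear_mult]
lemmas smooth_fun_inner = smooth_fun_bilinear[OF bounded_bilinear_inner]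

lemma smooth_fun_diff: "smooth_fun A U f \<Longrightarrow> smooth_fun A U h \<Longrightarrow> smooth_fun A U (\<lambda>q. f q - h q)"
  using smooth_fun_add[of U f "\<lambda>q. (-1) *\<^sub>R h q"]
    smooth_fun_scaleR[OF smooth_fun_const[of U "-1"], of h] smooth_fun_open by auto

lemma smooth_fun_bounded_linear: "bounded_linear L \<Longrightarrow> smooth_fun A U f \<Longrightarrow> smooth_fun A U (\<lambda>q. L (f q))"
  by (rule smooth_funI, erule smooth_fun_open, rule smooth_on_bounded_linear) (auto intro: smooth_funD)

lemma smooth_fun_compose:
  fixes f :: "'m \<Rightarrow> 'b::euclidean_space" and G :: "'b \<Rightarrow> 'c::real_normed_vector"
  assumes "smooth_fun A U f" "smooth_on T G" "f ` U \<subseteq> T"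
  shows "smooth_fun A U (\<lambda>q. G (f q))"
proof (rule smooth_funI)
  fix V \<phi> assume c: "(V, \<phi>) \<in> A" "open (\<phi> ` (U \<inter> V))"
  show "smooth_on (\<phi> ` (U \<inter> V)) (\<lambda>x. G (f (inv_into V \<phi> x)))"
    by (rule smooth_on_compose[OF c(2) smooth_funD[OF assms(1) c(1)] assms(2)])
      (use assms(3) chart_inv[OF c(1)] in auto)
qed (use assms smooth_fun_open in auto)

lemma smooth_fun_subset: "smooth_fun A U f \<Longrightarrow> open V \<Longrightarrow> V \<subseteq> U \<Longrightarrow> smooth_fun A V f"
  by (intro smooth_funI) (auto elim!: smooth_on_subset[OF smooth_funD])

lemma smooth_fun_cong: "smooth_fun A U f \<Longrightarrow> (\<And>q. q \<in> U \<Longrightarrow> f q = h q) \<Longrightarrow> smooth_fun A U h"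
proof (rule smooth_funI)
  fix V \<phi> assume h: "smooth_fun A U f" "\<And>q. q \<in> U \<Longrightarrow> f q = h q" and c: "(V, \<phi>) \<in> A" "open (\<phi> ` (U \<inter> V))"
  show "smooth_on (\<phi> ` (U \<inter> V)) (\<lambda>x. h (inv_into V \<phi> x))"
    by (rule smooth_on_cong[OF c(2) _ smooth_funD[OF h(1) c(1)]]) (use h(2) chart_inv[OF c(1)] in auto)
qed (use smooth_fun_open in auto)

lemma smooth_fun_local:
  assumes "\<And>p. p \<in> U \<Longrightarrow> \<exists>W. p \<in> W \<and> smooth_fun A W f"
  shows "open U \<Longrightarrow> smooth_fun A U f"
proof (rule smooth_funI)
  fix V \<phi> assume c: "(V, \<phi>) \<in> A" "open (\<phi> ` (U \<inter> V))"
  show "smooth_on (\<phi> ` (U \<inter> V)) (\<lambda>x. f (inv_into V \<phi> x))"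
  proof (rule smooth_on_local)
    fix x assume "x \<in> \<phi> ` (U \<inter> V)"
    then obtain q where q: "q \<in> U" "q \<in> V" "x = \<phi> q" by auto
    obtain W where W: "q \<in> W" "smooth_fun A W f" using assms q by blast
    have "open (W \<inter> V)" using smooth_fun_open[OF W(2)] chart_open[OF c(1)] by auto
    then have "open (\<phi> ` (W \<inter> V))" by (rule chart_open_image[OF c(1)]) simp
    moreover have "x \<in> \<phi> ` (W \<inter> V)" using W(1) q by simp
    ultimately show "\<exists>T. open T \<and> x \<in> T \<and> smooth_on T (\<lambda>x. f (inv_into V \<phi> x))"
      using smooth_funD[OF W(2) c(1)] by (intro exI conjI)
  qed
qed

lemma smooth_fun_componentwise:
  fixes f :: "'m \<Rightarrow> 'b::euclidean_space"
  shows "open U \<Longrightarrow> (\<And>b. b \<in> Basis \<Longrightarrow> smooth_fun A U (\<lambda>q. f q \<bullet> b)) \<Longrightarrow> smooth_fun A U f"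
  by (rule smooth_funI, assumption, rule smooth_on_componentwise) (auto intro: smooth_funD)

lemma smooth_fun_chartI:
  assumes "(V, \<phi>) \<in> A" "open U" "U \<subseteq> V" "smooth_on (\<phi> ` U) (\<lambda>x. h (inv_into V \<phi> x))"
  shows "smooth_fun A U h"
proof (rule smooth_funI[OF assms(2)])
  fix V' \<phi>' assume c: "(V', \<phi>') \<in> A" and o: "open (\<phi>' ` (U \<inter> V'))"
  have "smooth_on (\<phi>' ` (U \<inter> V')) (\<lambda>x. h (inv_into V \<phi> (\<phi> (inv_into V' \<phi>' x))))"
    by (rule smooth_on_compose[OF o smooth_on_subset[OF chart_transition[OF c assms(1)]] assms(4)])
      (use assms(3) chart_inv[OF c] in auto)
  then show "smooth_on (\<phi>' ` (U \<inter> V')) (\<lambda>x. h (inv_into V' \<phi>' x))"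
    by (rule smooth_on_cong[OF o, rotated]) (use assms(3) chart_inv[OF c] chart_inv[OF assms(1)] in auto)
qed

lemma smooth_fun_coord: "(V, \<phi>) \<in> A \<Longrightarrow> smooth_fun A V \<phi>"
  by (rule smooth_funI) (auto simp: chart_open Int_commute intro: chart_transition)

lemma smooth_fun_coord_nth: "(V, \<phi>) \<in> A \<Longrightarrow> smooth_fun A V (\<lambda>q. \<phi> q $ i)"
  using smooth_fun_bounded_linear[OF bounded_linear_vec_nth smooth_fun_coord] .

lemma smooth_fun_continuous:
  assumes "smooth_fun A U h" shows "continuous_on U h"
proof -
  have "isCont h p" if p: "p \<in> U" for p
  proof -
    obtain V \<phi> where c: "(V, \<phi>) \<in> A" "p \<in> V" using ex_chart by blast
    have o: "open (U \<inter> V)" using smooth_fun_open[OF assms] chart_open[OF c(1)] by auto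
    have "continuous_on (U \<inter> V) (\<lambda>q. h (inv_into V \<phi> (\<phi> q)))"
      by (rule continuous_on_compose2[OF smooth_on_continuous_on[OF smooth_funD[OF assms c(1)]]])
        (auto intro: continuous_on_subset[OF chart_continuous[OF c(1)]])
    then have "continuous_on (U \<inter> V) h"
      by (rule continuous_on_eq) (simp add: chart_inv[OF c(1)])
    then show ?thesis using o p c(2) by (auto simp: continuous_on_eq_continuous_at)
  qed
  then show ?thesis by (simp add: continuous_at_imp_continuous_on)
qed

subsection \<open>Tangent vectors\<close>

lemma smooth_nearI: "smooth_fun A U h \<Longrightarrow> p \<in> U \<Longrightarrow> smooth_near A p h"
  by (auto simp: smooth_near_def)

lemma smooth_near_cong:
  assumes "open W" "p \<in> W" "\<And>q. q \<in> W \<Longrightarrow> h q = h' q" "smooth_near A p h"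
  shows "smooth_near A p h'"
proof -
  obtain U where U: "p \<in> U" "smooth_fun A U h" using assms(4) by (auto simp: smooth_near_def)
  have "smooth_fun A (U \<inter> W) h"
    using U assms(1) smooth_fun_open by (intro smooth_fun_subset[OF U(2)]) auto
  then have "smooth_fun A (U \<inter> W) h'" by (rule smooth_fun_cong) (use assms in auto)
  then show ?thesis using U assms(2) by (auto simp: smooth_near_def)
qed

lemma smooth_near_common:
  assumes "smooth_near A p h" "smooth_near A p h'"
  obtains U where "p \<in> U" "smooth_fun A U h" "smooth_fun A U h'"
proof -
  obtain U V where "p \<in> U" "smooth_fun A U h" "p \<in> V" "smooth_fun A V h'"
    using assms by (auto simp: smooth_near_def)
  then show thesis
    using smooth_fun_open by (intro that[of "U \<inter> V"]) (auto intro: smooth_fun_subset)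
qed

lemma smooth_near_add: "smooth_near A p h \<Longrightarrow> smooth_near A p h' \<Longrightarrow> smooth_near A p (\<lambda>q. h q + h' q)"
  and smooth_near_mult: "smooth_near A p h \<Longrightarrow> smooth_near A p h' \<Longrightarrow> smooth_near A p (\<lambda>q. h q * h' q)"
  by (erule (1) smooth_near_common, rule smooth_nearI[rotated], assumption,
      auto intro: smooth_fun_add smooth_fun_mult)+

lemma smooth_near_const: "smooth_near A p (\<lambda>q. c)"
  by (rule smooth_nearI[OF smooth_fun_const[OF open_UNIV]]) simp

lemma chart_differentiable:
  assumes "(U, \<phi>) \<in> A" "p \<in> U" "smooth_near A p h"
  shows "(\<lambda>x. h (inv_into U \<phi> x)) differentiable (at (\<phi> p))"
proof -
  obtain W where W: "p \<in> W" "smooth_fun A W h" using assms by (auto simp: smooth_near_def)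
  then show ?thesis using smooth_on_differentiable[OF smooth_funD[OF W(2) assms(1)]] assms(2) by auto
qed

lemma chart_tvec_apply:
  "smooth_near A p h \<Longrightarrow>
    chart_tvec A (U, \<phi>) p w h = frechet_derivative (\<lambda>x. h (inv_into U \<phi> x)) (at (\<phi> p)) w"
  by (simp add: o_def)

lemma chart_tvec_not_near: "\<not> smooth_near A p h \<Longrightarrow> chart_tvec A (U, \<phi>) p w h = 0"
  by simp

declare chart_tvec.simps [simp del]

lemma tangent_spaceI: "(U, \<phi>) \<in> A \<Longrightarrow> p \<in> U \<Longrightarrow> chart_tvec A (U, \<phi>) p w \<in> tangent_space A p"
  by (force simp: tangent_space_def)

lemma tangent_not_near: "v \<in> tangent_space A p \<Longrightarrow> \<not> smooth_near A p h \<Longrightarrow> v h = 0"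
  by (auto simp: tangent_space_def chart_tvec_not_near)

lemma chart_tvec_change:
  assumes "(U, \<phi>) \<in> A" "(V, \<psi>) \<in> A" "p \<in> U" "p \<in> V"
  shows "chart_tvec A (U, \<phi>) p w
    = chart_tvec A (V, \<psi>) p (frechet_derivative (\<lambda>x. \<psi> (inv_into U \<phi> x)) (at (\<phi> p)) w)"
proof
  fix h
  show "chart_tvec A (U, \<phi>) p w h
    = chart_tvec A (V, \<psi>) p (frechet_derivative (\<lambda>x. \<psi> (inv_into U \<phi> x)) (at (\<phi> p)) w) h"
  proof (cases "smooth_near A p h")
    case True
    have o: "open (\<phi> ` (U \<inter> V))" using assms chart_open by (intro chart_open_image) auto
    have x: "\<phi> p \<in> \<phi> ` (U \<inter> V)" using assms by auto
    have "(\<lambda>x. h (inv_into V \<psi> x)) differentiable (at (\<psi> p))"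
      using assms True by (intro chart_differentiable)
    then have "((\<lambda>x. h (inv_into V \<psi> x)) has_derivative frechet_derivative (\<lambda>x. h (inv_into V \<psi> x)) (at (\<psi> p)))
        (at (\<psi> (inv_into U \<phi> (\<phi> p))))"
      by (simp add: chart_inv assms frechet_derivative_works[symmetric])
    then have "((\<lambda>x. h (inv_into V \<psi> (\<psi> (inv_into U \<phi> x)))) has_derivative
        (\<lambda>w. frechet_derivative (\<lambda>x. h (inv_into V \<psi> x)) (at (\<psi> p))
          (frechet_derivative (\<lambda>x. \<psi> (inv_into U \<phi> x)) (at (\<phi> p)) w))) (at (\<phi> p))"
      by (rule has_derivative_compose[rotated])
        (use smooth_on_differentiable[OF chart_transition x] assms in \<open>simp add: frechet_derivative_works[symmetric]\<close>)
    then have "((\<lambda>x. h (inv_into U \<phi> x)) has_derivative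
        (\<lambda>w. frechet_derivative (\<lambda>x. h (inv_into V \<psi> x)) (at (\<psi> p))
          (frechet_derivative (\<lambda>x. \<psi> (inv_into U \<phi> x)) (at (\<phi> p)) w))) (at (\<phi> p))"
      by (rule has_derivative_transform_within_open[OF _ o x]) (auto simp: chart_inv assms)
    from frechet_derivative_at[OF this, symmetric] show ?thesis
      using True by (simp add: chart_tvec_apply)
  qed (simp add: chart_tvec_not_near)
qed

lemma tangent_space_chart:
  assumes "(U, \<phi>) \<in> A" "p \<in> U"
  shows "tangent_space A p = range (chart_tvec A (U, \<phi>) p)"
proof
  show "tangent_space A p \<subseteq> range (chart_tvec A (U, \<phi>) p)"
    using chart_tvec_change[OF _ assms(1) _ assms(2)] by (fastforce simp: tangent_space_def)
qed (use assms in \<open>auto intro: tangent_spaceI\<close>)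

lemma chart_tvec_linear:
  assumes "(U, \<phi>) \<in> A" "p \<in> U"
  shows "linear (\<lambda>w. chart_tvec A (U, \<phi>) p w h)"
proof (cases "smooth_near A p h")
  case True
  then show ?thesis
    using linear_frechet_derivative[OF chart_differentiable[OF assms True]] by (simp add: chart_tvec_apply)
qed (simp add: chart_tvec_not_near linear_iff)

lemma tangent_sum:
  assumes "\<And>i. i \<in> I \<Longrightarrow> u i \<in> tangent_space A p"
  shows "(\<lambda>h. \<Sum>i\<in>I. c i * u i h) \<in> tangent_space A p"
proof -
  obtain U \<phi> where c: "(U, \<phi>) \<in> A" "p \<in> U" using ex_chart by blast
  have "\<forall>i\<in>I. \<exists>w. u i = chart_tvec A (U, \<phi>) p w"
    using assms tangent_space_chart[OF c] by auto
  then obtain w where w: "\<And>i. i \<in> I \<Longrightarrow> u i = chart_tvec A (U, \<phi>) p (w i)" by metis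
  have "(\<lambda>h. \<Sum>i\<in>I. c i * u i h) = chart_tvec A (U, \<phi>) p (\<Sum>i\<in>I. c i *\<^sub>R w i)"
    by (simp add: w linear_sum[OF chart_tvec_linear[OF c]] linear_cmul[OF chart_tvec_linear[OF c]] fun_eq_iff)
  then show ?thesis using tangent_spaceI[OF c] by simp
qed

lemma tangent_lincomb:
  assumes "u \<in> tangent_space A p" "v \<in> tangent_space A p"
  shows "(\<lambda>h. a * u h + b * v h) \<in> tangent_space A p"
  using tangent_sum[of "UNIV::bool set" "\<lambda>i. if i then u else v" p "\<lambda>i. if i then a else b"] assms
  by (simp add: UNIV_bool add.commute)

lemma tangent_zero: "(\<lambda>h. 0) \<in> tangent_space A p"
  using tangent_sum[of "{}" _ p] by simp

lemma tangent_local: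
  assumes "v \<in> tangent_space A p" "open W" "p \<in> W" "\<And>q. q \<in> W \<Longrightarrow> h q = h' q"
  shows "v h = v h'"
proof (cases "smooth_near A p h")
  case True
  then have n: "smooth_near A p h'" using smooth_near_cong assms by blast
  obtain U \<phi> w where v: "v = chart_tvec A (U, \<phi>) p w" and c: "(U, \<phi>) \<in> A" "p \<in> U"
    using assms(1) by (auto simp: tangent_space_def)
  have "open (\<phi> ` (U \<inter> W))" using c assms chart_open by (intro chart_open_image) auto
  then have "frechet_derivative (\<lambda>x. h' (inv_into U \<phi> x)) (at (\<phi> p)) = frechet_derivative (\<lambda>x. h (inv_into U \<phi> x)) (at (\<phi> p))"
    by (rule frechet_derivative_cong_open) (use c assms chart_differentiable[OF c True] chart_inv[OF c(1)] in auto)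
  then show ?thesis by (simp add: v chart_tvec_apply n True)
next
  case False
  then have "\<not> smooth_near A p h'" using smooth_near_cong[of W p h' h] assms by metis
  then show ?thesis using tangent_not_near[OF assms(1)] False by simp
qed

lemma tangent_const: "v \<in> tangent_space A p \<Longrightarrow> v (\<lambda>q. c) = 0"
  by (auto simp: tangent_space_def chart_tvec_apply smooth_near_const)

lemma tangent_add:
  assumes "v \<in> tangent_space A p" "smooth_near A p h" "smooth_near A p h'"
  shows "v (\<lambda>q. h q + h' q) = v h + v h'"
proof -
  obtain U \<phi> w where v: "v = chart_tvec A (U, \<phi>) p w" and c: "(U, \<phi>) \<in> A" "p \<in> U"
    using assms(1) by (auto simp: tangent_space_def)
  have "((\<lambda>x. h (inv_into U \<phi> x) + h' (inv_into U \<phi> x)) has_derivative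
     (\<lambda>w. frechet_derivative (\<lambda>x. h (inv_into U \<phi> x)) (at (\<phi> p)) w
        + frechet_derivative (\<lambda>x. h' (inv_into U \<phi> x)) (at (\<phi> p)) w)) (at (\<phi> p))"
    by (intro has_derivative_add) (simp_all add: frechet_derivative_works[symmetric] chart_differentiable c assms)
  from frechet_derivative_at[OF this, symmetric] show ?thesis
    by (simp add: v chart_tvec_apply assms smooth_near_add)
qed

lemma tangent_mult:
  assumes "v \<in> tangent_space A p" "smooth_near A p h" "smooth_near A p h'"
  shows "v (\<lambda>q. h q * h' q) = v h * h' p + h p * v h'"
proof -
  obtain U \<phi> w where v: "v = chart_tvec A (U, \<phi>) p w" and c: "(U, \<phi>) \<in> A" "p \<in> U"
    using assms(1) by (auto simp: tangent_space_def)
  have "((\<lambda>x. h (inv_into U \<phi> x) * h' (inv_into U \<phi> x)) has_derivative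
     (\<lambda>w. h (inv_into U \<phi> (\<phi> p)) * frechet_derivative (\<lambda>x. h' (inv_into U \<phi> x)) (at (\<phi> p)) w
        + frechet_derivative (\<lambda>x. h (inv_into U \<phi> x)) (at (\<phi> p)) w * h' (inv_into U \<phi> (\<phi> p)))) (at (\<phi> p))"
    by (intro has_derivative_mult) (simp_all add: frechet_derivative_works[symmetric] chart_differentiable c assms)
  from frechet_derivative_at[OF this, symmetric] show ?thesis
    by (simp add: v chart_tvec_apply assms smooth_near_mult chart_inv[OF c])
qed

lemma smooth_near_sum: "(\<And>i. i \<in> I \<Longrightarrow> smooth_near A p (h i)) \<Longrightarrow> smooth_near A p (\<lambda>q. \<Sum>i\<in>I. h i q)"
  by (induction I rule: infinite_finite_induct) (auto intro: smooth_near_const smooth_near_add)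

lemma tangent_sum_fun:
  assumes "v \<in> tangent_space A p" "\<And>i. i \<in> I \<Longrightarrow> smooth_near A p (h i)"
  shows "v (\<lambda>q. \<Sum>i\<in>I. h i q) = (\<Sum>i\<in>I. v (h i))"
  using assms(2)
  by (induction I rule: infinite_finite_induct)
    (auto simp: tangent_const[OF assms(1)] tangent_add[OF assms(1)] smooth_near_sum)

lemma chart_tvec_coord:
  assumes "(U, \<phi>) \<in> A" "p \<in> U"
  shows "chart_tvec A (U, \<phi>) p w (\<lambda>q. \<phi> q $ i) = w $ i"
proof -
  have "((\<lambda>x. x $ i) has_derivative (\<lambda>w. w $ i)) (at (\<phi> p))"
    by (rule bounded_linear.has_derivative[OF bounded_linear_vec_nth has_derivative_ident])
  then have "((\<lambda>x. \<phi> (inv_into U \<phi> x) $ i) has_derivative (\<lambda>w. w $ i)) (at (\<phi> p))"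
    by (rule has_derivative_transform_within_open[OF _ chart_image_open[OF assms(1)]])
      (use assms chart_inv in auto)
  then have "frechet_derivative (\<lambda>x. \<phi> (inv_into U \<phi> x) $ i) (at (\<phi> p)) = (\<lambda>w. w $ i)"
    by (rule frechet_derivative_at[symmetric])
  moreover have "smooth_near A p (\<lambda>q. \<phi> q $ i)"
    by (rule smooth_nearI[OF smooth_fun_coord_nth[OF assms(1)] assms(2)])
  ultimately show ?thesis by (simp add: chart_tvec_apply)
qed

lemma tangent_eq_chart_tvec:
  assumes "(U, \<phi>) \<in> A" "p \<in> U" "v \<in> tangent_space A p"
  shows "v = chart_tvec A (U, \<phi>) p (\<chi> i. v (\<lambda>q. \<phi> q $ i))"
proof -
  obtain w where w: "v = chart_tvec A (U, \<phi>) p w" using assms tangent_space_chart by auto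
  then have "(\<chi> i. v (\<lambda>q. \<phi> q $ i)) = w" by (simp add: chart_tvec_coord[OF assms(1,2)] vec_eq_iff)
  then show ?thesis using w by simp
qed

lemma tangent_eqI:
  assumes "(U, \<phi>) \<in> A" "p \<in> U" "v \<in> tangent_space A p" "u \<in> tangent_space A p"
    "\<And>i. v (\<lambda>q. \<phi> q $ i) = u (\<lambda>q. \<phi> q $ i)"
  shows "v = u"
  using tangent_eq_chart_tvec[OF assms(1-3)] tangent_eq_chart_tvec[OF assms(1,2,4)] assms(5) by simp

lemma tangent_expand:
  assumes "(U, \<phi>) \<in> A" "p \<in> U" "v \<in> tangent_space A p"
  shows "v h = (\<Sum>i\<in>UNIV. v (\<lambda>q. \<phi> q $ i) * chart_tvec A (U, \<phi>) p (axis i 1) h)"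
proof -
  have "v h = chart_tvec A (U, \<phi>) p (\<Sum>i\<in>UNIV. v (\<lambda>q. \<phi> q $ i) *\<^sub>R axis i 1) h"
    using tangent_eq_chart_tvec[OF assms] basis_expansion[of "\<chi> i. v (\<lambda>q. \<phi> q $ i)"]
    by (simp add: scalar_mult_eq_scaleR)
  then show ?thesis
    by (simp add: linear_sum[OF chart_tvec_linear[OF assms(1,2)]] linear_cmul[OF chart_tvec_linear[OF assms(1,2)]])
qed

subsection \<open>Vector fields\<close>

lemma smooth_vfieldD:
  assumes "smooth_vfield A U X"
  shows "open U" "\<And>p. p \<in> U \<Longrightarrow> X p \<in> tangent_space A p"
    "\<And>V h. V \<subseteq> U \<Longrightarrow> smooth_fun A V h \<Longrightarrow> smooth_fun A V (\<lambda>q. X q h)"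
  using assms by (auto simp: smooth_vfield_def)

lemma smooth_vfield_coord:
  assumes c: "(U, \<phi>) \<in> A"
  shows "smooth_vfield A U (\<lambda>q. chart_tvec A (U, \<phi>) q w)"
  unfolding smooth_vfield_def
proof (intro conjI ballI allI impI)
  show "open U" using chart_open[OF c] .
  show "chart_tvec A (U, \<phi>) p w \<in> tangent_space A p" if "p \<in> U" for p using tangent_spaceI[OF c that] .
  fix V and h :: "'m \<Rightarrow> real" assume V: "V \<subseteq> U" "smooth_fun A V h"
  have o: "open V" using V smooth_fun_open by auto
  have "smooth_on (\<phi> ` V) (\<lambda>x. frechet_derivative (\<lambda>x. h (inv_into U \<phi> x)) (at x) w)"
    using smooth_on_frechet_derivative[OF smooth_funD[OF V(2) c]] V by (simp add: Int_absorb2)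
  then have "smooth_on (\<phi> ` V) (\<lambda>x. chart_tvec A (U, \<phi>) (inv_into U \<phi> x) w h)"
    by (rule smooth_on_cong[OF chart_open_image[OF c o V(1)], rotated])
      (use V smooth_nearI chart_inv[OF c] in \<open>auto simp: chart_tvec_apply\<close>)
  then show "smooth_fun A V (\<lambda>q. chart_tvec A (U, \<phi>) q w h)"
    by (rule smooth_fun_chartI[OF c o V(1)])
qed

lemma smooth_vfield_sum:
  assumes "open U" "\<And>i. i \<in> I \<Longrightarrow> smooth_fun A U (f i)" "\<And>i. i \<in> I \<Longrightarrow> smooth_vfield A U (X i)"
  shows "smooth_vfield A U (\<lambda>q h. \<Sum>i\<in>I. f i q * X i q h)"
  unfolding smooth_vfield_def
proof (intro conjI ballI allI impI)
  show "(\<lambda>h. \<Sum>i\<in>I. f i p * X i p h) \<in> tangent_space A p" if "p \<in> U" for p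
    using smooth_vfieldD(2)[OF assms(3) that] by (rule tangent_sum)
  fix V and h :: "'m \<Rightarrow> real" assume V: "V \<subseteq> U" "smooth_fun A V h"
  show "smooth_fun A V (\<lambda>q. \<Sum>i\<in>I. f i q * X i q h)"
  proof (rule smooth_fun_sum[OF smooth_fun_open[OF V(2)]])
    fix i assume i: "i \<in> I"
    show "smooth_fun A V (\<lambda>q. f i q * X i q h)"
      by (rule smooth_fun_mult[OF smooth_fun_subset[OF assms(2)[OF i] smooth_fun_open[OF V(2)] V(1)]
            smooth_vfieldD(3)[OF assms(3)[OF i] V]])
  qed
qed (rule assms(1))

lemma smooth_vfield_scale: "smooth_fun A U f \<Longrightarrow> smooth_vfield A U X \<Longrightarrow> smooth_vfield A U (\<lambda>q h. f q * X q h)"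
  using smooth_vfield_sum[of U "{()}" "\<lambda>_. f" "\<lambda>_. X"] smooth_fun_open by auto

lemma smooth_vfield_subset: "smooth_vfield A U X \<Longrightarrow> open V \<Longrightarrow> V \<subseteq> U \<Longrightarrow> smooth_vfield A V X"
  unfolding smooth_vfield_def by blast

lemma smooth_vfield_cong: "smooth_vfield A U X \<Longrightarrow> (\<And>q. q \<in> U \<Longrightarrow> X q = Y q) \<Longrightarrow> smooth_vfield A U Y"
  unfolding smooth_vfield_def
proof (intro conjI ballI allI impI, simp, metis)
  fix V and h :: "'m \<Rightarrow> real"
  assume h: "open U \<and> (\<forall>p\<in>U. X p \<in> tangent_space A p) \<and>
     (\<forall>V h. V \<subseteq> U \<longrightarrow> smooth_fun A V h \<longrightarrow> smooth_fun A V (\<lambda>q. X q h))"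
    "\<And>q. q \<in> U \<Longrightarrow> X q = Y q" "V \<subseteq> U" "smooth_fun A V h"
  then have "smooth_fun A V (\<lambda>q. X q h)" by blast
  then show "smooth_fun A V (\<lambda>q. Y q h)" by (rule smooth_fun_cong) (use h in auto)
qed

lemma smooth_vfield_local:
  assumes "open U" "\<And>p. p \<in> U \<Longrightarrow> \<exists>W. p \<in> W \<and> smooth_vfield A W X"
  shows "smooth_vfield A U X"
  unfolding smooth_vfield_def
proof (intro conjI ballI allI impI)
  show "X p \<in> tangent_space A p" if "p \<in> U" for p using assms(2)[OF that] by (auto dest: smooth_vfieldD)
  fix V and h :: "'m \<Rightarrow> real" assume V: "V \<subseteq> U" "smooth_fun A V h"
  show "smooth_fun A V (\<lambda>q. X q h)"
  proof (rule smooth_fun_local)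
    fix p assume p: "p \<in> V"
    then obtain W where W: "p \<in> W" "smooth_vfield A W X" using assms(2) V by blast
    have "smooth_fun A (V \<inter> W) (\<lambda>q. X q h)"
      using smooth_fun_open[OF V(2)] smooth_vfieldD(1)[OF W(2)]
      by (intro smooth_vfieldD(3)[OF W(2)] smooth_fun_subset[OF V(2)]) auto
    then show "\<exists>W. p \<in> W \<and> smooth_fun A W (\<lambda>q. X q h)" using p W by blast
  qed (use smooth_fun_open V in auto)
qed (rule assms(1))

lemma vfield_through:
  assumes "v \<in> tangent_space A p"
  obtains U X where "p \<in> U" "smooth_vfield A U X" "X p = v"
proof -
  obtain U \<phi> w where v: "v = chart_tvec A (U, \<phi>) p w" and c: "(U, \<phi>) \<in> A" "p \<in> U"
    using assms by (auto simp: tangent_space_def)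
  show thesis using that[OF c(2) smooth_vfield_coord[OF c(1)]] v by blast
qed

subsection \<open>Bump functions\<close>

lemma ex_bump:
  assumes "open W" "p \<in> W"
  obtains \<psi> B C where "smooth_fun A UNIV \<psi>" "open B" "p \<in> B" "compact C" "C \<subseteq> W"
    "\<And>q. q \<in> B \<Longrightarrow> \<psi> q = (1::real)" "\<And>q. \<psi> q \<noteq> 0 \<Longrightarrow> q \<in> C" "\<And>q. \<psi> q \<ge> 0"
proof -
  obtain U \<phi> where c: "(U, \<phi>) \<in> A" "p \<in> U" using ex_chart by blast
  define x0 where "x0 = \<phi> p"
  have "open (\<phi> ` (U \<inter> W))" using c assms chart_open by (intro chart_open_image) auto
  moreover have "x0 \<in> \<phi> ` (U \<inter> W)" using c assms by (auto simp: x0_def)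
  ultimately obtain e where e: "e > 0" "cball x0 e \<subseteq> \<phi> ` (U \<inter> W)"
    unfolding open_contains_cball by blast
  \<comment> \<open>The argument of \<open>smooth_step\<close>: at least \<open>1\<close> on the ball of radius \<open>e / 2\<close>, at most \<open>0\<close> outside
    the ball of radius \<open>e\<close>.\<close>
  define t where "t x = 2 + (- 2 / e\<^sup>2) * ((x - x0) \<bullet> (x - x0))" for x
  have t_eq: "t x = 2 - 2 * (dist x0 x / e)\<^sup>2" for x
    by (simp add: t_def dist_norm power_divide power2_norm_eq_inner inner_diff_left inner_diff_right inner_commute)
  define \<psi> where "\<psi> q = (if q \<in> U then smooth_step (t (\<phi> q)) else 0)" for q
  define C where "C = inv_into U \<phi> ` cball x0 e"
  define B where "B = U \<inter> \<phi> -` ball x0 (e/2)"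
  have C: "compact C" unfolding C_def
    using e by (intro compact_continuous_image continuous_on_subset[OF chart_inv_continuous[OF c(1)]]) auto
  have CW: "C \<subseteq> W" using e chart_inv[OF c(1)] by (auto simp: C_def)
  have nz: "q \<in> C" if "\<psi> q \<noteq> 0" for q
  proof -
    have q: "q \<in> U" "t (\<phi> q) > 0" using that smooth_step_le_0 by (auto simp: \<psi>_def not_le[symmetric] split: if_splits)
    have "dist x0 (\<phi> q) / e \<le> 1"
    proof (rule ccontr)
      assume "\<not> dist x0 (\<phi> q) / e \<le> 1"
      then have "1 \<le> (dist x0 (\<phi> q) / e)\<^sup>2" by (simp add: one_le_power)
      then show False using q by (simp add: t_eq)
    qed
    then have "\<phi> q \<in> cball x0 e" using e by (simp add: field_simps)
    then show ?thesis using q chart_inv[OF c(1)] unfolding C_def by (metis imageI)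
  qed
  have one: "\<psi> q = 1" if "q \<in> B" for q
  proof -
    have "dist x0 (\<phi> q) / e \<le> 1/2" using that e by (simp add: B_def field_simps)
    then have "(dist x0 (\<phi> q) / e)\<^sup>2 \<le> (1/2)\<^sup>2" using e by (intro power_mono) auto
    also have "(1/2)\<^sup>2 = (1/4::real)" by (simp add: power2_eq_square)
    finally have "t (\<phi> q) \<ge> 1" unfolding t_eq by linarith
    then show ?thesis using that by (simp add: \<psi>_def B_def smooth_step_ge_1)
  qed
  have sU: "smooth_fun A U \<psi>"
  proof -
    have d: "smooth_on (UNIV :: (real^'n) set) (\<lambda>x. x - x0)"
      using smooth_on_add[OF open_UNIV smooth_on_id[OF open_UNIV] smooth_on_const[of _ "- x0"]] by simp
    have "smooth_on UNIV t" unfolding t_def[abs_def]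
      by (intro smooth_on_add smooth_on_mult smooth_on_inner smooth_on_const d open_UNIV)
    then have "smooth_fun A U (\<lambda>q. t (\<phi> q))"
      by (rule smooth_fun_compose[OF smooth_fun_coord[OF c(1)]]) simp
    then have "smooth_fun A U (\<lambda>q. smooth_step (t (\<phi> q)))"
      by (rule smooth_fun_compose[OF _ smooth_on_smooth_step]) simp
    then show ?thesis by (rule smooth_fun_cong) (simp add: \<psi>_def)
  qed
  have "smooth_fun A (- C) \<psi>"
    by (rule smooth_fun_cong[OF smooth_fun_const[of _ 0]]) (use nz C in \<open>auto simp: compact_imp_closed open_Compl\<close>)
  moreover have "U \<union> - C = UNIV" using e chart_inv[OF c(1)] by (auto simp: C_def)
  ultimately have "smooth_fun A UNIV \<psi>"
    using sU by (intro smooth_fun_local) (blast, simp)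
  moreover have "open B" unfolding B_def Int_commute[of U]
    using chart_continuous[OF c(1)] continuous_on_open_vimage[OF chart_open[OF c(1)]] by blast
  moreover have "p \<in> B" using c e by (simp add: B_def x0_def)
  ultimately show thesis
    using that[of \<psi> B C] C CW nz one smooth_step_nonneg by (auto simp: \<psi>_def)
qed

end

section \<open>Metric connections\<close>

context oriented_manifold begin

lemma metric_connectionD:
  assumes "metric_connection A Sec ip nab" "p \<in> U" "open U" "Sec U \<xi>" "v \<in> tangent_space A p"
  shows "u \<in> tangent_space A p \<Longrightarrow>
      nab p (\<lambda>k. a * u k + b * v k) \<xi> = (\<lambda>x. a *\<^sub>R nab p u \<xi> x + b *\<^sub>R nab p v \<xi> x)"
    and "Sec U \<eta> \<Longrightarrow> nab p v (\<lambda>q x. \<xi> q x + \<eta> q x) = (\<lambda>x. nab p v \<xi> x + nab p v \<eta> x)"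
    and "smooth_fun A U h \<Longrightarrow>
      nab p v (\<lambda>q x. h q *\<^sub>R \<xi> q x) = (\<lambda>x. v h *\<^sub>R \<xi> p x + h p *\<^sub>R nab p v \<xi> x)"
    and "Sec U \<eta> \<Longrightarrow>
      v (\<lambda>q. ip q (\<xi> q) (\<eta> q)) = ip p (nab p v \<xi>) (\<eta> p) + ip p (\<xi> p) (nab p v \<eta>)"
proof -
  note c = assms(1)[unfolded metric_connection_def, THEN conjunct1, rule_format, OF assms(3,2)]
  note z = smooth_fun_const[OF assms(3)]
  show "u \<in> tangent_space A p \<Longrightarrow>
      nab p (\<lambda>k. a * u k + b * v k) \<xi> = (\<lambda>x. a *\<^sub>R nab p u \<xi> x + b *\<^sub>R nab p v \<xi> x)"
    using c[OF assms(4) assms(4) z _ assms(5)] by auto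
  show "Sec U \<eta> \<Longrightarrow> nab p v (\<lambda>q x. \<xi> q x + \<eta> q x) = (\<lambda>x. nab p v \<xi> x + nab p v \<eta> x)"
    using c[OF assms(4) _ z assms(5) assms(5)] by auto
  show "smooth_fun A U h \<Longrightarrow>
      nab p v (\<lambda>q x. h q *\<^sub>R \<xi> q x) = (\<lambda>x. v h *\<^sub>R \<xi> p x + h p *\<^sub>R nab p v \<xi> x)"
    using c[OF assms(4) assms(4) _ assms(5) assms(5)] by auto
  show "Sec U \<eta> \<Longrightarrow>
      v (\<lambda>q. ip q (\<xi> q) (\<eta> q)) = ip p (nab p v \<xi>) (\<eta> p) + ip p (\<xi> p) (nab p v \<eta>)"
    using c[OF assms(4) _ z assms(5) assms(5)] by auto
qed

lemma metric_connection_smooth: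
  "metric_connection A Sec ip nab \<Longrightarrow> smooth_vfield A U X \<Longrightarrow> Sec U \<xi> \<Longrightarrow> Sec U (\<lambda>q. nab q (X q) \<xi>)"
  by (simp add: metric_connection_def)

text \<open>Multiply by a bump function: the products are equal everywhere, and by the Leibniz rule they
  have the same derivative at \<open>p\<close> as the sections themselves.\<close>
lemma metric_connection_local:
  assumes "metric_connection A Sec ip nab" "p \<in> U" "open U" "Sec U \<xi>" "Sec U \<eta>" "v \<in> tangent_space A p"
    "\<And>q. q \<in> U \<Longrightarrow> \<xi> q = \<eta> q"
  shows "nab p v \<xi> = nab p v \<eta>"
proof -
  obtain \<psi> B C where \<psi>: "smooth_fun A UNIV \<psi>" "open B" "p \<in> B" "compact C" "C \<subseteq> U"
    "\<And>q. q \<in> B \<Longrightarrow> \<psi> q = (1::real)" "\<And>q. \<psi> q \<noteq> 0 \<Longrightarrow> q \<in> C"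
    using ex_bump[OF assms(3,2)] by metis
  have s: "smooth_fun A U \<psi>" using smooth_fun_subset[OF \<psi>(1) assms(3)] by simp
  have v: "v \<psi> = 0"
    using tangent_local[OF assms(6) \<psi>(2,3), of \<psi> "\<lambda>_. 1"] \<psi>(6) tangent_const[OF assms(6)] by simp
  have e: "(\<lambda>q x. \<psi> q *\<^sub>R \<xi> q x) = (\<lambda>q x. \<psi> q *\<^sub>R \<eta> q x)"
  proof (intro ext)
    fix q x
    show "\<psi> q *\<^sub>R \<xi> q x = \<psi> q *\<^sub>R \<eta> q x"
      by (cases "\<psi> q = 0", simp) (use \<psi>(5) \<psi>(7)[of q] assms(7)[of q] in auto)
  qed
  show ?thesis
    using metric_connectionD(3)[OF assms(1-4,6) s] metric_connectionD(3)[OF assms(1-3,5,6) s] e v \<psi>(3,6)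
    by simp
qed

lemma metric_connection_zero_vector:
  assumes "metric_connection A Sec ip nab" "p \<in> U" "open U" "Sec U \<xi>"
  shows "nab p (\<lambda>k. 0) \<xi> = (\<lambda>x. 0)"
  using metric_connectionD(1)[OF assms tangent_zero tangent_zero, of 0 0] by simp

lemma metric_connection_sum_vector:
  assumes "metric_connection A Sec ip nab" "p \<in> U" "open U" "Sec U \<xi>"
    "\<And>i. i \<in> I \<Longrightarrow> v i \<in> tangent_space A p"
  shows "nab p (\<lambda>k. \<Sum>i\<in>I. c i * v i k) \<xi> = (\<lambda>x. \<Sum>i\<in>I. c i *\<^sub>R nab p (v i) \<xi> x)"
  using assms(5)
proof (induction I rule: infinite_finite_induct)
  case (insert i I)
  have "(\<lambda>k. \<Sum>i\<in>I. c i * v i k) \<in> tangent_space A p" using insert by (intro tangent_sum) auto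
  from metric_connectionD(1)[OF assms(1-4) this, of "v i" "c i" 1] insert
  show ?case by simp
qed (use metric_connection_zero_vector[OF assms(1-4)] in auto)

lemma metric_connection_zero:
  assumes "metric_connection A Sec ip nab" "p \<in> U" "open U" "Sec U \<xi>" "v \<in> tangent_space A p"
  shows "nab p v (\<lambda>q x. 0) = (\<lambda>x. 0)"
  using metric_connectionD(3)[OF assms smooth_fun_const[OF assms(3)], of 0] tangent_const[OF assms(5)] by simp

text \<open>The predicate \<open>Sec\<close> is arbitrary, and therefore closed under the sums that occur only by
  assumption; \<open>\<xi>\<^sub>0\<close> is there for the empty sum.\<close>
lemma metric_connection_sum:
  assumes "metric_connection A Sec ip nab" "p \<in> U" "open U" "Sec U \<xi>\<^sub>0" "v \<in> tangent_space A p"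
    "\<And>i. i \<in> I \<Longrightarrow> smooth_fun A U (h i)" "\<And>i. i \<in> I \<Longrightarrow> Sec U (\<xi> i)"
    "\<And>J. J \<subseteq> I \<Longrightarrow> Sec U (\<lambda>q x. \<Sum>i\<in>J. h i q *\<^sub>R \<xi> i q x)"
  shows "nab p v (\<lambda>q x. \<Sum>i\<in>I. h i q *\<^sub>R \<xi> i q x)
    = (\<lambda>x. \<Sum>i\<in>I. v (h i) *\<^sub>R \<xi> i p x + h i p *\<^sub>R nab p v (\<xi> i) x)"
  using assms(6-8)
proof (induction I rule: infinite_finite_induct)
  case (insert i I)
  have "Sec U (\<lambda>q x. h i q *\<^sub>R \<xi> i q x)" using insert.prems(3)[of "{i}"] by simp
  moreover have "Sec U (\<lambda>q x. \<Sum>i\<in>I. h i q *\<^sub>R \<xi> i q x)" using insert.prems(3)[of I] by auto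
  ultimately have "nab p v (\<lambda>q x. h i q *\<^sub>R \<xi> i q x + (\<Sum>i\<in>I. h i q *\<^sub>R \<xi> i q x))
    = (\<lambda>x. nab p v (\<lambda>q x. h i q *\<^sub>R \<xi> i q x) x + nab p v (\<lambda>q x. \<Sum>i\<in>I. h i q *\<^sub>R \<xi> i q x) x)"
    by (rule metric_connectionD(2)[OF assms(1-3) _ assms(5)])
  moreover have "nab p v (\<lambda>q x. h i q *\<^sub>R \<xi> i q x) = (\<lambda>x. v (h i) *\<^sub>R \<xi> i p x + h i p *\<^sub>R nab p v (\<xi> i) x)"
    by (rule metric_connectionD(3)[OF assms(1-3) _ assms(5)]) (use insert.prems in auto)
  moreover have "nab p v (\<lambda>q x. \<Sum>i\<in>I. h i q *\<^sub>R \<xi> i q x)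
    = (\<lambda>x. \<Sum>i\<in>I. v (h i) *\<^sub>R \<xi> i p x + h i p *\<^sub>R nab p v (\<xi> i) x)"
  proof (rule insert.IH)
    show "Sec U (\<lambda>q x. \<Sum>i\<in>J. h i q *\<^sub>R \<xi> i q x)" if "J \<subseteq> I" for J
      using insert.prems(3)[of J] that by auto
  qed (use insert.prems in auto)
  ultimately show ?case using insert.hyps by simp
qed (use metric_connection_zero[OF assms(1-5)] in auto)

end

section \<open>Orthonormal frames\<close>

lemma det_nonzero_of_ker:
  fixes F :: "real ^ 'n ^ 'n"
  assumes "\<And>c. F *v c = 0 \<Longrightarrow> c = 0"
  shows "det F \<noteq> 0"
  using assms matrix_left_invertible_ker[of F] invertible_det_nz[of F]
  by (auto simp: invertible_left_inverse)

lemma continuous_on_det: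
  fixes F :: "'a::topological_space \<Rightarrow> real ^ 'n ^ 'n"
  assumes "\<And>i j. continuous_on S (\<lambda>x. F x $ i $ j)"
  shows "continuous_on S (\<lambda>x. det (F x))"
  unfolding det_def by (intro continuous_intros assms)

locale riemannian_manifold =
  fixes M :: "('m::{t2_space, second_countable_topology}, 'n::finite) oriented_riemannian_data"
  assumes M: "oriented_riemannian_manifold M"

sublocale riemannian_manifold \<subseteq> oriented_manifold "charts M"
  by unfold_locales (use M in \<open>simp add: oriented_riemannian_manifold_def\<close>)

context riemannian_manifold begin

abbreviation TS where "TS \<equiv> tangent_space (charts M)"
abbreviation SF :: "'m set \<Rightarrow> ('m \<Rightarrow> 'b::real_normed_vector) \<Rightarrow> bool" where "SF \<equiv> smooth_fun (charts M)"
abbreviation VF where "VF \<equiv> smooth_vfield (charts M)"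
abbreviation g where "g \<equiv> metric M"
abbreviation fr where "fr \<equiv> SO_frames M"

lemma riem: "riemannian_metric (charts M) g"
  using M by (simp add: oriented_riemannian_manifold_def)

lemma g_sym: "u \<in> TS p \<Longrightarrow> v \<in> TS p \<Longrightarrow> g p u v = g p v u"
  and g_pos: "u \<in> TS p \<Longrightarrow> u \<noteq> (\<lambda>h. 0) \<Longrightarrow> g p u u > 0"
  and g_lin: "u \<in> TS p \<Longrightarrow> v \<in> TS p \<Longrightarrow> w \<in> TS p \<Longrightarrow>
    g p (\<lambda>h. a * u h + b * v h) w = a * g p u w + b * g p v w"
  and g_smooth: "VF U X \<Longrightarrow> VF U Y \<Longrightarrow> SF U (\<lambda>q. g q (X q) (Y q))"
  using riem by (auto simp: riemannian_metric_def)

lemma g_zero: "w \<in> TS p \<Longrightarrow> g p (\<lambda>h. 0) w = 0"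
  using g_lin[OF tangent_zero tangent_zero, of w p 0 0] by simp

lemma g_sum_left:
  assumes "\<And>i. i \<in> I \<Longrightarrow> u i \<in> TS p" "w \<in> TS p"
  shows "g p (\<lambda>h. \<Sum>i\<in>I. c i * u i h) w = (\<Sum>i\<in>I. c i * g p (u i) w)"
  using assms(1)
proof (induction I rule: infinite_finite_induct)
  case (insert i I)
  have "(\<lambda>h. \<Sum>i\<in>I. c i * u i h) \<in> TS p" using insert by (intro tangent_sum) auto
  from g_lin[OF _ this assms(2), of "u i" "c i" 1] insert show ?case by simp
qed (auto simp: g_zero assms)

lemma g_sum_right:
  assumes "\<And>i. i \<in> I \<Longrightarrow> u i \<in> TS p" "w \<in> TS p"
  shows "g p w (\<lambda>h. \<Sum>i\<in>I. c i * u i h) = (\<Sum>i\<in>I. c i * g p w (u i))"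
proof -
  have "g p w (\<lambda>h. \<Sum>i\<in>I. c i * u i h) = g p (\<lambda>h. \<Sum>i\<in>I. c i * u i h) w"
    using assms by (intro g_sym tangent_sum)
  also have "\<dots> = (\<Sum>i\<in>I. c i * g p w (u i))"
    using assms by (simp add: g_sum_left) (intro sum.cong refl, use g_sym in auto)
  finally show ?thesis .
qed

definition frame_matrix :: "('m \<Rightarrow> real ^ 'n) \<Rightarrow> ('m, 'n) frame \<Rightarrow> real ^ 'n ^ 'n" where
  "frame_matrix \<phi> f = (\<chi> i j. f j (\<lambda>q. \<phi> q $ i))"

lemma fr_tangent: "f \<in> fr p \<Longrightarrow> f i \<in> TS p"
  and fr_orth: "f \<in> fr p \<Longrightarrow> g p (f i) (f j) = (if i = j then 1 else 0)"
  and fr_det: "f \<in> fr p \<Longrightarrow> (U, \<phi>) \<in> charts M \<Longrightarrow> p \<in> U \<Longrightarrow> det (frame_matrix \<phi> f) > 0"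
  by (auto simp: SO_frames_def frame_matrix_def)

definition orthonormal_at :: "'m \<Rightarrow> ('m, 'n) frame \<Rightarrow> bool" where
  "orthonormal_at p f \<longleftrightarrow> (\<forall>i. f i \<in> TS p) \<and> (\<forall>i j. g p (f i) (f j) = (if i = j then 1 else 0))"

lemma orthonormal_atD:
  assumes "orthonormal_at p f"
  shows "f i \<in> TS p" "g p (f i) (f j) = (if i = j then 1 else 0)"
  using assms by (auto simp: orthonormal_at_def)

lemma fr_orthonormal_at: "f \<in> fr p \<Longrightarrow> orthonormal_at p f"
  by (simp add: orthonormal_at_def fr_tangent fr_orth)

lemma g_orthonormal_sum:
  assumes "orthonormal_at p f"
  shows "g p (\<lambda>h. \<Sum>j\<in>UNIV. c j * f j h) (f i) = c i" "g p (f i) (\<lambda>h. \<Sum>j\<in>UNIV. c j * f j h) = c i"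
  using orthonormal_atD[OF assms]
  by (simp_all add: g_sum_left g_sum_right orthonormal_atD(2)[OF assms] if_distrib cong: if_cong)

lemma orthonormal_independent:
  assumes "orthonormal_at p f" "(\<lambda>h. \<Sum>j\<in>UNIV. c j * f j h) = (\<lambda>h. 0)"
  shows "c i = 0"
  using g_orthonormal_sum(1)[OF assms(1), of c i] assms(2) g_zero[OF orthonormal_atD(1)[OF assms(1)]] by simp

lemma orthonormal_det_nonzero:
  assumes f: "orthonormal_at p f" and c: "(U, \<phi>) \<in> charts M" "p \<in> U"
  shows "det (frame_matrix \<phi> f) \<noteq> 0"
proof (rule det_nonzero_of_ker)
  fix c assume "frame_matrix \<phi> f *v c = 0"
  then have z: "(\<Sum>j\<in>UNIV. c $ j * f j (\<lambda>q. \<phi> q $ i)) = 0" for i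
    by (auto simp: matrix_vector_mult_def frame_matrix_def vec_eq_iff mult.commute)
  have "(\<lambda>h. \<Sum>j\<in>UNIV. c $ j * f j h) = (\<lambda>h. 0)"
    by (rule tangent_eqI[OF c tangent_sum[OF orthonormal_atD(1)[OF f]] tangent_zero]) (rule z)
  from orthonormal_independent[OF f this] show "c = 0" by (simp add: vec_eq_iff)
qed

lemma orthonormal_expand:
  assumes f: "orthonormal_at p f" and v: "v \<in> TS p"
  shows "v = (\<lambda>h. \<Sum>i\<in>UNIV. g p v (f i) * f i h)"
proof -
  obtain U \<phi> where c: "(U, \<phi>) \<in> charts M" "p \<in> U" using ex_chart by blast
  have "invertible (frame_matrix \<phi> f)"
    using orthonormal_det_nonzero[OF f c] by (simp add: invertible_det_nz)
  then obtain G where G: "frame_matrix \<phi> f ** G = mat 1" by (auto simp: invertible_def)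
  define a where "a = G *v (\<chi> i. v (\<lambda>q. \<phi> q $ i))"
  have "frame_matrix \<phi> f *v a = (\<chi> i. v (\<lambda>q. \<phi> q $ i))"
    by (simp add: a_def matrix_vector_mul_assoc G)
  then have z: "(\<Sum>j\<in>UNIV. a $ j * f j (\<lambda>q. \<phi> q $ i)) = v (\<lambda>q. \<phi> q $ i)" for i
    by (auto simp: matrix_vector_mult_def frame_matrix_def vec_eq_iff mult.commute)
  have va: "v = (\<lambda>h. \<Sum>j\<in>UNIV. a $ j * f j h)"
    by (rule tangent_eqI[OF c v tangent_sum[OF orthonormal_atD(1)[OF f]]]) (rule z[symmetric])
  have "g p v (f i) = a $ i" for i unfolding va by (rule g_orthonormal_sum[OF f])
  with va show ?thesis by simp
qed

lemmas fr_expand = orthonormal_expand[OF fr_orthonormal_at]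

lemma fr_expand_apply: "f \<in> fr p \<Longrightarrow> v \<in> TS p \<Longrightarrow> v h = (\<Sum>i\<in>UNIV. g p v (f i) * f i h)"
  using fr_expand[of f p v] by metis

text \<open>The chain rule for the coordinate change, evaluated on the coordinate functions.\<close>
lemma frame_matrix_change:
  assumes c: "(U, \<phi>) \<in> charts M" "(V, \<psi>) \<in> charts M" "p \<in> U" "p \<in> V" and f: "\<And>i::'n. f i \<in> TS p"
  shows "frame_matrix \<psi> f = matrix (frechet_derivative (\<lambda>x. \<psi> (inv_into U \<phi> x)) (at (\<phi> p))) ** frame_matrix \<phi> f"
proof -
  let ?D = "frechet_derivative (\<lambda>x. \<psi> (inv_into U \<phi> x)) (at (\<phi> p))"
  have l: "linear ?D"
    by (rule linear_frechet_derivative smooth_on_differentiable[OF chart_transition])+ (use c in auto)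
  have "f j (\<lambda>q. \<psi> q $ i) = (\<Sum>k\<in>UNIV. ?D (axis k 1) $ i * f j (\<lambda>q. \<phi> q $ k))" for i j
  proof -
    let ?w = "\<chi> i. f j (\<lambda>q. \<phi> q $ i)"
    have "f j = chart_tvec (charts M) (V, \<psi>) p (?D ?w)"
      using tangent_eq_chart_tvec[OF c(1,3) f, of j] chart_tvec_change[OF c, of ?w] by simp
    then have "f j (\<lambda>q. \<psi> q $ i) = ?D ?w $ i"
      using chart_tvec_coord[OF c(2,4)] by metis
    also have "?D ?w = matrix ?D *v ?w" using l by (simp add: matrix_works)
    finally show ?thesis by (simp add: matrix_vector_mult_def matrix_def)
  qed
  then show ?thesis by (simp add: frame_matrix_def matrix_matrix_mult_def matrix_def vec_eq_iff)
qed

text \<open>One chart suffices to test the orientation, as the transition maps have positive determinant.\<close>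
lemma fr_I:
  assumes c: "(U, \<phi>) \<in> charts M" "p \<in> U"
    and f: "orthonormal_at p f" "det (frame_matrix \<phi> f) > 0"
  shows "f \<in> fr p"
  unfolding SO_frames_def
proof (intro CollectI conjI allI ballI, unfold case_prod_unfold, goal_cases)
  case (3 x)
  obtain V \<psi> where x: "x = (V, \<psi>)" by (cases x)
  have "det (frame_matrix \<psi> f) > 0" if "p \<in> V"
    using frame_matrix_change[OF c(1) _ c(2) that orthonormal_atD(1)[OF f(1)], of \<psi>] chart_transition_det[OF c(1), of V \<psi> "\<phi> p"] 3 x that c f(2)
    by (auto simp: det_mul)
  then show ?case using x by (simp add: frame_matrix_def)
qed (use orthonormal_atD[OF f(1)] in auto)

lemma frame_matrix_act: "frame_matrix \<phi> (frame_act f a) = frame_matrix \<phi> f ** a"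
  by (simp add: frame_matrix_def frame_act_def matrix_matrix_mult_def vec_eq_iff mult.commute)

lemma g_frame_act:
  assumes "orthonormal_at p f"
  shows "frame_act f a i \<in> TS p" "g p (frame_act f a i) (frame_act f a j) = (transpose a ** a) $ i $ j"
    "g p (f i) (frame_act f a j) = a $ i $ j"
proof -
  note f = orthonormal_atD[OF assms]
  show t: "frame_act f a i \<in> TS p" for i unfolding frame_act_def by (rule tangent_sum[OF f(1)])
  show 1: "g p (f i) (frame_act f a j) = a $ i $ j" for i
    unfolding frame_act_def by (rule g_orthonormal_sum[OF assms])
  have "g p (frame_act f a i) (frame_act f a j) = (\<Sum>k\<in>UNIV. a $ k $ i * g p (f k) (frame_act f a j))"
    using g_sum_left[where I = UNIV and c = "\<lambda>k. a $ k $ i", OF f(1) t] by (simp add: frame_act_def)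
  then show "g p (frame_act f a i) (frame_act f a j) = (transpose a ** a) $ i $ j"
    by (simp add: 1 matrix_matrix_mult_def transpose_def)
qed

lemma orthonormal_frame_act:
  assumes "orthonormal_at p f" "orthogonal_matrix a"
  shows "orthonormal_at p (frame_act f a)"
  using g_frame_act[OF assms(1)] assms(2) by (simp add: orthonormal_at_def orthogonal_matrix mat_def)

lemma frame_act_fr:
  assumes "f \<in> fr p" "rotation_matrix a"
  shows "frame_act f a \<in> fr p"
proof -
  obtain U \<phi> where c: "(U, \<phi>) \<in> charts M" "p \<in> U" using ex_chart by blast
  show ?thesis
    using assms(2) fr_det[OF assms(1) c] orthonormal_frame_act[OF fr_orthonormal_at[OF assms(1)]]
    by (intro fr_I[OF c]) (auto simp: rotation_matrix_def frame_matrix_act det_mul)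
qed

definition frame_transition :: "'m \<Rightarrow> ('m, 'n) frame \<Rightarrow> ('m, 'n) frame \<Rightarrow> real ^ 'n ^ 'n" where
  "frame_transition p f f' = (\<chi> i j. g p (f i) (f' j))"

lemma frame_transition_nth: "frame_transition p f f' $ i $ j = g p (f i) (f' j)"
  by (simp add: frame_transition_def)

lemma frame_act_transition:
  assumes "f \<in> fr p" "f' \<in> fr p"
  shows "frame_act f (frame_transition p f f') = f'"
proof
  fix j
  have "f' j = (\<lambda>h. \<Sum>i\<in>UNIV. g p (f' j) (f i) * f i h)" by (rule fr_expand[OF assms(1) fr_tangent[OF assms(2)]])
  also have "\<dots> = frame_act f (frame_transition p f f') j"
    unfolding frame_act_def frame_transition_def
    by (auto simp: fun_eq_iff intro!: sum.cong g_sym fr_tangent assms)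
  finally show "frame_act f (frame_transition p f f') j = f' j" by simp
qed

lemma frame_transition_act: "f \<in> fr p \<Longrightarrow> frame_transition p f (frame_act f a) = a"
  using g_frame_act(3)[OF fr_orthonormal_at] by (simp add: frame_transition_def vec_eq_iff)

lemma frame_transition_rotation:
  assumes "f \<in> fr p" "f' \<in> fr p"
  shows "rotation_matrix (frame_transition p f f')"
proof -
  let ?a = "frame_transition p f f'"
  obtain U \<phi> where c: "(U, \<phi>) \<in> charts M" "p \<in> U" using ex_chart by blast
  have "(transpose ?a ** ?a) $ i $ j = (if i = j then 1 else 0)" for i j
    using g_frame_act(2)[OF fr_orthonormal_at[OF assms(1)], of ?a i j]
      frame_act_transition[OF assms] fr_orth[OF assms(2)] by simp
  then have o: "orthogonal_matrix ?a" by (simp add: orthogonal_matrix vec_eq_iff mat_def)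
  have "frame_matrix \<phi> f' = frame_matrix \<phi> f ** ?a"
    using frame_matrix_act[of \<phi> f ?a] frame_act_transition[OF assms] by simp
  then have "det ?a > 0" using fr_det[OF assms(1) c] fr_det[OF assms(2) c]
    by (auto simp: det_mul zero_less_mult_iff)
  then show ?thesis using det_orthogonal_matrix[OF o] o by (auto simp: rotation_matrix_def)
qed

lemma frame_act_act: "frame_act (frame_act f a) b = frame_act f (a ** b)"
  unfolding frame_act_def matrix_matrix_mult_def
  by (auto simp: fun_eq_iff sum_distrib_left sum_distrib_right mult_ac intro: sum.swap)

lemma rotation_matrix_transpose: "rotation_matrix a \<Longrightarrow> rotation_matrix (transpose a)"
  by (simp add: rotation_matrix_def orthogonal_matrix_def)

lemma rotation_matrix_mult: "rotation_matrix a \<Longrightarrow> transpose a ** a = mat 1" "rotation_matrix a \<Longrightarrow> a ** transpose a = mat 1"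
  by (auto simp: rotation_matrix_def orthogonal_matrix_def)

subsection \<open>Local frames by the Gram-Schmidt process\<close>

text \<open>The process adds one vector field at a time and shrinks the neighbourhood so that the new field
  can be normalized. That the field is not zero at \<open>p\<close> follows from independence, since the earlier fields
  are at \<open>p\<close> combinations of the earlier \<open>X j p\<close>: hence the clause on the coefficients \<open>c\<close>. The last clause makes it
  possible to extend a prescribed orthonormal frame at \<open>p\<close>.\<close>
lemma gram_schmidt:
  assumes U: "p \<in> U" "\<And>i. VF U (X i)"
    and ind: "\<forall>c. (\<lambda>h. \<Sum>j\<in>UNIV. c j * X j p h) = (\<lambda>h. 0) \<longrightarrow> c = (\<lambda>j::'n. 0)"
  shows "finite (S :: 'n set) \<Longrightarrow> \<exists>W e. p \<in> W \<and> (\<forall>i\<in>S. VF W (e i)) \<and> W \<subseteq> U \<and> open W \<and>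
    (\<forall>i\<in>S. \<forall>j\<in>S. \<forall>q\<in>W. g q (e i q) (e j q) = (if i = j then 1 else 0)) \<and>
    (\<forall>i\<in>S. \<exists>c. e i p = (\<lambda>h. \<Sum>j\<in>UNIV. c j * X j p h) \<and> (\<forall>j. j \<notin> S \<longrightarrow> c j = 0)) \<and>
    ((\<forall>i j. g p (X i p) (X j p) = (if i = j then 1 else 0)) \<longrightarrow> (\<forall>i\<in>S. e i p = X i p))"
proof -
  define P where "P S W e \<longleftrightarrow> p \<in> W \<and> (\<forall>i\<in>S. VF W (e i)) \<and> W \<subseteq> U \<and> open W \<and>
    (\<forall>i\<in>S. \<forall>j\<in>S. \<forall>q\<in>W. g q (e i q) (e j q) = (if i = j then 1 else 0)) \<and>
    (\<forall>i\<in>S. \<exists>c. e i p = (\<lambda>h. \<Sum>j\<in>UNIV. c j * X j p h) \<and> (\<forall>j. j \<notin> S \<longrightarrow> c j = 0)) \<and>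
    ((\<forall>i j. g p (X i p) (X j p) = (if i = j then 1 else 0)) \<longrightarrow> (\<forall>i\<in>S. e i p = X i p))" for S W e
  assume "finite S"
  then have "\<exists>W e. P S W e"
  proof (induction S rule: finite_induct)
    case empty
    have "open U" using U smooth_vfieldD by blast
    then show ?case using U(1) by (intro exI[of _ U]) (simp add: P_def)
  next
    case (insert k S)
    from insert.IH obtain W e where H: "P S W e" by blast
    then have W: "p \<in> W" "\<And>i. i \<in> S \<Longrightarrow> VF W (e i)" "W \<subseteq> U" "open W"
      and orth: "\<And>i j q. i \<in> S \<Longrightarrow> j \<in> S \<Longrightarrow> q \<in> W \<Longrightarrow> g q (e i q) (e j q) = (if i = j then 1 else 0)"
      and span: "\<And>i. i \<in> S \<Longrightarrow> \<exists>c. e i p = (\<lambda>h. \<Sum>j\<in>UNIV. c j * X j p h) \<and> (\<forall>j. j \<notin> S \<longrightarrow> c j = 0)"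
      and same: "(\<forall>i j. g p (X i p) (X j p) = (if i = j then 1 else 0)) \<Longrightarrow> \<forall>i\<in>S. e i p = X i p"
      unfolding P_def by simp_all
    have XW: "VF W (X i)" for i using smooth_vfield_subset[OF U(2) W(4,3)] .
    have eT: "e i q \<in> TS q" if "i \<in> S" "q \<in> W" for i q using smooth_vfieldD(2)[OF W(2)[OF that(1)] that(2)] .
    have XT: "X i q \<in> TS q" if "q \<in> W" for i q using smooth_vfieldD(2)[OF XW that] .
    define Z where "Z q = (\<lambda>h. \<Sum>j\<in>S. g q (X k q) (e j q) * e j q h)" for q
    define Y where "Y q = (\<lambda>h. 1 * X k q h + (-1) * Z q h)" for q
    have ZV: "VF W Z" unfolding Z_def[abs_def]
      using W(2,4) XW by (intro smooth_vfield_sum g_smooth)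
    have YV: "VF W Y"
    proof -
      have "VF W (\<lambda>q h. \<Sum>b\<in>UNIV. (if b then 1 else -1) * (if b then X k else Z) q h)"
        by (rule smooth_vfield_sum[OF W(4)]) (auto intro: XW ZV smooth_fun_const[OF W(4)])
      then show ?thesis by (simp add: UNIV_bool Y_def[abs_def])
    qed
    have ZT: "Z q \<in> TS q" and YT: "Y q \<in> TS q" if "q \<in> W" for q
      using smooth_vfieldD(2)[OF ZV that] smooth_vfieldD(2)[OF YV that] .
    have Ye: "g q (Y q) (e j q) = 0" if "j \<in> S" "q \<in> W" for j q
    proof -
      have "g q (Z q) (e j q) = g q (X k q) (e j q)"
      proof -
        have "g q (Z q) (e j q) = (\<Sum>i\<in>S. g q (X k q) (e i q) * g q (e i q) (e j q))"
          unfolding Z_def by (rule g_sum_left) (use eT that in auto)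
        also have "\<dots> = (\<Sum>i\<in>S. if i = j then g q (X k q) (e j q) else 0)"
          by (intro sum.cong) (use orth that in auto)
        finally show ?thesis using insert.hyps that by simp
      qed
      moreover have "g q (Y q) (e j q) = 1 * g q (X k q) (e j q) + (-1) * g q (Z q) (e j q)"
        unfolding Y_def by (rule g_lin) (use XT ZT eT that in auto)
      ultimately show ?thesis by simp
    qed
    have "\<forall>i\<in>S. \<exists>c. e i p = (\<lambda>h. \<Sum>j\<in>UNIV. c j * X j p h) \<and> (\<forall>j. j \<notin> S \<longrightarrow> c j = 0)" using span by blast
    then obtain C where C: "\<And>i. i \<in> S \<Longrightarrow> e i p = (\<lambda>h. \<Sum>j\<in>UNIV. C i j * X j p h)"
      "\<And>i j. i \<in> S \<Longrightarrow> j \<notin> S \<Longrightarrow> C i j = 0"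
      unfolding bchoice_iff by blast
    define d where "d j = (if j = k then 1 else - (\<Sum>i\<in>S. g p (X k p) (e i p) * C i j))" for j
    have Yd: "Y p = (\<lambda>h. \<Sum>j\<in>UNIV. d j * X j p h)"
    proof
      fix h
      have "(\<Sum>i\<in>S. g p (X k p) (e i p) * C i k) = 0" using C(2) insert.hyps by (intro sum.neutral) auto
      then have dj: "d j = (if j = k then 1 else 0) - (\<Sum>i\<in>S. g p (X k p) (e i p) * C i j)" for j
        by (simp add: d_def)
      have "Y p h = X k p h - (\<Sum>i\<in>S. g p (X k p) (e i p) * (\<Sum>j\<in>UNIV. C i j * X j p h))"
        by (simp add: Y_def Z_def C(1))
      also have "(\<Sum>i\<in>S. g p (X k p) (e i p) * (\<Sum>j\<in>UNIV. C i j * X j p h))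
        = (\<Sum>j\<in>UNIV. (\<Sum>i\<in>S. g p (X k p) (e i p) * C i j) * X j p h)"
        unfolding sum_distrib_left sum_distrib_right by (subst sum.swap) (simp add: mult_ac)
      finally have Yh: "Y p h = X k p h - (\<Sum>j\<in>UNIV. (\<Sum>i\<in>S. g p (X k p) (e i p) * C i j) * X j p h)" .
      have "(\<Sum>j\<in>UNIV. (if j = k then 1 else 0) * X j p h) = (\<Sum>j\<in>UNIV. if j = k then X j p h else 0)"
        by (intro sum.cong) auto
      then have "(\<Sum>j\<in>UNIV. (if j = k then 1 else 0) * X j p h) = X k p h" by simp
      then show "Y p h = (\<Sum>j\<in>UNIV. d j * X j p h)"
        by (simp only: Yh dj left_diff_distrib sum_subtractf)
    qed
    have dS: "d j = 0" if "j \<notin> insert k S" for j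
      using that C(2) by (auto simp: d_def intro!: sum.neutral)
    have "Y p \<noteq> (\<lambda>h. 0)"
    proof
      assume "Y p = (\<lambda>h. 0)"
      then have "d = (\<lambda>j. 0)" using ind Yd by simp
      then have "d k = 0" by simp
      then show False by (simp add: d_def)
    qed
    then have Yp: "g p (Y p) (Y p) > 0" using YT[OF W(1)] by (intro g_pos)
    have gY: "SF W (\<lambda>q. g q (Y q) (Y q))" using YV by (intro g_smooth)
    define W' where "W' = W \<inter> (\<lambda>q. g q (Y q) (Y q)) -` {0<..}"
    have oW': "open W'" unfolding W'_def Int_commute[of W]
      using smooth_fun_continuous[OF gY] continuous_on_open_vimage[OF W(4)] open_greaterThan by blast
    have pW': "p \<in> W'" using W(1) Yp by (simp add: W'_def)
    have sub: "W' \<subseteq> W" by (auto simp: W'_def)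
    define e' where "e' i = (if i = k then (\<lambda>q h. rsqrt (g q (Y q) (Y q)) * Y q h) else e i)" for i
    have rs: "SF W' (\<lambda>q. rsqrt (g q (Y q) (Y q)))"
      by (rule smooth_fun_compose[OF smooth_fun_subset[OF gY oW' sub] smooth_on_rsqrt]) (auto simp: W'_def)
    have e'V: "VF W' (e' i)" if "i \<in> insert k S" for i
      using that smooth_vfield_scale[OF rs smooth_vfield_subset[OF YV oW' sub]] smooth_vfield_subset[OF W(2) oW' sub]
      by (auto simp: e'_def)
    have e'T: "e' i q \<in> TS q" if "i \<in> insert k S" "q \<in> W'" for i q
      using smooth_vfieldD(2)[OF e'V[OF that(1)] that(2)] .
    have sc: "g q (e' k q) w = rsqrt (g q (Y q) (Y q)) * g q (Y q) w" if "q \<in> W'" "w \<in> TS q" for q w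
      using g_sum_left[of "{()}" "\<lambda>_. Y q" q w "\<lambda>_. rsqrt (g q (Y q) (Y q))"] YT that sub by (auto simp: e'_def)
    have kj: "g q (e' k q) (e' j q) = (if k = j then 1 else 0)" if "j \<in> insert k S" "q \<in> W'" for j q
    proof (cases "j = k")
      case True
      have q: "q \<in> W" "g q (Y q) (Y q) > 0" using that by (auto simp: W'_def)
      have "g q (Y q) (e' k q) = g q (e' k q) (Y q)" using YT q e'T that by (intro g_sym) auto
      then show ?thesis using True sc[OF that(2)] e'T that YT q rsqrt_square[OF q(2)] by simp
    next
      case False
      then have "j \<in> S" using that by simp
      then show ?thesis using sc[OF that(2), of "e' j q"] False that(2) sub eT Ye by (auto simp: e'_def)
    qed
    have orth': "g q (e' i q) (e' j q) = (if i = j then 1 else 0)" if "i \<in> insert k S" "j \<in> insert k S" "q \<in> W'" for i j q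
    proof (cases "i = k")
      case False
      show ?thesis
      proof (cases "j = k")
        case True
        have "g q (e' i q) (e' j q) = g q (e' j q) (e' i q)" using e'T that by (intro g_sym) auto
        then show ?thesis using kj[OF that(1,3)] True by auto
      qed (use False that orth sub in \<open>auto simp: e'_def\<close>)
    qed (use kj that in auto)
    have span': "\<exists>c. e' i p = (\<lambda>h. \<Sum>j\<in>UNIV. c j * X j p h) \<and> (\<forall>j. j \<notin> insert k S \<longrightarrow> c j = 0)" if "i \<in> insert k S" for i
    proof (cases "i = k")
      case True
      then show ?thesis using dS
        by (intro exI[of _ "\<lambda>j. rsqrt (g p (Y p) (Y p)) * d j"]) (auto simp: e'_def Yd sum_distrib_left mult.assoc)
    next
      case False
      then show ?thesis using span[of i] that by (auto simp: e'_def)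
    qed
    have same': "\<forall>i\<in>insert k S. e' i p = X i p" if o: "\<forall>i j. g p (X i p) (X j p) = (if i = j then 1 else 0)"
    proof -
      have eX: "e i p = X i p" if "i \<in> S" for i using same[OF o] that by blast
      have "Z p h = 0" for h unfolding Z_def
        by (intro sum.neutral ballI) (use eX o insert.hyps in auto)
      then have "Y p = X k p" by (simp add: Y_def)
      then show ?thesis using eX o by (simp add: e'_def rsqrt_def)
    qed
    have "P (insert k S) W' e'"
      unfolding P_def using pW' e'V sub W(3) oW' orth' span' same' by (intro conjI ballI impI) auto
    then show ?case by blast
  qed
  then show ?thesis by (simp add: P_def)
qed

lemma ex_orthonormal_fields:
  assumes U: "p \<in> U" "\<And>i. VF U (X i)"
    and ind: "\<forall>c. (\<lambda>h. \<Sum>j\<in>UNIV. c j * X j p h) = (\<lambda>h. 0) \<longrightarrow> c = (\<lambda>j::'n. 0)"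
  obtains W e where "p \<in> W" "\<And>i. VF W (e i)" "W \<subseteq> U" "open W" "\<And>q. q \<in> W \<Longrightarrow> orthonormal_at q (\<lambda>i. e i q)"
    "orthonormal_at p (\<lambda>i. X i p) \<Longrightarrow> (\<lambda>i. e i p) = (\<lambda>i. X i p)"
proof -
  obtain W e where W: "p \<in> W" "\<forall>i. VF W (e i)" "W \<subseteq> U" "open W"
    "\<forall>i j. \<forall>q\<in>W. g q (e i q) (e j q) = (if i = j then 1 else 0)"
    "(\<forall>i j. g p (X i p) (X j p) = (if i = j then 1 else 0)) \<longrightarrow> (\<forall>i. e i p = X i p)"
    using gram_schmidt[where X = X, OF assms finite[of UNIV]] by (elim exE conjE) simp
  have "e i q \<in> TS q" if "q \<in> W" for i q using smooth_vfieldD(2)[OF W(2)[rule_format] that] .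
  then show thesis
    by (intro that[of W e]) (use W in \<open>auto simp: orthonormal_at_def\<close>)
qed

lemma fr_nonempty: "fr p \<noteq> {}"
proof -
  obtain U \<phi> where c: "(U, \<phi>) \<in> charts M" "p \<in> U" using ex_chart by blast
  let ?X = "\<lambda>i q. chart_tvec (charts M) (U, \<phi>) q (axis i 1)"
  have ind1: "c = (\<lambda>j. 0)" if "(\<lambda>h. \<Sum>j\<in>UNIV. c j * ?X j p h) = (\<lambda>h. 0)" for c
  proof
    fix i
    have "(\<Sum>j\<in>UNIV. c j * ?X j p (\<lambda>q. \<phi> q $ i)) = 0" using fun_cong[OF that] .
    then show "c i = 0" by (simp add: chart_tvec_coord[OF c] axis_def if_distrib cong: if_cong)
  qed
  have ind: "\<forall>c. (\<lambda>h. \<Sum>j\<in>UNIV. c j * ?X j p h) = (\<lambda>h. 0) \<longrightarrow> c = (\<lambda>j. 0)" using ind1 by blast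
  obtain W e where W: "p \<in> W" "\<And>q. q \<in> W \<Longrightarrow> orthonormal_at q (\<lambda>i. e i q)"
    using ex_orthonormal_fields[where X = ?X, OF c(2) smooth_vfield_coord[OF c(1)] ind] by metis
  define f where "f i = e i p" for i
  have f: "orthonormal_at p f" using W(2)[OF W(1)] by (simp add: f_def[abs_def])
  show ?thesis
  proof (cases "det (frame_matrix \<phi> f) > 0")
    case True
    then show ?thesis using fr_I[OF c f] by blast
  next
    case False
    then have neg: "det (frame_matrix \<phi> f) < 0" using orthonormal_det_nonzero[OF f c] by linarith
    \<comment> \<open>Reversing one vector corrects the orientation.\<close>
    obtain k :: 'n where True by simp
    define a :: "real^'n^'n" where "a = (\<chi> i j. if i = j then (if i = k then -1 else 1) else 0)"
    have "det a = (\<Prod>i\<in>UNIV. a $ i $ i)" by (rule det_diagonal) (simp add: a_def)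
    also have "\<dots> = -1" by (simp add: a_def)
    finally have "det (frame_matrix \<phi> (frame_act f a)) > 0" using neg by (simp add: frame_matrix_act det_mul)
    moreover have "orthogonal_matrix a"
    proof -
      have "(\<Sum>l\<in>UNIV. a $ l $ i * a $ l $ j) = (\<Sum>l\<in>UNIV. if l = i then (if i = j then 1 else 0) else 0)" for i j
        by (intro sum.cong) (auto simp: a_def)
      then show ?thesis by (simp add: orthogonal_matrix vec_eq_iff mat_def matrix_matrix_mult_def transpose_def)
    qed
    ultimately have "frame_act f a \<in> fr p" using orthonormal_frame_act[OF f] by (intro fr_I[OF c]) auto
    then show ?thesis by blast
  qed
qed

lemma local_frameD:
  assumes "local_frame M U e"
  shows "q \<in> U \<Longrightarrow> e q \<in> fr q" "VF U (\<lambda>q. e q i)" "open U"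
  using assms by (auto simp: local_frame_def dest: smooth_vfieldD)

lemma local_frame_subset: "local_frame M U e \<Longrightarrow> open V \<Longrightarrow> V \<subseteq> U \<Longrightarrow> local_frame M V e"
  by (auto simp: local_frame_def intro: smooth_vfield_subset)

text \<open>Extend the vectors of \<open>f\<close> with constant coordinates; the Gram-Schmidt process keeps them at \<open>p\<close>,
  and the orientation is right near \<open>p\<close> by continuity of the determinant.\<close>
lemma ex_local_frame:
  assumes f: "f \<in> fr p"
  shows "\<exists>e U. e p = f \<and> p \<in> U \<and> local_frame M U e"
proof -
  obtain U \<phi> where c: "(U, \<phi>) \<in> charts M" "p \<in> U" using ex_chart by blast
  let ?X = "\<lambda>i q. chart_tvec (charts M) (U, \<phi>) q (\<chi> k. f i (\<lambda>q. \<phi> q $ k))"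
  have X: "?X i p = f i" for i using tangent_eq_chart_tvec[OF c fr_tangent[OF f]] by metis
  have ind1: "c = (\<lambda>j. 0)" if "(\<lambda>h. \<Sum>j\<in>UNIV. c j * ?X j p h) = (\<lambda>h. 0)" for c
    using orthonormal_independent[OF fr_orthonormal_at[OF f], of c] that by (auto simp: X)
  have ind: "\<forall>c. (\<lambda>h. \<Sum>j\<in>UNIV. c j * ?X j p h) = (\<lambda>h. 0) \<longrightarrow> c = (\<lambda>j. 0)" using ind1 by blast
  obtain W e where W: "p \<in> W" "\<And>i. VF W (e i)" "W \<subseteq> U" "open W" "\<And>q. q \<in> W \<Longrightarrow> orthonormal_at q (\<lambda>i. e i q)"
    "orthonormal_at p (\<lambda>i. ?X i p) \<Longrightarrow> (\<lambda>i. e i p) = (\<lambda>i. ?X i p)"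
    by (rule ex_orthonormal_fields[where X = ?X, OF c(2) smooth_vfield_coord[OF c(1)] ind]) blast+
  have ep: "(\<lambda>i. e i p) = f" using W(6) fr_orthonormal_at[OF f] by (simp add: X)
  define F where "F q = frame_matrix \<phi> (\<lambda>i. e i q)" for q
  have "continuous_on W (\<lambda>q. F q $ i $ j)" for i j
  proof -
    have "SF W (\<lambda>q. e j q (\<lambda>q. \<phi> q $ i))"
      by (rule smooth_vfieldD(3)[OF W(2)]) (use smooth_fun_subset[OF smooth_fun_coord_nth[OF c(1)] W(4,3)] in auto)
    then show ?thesis using smooth_fun_continuous by (simp add: F_def frame_matrix_def)
  qed
  then have dc: "continuous_on W (\<lambda>q. det (F q))" by (rule continuous_on_det)
  define W' where "W' = W \<inter> (\<lambda>q. det (F q)) -` {0<..}"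
  have oW': "open W'" unfolding W'_def Int_commute[of W]
    using dc continuous_on_open_vimage[OF W(4)] open_greaterThan by blast
  have "F p = frame_matrix \<phi> f" by (simp add: F_def ep)
  then have pW': "p \<in> W'" using W(1) fr_det[OF f c] by (simp add: W'_def)
  have "(\<lambda>i. e i q) \<in> fr q" if "q \<in> W'" for q
    by (rule fr_I[OF c(1)]) (use that W(3,5) in \<open>auto simp: W'_def F_def\<close>)
  then have "local_frame M W' (\<lambda>q i. e i q)"
    using smooth_vfield_subset[OF W(2) oW'] by (auto simp: local_frame_def W'_def)
  then show ?thesis using pW' ep by (intro exI[of _ "\<lambda>q i. e i q"] exI[of _ W']) auto
qed

lemma frame_ext:
  assumes "f \<in> fr p"
  shows "frame_ext M p f p = f" "\<exists>U. p \<in> U \<and> local_frame M U (frame_ext M p f)"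
proof -
  have "\<exists>e. e p = f \<and> (\<exists>U. p \<in> U \<and> local_frame M U e)" using ex_local_frame[OF assms] by blast
  from someI_ex[OF this] show "frame_ext M p f p = f" "\<exists>U. p \<in> U \<and> local_frame M U (frame_ext M p f)"
    unfolding frame_ext_def[symmetric] by auto
qed

lemma frame_transition_smooth:
  assumes "local_frame M U e" "local_frame M U e'"
  shows "SF U (\<lambda>q. frame_transition q (e q) (e' q))" "SF U (\<lambda>q. frame_transition q (e q) (e' q) $ i $ j)"
proof -
  show 1: "SF U (\<lambda>q. frame_transition q (e q) (e' q) $ i $ j)" for i j
    using assms by (auto simp: frame_transition_nth intro!: g_smooth local_frameD)
  show "SF U (\<lambda>q. frame_transition q (e q) (e' q))"
  proof (rule smooth_fun_componentwise)
    fix b :: "real^'n^'n" assume "b \<in> Basis"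
    then obtain i j where "b = axis i (axis j 1)" by (auto simp: Basis_vec_def)
    then show "SF U (\<lambda>q. frame_transition q (e q) (e' q) \<bullet> b)" using 1 by (simp add: inner_axis)
  qed (use assms local_frameD in auto)
qed

subsection \<open>The Levi-Civita connection\<close>

lemma lc: "levi_civita (charts M) g (nabla M)"
  using M by (simp add: oriented_riemannian_manifold_def)

lemma lc_metric: "metric_connection (charts M) (smooth_vfield (charts M)) g (nabla M)"
  using lc by (simp add: levi_civita_def)

lemma lc_torsion_free:
  "VF U X \<Longrightarrow> VF U Y \<Longrightarrow> p \<in> U \<Longrightarrow> SF U h \<Longrightarrow>
    nabla M p (X p) Y h - nabla M p (Y p) X h = X p (\<lambda>q. Y q h) - Y p (\<lambda>q. X q h)"
  using lc unfolding levi_civita_def by blast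

lemma nabla_tangent:
  assumes "VF U Y" "p \<in> U" "v \<in> TS p"
  shows "nabla M p v Y \<in> TS p"
proof -
  obtain W X where W: "p \<in> W" "VF W X" "X p = v" using vfield_through[OF assms(3)] .
  have o: "open (U \<inter> W)" using assms W smooth_vfieldD(1) by auto
  have "VF (U \<inter> W) (\<lambda>q. nabla M q (X q) Y)"
    by (rule metric_connection_smooth[OF lc_metric])
      (auto intro: smooth_vfield_subset[OF assms(1) o] smooth_vfield_subset[OF W(2) o])
  then show ?thesis using smooth_vfieldD(2) W assms by fastforce
qed

lemmas lc_local = metric_connection_local[OF lc_metric]
  and lc_smooth = metric_connection_smooth[OF lc_metric]
  and lc_sum = metric_connection_sum[OF lc_metric]
  and lc_sum_vector = metric_connection_sum_vector[OF lc_metric]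
  and lc_product_rule = metric_connectionD(4)[OF lc_metric]
  and lc_add = metric_connectionD(2)[OF lc_metric]
  and lc_zero = metric_connection_zero[OF lc_metric]

end

section \<open>Tensors by recursion over the index list\<close>

lemma finite_lists_of_length: "finite {l :: 'n::finite list. length l = n}"
  using finite_lists_length_eq[of "UNIV :: 'n set" n] by simp

lemma sum_lists_Suc:
  fixes F :: "'n::finite list \<Rightarrow> 'b::comm_monoid_add"
  shows "(\<Sum>l | length l = Suc n. F l) = (\<Sum>j\<in>UNIV. \<Sum>l | length l = n. F (j # l))"
proof -
  have eq: "{l :: 'n list. length l = Suc n} = (\<lambda>(j, l). j # l) ` (UNIV \<times> {l. length l = n})"
    by (auto simp: image_iff length_Suc_conv)
  show ?thesis unfolding eq
    by (subst sum.reindex) (auto simp: inj_on_def sum.cartesian_product case_prod_beta)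
qed

lemma derivation_ext_Nil: "derivation_ext B K [] = 0"
  and derivation_ext_Cons:
    "derivation_ext B K (i # l) = (\<Sum>c\<in>UNIV. B i c *\<^sub>R K (c # l)) + derivation_ext B (slot i K) l"
  by (simp_all add: derivation_ext_def sum.lessThan_Suc_shift del: sum.lessThan_Suc)

lemma derivation_ext_zero: "derivation_ext B (\<lambda>l. 0) l = 0"
  by (simp add: derivation_ext_def)

lemma derivation_ext_add: "derivation_ext B (\<lambda>l. K l + L l) l = derivation_ext B K l + derivation_ext B L l"
  by (simp add: derivation_ext_def sum.distrib scaleR_right_distrib)

lemma derivation_ext_scale: "derivation_ext B (\<lambda>l. c *\<^sub>R K l) l = c *\<^sub>R derivation_ext B K l"
  by (simp add: derivation_ext_def scaleR_sum_right mult.commute)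

lemma derivation_ext_sum: "derivation_ext B (\<lambda>l. \<Sum>i\<in>I. K i l) l = (\<Sum>i\<in>I. derivation_ext B (K i) l)"
  by (induction I rule: infinite_finite_induct) (auto simp: derivation_ext_zero derivation_ext_add)

lemma derivation_ext_matrix_sum: "derivation_ext (\<lambda>a b. \<Sum>i\<in>I. c i * B i a b) K l = (\<Sum>i\<in>I. c i *\<^sub>R derivation_ext (B i) K l)"
proof (induction l arbitrary: K)
  case (Cons i l)
  have "(\<Sum>c'\<in>UNIV. (\<Sum>ia\<in>I. c ia * B ia i c') *\<^sub>R K (c' # l)) = (\<Sum>ia\<in>I. c ia *\<^sub>R (\<Sum>c'\<in>UNIV. B ia i c' *\<^sub>R K (c' # l)))"
    unfolding scaleR_sum_left scaleR_sum_right by (subst sum.swap) simp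
  then show ?case by (simp add: derivation_ext_Cons Cons.IH scaleR_right_distrib sum.distrib)
qed (simp add: derivation_ext_Nil)

text \<open>The part of \<open>tensor_act\<close> that concerns the indices, by recursion: inductions over the index list
  then replace manipulations of sums over all lists of a given length.\<close>
fun index_act :: "real ^ 'n::finite ^ 'n \<Rightarrow> ('n, 'e::real_vector) tensor \<Rightarrow> ('n, 'e) tensor" where
  "index_act b K [] = K []"
| "index_act b K (i # l) = (\<Sum>j\<in>UNIV. b $ i $ j *\<^sub>R index_act b (slot j K) l)"

lemma tensor_act_index_act:
  "tensor_act \<rho> b K l = index_act b (\<lambda>l. \<rho> b (K l)) l"
proof (induction l arbitrary: K)
  case (Cons i l)
  have "tensor_act \<rho> b K (i # l) = (\<Sum>j\<in>UNIV. b $ i $ j *\<^sub>R tensor_act \<rho> b (slot j K) l)"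
    by (simp add: tensor_act_def sum_lists_Suc scaleR_sum_right prod.lessThan_Suc_shift del: prod.lessThan_Suc)
  then show ?case by (simp add: Cons.IH)
qed (simp add: tensor_act_def)

lemma index_act_add: "index_act b (\<lambda>l. K l + L l) l = index_act b K l + index_act b L l"
  by (induction l arbitrary: K L) (auto simp: scaleR_right_distrib sum.distrib)

lemma index_act_scale: "index_act b (\<lambda>l. c *\<^sub>R K l) l = c *\<^sub>R index_act b K l"
  by (induction l arbitrary: K) (auto simp: scaleR_sum_right mult.commute)

lemma index_act_zero: "index_act b (\<lambda>l. 0) l = 0"
  by (induction l) auto

lemma index_act_sum: "index_act b (\<lambda>l. \<Sum>i\<in>I. K i l) l = (\<Sum>i\<in>I. index_act b (K i) l)"
  by (induction I rule: infinite_finite_induct) (auto simp: index_act_zero index_act_add)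

lemma index_act_id: "index_act (mat 1) K l = K l"
proof (induction l arbitrary: K)
  case (Cons i l)
  have "index_act (mat 1) K (i # l) = (\<Sum>j\<in>UNIV. if i = j then index_act (mat 1) (slot j K) l else 0)"
    unfolding index_act.simps by (intro sum.cong) (auto simp: mat_def)
  then show ?case by (simp add: Cons.IH)
qed simp

text \<open>The derivative of \<open>index_act\<close> with respect to the matrix in the direction \<open>b'\<close>.\<close>
fun index_act_deriv :: "real ^ 'n::finite ^ 'n \<Rightarrow> ('n \<Rightarrow> 'n \<Rightarrow> real) \<Rightarrow> ('n, 'e::real_vector) tensor \<Rightarrow> ('n, 'e) tensor" where
  "index_act_deriv b b' K [] = 0"
| "index_act_deriv b b' K (i # l) =
    (\<Sum>j\<in>UNIV. b' i j *\<^sub>R index_act b (slot j K) l + b $ i $ j *\<^sub>R index_act_deriv b b' (slot j K) l)"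

text \<open>Here \<open>b\<close> is the matrix of a change of frame, \<open>b'\<close> its derivative, and \<open>B\<close> and \<open>B'\<close> are the matrices
  of a connection in the two frames; the assumption is their transformation law. The
  derivative of \<open>b\<close> cancels, which is why covariant derivatives do not depend on the frame.\<close>
lemma index_act_deriv_gauge:
  assumes "\<And>i j. b' i j = (\<Sum>c\<in>UNIV. b $ i $ c * B c j) - (\<Sum>c\<in>UNIV. B' i c * b $ c $ j)"
  shows "index_act_deriv b b' K l + derivation_ext B' (index_act b K) l = index_act b (derivation_ext B K) l"
proof (induction l arbitrary: K)
  case Nil
  then show ?case by (simp add: derivation_ext_Nil)
next
  case (Cons i l)
  let ?T = "\<lambda>j. index_act b (slot j K) l"
  have "derivation_ext B' (index_act b K) (i # l)
      = (\<Sum>c\<in>UNIV. \<Sum>j\<in>UNIV. (B' i c * b $ c $ j) *\<^sub>R ?T j)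
        + (\<Sum>j\<in>UNIV. b $ i $ j *\<^sub>R derivation_ext B' (index_act b (slot j K)) l)"
    by (simp add: derivation_ext_Cons derivation_ext_sum derivation_ext_scale scaleR_sum_right)
  also have "(\<Sum>c\<in>UNIV. \<Sum>j\<in>UNIV. (B' i c * b $ c $ j) *\<^sub>R ?T j) = (\<Sum>j\<in>UNIV. (\<Sum>c\<in>UNIV. B' i c * b $ c $ j) *\<^sub>R ?T j)"
    by (subst sum.swap) (simp add: scaleR_sum_left)
  finally have 1: "derivation_ext B' (index_act b K) (i # l)
      = (\<Sum>j\<in>UNIV. (\<Sum>c\<in>UNIV. B' i c * b $ c $ j) *\<^sub>R ?T j)
        + (\<Sum>j\<in>UNIV. b $ i $ j *\<^sub>R derivation_ext B' (index_act b (slot j K)) l)" .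
  have "index_act b (derivation_ext B K) (i # l)
      = (\<Sum>c\<in>UNIV. \<Sum>j\<in>UNIV. (b $ i $ c * B c j) *\<^sub>R ?T j)
        + (\<Sum>j\<in>UNIV. b $ i $ j *\<^sub>R index_act b (derivation_ext B (slot j K)) l)"
    by (simp add: derivation_ext_Cons index_act_add index_act_sum index_act_scale scaleR_sum_right
        scaleR_right_distrib sum.distrib)
  also have "(\<Sum>c\<in>UNIV. \<Sum>j\<in>UNIV. (b $ i $ c * B c j) *\<^sub>R ?T j) = (\<Sum>j\<in>UNIV. (\<Sum>c\<in>UNIV. b $ i $ c * B c j) *\<^sub>R ?T j)"
    by (subst sum.swap) (simp add: scaleR_sum_left)
  finally have 2: "index_act b (derivation_ext B K) (i # l)
      = (\<Sum>j\<in>UNIV. (\<Sum>c\<in>UNIV. b $ i $ c * B c j) *\<^sub>R ?T j)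
        + (\<Sum>j\<in>UNIV. b $ i $ j *\<^sub>R index_act b (derivation_ext B (slot j K)) l)" .
  show ?case
    unfolding 1 2 by (simp add: assms Cons.IH[symmetric] sum.distrib scaleR_right_distrib scaleR_left_diff_distrib sum_subtractf)
qed

text \<open>The scalar product of \<open>T\<^sup>\<otimes>\<^sup>m\<close>, without the factor \<open>1 / m!\<close> of \<open>sym_inner\<close>: it is compatible with
  splitting off the first index.\<close>
definition full_inner :: "nat \<Rightarrow> ('n::finite, 'e::real_inner) tensor \<Rightarrow> ('n, 'e) tensor \<Rightarrow> real" where
  "full_inner m K L = (\<Sum>l | length l = m. K l \<bullet> L l)"

lemma full_inner_0: "full_inner 0 K L = K [] \<bullet> L []"
  and full_inner_Suc: "full_inner (Suc m) K L = (\<Sum>j\<in>UNIV. full_inner m (slot j K) (slot j L))"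
  by (simp_all add: full_inner_def sum_lists_Suc)

lemma full_inner_add_left: "full_inner m (\<lambda>l. K l + K' l) L = full_inner m K L + full_inner m K' L"
  and full_inner_add_right: "full_inner m L (\<lambda>l. K l + K' l) = full_inner m L K + full_inner m L K'"
  and full_inner_scale_left: "full_inner m (\<lambda>l. c *\<^sub>R K l) L = c * full_inner m K L"
  and full_inner_scale_right: "full_inner m L (\<lambda>l. c *\<^sub>R K l) = c * full_inner m L K"
  and full_inner_sum_left: "full_inner m (\<lambda>l. \<Sum>i\<in>I. F i l) L = (\<Sum>i\<in>I. full_inner m (F i) L)"
  and full_inner_sum_right: "full_inner m L (\<lambda>l. \<Sum>i\<in>I. F i l) = (\<Sum>i\<in>I. full_inner m L (F i))"
  and full_inner_commute: "full_inner m K L = full_inner m L K"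
  unfolding full_inner_def
       apply (simp_all add: inner_add_left inner_add_right sum.distrib sum_distrib_left inner_sum_left inner_sum_right inner_commute)
  by (subst sum.swap, simp)+

text \<open>Skew-symmetric matrices are infinitesimal rotations.\<close>
lemma full_inner_derivation_ext:
  assumes skew: "\<And>a b. B a b = - B b a"
  shows "full_inner m (derivation_ext B K) L + full_inner m K (derivation_ext B L) = 0"
proof (induction m arbitrary: K L)
  case 0
  then show ?case by (simp add: full_inner_0 derivation_ext_Nil)
next
  case (Suc m)
  let ?I = "\<lambda>i j. full_inner m (slot i K) (slot j L)"
  have "full_inner (Suc m) (derivation_ext B K) L + full_inner (Suc m) K (derivation_ext B L)
     = (\<Sum>j\<in>UNIV. (\<Sum>c\<in>UNIV. B j c * ?I c j) + (\<Sum>c\<in>UNIV. B j c * ?I j c))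
       + (\<Sum>j\<in>UNIV. full_inner m (derivation_ext B (slot j K)) (slot j L) + full_inner m (slot j K) (derivation_ext B (slot j L)))"
    by (simp add: full_inner_Suc derivation_ext_Cons full_inner_add_left full_inner_add_right full_inner_sum_left full_inner_sum_right
        full_inner_scale_left full_inner_scale_right sum.distrib)
  also have "\<dots> = (\<Sum>j\<in>UNIV. \<Sum>c\<in>UNIV. B j c * ?I c j) + (\<Sum>j\<in>UNIV. \<Sum>c\<in>UNIV. B j c * ?I j c)"
    by (simp add: Suc.IH sum.distrib)
  also have "(\<Sum>j\<in>UNIV. \<Sum>c\<in>UNIV. B j c * ?I j c) = (\<Sum>j\<in>UNIV. \<Sum>c\<in>UNIV. B c j * ?I c j)"
    by (rule sum.swap)
  also have "\<dots> = - (\<Sum>j\<in>UNIV. \<Sum>c\<in>UNIV. B j c * ?I c j)"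
    by (subst skew) (simp add: sum_negf)
  finally show ?case by simp
qed

lemma full_inner_index_act:
  assumes "transpose b ** b = mat 1"
  shows "full_inner m (index_act b K) (index_act b L) = full_inner m K L"
proof (induction m arbitrary: K L)
  case 0
  then show ?case by (simp add: full_inner_0)
next
  case (Suc m)
  have o: "(\<Sum>i\<in>UNIV. b $ i $ j * b $ i $ j') = (if j = j' then 1 else 0)" for j j'
    using assms by (auto simp: matrix_matrix_mult_def transpose_def mat_def vec_eq_iff)
  have "full_inner (Suc m) (index_act b K) (index_act b L)
    = (\<Sum>i\<in>UNIV. \<Sum>j\<in>UNIV. \<Sum>j'\<in>UNIV. (b $ i $ j * b $ i $ j') * full_inner m (slot j K) (slot j' L))"
    by (simp add: full_inner_Suc full_inner_sum_left full_inner_sum_right full_inner_scale_left full_inner_scale_right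
        Suc.IH sum_distrib_left mult.assoc)
  also have "\<dots> = (\<Sum>j\<in>UNIV. \<Sum>j'\<in>UNIV. \<Sum>i\<in>UNIV. (b $ i $ j * b $ i $ j') * full_inner m (slot j K) (slot j' L))"
    by (subst sum.swap, rule sum.cong[OF refl], rule sum.swap)
  also have "\<dots> = (\<Sum>j\<in>UNIV. \<Sum>j'\<in>UNIV. if j = j' then full_inner m (slot j K) (slot j' L) else 0)"
    unfolding sum_distrib_right[symmetric] o by (intro sum.cong refl) simp
  also have "\<dots> = full_inner (Suc m) K L" by (simp add: full_inner_Suc)
  finally show ?case .
qed

section \<open>The associated bundle in local frames\<close>

locale twisted_manifold = riemannian_manifold M
  for M :: "('m::{t2_space, second_countable_topology}, 'n::finite) oriented_riemannian_data" +
  fixes E :: "('m, 'n, 'e::euclidean_space) associated_bundle_data"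
  assumes E: "associated_bundle_with_connection M E"
begin

abbreviation \<rho> where "\<rho> \<equiv> rep E"
abbreviation fc where "fc \<equiv> frame_class (rep E)"
abbreviation SE where "SE \<equiv> smooth_E_section M (rep E)"
abbreviation tr where "tr \<equiv> frame_transition"

lemma rho: "SO_representation \<rho>"
  using E by (simp add: associated_bundle_with_connection_def)

lemma rho_orthogonal: "rotation_matrix a \<Longrightarrow> orthogonal_transformation (\<rho> a)"
  and rho_id: "\<rho> (mat 1) = id"
  and rho_mult: "rotation_matrix a \<Longrightarrow> rotation_matrix b \<Longrightarrow> \<rho> (a ** b) x = \<rho> a (\<rho> b x)"
  and rho_smooth: "\<exists>W F. open W \<and> Collect rotation_matrix \<subseteq> W \<and> smooth_on W F \<and> (\<forall>a. rotation_matrix a \<longrightarrow> F a = \<rho> a x)"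
  using rho by (auto simp: SO_representation_def)

lemma rho_linear: "rotation_matrix a \<Longrightarrow> linear (\<rho> a)"
  using rho_orthogonal by (simp add: orthogonal_transformation_def)

lemma rho_inner: "rotation_matrix a \<Longrightarrow> \<rho> a x \<bullet> \<rho> a y = x \<bullet> y"
  using rho_orthogonal by (simp add: orthogonal_transformation_def)

lemma conn_metric: "metric_connection (charts M) (smooth_E_section M (rep E)) (E_inner M) (conn E)"
  using E by (simp add: associated_bundle_with_connection_def)

lemmas conn_local = metric_connection_local[OF conn_metric]
  and conn_smooth = metric_connection_smooth[OF conn_metric]
  and conn_sum = metric_connection_sum[OF conn_metric]
  and conn_sum_vector = metric_connection_sum_vector[OF conn_metric]
  and conn_product_rule = metric_connectionD(4)[OF conn_metric]

lemma transition_self: "f \<in> fr p \<Longrightarrow> tr p f f = mat 1"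
  by (simp add: frame_transition_def fr_orth mat_def vec_eq_iff)

lemma transition_transpose: "f \<in> fr p \<Longrightarrow> f' \<in> fr p \<Longrightarrow> transpose (tr p f f') = tr p f' f"
  by (simp add: frame_transition_def transpose_def vec_eq_iff g_sym fr_tangent)

lemma transition_mult:
  assumes "f \<in> fr p" "f' \<in> fr p" "f'' \<in> fr p"
  shows "tr p f f' ** tr p f' f'' = tr p f f''"
proof -
  have "frame_act f (tr p f f' ** tr p f' f'') = f''"
    using assms by (simp add: frame_act_act[symmetric] frame_act_transition)
  then show ?thesis using frame_transition_act[OF assms(1)] by metis
qed

lemma fc_apply:
  assumes "f \<in> fr p" "f' \<in> fr p"
  shows "fc f x f' = \<rho> (tr p f' f) x"
proof -
  have ex: "\<exists>a. rotation_matrix a \<and> f' = frame_act f a"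
    using frame_transition_rotation[OF assms] frame_act_transition[OF assms] by metis
  have "(THE a. rotation_matrix a \<and> f' = frame_act f a) = tr p f f'"
    using frame_transition_rotation[OF assms] frame_act_transition[OF assms] frame_transition_act[OF assms(1)]
    by (intro the_equality) auto
  then show ?thesis using ex transition_transpose[OF assms] by (simp add: frame_class_def)
qed

lemma fc_not_frame: "f \<in> fr p \<Longrightarrow> f' \<notin> fr p \<Longrightarrow> fc f x f' = 0"
  using frame_act_fr by (auto simp: frame_class_def)

lemma fc_self: "f \<in> fr p \<Longrightarrow> fc f x f = x"
  by (simp add: fc_apply transition_self rho_id)

lemma fc_fibre:
  assumes f: "f \<in> fr p"
  shows "fc f x \<in> E_fibre M \<rho> p"
  unfolding E_fibre_def
proof (intro CollectI conjI ballI allI impI)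
  fix f' and a :: "real^'n^'n" assume f': "f' \<in> fr p" and a: "rotation_matrix a"
  have fa: "frame_act f' a \<in> fr p" using frame_act_fr[OF f' a] .
  have "tr p (frame_act f' a) f = tr p (frame_act f' a) f' ** tr p f' f"
    using transition_mult[OF fa f' f] by simp
  also have "tr p (frame_act f' a) f' = transpose a"
    using transition_transpose[OF f' fa] frame_transition_act[OF f'] by metis
  finally show "fc f x (frame_act f' a) = \<rho> (transpose a) (fc f x f')"
    using rho_mult[OF rotation_matrix_transpose[OF a] frame_transition_rotation[OF f' f]] fc_apply[OF f f'] fc_apply[OF f fa]
    by simp
qed (use f fc_not_frame in auto)

lemma fibre_apply:
  assumes "u \<in> E_fibre M \<rho> p" "f \<in> fr p" "f' \<in> fr p"
  shows "u f' = \<rho> (tr p f' f) (u f)"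
proof -
  have "u (frame_act f (tr p f f')) = \<rho> (transpose (tr p f f')) (u f)"
    using assms frame_transition_rotation by (auto simp: E_fibre_def)
  then show ?thesis using assms by (simp add: frame_act_transition transition_transpose)
qed

lemma fibre_not_frame: "u \<in> E_fibre M \<rho> p \<Longrightarrow> f \<notin> fr p \<Longrightarrow> u f = 0"
  by (simp add: E_fibre_def)

lemma fibre_eqI:
  assumes "u \<in> E_fibre M \<rho> p" "w \<in> E_fibre M \<rho> p" "f \<in> fr p" "u f = w f"
  shows "u = w"
proof
  fix f' show "u f' = w f'"
    using fibre_apply[OF assms(1,3), of f'] fibre_apply[OF assms(2,3), of f'] assms(4)
      fibre_not_frame[OF assms(1), of f'] fibre_not_frame[OF assms(2), of f']
    by (cases "f' \<in> fr p") simp_all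
qed

lemma fibre_eq_fc: "u \<in> E_fibre M \<rho> p \<Longrightarrow> f \<in> fr p \<Longrightarrow> fc f (u f) = u"
  by (rule fibre_eqI) (auto simp: fc_fibre fc_self)

lemma E_inner_frame:
  assumes "u \<in> E_fibre M \<rho> p" "w \<in> E_fibre M \<rho> p" "f \<in> fr p"
  shows "E_inner M p u w = u f \<bullet> w f"
proof -
  define f' where "f' = (SOME f. f \<in> fr p)"
  have f': "f' \<in> fr p" unfolding f'_def using fr_nonempty[of p] by (simp add: some_in_eq)
  have "E_inner M p u w = u f' \<bullet> w f'" by (simp add: E_inner_def f'_def Let_def)
  also have "\<dots> = u f \<bullet> w f"
    using fibre_apply[OF assms(1,3) f'] fibre_apply[OF assms(2,3) f'] rho_inner[OF frame_transition_rotation[OF f' assms(3)]] by simp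
  finally show ?thesis .
qed

text \<open>The smooth extensions of \<open>\<rho>\<close> depend on the vector that it acts on. They are applied to the vectors of a
  fixed basis of \<open>E\<close>, in which \<open>F\<close> is expanded.\<close>
lemma smooth_rho_transition:
  assumes "local_frame M U e" "local_frame M U e'" "SF U F"
  shows "SF U (\<lambda>q. \<rho> (tr q (e' q) (e q)) (F q))"
proof -
  have rot: "rotation_matrix (tr q (e' q) (e q))" if "q \<in> U" for q
    using assms that by (intro frame_transition_rotation) (auto dest: local_frameD)
  have 1: "SF U (\<lambda>q. \<rho> (tr q (e' q) (e q)) x)" for x
  proof -
    obtain W G where W: "open W" "Collect rotation_matrix \<subseteq> W" "smooth_on W G" "\<And>a. rotation_matrix a \<Longrightarrow> G a = \<rho> a x"
      using rho_smooth by blast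
    have "SF U (\<lambda>q. G (tr q (e' q) (e q)))"
      by (rule smooth_fun_compose[OF frame_transition_smooth(1)[OF assms(2,1)] W(3)]) (use W(2) rot in auto)
    then show ?thesis by (rule smooth_fun_cong) (use W(4) rot in auto)
  qed
  have "SF U (\<lambda>q. \<Sum>b\<in>Basis. (F q \<bullet> b) *\<^sub>R \<rho> (tr q (e' q) (e q)) b)"
    by (rule smooth_fun_sum[OF local_frameD(3)[OF assms(1)] smooth_fun_scaleR[OF smooth_fun_inner[OF assms(3) smooth_fun_const] 1]])
      (rule local_frameD(3)[OF assms(1)])
  then show ?thesis
    by (rule smooth_fun_cong) (simp add: linear_euclidean_expansion[OF rho_linear[OF rot], symmetric])
qed

lemma SE_fc:
  assumes e: "local_frame M U e" and F: "SF U F"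
  shows "SE U (\<lambda>q. fc (e q) (F q))"
  unfolding smooth_E_section_def
proof (intro conjI ballI allI impI)
  show "open U" using local_frameD(3)[OF e] .
  show "fc (e p) (F p) \<in> E_fibre M \<rho> p" if "p \<in> U" for p using fc_fibre local_frameD(1)[OF e that] by blast
  fix V e' assume V: "V \<subseteq> U" "local_frame M V e'"
  note o = local_frameD(3)[OF V(2)]
  have eV: "local_frame M V e" using local_frame_subset[OF e o V(1)] .
  show "SF V (\<lambda>q. fc (e q) (F q) (e' q))"
    by (rule smooth_fun_cong[OF smooth_rho_transition[OF eV V(2) smooth_fun_subset[OF F o V(1)]]])
      (simp add: fc_apply[OF local_frameD(1)[OF eV] local_frameD(1)[OF V(2)]])
qed

lemma SE_fibre: "SE U \<xi> \<Longrightarrow> p \<in> U \<Longrightarrow> \<xi> p \<in> E_fibre M \<rho> p"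
  and SE_open: "SE U \<xi> \<Longrightarrow> open U"
  and SE_smooth: "SE U \<xi> \<Longrightarrow> V \<subseteq> U \<Longrightarrow> local_frame M V e \<Longrightarrow> SF V (\<lambda>q. \<xi> q (e q))"
  by (auto simp: smooth_E_section_def)

lemma SE_subset: "SE U \<xi> \<Longrightarrow> open V \<Longrightarrow> V \<subseteq> U \<Longrightarrow> SE V \<xi>"
  unfolding smooth_E_section_def by (meson subset_iff subset_trans)

lemma SE_cong:
  assumes "SE U \<xi>" "\<And>q. q \<in> U \<Longrightarrow> \<xi> q = \<eta> q"
  shows "SE U \<eta>"
  unfolding smooth_E_section_def
proof (intro conjI ballI allI impI)
  show "open U" by (rule SE_open[OF assms(1)])
  show "\<eta> p \<in> E_fibre M \<rho> p" if "p \<in> U" for p using SE_fibre[OF assms(1) that] assms(2)[OF that] by simp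
  show "SF V (\<lambda>q. \<eta> q (e q))" if "V \<subseteq> U" "local_frame M V e" for V e
    by (rule smooth_fun_cong[OF SE_smooth[OF assms(1) that]]) (use assms(2) that in auto)
qed

lemma conn_fibre:
  assumes "SE U \<xi>" "p \<in> U" "v \<in> TS p"
  shows "conn E p v \<xi> \<in> E_fibre M \<rho> p"
proof -
  obtain W X where W: "p \<in> W" "VF W X" "X p = v" using vfield_through[OF assms(3)] .
  have o: "open (U \<inter> W)" using SE_open[OF assms(1)] smooth_vfieldD(1)[OF W(2)] by auto
  have "SE (U \<inter> W) (\<lambda>q. conn E q (X q) \<xi>)"
    by (rule conn_smooth[OF smooth_vfield_subset[OF W(2) o] SE_subset[OF assms(1) o]]) auto
  from SE_fibre[OF this, of p] show ?thesis using W assms by auto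
qed

text \<open>A section of \<open>EM\<close> over the domain of a frame \<open>e\<close> is a function \<open>F\<close> with values in \<open>E\<close>; this is \<open>\<nabla>\<^sup>E\<close>
  in these terms, a connection on the trivial bundle.\<close>
definition frame_conn :: "('m \<Rightarrow> ('m, 'n) frame) \<Rightarrow> 'm \<Rightarrow> 'm tvec \<Rightarrow> ('m \<Rightarrow> 'e) \<Rightarrow> 'e" where
  "frame_conn e q v F = conn E q v (\<lambda>q. fc (e q) (F q)) (e q)"

definition christoffel :: "('m \<Rightarrow> ('m, 'n) frame) \<Rightarrow> 'm \<Rightarrow> 'm tvec \<Rightarrow> 'n \<Rightarrow> 'n \<Rightarrow> real" where
  "christoffel e q v a b = g q (nabla M q v (\<lambda>q. e q b)) (e q a)"

text \<open>The product rule for \<open>\<Sum>\<^sub>l e\<^sub>l\<^sub>1 \<otimes> \<dots> \<otimes> e\<^sub>l\<^sub>m \<otimes> S\<^sub>l\<close>, as in \<open>nablaE\<close>, but in an arbitrary local frame.\<close>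
definition tensor_deriv :: "('m \<Rightarrow> ('m, 'n) frame) \<Rightarrow> 'm \<Rightarrow> 'm tvec \<Rightarrow> ('m \<Rightarrow> ('n, 'e) tensor) \<Rightarrow> ('n, 'e) tensor" where
  "tensor_deriv e q v S l = frame_conn e q v (\<lambda>q. S q l) + derivation_ext (christoffel e q v) (S q) l"

context
  fixes U e assumes e: "local_frame M U e"
begin

lemmas eU = local_frameD(1)[OF e] and eV = local_frameD(2)[OF e] and oU = local_frameD(3)[OF e]

lemma fc_lincomb: "q \<in> U \<Longrightarrow> fc (e q) (\<Sum>i\<in>I. c i *\<^sub>R x i) f = (\<Sum>i\<in>I. c i *\<^sub>R fc (e q) (x i) f)"
proof (cases "f \<in> fr q")
  case True
  assume q: "q \<in> U"
  have "linear (\<rho> (tr q f (e q)))" by (intro rho_linear frame_transition_rotation True eU q)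
  then show ?thesis by (simp add: fc_apply[OF eU[OF q] True] linear_sum linear_cmul)
qed (simp add: fc_not_frame[OF eU])

lemma frame_conn_cong:
  assumes "q \<in> U" "v \<in> TS q" "SF U F" "SF U G" "\<And>q. q \<in> U \<Longrightarrow> F q = G q"
  shows "frame_conn e q v F = frame_conn e q v G"
  unfolding frame_conn_def
  using conn_local[OF assms(1) oU SE_fc[OF e assms(3)] SE_fc[OF e assms(4)] assms(2)] assms(5)
  by simp

lemma frame_conn_sum:
  assumes "q \<in> U" "v \<in> TS q" "\<And>i. i \<in> I \<Longrightarrow> SF U (h i)" "\<And>i. i \<in> I \<Longrightarrow> SF U (F i)"
  shows "frame_conn e q v (\<lambda>q. \<Sum>i\<in>I. h i q *\<^sub>R F i q)
    = (\<Sum>i\<in>I. v (h i) *\<^sub>R F i q + h i q *\<^sub>R frame_conn e q v (F i))"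
proof -
  let ?S = "\<lambda>J q f. \<Sum>i\<in>J. h i q *\<^sub>R fc (e q) (F i q) f"
  have sm: "SF U (\<lambda>q. \<Sum>i\<in>J. h i q *\<^sub>R F i q)" if "J \<subseteq> I" for J
    by (rule smooth_fun_sum[OF oU smooth_fun_scaleR]) (use assms(3,4) that in auto)
  have eq: "?S J q = fc (e q) (\<Sum>i\<in>J. h i q *\<^sub>R F i q)" if "q \<in> U" for J q
    by (rule ext) (simp add: fc_lincomb[OF that])
  have sec: "SE U (?S J)" if "J \<subseteq> I" for J
  proof -
    have "SE U (\<lambda>q. fc (e q) (\<Sum>i\<in>J. h i q *\<^sub>R F i q))" by (rule SE_fc[OF e sm[OF that]])
    then show ?thesis by (rule SE_cong) (simp only: eq)
  qed
  have z: "SE U (\<lambda>q. fc (e q) 0)" by (rule SE_fc[OF e smooth_fun_const[OF oU]])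
  have "conn E q v (\<lambda>q. fc (e q) (\<Sum>i\<in>I. h i q *\<^sub>R F i q)) = conn E q v (?S I)"
    by (rule conn_local[OF assms(1) oU SE_fc[OF e sm] sec assms(2)]) (use eq in auto)
  also have "\<dots> = (\<lambda>f. \<Sum>i\<in>I. v (h i) *\<^sub>R fc (e q) (F i q) f + h i q *\<^sub>R conn E q v (\<lambda>q. fc (e q) (F i q)) f)"
    by (rule conn_sum[OF assms(1) oU z assms(2,3)])
      (use SE_fc[OF e assms(4)] sec in auto)
  finally show ?thesis using fc_self[OF eU[OF assms(1)]] by (simp add: frame_conn_def)
qed

lemma frame_conn_scale:
  assumes "q \<in> U" "v \<in> TS q" "SF U h" "SF U F"
  shows "frame_conn e q v (\<lambda>q. h q *\<^sub>R F q) = v h *\<^sub>R F q + h q *\<^sub>R frame_conn e q v F"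
  using frame_conn_sum[OF assms(1,2), of "{()}" "\<lambda>_. h" "\<lambda>_. F"] assms(3,4) by simp

lemma frame_conn_lincomb:
  assumes "q \<in> U" "v \<in> TS q" "\<And>i. i \<in> I \<Longrightarrow> SF U (F i)"
  shows "frame_conn e q v (\<lambda>q. \<Sum>i\<in>I. c i *\<^sub>R F i q) = (\<Sum>i\<in>I. c i *\<^sub>R frame_conn e q v (F i))"
  using frame_conn_sum[OF assms(1,2) smooth_fun_const[OF oU] assms(3), of I "\<lambda>i. i" c] tangent_const[OF assms(2)] by simp

lemma frame_conn_add:
  assumes "q \<in> U" "v \<in> TS q" "SF U F" "SF U G"
  shows "frame_conn e q v (\<lambda>q. F q + G q) = frame_conn e q v F + frame_conn e q v G"
  using frame_conn_lincomb[OF assms(1,2), of UNIV "\<lambda>b. if b then F else G" "\<lambda>_. 1"] assms(3,4)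
  by (simp add: UNIV_bool add.commute)

lemma frame_conn_zero: "q \<in> U \<Longrightarrow> v \<in> TS q \<Longrightarrow> frame_conn e q v (\<lambda>q. 0) = 0"
  using frame_conn_lincomb[of q v "{}"] by simp

lemma frame_conn_sum_vector:
  assumes "q \<in> U" "\<And>i. i \<in> I \<Longrightarrow> v i \<in> TS q" "SF U F"
  shows "frame_conn e q (\<lambda>h. \<Sum>i\<in>I. c i * v i h) F = (\<Sum>i\<in>I. c i *\<^sub>R frame_conn e q (v i) F)"
  unfolding frame_conn_def
  using conn_sum_vector[OF assms(1) oU SE_fc[OF e assms(3)] assms(2), of I "\<lambda>i. i" c] by simp

lemma frame_conn_smooth:
  assumes "VF U X" "SF U F"
  shows "SF U (\<lambda>q. frame_conn e q (X q) F)"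
  unfolding frame_conn_def
  by (rule SE_smooth[OF conn_smooth[OF assms(1) SE_fc[OF e assms(2)]] subset_refl e])

lemma frame_conn_metric:
  assumes "q \<in> U" "v \<in> TS q" "SF U F" "SF U G"
  shows "v (\<lambda>q. F q \<bullet> G q) = frame_conn e q v F \<bullet> G q + F q \<bullet> frame_conn e q v G"
proof -
  have "v (\<lambda>q. F q \<bullet> G q) = v (\<lambda>q. E_inner M q (fc (e q) (F q)) (fc (e q) (G q)))"
    by (rule tangent_local[OF assms(2) oU assms(1)])
      (simp add: E_inner_frame[OF fc_fibre[OF eU] fc_fibre[OF eU] eU] fc_self[OF eU])
  also have "\<dots> = E_inner M q (conn E q v (\<lambda>q. fc (e q) (F q))) (fc (e q) (G q))
      + E_inner M q (fc (e q) (F q)) (conn E q v (\<lambda>q. fc (e q) (G q)))"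
    by (rule conn_product_rule[OF assms(1) oU SE_fc[OF e assms(3)] assms(2) SE_fc[OF e assms(4)]])
  also have "\<dots> = frame_conn e q v F \<bullet> G q + F q \<bullet> frame_conn e q v G"
    using E_inner_frame[OF conn_fibre[OF SE_fc[OF e assms(3)] assms(1,2)] fc_fibre[OF eU[OF assms(1)]] eU[OF assms(1)]]
      E_inner_frame[OF fc_fibre[OF eU[OF assms(1)]] conn_fibre[OF SE_fc[OF e assms(4)] assms(1,2)] eU[OF assms(1)]]
      fc_self[OF eU[OF assms(1)]]
    by (simp add: frame_conn_def)
  finally show ?thesis .
qed

text \<open>The inner derivative is again a section with components in \<open>e\<close>, so second derivatives can be
  taken in terms of components.\<close>
lemma conn_conn_frame:
  assumes "q \<in> U" "v \<in> TS q" "VF U X" "SF U F"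
  shows "conn E q v (\<lambda>q. conn E q (X q) (\<lambda>q. fc (e q) (F q))) (e q) = frame_conn e q v (\<lambda>q. frame_conn e q (X q) F)"
  unfolding frame_conn_def[of e q v]
proof (rule fun_cong[OF conn_local[OF assms(1) oU _ _ assms(2)]])
  show "SE U (\<lambda>q. conn E q (X q) (\<lambda>q. fc (e q) (F q)))"
    by (rule conn_smooth[OF assms(3) SE_fc[OF e assms(4)]])
  show "SE U (\<lambda>q. fc (e q) (frame_conn e q (X q) F))"
    by (rule SE_fc[OF e frame_conn_smooth[OF assms(3,4)]])
  fix q assume q: "q \<in> U"
  show "conn E q (X q) (\<lambda>q. fc (e q) (F q)) = fc (e q) (frame_conn e q (X q) F)"
    unfolding frame_conn_def
    by (rule fibre_eq_fc[symmetric, OF conn_fibre[OF SE_fc[OF e assms(4)] q smooth_vfieldD(2)[OF assms(3) q]] eU[OF q]])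
qed

subsection \<open>Christoffel symbols and covariant derivatives of tensor fields\<close>

lemma eT: "q \<in> U \<Longrightarrow> e q i \<in> TS q"
  using fr_tangent eU by blast

lemma nabla_frame_tangent: "q \<in> U \<Longrightarrow> v \<in> TS q \<Longrightarrow> nabla M q v (\<lambda>q. e q b) \<in> TS q"
  by (rule nabla_tangent[OF eV])

lemma nabla_frame: "q \<in> U \<Longrightarrow> v \<in> TS q \<Longrightarrow>
    nabla M q v (\<lambda>q. e q b) = (\<lambda>h. \<Sum>a\<in>UNIV. christoffel e q v a b * e q a h)"
  unfolding christoffel_def by (rule fr_expand[OF eU nabla_frame_tangent])

text \<open>Differentiate \<open>g e\<^sub>a e\<^sub>b = \<delta>\<^sub>a\<^sub>b\<close>.\<close>
lemma christoffel_skew: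
  assumes "q \<in> U" "v \<in> TS q"
  shows "christoffel e q v a b = - christoffel e q v b a"
proof -
  have "v (\<lambda>q. g q (e q a) (e q b)) = v (\<lambda>q. if a = b then 1 else 0)"
    by (rule tangent_local[OF assms(2) oU assms(1)]) (simp add: fr_orth[OF eU])
  then have "v (\<lambda>q. g q (e q a) (e q b)) = 0" using tangent_const[OF assms(2)] by simp
  moreover have "v (\<lambda>q. g q (e q a) (e q b)) = g q (nabla M q v (\<lambda>q. e q a)) (e q b) + g q (e q a) (nabla M q v (\<lambda>q. e q b))"
    by (rule lc_product_rule[OF assms(1) oU eV assms(2) eV])
  moreover have "g q (e q a) (nabla M q v (\<lambda>q. e q b)) = g q (nabla M q v (\<lambda>q. e q b)) (e q a)"
    by (rule g_sym[OF eT nabla_frame_tangent]) (rule assms)+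
  ultimately show ?thesis unfolding christoffel_def by linarith
qed

lemma christoffel_smooth: "VF U X \<Longrightarrow> SF U (\<lambda>q. christoffel e q (X q) a b)"
  unfolding christoffel_def by (rule g_smooth[OF lc_smooth eV]) (auto intro: eV)

lemma christoffel_sum_vector:
  assumes "q \<in> U" "\<And>i. i \<in> I \<Longrightarrow> v i \<in> TS q"
  shows "christoffel e q (\<lambda>h. \<Sum>i\<in>I. c i * v i h) a b = (\<Sum>i\<in>I. c i * christoffel e q (v i) a b)"
proof -
  have "nabla M q (\<lambda>h. \<Sum>i\<in>I. c i * v i h) (\<lambda>q. e q b) = (\<lambda>h. \<Sum>i\<in>I. c i * nabla M q (v i) (\<lambda>q. e q b) h)"
    using lc_sum_vector[OF assms(1) oU eV[of b] assms(2), of I "\<lambda>i. i" c] by simp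
  moreover have "g q (\<lambda>h. \<Sum>i\<in>I. c i * nabla M q (v i) (\<lambda>q. e q b) h) (e q a)
      = (\<Sum>i\<in>I. c i * g q (nabla M q (v i) (\<lambda>q. e q b)) (e q a))"
    by (rule g_sum_left) (use nabla_frame_tangent eT assms in auto)
  ultimately show ?thesis by (simp add: christoffel_def)
qed

lemma tensor_deriv_sum_vector:
  assumes "q \<in> U" "\<And>i. i \<in> I \<Longrightarrow> v i \<in> TS q" "SF U (\<lambda>q. S q l)"
  shows "tensor_deriv e q (\<lambda>h. \<Sum>i\<in>I. c i * v i h) S l = (\<Sum>i\<in>I. c i *\<^sub>R tensor_deriv e q (v i) S l)"
proof -
  have "christoffel e q (\<lambda>h. \<Sum>i\<in>I. c i * v i h) = (\<lambda>a b. \<Sum>i\<in>I. c i * christoffel e q (v i) a b)"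
    by (intro ext christoffel_sum_vector assms)
  then show ?thesis
    using frame_conn_sum_vector[OF assms]
    by (simp add: tensor_deriv_def derivation_ext_matrix_sum scaleR_right_distrib sum.distrib)
qed

lemma derivation_ext_smooth:
  assumes "VF U X" "\<And>l. SF U (\<lambda>q. S q l)"
  shows "SF U (\<lambda>q. derivation_ext (christoffel e q (X q)) (S q) l)"
  unfolding derivation_ext_def
  by (intro smooth_fun_sum oU smooth_fun_scaleR christoffel_smooth assms)

lemma tensor_deriv_smooth:
  assumes "VF U X" "\<And>l. SF U (\<lambda>q. S q l)"
  shows "SF U (\<lambda>q. tensor_deriv e q (X q) S l)"
  unfolding tensor_deriv_def
  by (intro smooth_fun_add frame_conn_smooth derivation_ext_smooth assms)

lemma tensor_deriv_cong:
  assumes "q \<in> U" "v \<in> TS q" "\<And>l. SF U (\<lambda>q. S q l)" "\<And>q. q \<in> U \<Longrightarrow> S q = T q"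
  shows "tensor_deriv e q v S = tensor_deriv e q v T"
proof
  fix l
  have "SF U (\<lambda>q. T q l)" by (rule smooth_fun_cong[OF assms(3)]) (simp add: assms(4))
  then have "frame_conn e q v (\<lambda>q. S q l) = frame_conn e q v (\<lambda>q. T q l)"
    by (intro frame_conn_cong[OF assms(1,2) assms(3)]) (simp_all add: assms(4))
  then show "tensor_deriv e q v S l = tensor_deriv e q v T l" by (simp add: tensor_deriv_def assms)
qed

lemma index_act_smooth:
  assumes "\<And>i j. SF U (\<lambda>q. b q $ i $ j)" "\<And>l. SF U (\<lambda>q. T q l)"
  shows "SF U (\<lambda>q. index_act (b q) (T q) l)"
  using assms(2)
proof (induction l arbitrary: T)
  case (Cons i l)
  have "SF U (\<lambda>q. index_act (b q) (slot j (T q)) l)" for j by (rule Cons.IH) (rule Cons.prems)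
  then show ?case by (auto intro!: smooth_fun_sum oU smooth_fun_scaleR assms(1))
qed simp

lemma frame_conn_index_act:
  assumes q: "q \<in> U" "v \<in> TS q" and b: "\<And>i j. SF U (\<lambda>q. b q $ i $ j)" and T: "\<And>l. SF U (\<lambda>q. T q l)"
  shows "frame_conn e q v (\<lambda>q. index_act (b q) (T q) l)
    = index_act (b q) (\<lambda>l. frame_conn e q v (\<lambda>q. T q l)) l
      + index_act_deriv (b q) (\<lambda>i j. v (\<lambda>q. b q $ i $ j)) (T q) l"
  using T
proof (induction l arbitrary: T)
  case (Cons i l)
  have s: "SF U (\<lambda>q. index_act (b q) (slot j (T q)) l)" for j
    by (rule index_act_smooth[OF b]) (rule Cons.prems)
  have "frame_conn e q v (\<lambda>q. index_act (b q) (T q) (i # l))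
    = (\<Sum>j\<in>UNIV. v (\<lambda>q. b q $ i $ j) *\<^sub>R index_act (b q) (slot j (T q)) l
        + b q $ i $ j *\<^sub>R frame_conn e q v (\<lambda>q. index_act (b q) (slot j (T q)) l))"
    unfolding index_act.simps by (rule frame_conn_sum[OF q b s])
  moreover have "frame_conn e q v (\<lambda>q. index_act (b q) (slot j (T q)) l)
    = index_act (b q) (\<lambda>l. frame_conn e q v (\<lambda>q. T q (j # l))) l
      + index_act_deriv (b q) (\<lambda>i j. v (\<lambda>q. b q $ i $ j)) (slot j (T q)) l" for j
    by (rule Cons.IH) (rule Cons.prems)
  ultimately show ?case by (simp add: sum.distrib scaleR_right_distrib add_ac)
qed simp

end

subsection \<open>Change of the frame\<close>

text \<open>Both sides differentiate the same section of \<open>EM\<close>, since \<open>[e, x] = [e', \<rho>(a) x]\<close> for the change of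
  frame \<open>a\<close>.\<close>
lemma frame_conn_change:
  assumes e: "local_frame M U e" and e': "local_frame M U e'" and q: "q \<in> U" "v \<in> TS q" and F: "SF U F"
  shows "frame_conn e' q v (\<lambda>q. \<rho> (tr q (e' q) (e q)) (F q)) = \<rho> (tr q (e' q) (e q)) (frame_conn e q v F)"
proof -
  note F' = smooth_rho_transition[OF e e' F]
  have "fc (e' q) (\<rho> (tr q (e' q) (e q)) (F q)) = fc (e q) (F q)" if "q \<in> U" for q
    using fibre_eq_fc[OF fc_fibre[OF local_frameD(1)[OF e that]] local_frameD(1)[OF e' that]]
      fc_apply[OF local_frameD(1)[OF e that] local_frameD(1)[OF e' that]] by simp
  then have "conn E q v (\<lambda>q. fc (e' q) (\<rho> (tr q (e' q) (e q)) (F q))) = conn E q v (\<lambda>q. fc (e q) (F q))"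
    by (intro conn_local[OF q(1) local_frameD(3)[OF e] SE_fc[OF e' F'] SE_fc[OF e F] q(2)])
  then show ?thesis
    using fibre_apply[OF conn_fibre[OF SE_fc[OF e F] q] local_frameD(1)[OF e q(1)] local_frameD(1)[OF e' q(1)]]
    by (simp add: frame_conn_def)
qed

lemma nabla_frame_change:
  assumes e: "local_frame M U e" and e': "local_frame M U e'" and q: "q \<in> U" "v \<in> TS q"
  shows "nabla M q v (\<lambda>q. e' q y) = (\<lambda>h. \<Sum>c\<in>UNIV.
    v (\<lambda>q. tr q (e q) (e' q) $ c $ y) * e q c h + tr q (e q) (e' q) $ c $ y * nabla M q v (\<lambda>q. e q c) h)"
proof -
  let ?X = "\<lambda>J q h. \<Sum>c\<in>J. tr q (e q) (e' q) $ c $ y *\<^sub>R e q c h"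
  note a = frame_transition_smooth(2)[OF e e']
  have X: "VF U (?X J)" for J
    using smooth_vfield_sum[OF local_frameD(3)[OF e] a local_frameD(2)[OF e]] by simp
  have "e' q y = ?X UNIV q" if "q \<in> U" for q
    using frame_act_transition[OF local_frameD(1)[OF e that] local_frameD(1)[OF e' that]]
    by (auto simp: frame_act_def fun_eq_iff)
  then have "nabla M q v (\<lambda>q. e' q y) = nabla M q v (?X UNIV)"
    by (intro lc_local[OF q(1) local_frameD(3)[OF e] local_frameD(2)[OF e'] X q(2)])
  also have "\<dots> = (\<lambda>h. \<Sum>c\<in>UNIV.
    v (\<lambda>q. tr q (e q) (e' q) $ c $ y) *\<^sub>R e q c h + tr q (e q) (e' q) $ c $ y *\<^sub>R nabla M q v (\<lambda>q. e q c) h)"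
    by (rule lc_sum[OF q(1) local_frameD(3)[OF e] local_frameD(2)[OF e] q(2) a local_frameD(2)[OF e] X])
  finally show ?thesis by simp
qed

lemma orthogonal_sum:
  assumes "f \<in> fr p" "f' \<in> fr p"
  shows "(\<Sum>c\<in>UNIV. tr p f f' $ i $ c * tr p f f' $ j $ c) = (if i = j then 1 else 0)"
  using rotation_matrix_mult(2)[OF frame_transition_rotation[OF assms]]
  by (auto simp: matrix_matrix_mult_def transpose_def mat_def vec_eq_iff)

lemma christoffel_change:
  assumes e: "local_frame M U e" and e': "local_frame M U e'" and q: "q \<in> U" "v \<in> TS q"
  shows "christoffel e' q v x y = (\<Sum>c\<in>UNIV. v (\<lambda>q. tr q (e q) (e' q) $ c $ y) * tr q (e q) (e' q) $ c $ x)
    + (\<Sum>c\<in>UNIV. \<Sum>d\<in>UNIV. tr q (e q) (e' q) $ c $ y * tr q (e q) (e' q) $ d $ x * christoffel e q v d c)"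
proof -
  let ?a = "tr q (e q) (e' q)"
  note eT' = eT[OF e q(1)] eT[OF e' q(1)] nabla_frame_tangent[OF e q]
  \<comment> \<open>The factors \<open>1\<close> bring the vector into the form of \<open>g_lin\<close>.\<close>
  have "christoffel e' q v x y
    = g q (\<lambda>h. 1 * (\<Sum>c\<in>UNIV. v (\<lambda>q. tr q (e q) (e' q) $ c $ y) * e q c h) + 1 * (\<Sum>c\<in>UNIV. ?a $ c $ y * nabla M q v (\<lambda>q. e q c) h)) (e' q x)"
    unfolding christoffel_def nabla_frame_change[OF e e' q] by (simp add: sum.distrib)
  also have "\<dots> = (\<Sum>c\<in>UNIV. v (\<lambda>q. tr q (e q) (e' q) $ c $ y) * g q (e q c) (e' q x))
      + (\<Sum>c\<in>UNIV. ?a $ c $ y * g q (nabla M q v (\<lambda>q. e q c)) (e' q x))"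
    using eT' by (subst g_lin) (auto intro: tangent_sum simp: g_sum_left)
  finally have "christoffel e' q v x y = (\<Sum>c\<in>UNIV. v (\<lambda>q. tr q (e q) (e' q) $ c $ y) * g q (e q c) (e' q x))
      + (\<Sum>c\<in>UNIV. ?a $ c $ y * g q (nabla M q v (\<lambda>q. e q c)) (e' q x))" .
  moreover have "g q (nabla M q v (\<lambda>q. e q c)) (e' q x) = (\<Sum>d\<in>UNIV. ?a $ d $ x * christoffel e q v d c)" for c
  proof -
    have "e' q x = (\<lambda>h. \<Sum>d\<in>UNIV. ?a $ d $ x * e q d h)"
      using frame_act_transition[OF local_frameD(1)[OF e q(1)] local_frameD(1)[OF e' q(1)]]
      by (auto simp: frame_act_def fun_eq_iff)
    then show ?thesis using g_sum_right[OF eT'(1) eT'(3)] by (simp add: christoffel_def)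
  qed
  ultimately show ?thesis by (simp add: frame_transition_nth sum_distrib_left mult.assoc)
qed

text \<open>The Christoffel symbols transform so that the derivative of the matrix of the frame change is
  absorbed: this is the hypothesis of \<open>index_act_deriv_gauge\<close>.\<close>
lemma christoffel_gauge:
  assumes e: "local_frame M U e" and e': "local_frame M U e'" and q: "q \<in> U" "v \<in> TS q"
  shows "v (\<lambda>q. tr q (e' q) (e q) $ i $ j) = (\<Sum>c\<in>UNIV. tr q (e' q) (e q) $ i $ c * christoffel e q v c j)
    - (\<Sum>c\<in>UNIV. christoffel e' q v i c * tr q (e' q) (e q) $ c $ j)"
proof -
  let ?a = "tr q (e q) (e' q)" and ?da = "\<lambda>i j. v (\<lambda>q. tr q (e q) (e' q) $ i $ j)"
  have swap: "tr q (e' q) (e q) $ i $ j = tr q (e q) (e' q) $ j $ i" if "q \<in> U" for q i j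
    using transition_transpose[OF local_frameD(1)[OF e that] local_frameD(1)[OF e' that]]
    by (auto simp: transpose_def vec_eq_iff)
  have 1: "v (\<lambda>q. tr q (e' q) (e q) $ i $ j) = ?da j i"
    by (rule tangent_local[OF q(2) local_frameD(3)[OF e] q(1)]) (simp add: swap)
  have o: "(\<Sum>c\<in>UNIV. ?a $ i $ c * ?a $ j $ c) = (if i = j then 1 else 0)" for i j
    by (rule orthogonal_sum[OF local_frameD(1)[OF e q(1)] local_frameD(1)[OF e' q(1)]])
  have "(\<Sum>c\<in>UNIV. christoffel e' q v i c * ?a $ j $ c) = - (\<Sum>c\<in>UNIV. ?a $ j $ c * christoffel e' q v c i)"
    by (subst christoffel_skew[OF e' q]) (simp add: sum_negf mult.commute)
  also have "(\<Sum>c\<in>UNIV. ?a $ j $ c * christoffel e' q v c i)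
     = (\<Sum>c\<in>UNIV. \<Sum>d\<in>UNIV. ?a $ j $ c * (?da d i * ?a $ d $ c))
       + (\<Sum>c\<in>UNIV. \<Sum>d\<in>UNIV. \<Sum>x\<in>UNIV. ?a $ j $ c * (?a $ d $ i * ?a $ x $ c * christoffel e q v x d))"
    by (simp add: christoffel_change[OF e e' q] distrib_left sum.distrib sum_distrib_left)
  also have "(\<Sum>c\<in>UNIV. \<Sum>d\<in>UNIV. ?a $ j $ c * (?da d i * ?a $ d $ c)) = (\<Sum>d\<in>UNIV. ?da d i * (\<Sum>c\<in>UNIV. ?a $ j $ c * ?a $ d $ c))"
    by (subst sum.swap) (simp add: sum_distrib_left mult_ac)
  also have "\<dots> = ?da j i" by (simp add: o if_distrib cong: if_cong)
  also have "(\<Sum>c\<in>UNIV. \<Sum>d\<in>UNIV. \<Sum>x\<in>UNIV. ?a $ j $ c * (?a $ d $ i * ?a $ x $ c * christoffel e q v x d))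
     = (\<Sum>d\<in>UNIV. \<Sum>x\<in>UNIV. \<Sum>c\<in>UNIV. ?a $ j $ c * (?a $ d $ i * ?a $ x $ c * christoffel e q v x d))"
    by (subst sum.swap, rule sum.cong[OF refl], rule sum.swap)
  also have "\<dots> = (\<Sum>d\<in>UNIV. \<Sum>x\<in>UNIV. ?a $ d $ i * christoffel e q v x d * (\<Sum>c\<in>UNIV. ?a $ j $ c * ?a $ x $ c))"
    by (simp add: sum_distrib_left mult_ac)
  also have "\<dots> = (\<Sum>d\<in>UNIV. ?a $ d $ i * christoffel e q v j d)" by (simp add: o if_distrib cong: if_cong)
  also have "\<dots> = - (\<Sum>d\<in>UNIV. ?a $ d $ i * christoffel e q v d j)"
    by (subst christoffel_skew[OF e q]) (simp add: sum_negf)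
  finally show ?thesis by (simp add: 1 swap[OF q(1)])
qed

lemma tensor_act_eq: "tensor_act \<rho> b K = index_act b (\<lambda>l. \<rho> b (K l))"
  by (rule ext) (rule tensor_act_index_act)

lemma tensor_deriv_change:
  assumes e: "local_frame M U e" and e': "local_frame M U e'" and q: "q \<in> U" "v \<in> TS q"
    and S: "\<And>l. SF U (\<lambda>q. S q l)"
  shows "tensor_deriv e' q v (\<lambda>q. tensor_act \<rho> (tr q (e' q) (e q)) (S q))
    = tensor_act \<rho> (tr q (e' q) (e q)) (tensor_deriv e q v S)"
proof
  fix l
  let ?b = "\<lambda>q. tr q (e' q) (e q)" and ?T = "\<lambda>q l. \<rho> (tr q (e' q) (e q)) (S q l)"
  have T: "SF U (\<lambda>q. ?T q l)" for l by (rule smooth_rho_transition[OF e e' S])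
  have lin: "linear (\<rho> (?b q))"
    by (intro rho_linear frame_transition_rotation local_frameD(1)[OF e'] local_frameD(1)[OF e] q(1))
  have "frame_conn e' q v (\<lambda>q. index_act (?b q) (?T q) l)
    = index_act (?b q) (\<lambda>l. frame_conn e' q v (\<lambda>q. ?T q l)) l
      + index_act_deriv (?b q) (\<lambda>i j. v (\<lambda>q. ?b q $ i $ j)) (?T q) l"
    by (rule frame_conn_index_act[OF e' q frame_transition_smooth(2)[OF e' e] T])
  then have "tensor_deriv e' q v (\<lambda>q. tensor_act \<rho> (?b q) (S q)) l
    = index_act (?b q) (\<lambda>l. frame_conn e' q v (\<lambda>q. ?T q l)) l
      + (index_act_deriv (?b q) (\<lambda>i j. v (\<lambda>q. ?b q $ i $ j)) (?T q) l
      + derivation_ext (christoffel e' q v) (index_act (?b q) (?T q)) l)"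
    by (simp add: tensor_deriv_def tensor_act_eq)
  also have "\<dots> = index_act (?b q) (\<lambda>l. frame_conn e' q v (\<lambda>q. ?T q l)) l
      + index_act (?b q) (derivation_ext (christoffel e q v) (?T q)) l"
    by (subst index_act_deriv_gauge[OF christoffel_gauge[OF e e' q]]) rule
  also have "(\<lambda>l. frame_conn e' q v (\<lambda>q. ?T q l)) = (\<lambda>l. \<rho> (?b q) (frame_conn e q v (\<lambda>q. S q l)))"
    by (intro ext frame_conn_change[OF e e' q S])
  also have "derivation_ext (christoffel e q v) (?T q) = (\<lambda>l. \<rho> (?b q) (derivation_ext (christoffel e q v) (S q) l))"
    by (rule ext) (simp add: derivation_ext_def linear_sum[OF lin] linear_cmul[OF lin])
  finally show "tensor_deriv e' q v (\<lambda>q. tensor_act \<rho> (?b q) (S q)) l = tensor_act \<rho> (?b q) (tensor_deriv e q v S) l"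
    by (simp add: tensor_act_eq tensor_deriv_def[abs_def] linear_add[OF lin] index_act_add)
qed

subsection \<open>The gradient of a section\<close>

abbreviation Secs where "Secs \<equiv> sections M E UNIV"

lemma section_smooth: "s \<in> Secs \<Longrightarrow> local_frame M U e \<Longrightarrow> SF U (\<lambda>q. s q (e q) l)"
  by (simp add: sections_def)

lemma section_transform:
  assumes "s \<in> Secs" "f \<in> fr p" "f' \<in> fr p"
  shows "s p f' = tensor_act \<rho> (tr p f' f) (s p f)"
proof -
  have "s p (frame_act f (tr p f f')) = tensor_act \<rho> (transpose (tr p f f')) (s p f)"
    using assms frame_transition_rotation by (auto simp: sections_def)
  then show ?thesis using assms by (simp add: frame_act_transition transition_transpose)
qed

lemma section_not_frame: "s \<in> Secs \<Longrightarrow> f \<notin> fr p \<Longrightarrow> s p f = (\<lambda>l. 0)"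
  by (simp add: sections_def)

text \<open>The frame chosen by \<open>frame_ext\<close> in the definition of \<open>nablaE\<close> may be replaced by any other.\<close>
lemma nablaE_local:
  assumes s: "s \<in> Secs" and e: "local_frame M U e" and q: "q \<in> U" "v \<in> TS q"
  shows "nablaE M E s q (e q) v = tensor_deriv e q v (\<lambda>q. s q (e q))"
proof -
  define e' where "e' = frame_ext M q (e q)"
  obtain U' where U': "q \<in> U'" "local_frame M U' e'" and eq: "e' q = e q"
    using frame_ext[OF local_frameD(1)[OF e q(1)]] unfolding e'_def by blast
  define W where "W = U \<inter> U'"
  have W: "open W" "q \<in> W" using q U' local_frameD(3)[OF e] local_frameD(3)[OF U'(2)] by (auto simp: W_def)
  have eW: "local_frame M W e" "local_frame M W e'"
    using local_frame_subset[OF e W(1)] local_frame_subset[OF U'(2) W(1)] by (auto simp: W_def)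
  have "nablaE M E s q (e q) v = tensor_deriv e' q v (\<lambda>q. s q (e' q))"
    unfolding nablaE_def Let_def e'_def[symmetric] tensor_deriv_def[abs_def] frame_conn_def christoffel_def[abs_def] eq ..
  also have "\<dots> = tensor_deriv e' q v (\<lambda>q. tensor_act \<rho> (tr q (e' q) (e q)) (s q (e q)))"
    by (rule tensor_deriv_cong[OF eW(2) W(2) q(2) section_smooth[OF s eW(2)]])
      (rule section_transform[OF s local_frameD(1)[OF eW(1)] local_frameD(1)[OF eW(2)]])
  also have "\<dots> = tensor_act \<rho> (tr q (e' q) (e q)) (tensor_deriv e q v (\<lambda>q. s q (e q)))"
    by (rule tensor_deriv_change[OF eW W(2) q(2) section_smooth[OF s eW(1)]])
  also have "\<dots> = tensor_deriv e q v (\<lambda>q. s q (e q))"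
    by (rule ext) (simp add: eq transition_self[OF local_frameD(1)[OF e q(1)]] tensor_act_index_act index_act_id rho_id)
  finally show ?thesis .
qed

text \<open>The covariant derivative \<open>\<nabla>\<^sup>E s\<close> as a section of \<open>T \<otimes> \<dots>\<close>, the direction of differentiation being the
  first index. Thus \<open>grad (grad s) p f (i # j # l)\<close> is \<open>(\<nabla>\<^sup>2\<^bsub>f\<^sub>i,f\<^sub>j\<^esub> s)\<^sub>l\<close>.\<close>
definition grad :: "('m \<Rightarrow> ('m, 'n) frame \<Rightarrow> ('n, 'e) tensor) \<Rightarrow> 'm \<Rightarrow> ('m, 'n) frame \<Rightarrow> ('n, 'e) tensor" where
  "grad s p f = (if f \<in> fr p then (\<lambda>l. case l of [] \<Rightarrow> 0 | i # l' \<Rightarrow> nablaE M E s p f (f i) l') else (\<lambda>l. 0))"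

lemma grad_Nil: "grad s p f [] = 0"
  by (simp add: grad_def)

lemma grad_Cons: "f \<in> fr p \<Longrightarrow> grad s p f (i # l) = nablaE M E s p f (f i) l"
  by (simp add: grad_def)

lemma grad_local:
  "s \<in> Secs \<Longrightarrow> local_frame M U e \<Longrightarrow> q \<in> U \<Longrightarrow>
    grad s q (e q) (i # l) = tensor_deriv e q (e q i) (\<lambda>q. s q (e q)) l"
  by (simp add: grad_Cons local_frameD(1) nablaE_local eT)

lemma local_frame_act:
  assumes "local_frame M U e" "rotation_matrix a"
  shows "local_frame M U (\<lambda>q. frame_act (e q) a)"
proof -
  have "VF U (\<lambda>q h. \<Sum>i\<in>UNIV. a $ i $ j * e q i h)" for j
    by (rule smooth_vfield_sum[OF local_frameD(3)[OF assms(1)] smooth_fun_const[OF local_frameD(3)[OF assms(1)]]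
        local_frameD(2)[OF assms(1)]])
  then show ?thesis
    using frame_act_fr[OF local_frameD(1)[OF assms(1)] assms(2)] by (simp add: local_frame_def frame_act_def)
qed

lemma grad_sections:
  assumes s: "s \<in> Secs"
  shows "grad s \<in> Secs"
  unfolding sections_def
proof (intro CollectI conjI allI ballI impI)
  fix p f and a :: "real^'n^'n" assume f: "f \<in> fr p" and a: "rotation_matrix a"
  obtain e U where e: "e p = f" "p \<in> U" "local_frame M U e" using ex_local_frame[OF f] by blast
  define e' where "e' q = frame_act (e q) a" for q
  have e': "local_frame M U e'" unfolding e'_def[abs_def] by (rule local_frame_act[OF e(3) a])
  note ss = section_smooth[OF s e(3)]
  have b: "tr q (e' q) (e q) = transpose a" if "q \<in> U" for q
    using transition_transpose[OF local_frameD(1)[OF e(3) that] local_frameD(1)[OF e' that]]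
      frame_transition_act[OF local_frameD(1)[OF e(3) that]] by (simp add: e'_def)
  have e'p: "e' p = frame_act f a" by (simp add: e'_def e)
  show "grad s p (frame_act f a) = tensor_act \<rho> (transpose a) (grad s p f)"
  proof
    fix l
    show "grad s p (frame_act f a) l = tensor_act \<rho> (transpose a) (grad s p f) l"
    proof (cases l)
      case Nil
      then show ?thesis
        using linear_0[OF rho_linear[OF rotation_matrix_transpose[OF a]]] by (simp add: grad_Nil tensor_act_index_act)
    next
      case (Cons i l')
      have "grad s p (e' p) (i # l') = tensor_deriv e' p (e' p i) (\<lambda>q. s q (e' q)) l'"
        by (rule grad_local[OF s e' e(2)])
      also have "\<dots> = tensor_deriv e' p (e' p i) (\<lambda>q. tensor_act \<rho> (tr q (e' q) (e q)) (s q (e q))) l'"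
        by (rule fun_cong[OF tensor_deriv_cong[OF e' e(2) eT[OF e' e(2)] section_smooth[OF s e']]])
          (rule section_transform[OF s local_frameD(1)[OF e(3)] local_frameD(1)[OF e']])
      also have "\<dots> = tensor_act \<rho> (transpose a) (tensor_deriv e p (e' p i) (\<lambda>q. s q (e q))) l'"
        by (simp add: tensor_deriv_change[OF e(3) e' e(2) eT[OF e' e(2)] ss] b[OF e(2)])
      also have "tensor_deriv e p (e' p i) (\<lambda>q. s q (e q)) = (\<lambda>l. \<Sum>j\<in>UNIV. a $ j $ i *\<^sub>R grad s p f (j # l))"
      proof
        fix l
        have "tensor_deriv e p (e' p i) (\<lambda>q. s q (e q)) l = (\<Sum>j\<in>UNIV. a $ j $ i *\<^sub>R tensor_deriv e p (e p j) (\<lambda>q. s q (e q)) l)"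
          unfolding e'_def frame_act_def
          by (rule tensor_deriv_sum_vector[OF e(3,2) eT[OF e(3,2)] ss])
        then show "tensor_deriv e p (e' p i) (\<lambda>q. s q (e q)) l = (\<Sum>j\<in>UNIV. a $ j $ i *\<^sub>R grad s p f (j # l))"
          using grad_local[OF s e(3,2)] e(1) by simp
      qed
      also have "tensor_act \<rho> (transpose a) (\<lambda>l. \<Sum>j\<in>UNIV. a $ j $ i *\<^sub>R grad s p f (j # l)) l'
          = tensor_act \<rho> (transpose a) (grad s p f) (i # l')"
        using rho_linear[OF rotation_matrix_transpose[OF a]]
        by (simp add: tensor_act_index_act index_act_sum index_act_scale linear_sum linear_cmul) (simp add: transpose_def)
      finally show ?thesis by (simp add: Cons e'p)
    qed
  qed
next
  fix U e l assume e: "local_frame M U e"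
  show "SF U (\<lambda>q. grad s q (e q) l)"
  proof (cases l)
    case Nil
    then show ?thesis using smooth_fun_const[OF local_frameD(3)[OF e]] by (simp add: grad_Nil)
  next
    case (Cons i l')
    have "SF U (\<lambda>q. tensor_deriv e q (e q i) (\<lambda>q. s q (e q)) l')"
      by (rule tensor_deriv_smooth[OF e local_frameD(2)[OF e] section_smooth[OF s e]])
    then show ?thesis
      by (rule smooth_fun_cong) (simp add: Cons grad_local[OF s e])
  qed
qed (auto simp: grad_def)

end

section \<open>Symmetric tensors as symmetric functions of their indices\<close>

definition index_symmetric :: "('n, 'e) tensor \<Rightarrow> bool" where
  "index_symmetric K \<longleftrightarrow> (\<forall>l l'. mset l = mset l' \<longrightarrow> K l = K l')"

lemma index_symmetricD: "index_symmetric K \<Longrightarrow> mset l = mset l' \<Longrightarrow> K l = K l'"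
  unfolding index_symmetric_def by blast

lemma index_symmetricI: "(\<And>l l'. mset l = mset l' \<Longrightarrow> K l = K l') \<Longrightarrow> index_symmetric K"
  unfolding index_symmetric_def by blast

lemma delta_sum_lists:
  fixes K :: "('n::finite, 'e::real_vector) tensor"
  assumes "length m = k"
  shows "(\<Sum>l' | length l' = k. (\<Prod>r<k. if l' ! r = m ! r then 1 else 0 :: real) *\<^sub>R K l') = K m"
proof -
  have "(\<Prod>r<k. if l' ! r = m ! r then 1 else 0 :: real) = (if l' = m then 1 else 0)" if "length l' = k" for l'
  proof (cases "l' = m")
    case False
    have "\<exists>r<k. l' ! r \<noteq> m ! r"
      by (rule ccontr) (use False that assms nth_equalityI[of l' m] in auto)
    then obtain r where "r < k" "l' ! r \<noteq> m ! r" by blast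
    then show ?thesis using False by (auto intro: prod_zero)
  qed simp
  then have "(\<Sum>l' | length l' = k. (\<Prod>r<k. if l' ! r = m ! r then 1 else 0 :: real) *\<^sub>R K l')
      = (\<Sum>l' | length l' = k. if l' = m then K m else 0)"
    by (intro sum.cong) auto
  then show ?thesis using assms by (simp add: finite_lists_of_length)
qed

text \<open>Every permutation of the factors contributes one summand, whose index list is a rearrangement of
  \<open>l\<close>.\<close>
lemma sym_prod_basis_expansion:
  fixes K :: "('n::finite, 'e::real_vector) tensor"
  assumes "index_symmetric K" "length l = k"
  shows "(\<Sum>l' | length l' = k. sym_prod (map std_basis l') l *\<^sub>R K l') = fact k *\<^sub>R K l"
proof -
  let ?S = "{\<sigma>. \<sigma> permutes {..<k}}"
  have "sym_prod (map std_basis l') l = (\<Sum>\<sigma>\<in>?S. \<Prod>r<k. if l' ! r = permute_list \<sigma> l ! r then 1 else 0)"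
    if l': "length l' = k" for l'
  proof -
    have "sym_prod (map std_basis l') l = (\<Sum>\<sigma>\<in>?S. \<Prod>r<k. (map std_basis l' ! r) $ (l ! \<sigma> r))"
      using l' assms by (subst sym_prod_inverse) auto
    also have "\<dots> = (\<Sum>\<sigma>\<in>?S. \<Prod>r<k. if l' ! r = permute_list \<sigma> l ! r then 1 else 0)"
      using l' assms by (intro sum.cong prod.cong) (auto simp: axis_def permute_list_nth)
    finally show ?thesis .
  qed
  then have "(\<Sum>l' | length l' = k. sym_prod (map std_basis l') l *\<^sub>R K l')
      = (\<Sum>l' | length l' = k. \<Sum>\<sigma>\<in>?S. (\<Prod>r<k. if l' ! r = permute_list \<sigma> l ! r then 1 else 0) *\<^sub>R K l')"
    by (intro sum.cong) (auto simp: scaleR_sum_left)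
  also have "\<dots> = (\<Sum>\<sigma>\<in>?S. K (permute_list \<sigma> l))"
    using assms by (subst sum.swap) (simp add: delta_sum_lists)
  also have "\<dots> = (\<Sum>\<sigma>\<in>?S. K l)"
    using assms(2) by (intro sum.cong refl index_symmetricD[OF assms(1)]) auto
  also have "\<dots> = fact k *\<^sub>R K l" by (simp add: card_permutations scaleR_conv_of_real[symmetric] sum_constant_scaleR)
  finally show ?thesis .
qed

text \<open>A symmetric function \<open>K\<close> of \<open>k\<close> indices is the sum of \<open>e\<^sub>l\<^sub>1 \<cdot> \<dots> \<cdot> e\<^sub>l\<^sub>k \<otimes> K l / k!\<close> over all \<open>l\<close>.\<close>
lemma Sym_iff: "K \<in> Sym k \<longleftrightarrow> index_symmetric K \<and> (\<forall>l. length l \<noteq> k \<longrightarrow> K l = 0)"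
proof
  assume "K \<in> Sym k"
  then obtain N vs x where K: "K = (\<lambda>l. \<Sum>c<(N::nat). sym_prod (vs c) l *\<^sub>R x c)" "\<forall>c<N. length (vs c) = k"
    by (auto simp: Sym_def)
  have "index_symmetric K"
    unfolding K(1) by (intro index_symmetricI sum.cong refl arg_cong2[where f = "(*\<^sub>R)"] sym_prod_permute_indices)
  then show "index_symmetric K \<and> (\<forall>l. length l \<noteq> k \<longrightarrow> K l = 0)"
    using K(2) by (simp add: K(1) sym_prod_def)
next
  assume K: "index_symmetric K \<and> (\<forall>l. length l \<noteq> k \<longrightarrow> K l = 0)"
  obtain N and h :: "nat \<Rightarrow> 'a list" where h: "bij_betw h {0..<N} {l. length l = k}"
    using ex_bij_betw_nat_finite[OF finite_lists_of_length] by blast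
  let ?F = "\<lambda>l l'. sym_prod (map std_basis l') l *\<^sub>R ((1 / fact k) *\<^sub>R K l')"
  have "K l = (\<Sum>c<N. ?F l (h c))" for l
  proof -
    have "(\<Sum>c<N. ?F l (h c)) = (\<Sum>l' | length l' = k. ?F l l')"
      using sum.reindex_bij_betw[OF h, of "?F l"] by (simp add: lessThan_atLeast0)
    also have "\<dots> = (1 / fact k) *\<^sub>R (\<Sum>l' | length l' = k. sym_prod (map std_basis l') l *\<^sub>R K l')"
      by (simp add: scaleR_sum_right mult.commute)
    also have "\<dots> = K l"
    proof (cases "length l = k")
      case True
      then show ?thesis using sym_prod_basis_expansion[of K l k] K by simp
    next
      case False
      then have "(\<Sum>l' | length l' = k. sym_prod (map std_basis l') l *\<^sub>R K l') = 0"
        by (intro sum.neutral) (auto simp: sym_prod_def)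
      then show ?thesis using False K by simp
    qed
    finally show ?thesis by simp
  qed
  moreover have "\<forall>c<N. length (map std_basis (h c) :: (real^'a) list) = k"
    using h by (auto simp: bij_betw_def)
  moreover have "K = (\<lambda>l. \<Sum>c<N. ?F l (h c))" by (rule ext) fact
  ultimately show "K \<in> Sym k" unfolding Sym_def
    by (intro CollectI exI[of _ N] exI[of _ "\<lambda>c. map std_basis (h c)"] exI[of _ "\<lambda>c. (1 / fact k) *\<^sub>R K (h c)"] conjI)
qed

lemma SymD:
  assumes "K \<in> Sym k"
  shows "mset l = mset l' \<Longrightarrow> K l = K l'" "length l \<noteq> k \<Longrightarrow> K l = 0" "K (i # j # l) = K (j # i # l)"
proof -
  have K: "index_symmetric K" "length l \<noteq> k \<Longrightarrow> K l = 0" using assms by (auto simp: Sym_iff)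
  show "mset l = mset l' \<Longrightarrow> K l = K l'" by (rule index_symmetricD[OF K(1)])
  show "length l \<noteq> k \<Longrightarrow> K l = 0" by (rule K(2))
  show "K (i # j # l) = K (j # i # l)" by (rule index_symmetricD[OF K(1)]) simp
qed

lemma index_symmetric_add: "index_symmetric K \<Longrightarrow> index_symmetric L \<Longrightarrow> index_symmetric (\<lambda>l. K l + L l)"
  by (rule index_symmetricI, rule arg_cong2[where f = plus]; erule (1) index_symmetricD)

lemma index_symmetric_scale: "index_symmetric K \<Longrightarrow> index_symmetric (\<lambda>l. c *\<^sub>R K l)"
  by (rule index_symmetricI, rule arg_cong[where f = "scaleR c"], erule (1) index_symmetricD)

lemma Sym_zero: "(\<lambda>l. 0) \<in> Sym k"
  and Sym_add: "K \<in> Sym k \<Longrightarrow> L \<in> Sym k \<Longrightarrow> (\<lambda>l. K l + L l) \<in> Sym k"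
  and Sym_scale: "K \<in> Sym k \<Longrightarrow> (\<lambda>l. c *\<^sub>R K l) \<in> Sym k"
  by (simp_all add: Sym_iff index_symmetricI index_symmetric_add index_symmetric_scale)

lemma Sym_diff: "K \<in> Sym k \<Longrightarrow> L \<in> Sym k \<Longrightarrow> (\<lambda>l. K l - L l) \<in> Sym k"
  using Sym_add[of K k "\<lambda>l. (-1) *\<^sub>R L l"] Sym_scale[of L k "-1"] by simp

lemma Sym_sum: "(\<And>i. i \<in> I \<Longrightarrow> K i \<in> Sym k) \<Longrightarrow> (\<lambda>l. \<Sum>i\<in>I. K i l) \<in> Sym k"
  by (induction I rule: infinite_finite_induct) (auto intro: Sym_zero Sym_add)

lemma index_symmetric_slot: "index_symmetric K \<Longrightarrow> index_symmetric (slot i K)"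
  by (intro index_symmetricI, erule index_symmetricD) simp

lemma Sym_slot: "K \<in> Sym (Suc k) \<Longrightarrow> slot i K \<in> Sym k"
  by (simp add: Sym_iff index_symmetric_slot)

lemma Sym_slot_0: "K \<in> Sym 0 \<Longrightarrow> slot i K = (\<lambda>l. 0)"
  by (auto simp: Sym_iff)

lemma index_symmetric_slotI:
  assumes "\<And>i. index_symmetric (slot i K)" "\<And>i j l. K (i # j # l) = K (j # i # l)"
  shows "index_symmetric K"
proof (rule index_symmetricI)
  fix l l' :: "'a list" assume m: "mset l = mset l'"
  show "K l = K l'"
  proof (cases l)
    case Nil
    then show ?thesis using m by simp
  next
    case l: (Cons i t)
    then obtain j t' where l': "l' = j # t'" using m by (cases l') auto
    show ?thesis
    proof (cases "i = j")
      case True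
      then show ?thesis using m l l' index_symmetricD[OF assms(1)[of i], of t t'] by simp
    next
      case False
      then have "j \<in># mset t" using m l l' by (metis insert_noteq_member mset.simps(2) union_iff)
      then obtain t0 where t0: "mset t = mset (j # t0)"
        by (metis mset.simps(2) multi_member_split ex_mset)
      have "add_mset i (mset t) = add_mset j (mset t')" using m l l' by simp
      then have "mset (i # t0) = mset t'" using t0 by (simp add: add_mset_commute)
      then show ?thesis
        using index_symmetricD[OF assms(1)[of i] t0] index_symmetricD[OF assms(1)[of j], of "i # t0" t'] assms(2) l l' by simp
    qed
  qed
qed

lemma Sym_SucI:
  assumes "\<And>i. slot i K \<in> Sym k" "K [] = 0" "\<And>i j l. K (i # j # l) = K (j # i # l)"
  shows "K \<in> Sym (Suc k)"
proof -
  have "K l = 0" if "length l \<noteq> Suc k" for l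
    using that assms(2) SymD(2)[OF assms(1)] by (cases l) auto
  moreover have "index_symmetric K"
  proof (rule index_symmetric_slotI)
    show "index_symmetric (slot i K)" for i using assms(1) by (simp add: Sym_iff)
  qed (rule assms(3))
  ultimately show ?thesis by (simp add: Sym_iff)
qed

lemma Sym_derivation_ext: "K \<in> Sym k \<Longrightarrow> derivation_ext B K \<in> Sym k"
proof (induction k arbitrary: K)
  case 0
  have "derivation_ext B K l = 0" for l
  proof (cases l)
    case (Cons i l')
    have "derivation_ext B (slot i K) l' = 0" using Sym_slot_0[OF 0] by (simp add: derivation_ext_zero)
    then show ?thesis using Cons SymD(2)[OF 0] by (simp add: derivation_ext_Cons)
  qed (simp add: derivation_ext_Nil)
  then show ?case using Sym_zero by (metis (full_types) ext)
next
  case (Suc k)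
  show ?case
  proof (rule Sym_SucI)
    show "slot i (derivation_ext B K) \<in> Sym k" for i
      unfolding derivation_ext_Cons
      by (intro Sym_add Sym_sum Sym_scale Sym_slot[OF Suc.prems] Suc.IH)
    show "derivation_ext B K (i # j # l) = derivation_ext B K (j # i # l)" for i j l
      using SymD(3)[OF Suc.prems] by (simp add: derivation_ext_Cons add_ac)
  qed (simp add: derivation_ext_Nil)
qed

section \<open>Multiplication, contraction and trace\<close>

lemma sym_mult_Nil: "sym_mult v K [] = 0"
  and sym_mult_Cons: "sym_mult v K (i # l) = v $ i *\<^sub>R K l + sym_mult v (slot i K) l"
  by (simp_all add: sym_mult_def sum.lessThan_Suc_shift del: sum.lessThan_Suc)

lemma sym_mult_add: "sym_mult v (\<lambda>l. K l + L l) l = sym_mult v K l + sym_mult v L l"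
  and sym_mult_scale: "sym_mult v (\<lambda>l. c *\<^sub>R K l) l = c *\<^sub>R sym_mult v K l"
  and sym_mult_zero: "sym_mult v (\<lambda>l. 0) l = 0"
  by (simp_all add: sym_mult_def scaleR_right_distrib sum.distrib scaleR_sum_right mult.commute)

lemma sym_mult_sum: "sym_mult v (\<lambda>l. \<Sum>i\<in>I. K i l) l = (\<Sum>i\<in>I. sym_mult v (K i) l)"
  by (induction I rule: infinite_finite_induct) (auto simp: sym_mult_zero sym_mult_add)

lemma sym_mult_sum_vector: "sym_mult (\<Sum>i\<in>I. c i *\<^sub>R u i) K l = (\<Sum>i\<in>I. c i *\<^sub>R sym_mult (u i) K l)"
  unfolding sym_mult_def scaleR_sum_right by (subst sum.swap) (simp add: scaleR_sum_left)

lemma sym_mult_basis: "sym_mult v K l = (\<Sum>i\<in>UNIV. v $ i *\<^sub>R sym_mult (std_basis i) K l)"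
  using sym_mult_sum_vector[where I = UNIV and c = "\<lambda>i. v $ i" and u = std_basis and K = K and l = l] basis_expansion[of v]
  by (simp add: scalar_mult_eq_scaleR)

lemma Sym_mult:
  fixes K :: "('n::finite, 'e::real_vector) tensor"
  assumes "K \<in> Sym k"
  shows "sym_mult v K \<in> Sym (Suc k)"
proof -
  from assms obtain N vs x where K: "K = (\<lambda>l. \<Sum>c<(N::nat). sym_prod (vs c) l *\<^sub>R x c)" "\<forall>c<N. length (vs c) = k"
    by (auto simp: Sym_def)
  have "sym_mult v (\<lambda>l. sym_prod w l *\<^sub>R x) l = sym_prod (v # w) l *\<^sub>R x" for w l and x :: 'e
    unfolding sym_mult_sym_prod[symmetric] by (simp add: sym_mult_def scaleR_sum_left)
  then have "sym_mult v K = (\<lambda>l. \<Sum>c<N. sym_prod (v # vs c) l *\<^sub>R x c)"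
    unfolding K(1) by (intro ext) (simp only: sym_mult_sum)
  then show ?thesis using K(2) unfolding Sym_def
    by (intro CollectI exI[of _ N] exI[of _ "\<lambda>c. v # vs c"] exI[of _ x]) auto
qed

text \<open>On symmetric tensors \<open>v \<lrcorner>\<close> is the contraction of \<open>v\<close> with the first index, see \<open>contract_Suc\<close>.\<close>
definition hook :: "real ^ 'n::finite \<Rightarrow> ('n, 'e::real_vector) tensor \<Rightarrow> ('n, 'e) tensor" where
  "hook v K l = (\<Sum>i\<in>UNIV. v $ i *\<^sub>R K (i # l))"

lemma hook_basis: "hook (std_basis i) K = slot i K"
proof
  fix l
  have "hook (std_basis i) K l = (\<Sum>j\<in>UNIV. if j = i then K (j # l) else 0)"
    unfolding hook_def by (intro sum.cong) (auto simp: axis_def)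
  then show "hook (std_basis i) K l = K (i # l)" by simp
qed

lemma Sym_hook: "K \<in> Sym (Suc k) \<Longrightarrow> hook v K \<in> Sym k"
  unfolding hook_def[abs_def] by (intro Sym_sum Sym_scale Sym_slot)

lemma full_inner_nondegenerate:
  assumes "K \<in> Sym k" "full_inner k K K = 0"
  shows "K = (\<lambda>l. 0)"
proof
  fix l
  show "K l = 0"
  proof (cases "length l = k")
    case True
    have "\<forall>l\<in>{l. length l = k}. K l \<bullet> K l = 0"
      using assms(2) unfolding full_inner_def by (subst (asm) sum_nonneg_eq_0_iff) (auto simp: finite_lists_of_length)
    then show ?thesis using True by simp
  qed (use SymD(2)[OF assms(1)] in simp)
qed

lemma sym_inner_full: "sym_inner k K L = full_inner k K L / fact k"
  by (simp add: sym_inner_def full_inner_def)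

text \<open>The factor \<open>v\<close> may stand at any of \<open>k + 1\<close> indices; by symmetry of \<open>K\<close> all positions contribute the
  same.\<close>
lemma full_inner_sym_mult:
  assumes "index_symmetric K"
  shows "full_inner (Suc k) (sym_mult v z) K = real (Suc k) * full_inner k z (hook v K)"
  using assms
proof (induction k arbitrary: z K)
  case 0
  show ?case
    by (simp add: full_inner_Suc full_inner_0 sym_mult_Cons sym_mult_Nil hook_def inner_sum_right)
next
  case (Suc k)
  have K: "index_symmetric (slot i K)" for i using Suc.prems by (rule index_symmetric_slot)
  have swap: "hook v (slot i K) = slot i (hook v K)" for i
    unfolding hook_def by (intro ext sum.cong refl arg_cong2[where f = "(*\<^sub>R)"] index_symmetricD[OF Suc.prems]) simp
  have "full_inner (Suc (Suc k)) (sym_mult v z) K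
     = (\<Sum>i\<in>UNIV. v $ i * full_inner (Suc k) z (slot i K)) + (\<Sum>i\<in>UNIV. real (Suc k) * full_inner k (slot i z) (slot i (hook v K)))"
    by (simp only: full_inner_Suc[of "Suc k"] sym_mult_Cons full_inner_add_left full_inner_scale_left Suc.IH[OF K] swap sum.distrib)
  also have "(\<Sum>i\<in>UNIV. v $ i * full_inner (Suc k) z (slot i K)) = full_inner (Suc k) z (hook v K)"
    unfolding hook_def[abs_def] by (simp only: full_inner_sum_right full_inner_scale_right)
  also have "(\<Sum>i\<in>UNIV. real (Suc k) * full_inner k (slot i z) (slot i (hook v K))) = real (Suc k) * full_inner (Suc k) z (hook v K)"
    by (simp only: full_inner_Suc[of k] sum_distrib_left)
  finally show ?case by (simp add: algebra_simps)
qed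

lemma sym_inner_sym_mult:
  "K \<in> Sym (Suc k) \<Longrightarrow> sym_inner (Suc k) (sym_mult v z) K = sym_inner k z (hook v K)"
  by (simp add: sym_inner_full full_inner_sym_mult Sym_iff fact_Suc del: of_nat_Suc)

lemma sym_inner_diff: "sym_inner k (\<lambda>l. K l - K' l) L = sym_inner k K L - sym_inner k K' L"
  and sym_inner_diff_right: "sym_inner k L (\<lambda>l. K l - K' l) = sym_inner k L K - sym_inner k L K'"
  and sym_inner_scale: "sym_inner k (\<lambda>l. c *\<^sub>R K l) L = c * sym_inner k K L"
  and sym_inner_sum: "sym_inner k (\<lambda>l. \<Sum>i\<in>I. F i l) L = (\<Sum>i\<in>I. sym_inner k (F i) L)"
  and sym_inner_commute: "sym_inner k K L = sym_inner k L K"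
  using full_inner_add_left[of k K "\<lambda>l. (-1) *\<^sub>R K' l" L] full_inner_scale_left[of k "-1" K' L]
    full_inner_add_right[of k L K "\<lambda>l. (-1) *\<^sub>R K' l"] full_inner_scale_right[of k L "-1" K']
  by (simp_all add: sym_inner_full full_inner_add_left full_inner_scale_left full_inner_sum_left full_inner_commute
      diff_divide_distrib sum_divide_distrib)

lemma sym_inner_self_zero: "K \<in> Sym k \<Longrightarrow> sym_inner k K K = 0 \<Longrightarrow> K = (\<lambda>l. 0)"
  by (rule full_inner_nondegenerate) (auto simp: sym_inner_full)

lemma contract_Suc:
  assumes K: "K \<in> Sym (Suc k)"
  shows "contract (Suc k) v K = hook v K"
  unfolding contract.simps adjoint_wrt_def
proof (rule the_equality)
  show "hook v K \<in> Sym k \<and> (\<forall>z\<in>Sym k. sym_inner (Suc k) (sym_mult v z) K = sym_inner k z (hook v K))"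
    using Sym_hook[OF K] sym_inner_sym_mult[OF K] by auto
  fix x assume x: "x \<in> Sym k \<and> (\<forall>z\<in>Sym k. sym_inner (Suc k) (sym_mult v z) K = sym_inner k z x)"
  let ?d = "\<lambda>l. x l - hook v K l"
  have d: "?d \<in> Sym k" using x Sym_hook[OF K] by (intro Sym_diff) auto
  have "sym_inner k ?d ?d = 0"
    using x d sym_inner_sym_mult[OF K, of v ?d] by (simp add: sym_inner_diff_right)
  from sym_inner_self_zero[OF d this] show "x = hook v K" by (auto simp: fun_eq_iff)
qed

lemma contract_basis: "K \<in> Sym k \<Longrightarrow> contract k (std_basis i) K = slot i K"
  by (cases k) (auto simp: contract_Suc hook_basis Sym_slot_0 simp del: contract.simps(2))

text \<open>On symmetric tensors this is \<open>\<Lambda>\<close>, on \<open>T \<otimes> Sym\<^sup>k\<^sub>0 T\<close> it is \<open>q\<^sub>2\<close>, and composed with \<open>grad\<close> it is the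
  divergence.\<close>
definition trc :: "('n::finite, 'e::real_vector) tensor \<Rightarrow> ('n, 'e) tensor" where
  "trc t l = (\<Sum>i\<in>UNIV. t (i # i # l))"

lemma sym_trace_eq: "K \<in> Sym k \<Longrightarrow> sym_trace k K = trc K"
proof
  fix l assume K: "K \<in> Sym k"
  have "contract (k - 1) (std_basis i) (slot i K) = slot i (slot i K)" for i
  proof (cases k)
    case 0
    then show ?thesis using K SymD(2)[OF K] by (auto simp: fun_eq_iff)
  next
    case (Suc m)
    then show ?thesis using K contract_basis[OF Sym_slot, of K m] by simp
  qed
  then show "sym_trace k K l = trc K l"
    using K by (simp add: sym_trace_def contract_basis trc_def)
qed

lemma Sym0_iff: "K \<in> Sym0 k \<longleftrightarrow> K \<in> Sym k \<and> (\<forall>l. trc K l = 0)"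
  by (auto simp: Sym0_def sym_trace_eq)

lemma Sym0D: "K \<in> Sym0 k \<Longrightarrow> K \<in> Sym k" "K \<in> Sym0 k \<Longrightarrow> trc K = (\<lambda>l. 0)"
  by (auto simp: Sym0_iff)

lemma trc_add: "trc (\<lambda>l. K l + L l) l = trc K l + trc L l"
  and trc_scale: "trc (\<lambda>l. c *\<^sub>R K l) l = c *\<^sub>R trc K l"
  and trc_diff: "trc (\<lambda>l. K l - L l) l = trc K l - trc L l"
  and trc_zero: "trc (\<lambda>l. 0) l = 0"
  by (simp_all add: trc_def sum.distrib scaleR_sum_right sum_subtractf)

lemma trc_sum: "trc (\<lambda>l. \<Sum>i\<in>I. K i l) l = (\<Sum>i\<in>I. trc (K i) l)"
  unfolding trc_def by (rule sum.swap)

lemma Sym0_zero: "(\<lambda>l. 0) \<in> Sym0 k"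
  and Sym0_add: "K \<in> Sym0 k \<Longrightarrow> L \<in> Sym0 k \<Longrightarrow> (\<lambda>l. K l + L l) \<in> Sym0 k"
  and Sym0_scale: "K \<in> Sym0 k \<Longrightarrow> (\<lambda>l. c *\<^sub>R K l) \<in> Sym0 k"
  and Sym0_diff: "K \<in> Sym0 k \<Longrightarrow> L \<in> Sym0 k \<Longrightarrow> (\<lambda>l. K l - L l) \<in> Sym0 k"
  by (auto simp: Sym0_iff trc_add trc_scale trc_diff trc_zero intro: Sym_zero Sym_add Sym_scale Sym_diff)

lemma Sym0_sum: "(\<And>i. i \<in> I \<Longrightarrow> K i \<in> Sym0 k) \<Longrightarrow> (\<lambda>l. \<Sum>i\<in>I. K i l) \<in> Sym0 k"
  by (induction I rule: infinite_finite_induct) (auto intro: Sym0_zero Sym0_add)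

lemma Sym0_slot: "K \<in> Sym0 (Suc k) \<Longrightarrow> slot i K \<in> Sym0 k"
proof -
  assume K: "K \<in> Sym0 (Suc k)"
  note s = SymD(1)[OF Sym0D(1)[OF K]]
  have "trc (slot i K) l = trc K (i # l)" for l
    unfolding trc_def by (intro sum.cong refl s) simp
  then show ?thesis using K by (auto simp: Sym0_iff intro: Sym_slot)
qed

lemma Sym0_hook: "K \<in> Sym0 (Suc k) \<Longrightarrow> hook v K \<in> Sym0 k"
  unfolding hook_def[abs_def] by (intro Sym0_sum Sym0_scale Sym0_slot)

text \<open>Multiplication by the tensor \<open>L\<close>.\<close>
definition Lop :: "('n::finite, 'e::real_vector) tensor \<Rightarrow> ('n, 'e) tensor" where
  "Lop K l = (\<Sum>i\<in>UNIV. sym_mult (std_basis i) (sym_mult (std_basis i) K) l)"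

lemma Sym_Lop: "K \<in> Sym k \<Longrightarrow> Lop K \<in> Sym (Suc (Suc k))"
  unfolding Lop_def[abs_def] by (intro Sym_sum Sym_mult)

lemma Lop_add: "Lop (\<lambda>l. K l + L l) l = Lop K l + Lop L l"
  and Lop_scale: "Lop (\<lambda>l. c *\<^sub>R K l) l = c *\<^sub>R Lop K l"
  and Lop_zero: "Lop (\<lambda>l. 0) l = 0"
  by (simp_all add: Lop_def sym_mult_add[abs_def] sym_mult_add sym_mult_scale[abs_def] sym_mult_scale sym_mult_zero[abs_def] sym_mult_zero
      sum.distrib scaleR_sum_right)

lemma Lop_sum: "Lop (\<lambda>l. \<Sum>i\<in>I. K i l) l = (\<Sum>i\<in>I. Lop (K i) l)"
  by (induction I rule: infinite_finite_induct) (auto simp: Lop_zero Lop_add)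

lemma sum_basis_scaleR:
  fixes F :: "'n::finite \<Rightarrow> 'e::real_vector"
  shows "(\<Sum>i\<in>UNIV. (std_basis i :: real^'n) $ j *\<^sub>R F i) = F j" "(\<Sum>i\<in>UNIV. (std_basis j :: real^'n) $ i *\<^sub>R F i) = F j"
proof -
  have "(\<Sum>i\<in>UNIV. (std_basis i :: real^'n) $ j *\<^sub>R F i) = (\<Sum>i\<in>UNIV. if i = j then F i else 0)"
    by (intro sum.cong) (auto simp: axis_def)
  then show "(\<Sum>i\<in>UNIV. (std_basis i :: real^'n) $ j *\<^sub>R F i) = F j" by simp
  have "(\<Sum>i\<in>UNIV. (std_basis j :: real^'n) $ i *\<^sub>R F i) = (\<Sum>i\<in>UNIV. if i = j then F i else 0)"
    by (intro sum.cong) (auto simp: axis_def)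
  then show "(\<Sum>i\<in>UNIV. (std_basis j :: real^'n) $ i *\<^sub>R F i) = F j" by simp
qed

lemma Lop_Cons:
  fixes K :: "('n::finite, 'e::real_vector) tensor"
  shows "Lop K (j # l) = 2 *\<^sub>R sym_mult (std_basis j) K l + Lop (slot j K) l"
proof -
  have "Lop K (j # l) = (\<Sum>i\<in>UNIV. (std_basis i :: real^'n) $ j *\<^sub>R sym_mult (std_basis i) K l)
     + (\<Sum>i\<in>UNIV. (std_basis i :: real^'n) $ j *\<^sub>R sym_mult (std_basis i) K l)
     + (\<Sum>i\<in>UNIV. sym_mult (std_basis i) (sym_mult (std_basis i) (slot j K)) l)"
    by (simp add: Lop_def sym_mult_Cons sym_mult_Cons[abs_def] sym_mult_add sym_mult_scale sum.distrib)
  then show ?thesis by (simp add: sum_basis_scaleR(1) Lop_def scaleR_2)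
qed

lemma trc_sym_mult: "trc (sym_mult v K) l = 2 *\<^sub>R hook v K l + sym_mult v (trc K) l"
proof -
  have "trc (sym_mult v K) l = hook v K l + hook v K l + sym_mult v (\<lambda>l. \<Sum>i\<in>UNIV. K (i # i # l)) l"
    by (simp add: trc_def sym_mult_Cons sum.distrib hook_def sym_mult_sum)
  then show ?thesis by (simp add: trc_def[abs_def] scaleR_2)
qed

text \<open>The symmetrization \<open>\<Sum>\<^sub>i e\<^sub>i \<otimes> t\<^sub>i \<mapsto> \<Sum>\<^sub>i e\<^sub>i \<cdot> t\<^sub>i\<close>. Under the identification of symmetric tensors with
  polynomials, it is on \<open>Sym\<^sup>k\<close> the Euler operator, with eigenvalue \<open>k\<close>.\<close>
definition euler :: "('n::finite, 'e::real_vector) tensor \<Rightarrow> ('n, 'e) tensor" where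
  "euler t l = (\<Sum>i\<in>UNIV. sym_mult (std_basis i) (slot i t) l)"

lemma euler_Sym:
  fixes K :: "('n::finite, 'e::real_vector) tensor"
  assumes "K \<in> Sym k"
  shows "euler K l = real k *\<^sub>R K l"
proof -
  have "euler K l = (\<Sum>r<length l. \<Sum>i\<in>UNIV. (std_basis i :: real^'n) $ (l ! r) *\<^sub>R K (i # take r l @ drop (Suc r) l))"
    unfolding euler_def sym_mult_def by (rule sum.swap)
  also have "\<dots> = (\<Sum>r<length l. K l)"
  proof (intro sum.cong refl)
    fix r assume "r \<in> {..<length l}"
    then have "mset (take r l @ l ! r # drop (Suc r) l) = mset l" by (simp add: id_take_nth_drop[symmetric])
    then have m: "mset (l ! r # take r l @ drop (Suc r) l) = mset l" by simp
    show "(\<Sum>i\<in>UNIV. (std_basis i :: real^'n) $ (l ! r) *\<^sub>R K (i # take r l @ drop (Suc r) l)) = K l"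
      unfolding sum_basis_scaleR(1) by (rule SymD(1)[OF assms m])
  qed
  also have "\<dots> = real (length l) *\<^sub>R K l" by (simp add: sum_constant_scaleR)
  also have "\<dots> = real k *\<^sub>R K l" using SymD(2)[OF assms] by (cases "length l = k") auto
  finally show ?thesis .
qed

lemma trc_Lop:
  fixes K :: "('n::finite, 'e::real_vector) tensor"
  shows "trc (Lop K) l = (2 * real CARD('n)) *\<^sub>R K l + 4 *\<^sub>R euler K l + Lop (trc K) l"
proof -
  have "trc (Lop K) l = (\<Sum>i\<in>UNIV. trc (sym_mult (std_basis i) (sym_mult (std_basis i) K)) l)"
    unfolding Lop_def[abs_def] by (rule trc_sum)
  also have "\<dots> = (\<Sum>i\<in>UNIV. 2 *\<^sub>R (K l + sym_mult (std_basis i) (slot i K) l)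
      + (2 *\<^sub>R sym_mult (std_basis i) (slot i K) l + sym_mult (std_basis i) (sym_mult (std_basis i) (trc K)) l))"
  proof (intro sum.cong refl)
    fix i :: 'n
    have "sym_mult (std_basis i) (trc (sym_mult (std_basis i) K)) l
      = 2 *\<^sub>R sym_mult (std_basis i) (slot i K) l + sym_mult (std_basis i) (sym_mult (std_basis i) (trc K)) l"
      by (simp add: trc_sym_mult[abs_def] sym_mult_add sym_mult_scale hook_basis)
    then show "trc (sym_mult (std_basis i) (sym_mult (std_basis i) K)) l = 2 *\<^sub>R (K l + sym_mult (std_basis i) (slot i K) l)
      + (2 *\<^sub>R sym_mult (std_basis i) (slot i K) l + sym_mult (std_basis i) (sym_mult (std_basis i) (trc K)) l)"
      by (simp add: trc_sym_mult hook_basis sym_mult_Cons)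
  qed
  also have "\<dots> = (2 * real CARD('n)) *\<^sub>R K l + 4 *\<^sub>R euler K l + Lop (trc K) l"
  proof -
    have "(\<Sum>i\<in>(UNIV::'n set). 2 *\<^sub>R K l) = (2 * real CARD('n)) *\<^sub>R K l"
      by (simp add: sum_constant_scaleR mult.commute)
    moreover have "2 *\<^sub>R x + 2 *\<^sub>R x = 4 *\<^sub>R x" for x :: 'e
      by (simp add: scaleR_left_distrib[symmetric])
    ultimately show ?thesis
      by (simp only: sum.distrib euler_def Lop_def scaleR_right_distrib scaleR_sum_right[symmetric] add.assoc[symmetric])
        (simp only: add.assoc)
  qed
  finally show ?thesis .
qed

lemma sym_inner_Lop:
  assumes "L \<in> Sym (Suc (Suc k))"
  shows "sym_inner (Suc (Suc k)) (Lop K) L = sym_inner k K (trc L)"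
proof -
  have "sym_inner (Suc (Suc k)) (Lop K) L = (\<Sum>i\<in>UNIV. sym_inner k K (slot i (slot i L)))"
    unfolding Lop_def[abs_def]
    by (simp add: sym_inner_sum sym_inner_sym_mult[OF assms] sym_inner_sym_mult[OF Sym_slot[OF assms]] hook_basis)
  also have "\<dots> = sym_inner k (trc L) K"
    unfolding trc_def[abs_def] by (simp add: sym_inner_sum sym_inner_commute)
  finally show ?thesis by (simp add: sym_inner_commute)
qed

subsection \<open>The trace-free part of a product\<close>

text \<open>The formula for the trace-free part of \<open>v \<cdot> K\<close> if \<open>K\<close> is trace-free.\<close>
definition tf_mult :: "nat \<Rightarrow> real ^ 'n::finite \<Rightarrow> ('n, 'e::real_vector) tensor \<Rightarrow> ('n, 'e) tensor" where
  "tf_mult k v K l = sym_mult v K l - (1 / (real CARD('n) + 2 * real k - 2)) *\<^sub>R Lop (hook v K) l"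

text \<open>The coefficient in \<open>tf_mult\<close> is determined by vanishing of the trace, because
  \<open>\<Lambda>(v \<cdot> K) = 2 v \<lrcorner> K\<close> and \<open>\<Lambda> L\<close> is the scalar \<open>2 (n + 2k - 2)\<close> on \<open>Sym\<^sup>k\<^sup>-\<^sup>1\<^sub>0\<close>. The correction is in the
  image of \<open>L\<close>, the adjoint of \<open>\<Lambda>\<close>, and thus orthogonal to all trace-free tensors.\<close>
lemma tf_mult_properties:
  fixes K :: "('n::finite, 'e::real_inner) tensor"
  assumes n: "CARD('n) \<ge> 3" and K: "K \<in> Sym0 k"
  shows "tf_mult k v K \<in> Sym0 (Suc k)"
    and "L \<in> Sym0 (Suc k) \<Longrightarrow> sym_inner (Suc k) (tf_mult k v K) L = sym_inner (Suc k) (sym_mult v K) L"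
proof -
  let ?c = "1 / (real CARD('n) + 2 * real k - 2)"
  have pos: "real CARD('n) + 2 * real k - 2 > 0" using n by linarith
  have "tf_mult k v K \<in> Sym0 (Suc k) \<and>
    (L \<in> Sym0 (Suc k) \<longrightarrow> sym_inner (Suc k) (tf_mult k v K) L = sym_inner (Suc k) (sym_mult v K) L)"
  proof (cases k)
    case 0
    have h: "hook v K = (\<lambda>l. 0)" using SymD(2)[OF Sym0D(1)[OF K]] 0 by (auto simp: hook_def fun_eq_iff)
    have t: "tf_mult k v K = sym_mult v K" by (auto simp: tf_mult_def h Lop_zero fun_eq_iff)
    have "trc (sym_mult v K) l = 0" for l by (simp add: trc_sym_mult h Sym0D(2)[OF K] sym_mult_zero)
    then show ?thesis using t Sym_mult[OF Sym0D(1)[OF K]] by (simp add: Sym0_iff)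
  next
    case (Suc m)
    have h: "hook v K \<in> Sym0 m" using Sym0_hook K Suc by blast
    have S: "tf_mult k v K \<in> Sym (Suc k)"
      unfolding tf_mult_def[abs_def] using Suc Sym_Lop[OF Sym0D(1)[OF h]]
      by (intro Sym_diff Sym_scale Sym_mult Sym0D(1)[OF K]) simp
    have "trc (tf_mult k v K) l = 0" for l
    proof -
      have "trc (tf_mult k v K) l = 2 *\<^sub>R hook v K l - ?c *\<^sub>R ((2 * real CARD('n)) *\<^sub>R hook v K l + 4 *\<^sub>R (real m *\<^sub>R hook v K l))"
        unfolding tf_mult_def[abs_def]
        by (simp add: trc_diff trc_scale trc_sym_mult trc_Lop euler_Sym[OF Sym0D(1)[OF h]] Sym0D(2)[OF K] Sym0D(2)[OF h]
            sym_mult_zero Lop_zero)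
      also have "\<dots> = (2 - ?c * (2 * real CARD('n) + 4 * real m)) *\<^sub>R hook v K l"
        by (simp add: scaleR_left_diff_distrib scaleR_left_distrib scaleR_right_distrib distrib_left add_divide_distrib)
      also have "2 - ?c * (2 * real CARD('n) + 4 * real m) = 0" using pos Suc by (simp add: field_simps)
      finally show ?thesis by simp
    qed
    moreover have "sym_inner (Suc k) (tf_mult k v K) L = sym_inner (Suc k) (sym_mult v K) L" if L: "L \<in> Sym0 (Suc k)"
    proof -
      have "sym_inner (Suc k) (Lop (hook v K)) L = 0"
        using sym_inner_Lop[of L m "hook v K"] L Suc by (simp add: Sym0D) (simp add: sym_inner_def)
      then show ?thesis unfolding tf_mult_def[abs_def] by (simp add: sym_inner_diff sym_inner_scale)
    qed
    ultimately show ?thesis using S by (simp add: Sym0_iff)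
  qed
  then show "tf_mult k v K \<in> Sym0 (Suc k)"
    and "L \<in> Sym0 (Suc k) \<Longrightarrow> sym_inner (Suc k) (tf_mult k v K) L = sym_inner (Suc k) (sym_mult v K) L"
    by auto
qed

lemma tracefree_sym_mult:
  fixes K :: "('n::finite, 'e::real_inner) tensor"
  assumes n: "CARD('n) \<ge> 3" and K: "K \<in> Sym0 k"
  shows "tracefree (Suc k) (sym_mult v K) = tf_mult k v K"
  unfolding tracefree_def
proof (rule the_equality)
  note p = tf_mult_properties[OF n K, where v = v]
  show "tf_mult k v K \<in> Sym0 (Suc k) \<and> (\<forall>L\<in>Sym0 (Suc k). sym_inner (Suc k) (\<lambda>l. sym_mult v K l - tf_mult k v K l) L = 0)"
    using p by (simp add: sym_inner_diff)
  fix K0 assume K0: "K0 \<in> Sym0 (Suc k) \<and> (\<forall>L\<in>Sym0 (Suc k). sym_inner (Suc k) (\<lambda>l. sym_mult v K l - K0 l) L = 0)"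
  let ?d = "\<lambda>l. K0 l - tf_mult k v K l"
  have d: "?d \<in> Sym0 (Suc k)" using K0 p by (intro Sym0_diff) auto
  have "sym_inner (Suc k) ?d ?d = 0" using K0 p(2)[OF d] d by (simp add: sym_inner_diff)
  from sym_inner_self_zero[OF Sym0D(1)[OF d] this] show "K0 = tf_mult k v K" by (auto simp: fun_eq_iff)
qed

section \<open>The projections on \<open>T \<otimes> Sym\<^sup>k\<^sub>0 T\<close>\<close>

text \<open>The map \<open>q\<^sub>1\<close> in closed form, linear on all tensors and built from parallel operations.\<close>
definition Q1 :: "nat \<Rightarrow> ('n::finite, 'e::real_vector) tensor \<Rightarrow> ('n, 'e) tensor" where
  "Q1 k t l = euler t l - (1 / (real CARD('n) + 2 * real k - 2)) *\<^sub>R Lop (trc t) l"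

text \<open>The map \<open>u \<mapsto> \<Sum>\<^sub>i e\<^sub>i \<otimes> (e\<^sub>i \<cdot> u)\<^sub>0\<close>, which is on \<open>Sym\<^sup>m\<^sub>0 T\<close> the adjoint of \<open>q\<^sub>2\<close>.\<close>
definition Q2_adj :: "nat \<Rightarrow> ('n::finite, 'e::real_vector) tensor \<Rightarrow> ('n, 'e) tensor" where
  "Q2_adj m u l = (case l of [] \<Rightarrow> 0 | i # l' \<Rightarrow> tf_mult m (std_basis i) u l')"

lemma Q2_adj_simps: "Q2_adj m u [] = 0" "Q2_adj m u (i # l) = tf_mult m (std_basis i) u l"
  by (simp_all add: Q2_adj_def)

lemma sym_mult_diff: "sym_mult v (\<lambda>l. K l - L l) l = sym_mult v K l - sym_mult v L l"
  using sym_mult_add[of v K "\<lambda>l. (-1) *\<^sub>R L l" l] sym_mult_scale[of v "-1" L l] by simp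

lemma Lop_diff: "Lop (\<lambda>l. K l - L l) l = Lop K l - Lop L l"
  using Lop_add[of K "\<lambda>l. (-1) *\<^sub>R L l" l] Lop_scale[of "-1" L l] by simp

lemma tf_mult_slot: "tf_mult k (std_basis i) K l
    = sym_mult (std_basis i) K l - (1 / (real CARD('n) + 2 * real k - 2)) *\<^sub>R Lop (slot i K) l"
  for K :: "('n::finite, 'e::real_vector) tensor"
  by (simp add: tf_mult_def hook_basis)

lemma Q1_tf_mult: "Q1 k t l = (\<Sum>i\<in>UNIV. tf_mult k (std_basis i) (slot i t) l)"
  by (simp add: Q1_def tf_mult_slot euler_def trc_def[abs_def] Lop_sum sum_subtractf scaleR_sum_right)

lemma T_Sym0D: "t \<in> T_Sym0 k \<Longrightarrow> slot i t \<in> Sym0 k" "t \<in> T_Sym0 k \<Longrightarrow> t [] = 0"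
  by (auto simp: T_Sym0_def)

lemma T_Sym0_scale: "t \<in> T_Sym0 k \<Longrightarrow> (\<lambda>l. c *\<^sub>R t l) \<in> T_Sym0 k"
  and T_Sym0_diff: "t \<in> T_Sym0 k \<Longrightarrow> t' \<in> T_Sym0 k \<Longrightarrow> (\<lambda>l. t l - t' l) \<in> T_Sym0 k"
  by (auto simp: T_Sym0_def intro: Sym0_scale Sym0_diff)

lemma Sym0_T_Sym0: "u \<in> Sym0 (Suc k) \<Longrightarrow> u \<in> T_Sym0 k"
  using SymD(2)[OF Sym0D(1), of u "Suc k" "[]"] by (simp add: T_Sym0_def Sym0_slot)

lemma trc_T_Sym0: "t \<in> T_Sym0 (Suc m) \<Longrightarrow> trc t \<in> Sym0 m"
  unfolding trc_def[abs_def] by (intro Sym0_sum) (rule Sym0_slot, rule T_Sym0D(1))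

lemma T_Sym_inner_commute: "T_Sym_inner k s t = T_Sym_inner k t s"
  by (simp add: T_Sym_inner_def sym_inner_commute)

lemma T_Sym_inner_diff: "T_Sym_inner k (\<lambda>l. s l - s' l) t = T_Sym_inner k s t - T_Sym_inner k s' t"
  by (simp add: T_Sym_inner_def sym_inner_diff sum_subtractf)

lemma T_Sym_inner_scale: "T_Sym_inner k (\<lambda>l. c *\<^sub>R s l) t = c * T_Sym_inner k s t"
  by (simp add: T_Sym_inner_def sym_inner_scale sum_distrib_left)

lemma T_Sym_inner_self_zero:
  assumes "t \<in> T_Sym0 k" "T_Sym_inner k t t = 0"
  shows "t = (\<lambda>l. 0)"
proof
  fix l
  have nn: "sym_inner k K K \<ge> 0" for K :: "('a, 'b) tensor"
    by (simp add: sym_inner_def sum_nonneg)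
  have "sym_inner k (slot i t) (slot i t) = 0" for i
    using assms(2) nn unfolding T_Sym_inner_def by (subst (asm) sum_nonneg_eq_0_iff) auto
  then have "slot i t = (\<lambda>l. 0)" for i
    using sym_inner_self_zero[OF Sym0D(1)[OF T_Sym0D(1)[OF assms(1)]]] by blast
  then show "t l = 0" using T_Sym0D(2)[OF assms(1)] by (cases l) (auto simp: fun_eq_iff)
qed

text \<open>The adjoint is unique as the scalar product is definite.\<close>
lemma adjoint_wrt_T_Sym0:
  assumes "x \<in> T_Sym0 k" "\<And>z. z \<in> T_Sym0 k \<Longrightarrow> ip' (F z) y = T_Sym_inner k z x"
  shows "adjoint_wrt (T_Sym0 k) (T_Sym0 k) (T_Sym_inner k) ip' F y = x"
  unfolding adjoint_wrt_def
proof (rule the_equality)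
  fix x' assume x': "x' \<in> T_Sym0 k \<and> (\<forall>z\<in>T_Sym0 k. ip' (F z) y = T_Sym_inner k z x')"
  let ?d = "\<lambda>l. x' l - x l"
  have d: "?d \<in> T_Sym0 k" using x' assms(1) by (intro T_Sym0_diff) auto
  have "T_Sym_inner k ?d ?d = T_Sym_inner k x' ?d - T_Sym_inner k x ?d" by (rule T_Sym_inner_diff)
  also have "\<dots> = T_Sym_inner k ?d x' - T_Sym_inner k ?d x"
    by (simp only: T_Sym_inner_commute[of k x' ?d] T_Sym_inner_commute[of k x ?d])
  also have "\<dots> = 0" using bspec[OF conjunct2[OF x'] d] assms(2)[OF d] by linarith
  finally have "T_Sym_inner k ?d ?d = 0" .
  from T_Sym_inner_self_zero[OF d this] show "x' = x" by (auto simp: fun_eq_iff)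
qed (use assms in auto)

text \<open>The projection \<open>p\<^sub>3\<close> for \<open>k = m + 1\<close>, where \<open>n + 2k - 4 = n + 2m - 2\<close> and so on.\<close>
definition P3_proj :: "nat \<Rightarrow> ('n::finite, 'e::real_vector) tensor \<Rightarrow> ('n, 'e) tensor" where
  "P3_proj m t l = t l - (1 / (real m + 2)) *\<^sub>R Q1 (Suc m) t l
    - ((real CARD('n) + 2 * real m - 2) / ((real CARD('n) + 2 * real m) * (real CARD('n) + real m - 2)))
      *\<^sub>R Q2_adj m (trc t) l"

text \<open>The statements in this context are fibrewise; \<open>n \<ge> 3\<close> keeps all denominators positive.\<close>
context
  assumes n: "CARD('n::finite) \<ge> 3"
begin

lemma Sym0_Q1:
  fixes t :: "('n, 'e::real_inner) tensor"
  assumes "t \<in> T_Sym0 k" shows "Q1 k t \<in> Sym0 (Suc k)"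
  unfolding Q1_tf_mult by (intro Sym0_sum tf_mult_properties(1)[OF n] T_Sym0D[OF assms])

lemma q1_eq: "q1 k t = Q1 k t" if "t \<in> T_Sym0 k" for t :: "('n, 'e::real_inner) tensor"
  by (auto simp: q1_def Q1_tf_mult tracefree_sym_mult[OF n T_Sym0D(1)[OF that]])

lemma q2_eq: "q2 k t = trc t" if "t \<in> T_Sym0 k" for t :: "('n, 'e::real_inner) tensor"
  by (auto simp: q2_def trc_def contract_basis[OF Sym0D(1)[OF T_Sym0D(1)[OF that]]])

text \<open>Taking the trace-free part is an orthogonal projection, and \<open>e\<^sub>i \<lrcorner>\<close> is adjoint to \<open>e\<^sub>i \<cdot>\<close>; hence \<open>q\<^sub>1\<^sup>*\<close>
  is the inclusion of \<open>Sym\<^sup>k\<^sup>+\<^sup>1\<^sub>0 T\<close> into \<open>T \<otimes> Sym\<^sup>k\<^sub>0 T\<close>.\<close>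
lemma Q1_adjoint:
  fixes t u :: "('n, 'e::real_inner) tensor"
  assumes t: "t \<in> T_Sym0 k" and u: "u \<in> Sym0 (Suc k)"
  shows "sym_inner (Suc k) (Q1 k t) u = T_Sym_inner k t u"
proof -
  have "sym_inner (Suc k) (Q1 k t) u = (\<Sum>i\<in>UNIV. sym_inner (Suc k) (sym_mult (std_basis i) (slot i t)) u)"
    unfolding Q1_tf_mult by (simp add: sym_inner_sum tf_mult_properties(2)[OF n T_Sym0D(1)[OF t] u])
  then show ?thesis by (simp add: T_Sym_inner_def sym_inner_sym_mult[OF Sym0D(1)[OF u]] hook_basis)
qed

lemma T_Sym0_Q2_adj: "u \<in> Sym0 m \<Longrightarrow> Q2_adj m u \<in> T_Sym0 (Suc m)" for u :: "('n, 'e::real_inner) tensor"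
  by (simp add: T_Sym0_def Q2_adj_simps tf_mult_properties(1)[OF n])

lemma Q2_adjoint:
  fixes t u :: "('n, 'e::real_inner) tensor"
  assumes t: "t \<in> T_Sym0 (Suc m)" and u: "u \<in> Sym0 m"
  shows "sym_inner m (trc t) u = T_Sym_inner (Suc m) t (Q2_adj m u)"
proof -
  have "T_Sym_inner (Suc m) t (Q2_adj m u) = (\<Sum>i\<in>UNIV. sym_inner (Suc m) (tf_mult m (std_basis i) u) (slot i t))"
    by (simp add: T_Sym_inner_def Q2_adj_simps sym_inner_commute)
  also have "\<dots> = (\<Sum>i\<in>UNIV. sym_inner m u (slot i (slot i t)))"
    by (simp add: tf_mult_properties(2)[OF n u T_Sym0D(1)[OF t]] sym_inner_sym_mult[OF Sym0D(1)[OF T_Sym0D(1)[OF t]]] hook_basis)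
  finally show ?thesis
    unfolding trc_def[abs_def] by (simp add: sym_inner_sum sym_inner_commute)
qed

lemma p3_eq:
  fixes t :: "('n, 'e::real_inner) tensor"
  assumes t: "t \<in> T_Sym0 (Suc m)"
  shows "p3 (Suc m) t = P3_proj m t"
proof -
  have "adjoint_wrt (T_Sym0 (Suc m)) (T_Sym0 (Suc m)) (T_Sym_inner (Suc m)) (sym_inner (Suc (Suc m))) (q1 (Suc m)) (q1 (Suc m) t) = Q1 (Suc m) t"
    using Q1_adjoint[OF _ Sym0_Q1[OF t]]
    by (intro adjoint_wrt_T_Sym0) (simp_all add: q1_eq t Sym0_T_Sym0[OF Sym0_Q1])
  moreover have "adjoint_wrt (T_Sym0 (Suc m)) (T_Sym0 (Suc m)) (T_Sym_inner (Suc m)) (sym_inner m) (q2 (Suc m)) (q2 (Suc m) t) = Q2_adj m (trc t)"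
    using Q2_adjoint[OF _ trc_T_Sym0[OF t]]
    by (intro adjoint_wrt_T_Sym0) (simp_all add: q2_eq t T_Sym0_Q2_adj[OF trc_T_Sym0])
  ultimately show ?thesis
    by (auto simp: p3_def p1_def p2_def P3_proj_def Let_def fun_eq_iff algebra_simps)
qed

lemma Q1_diff: "Q1 k (\<lambda>l. s l - t l) l = Q1 k s l - Q1 k t l"
  and Q1_scale: "Q1 k (\<lambda>l. c *\<^sub>R t l) l = c *\<^sub>R Q1 k t l"
  for s t :: "('n, 'e::real_vector) tensor"
proof -
  show "Q1 k (\<lambda>l. s l - t l) l = Q1 k s l - Q1 k t l"
    by (simp add: Q1_def euler_def sym_mult_diff sum_subtractf trc_diff[abs_def] Lop_diff scaleR_right_diff_distrib)
  show "Q1 k (\<lambda>l. c *\<^sub>R t l) l = c *\<^sub>R Q1 k t l"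
    by (simp add: Q1_def euler_def sym_mult_scale trc_scale[abs_def] Lop_scale scaleR_right_diff_distrib scaleR_sum_right mult.commute)
qed

lemma Q1_Sym0: "u \<in> Sym0 (Suc k) \<Longrightarrow> Q1 k u l = (real k + 1) *\<^sub>R u l" for u :: "('n, 'e::real_inner) tensor"
  by (simp add: Q1_def euler_Sym[OF Sym0D(1)] Sym0D(2) Lop_zero add.commute)

lemma euler_Q2_adj: "euler (Q2_adj m u) l = Lop u l
    - (1 / (real CARD('n) + 2 * real m - 2)) *\<^sub>R (real m *\<^sub>R Lop u l)"
  if "u \<in> Sym0 m" for u :: "('n, 'e::real_inner) tensor"
proof -
  have c: "sym_mult w (Lop K) l = Lop (sym_mult w K) l" for w :: "real^'n" and K :: "('n, 'e) tensor" and l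
  proof -
    have comm: "sym_mult v (sym_mult w K) l = sym_mult w (sym_mult v K) l" for v w :: "real^'n" and K :: "('n, 'e) tensor" and l
    proof (induction l arbitrary: K)
      case (Cons i l)
      show ?case by (simp add: sym_mult_Cons sym_mult_Cons[abs_def] sym_mult_add sym_mult_scale Cons.IH add_ac)
    qed (simp add: sym_mult_Nil)
    have "sym_mult w (sym_mult v (sym_mult v K)) l = sym_mult v (sym_mult v (sym_mult w K)) l" for v
    proof -
      have "sym_mult w (sym_mult v K) = sym_mult v (sym_mult w K)" by (rule ext) (rule comm)
      then show ?thesis using comm[of w v "sym_mult v K" l] by simp
    qed
    then show ?thesis unfolding Lop_def[abs_def] by (simp only: sym_mult_sum)
  qed
  have "euler (Q2_adj m u) l = Lop u l - (1 / (real CARD('n) + 2 * real m - 2)) *\<^sub>R (\<Sum>i\<in>UNIV. sym_mult (std_basis i) (Lop (slot i u)) l)"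
  proof -
    have "sym_mult (std_basis i) (slot i (Q2_adj m u)) l = sym_mult (std_basis i) (sym_mult (std_basis i) u) l
        - (1 / (real CARD('n) + 2 * real m - 2)) *\<^sub>R sym_mult (std_basis i) (Lop (slot i u)) l" for i
      by (simp add: Q2_adj_simps tf_mult_slot sym_mult_scale sym_mult_diff)
    then show ?thesis by (simp add: euler_def Lop_def sum_subtractf scaleR_sum_right)
  qed
  also have "(\<Sum>i\<in>UNIV. sym_mult (std_basis i) (Lop (slot i u)) l) = Lop (euler u) l"
    by (simp add: c euler_def[abs_def] Lop_sum)
  also have "\<dots> = real m *\<^sub>R Lop u l"
    by (simp add: euler_Sym[OF Sym0D(1)[OF that], abs_def] Lop_scale)
  finally show ?thesis .
qed

text \<open>The operator \<open>q\<^sub>2 q\<^sub>2\<^sup>*\<close> is a scalar, the inverse of the coefficient in \<open>p\<^sub>2\<close>; hence \<open>p\<^sub>2\<close> is a projection.\<close>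
lemma trc_Q2_adj: "trc (Q2_adj m u) l
    = ((real CARD('n) + 2 * real m) * (real CARD('n) + real m - 2) / (real CARD('n) + 2 * real m - 2)) *\<^sub>R u l"
  if u: "u \<in> Sym0 m" for u :: "('n, 'e::real_inner) tensor"
proof -
  let ?N = "real CARD('n)"
  let ?c = "1 / (?N + 2 * real m - 2)"
  have pos: "?N + 2 * real m - 2 > 0" using n by linarith
  have "trc (Q2_adj m u) l = (\<Sum>i\<in>UNIV. u l + sym_mult (std_basis i) (slot i u) l - ?c *\<^sub>R (2 *\<^sub>R sym_mult (std_basis i) (slot i u) l + Lop (slot i (slot i u)) l))"
    unfolding trc_def by (intro sum.cong refl) (simp add: Q2_adj_simps tf_mult_slot sym_mult_Cons Lop_Cons)
  also have "\<dots> = ?N *\<^sub>R u l + euler u l - ?c *\<^sub>R (2 *\<^sub>R euler u l + Lop (trc u) l)"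
    by (simp only: sum_subtractf sum.distrib scaleR_sum_right[symmetric] euler_def Lop_sum[symmetric] trc_def[abs_def] sum_constant_scaleR)
  also have "\<dots> = (?N + real m - ?c * (2 * real m)) *\<^sub>R u l"
    by (simp add: euler_Sym[OF Sym0D(1)[OF u]] Sym0D(2)[OF u] Lop_zero scaleR_left_distrib scaleR_left_diff_distrib)
  also have "?N + real m - ?c * (2 * real m) = (?N + 2 * real m) * (?N + real m - 2) / (?N + 2 * real m - 2)"
    using pos by (simp add: field_simps)
  finally show ?thesis .
qed

text \<open>The images of \<open>q\<^sub>1\<^sup>*\<close> and \<open>q\<^sub>2\<^sup>*\<close> are orthogonal.\<close>
lemma Q1_Q2_adj: "Q1 (Suc m) (Q2_adj m u) l = 0"
  if u: "u \<in> Sym0 m" for u :: "('n, 'e::real_inner) tensor"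
proof -
  let ?N = "real CARD('n)"
  have pos: "?N + 2 * real m - 2 > 0" "?N + 2 * real m > 0" using n by linarith+
  have "trc (Q2_adj m u) = (\<lambda>l. ((?N + 2 * real m) * (?N + real m - 2) / (?N + 2 * real m - 2)) *\<^sub>R u l)"
    by (rule ext) (rule trc_Q2_adj[OF u])
  then have "Q1 (Suc m) (Q2_adj m u) l = (1 - 1 / (?N + 2 * real m - 2) * real m
      - 1 / (?N + 2 * real m) * ((?N + 2 * real m) * (?N + real m - 2) / (?N + 2 * real m - 2))) *\<^sub>R Lop u l"
    by (simp add: Q1_def euler_Q2_adj[OF u] Lop_scale scaleR_left_diff_distrib)
  also have "1 - 1 / (?N + 2 * real m - 2) * real m
      - 1 / (?N + 2 * real m) * ((?N + 2 * real m) * (?N + real m - 2) / (?N + 2 * real m - 2)) = 0"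
  proof -
    have "1 / (?N + 2 * real m) * ((?N + 2 * real m) * (?N + real m - 2) / (?N + 2 * real m - 2)) = (?N + real m - 2) / (?N + 2 * real m - 2)"
      using pos(2) by simp
    moreover have "1 - 1 / (?N + 2 * real m - 2) * real m - (?N + real m - 2) / (?N + 2 * real m - 2) = 0"
      using pos(1) by (simp add: field_simps)
    ultimately show ?thesis by (simp only:)
  qed
  finally show ?thesis by simp
qed

lemma T_Sym0_P3_proj: "t \<in> T_Sym0 (Suc m) \<Longrightarrow> P3_proj m t \<in> T_Sym0 (Suc m)" for t :: "('n, 'e::real_inner) tensor"
  unfolding P3_proj_def[abs_def]
  by (intro T_Sym0_diff T_Sym0_scale) (simp_all add: Sym0_T_Sym0[OF Sym0_Q1] T_Sym0_Q2_adj trc_T_Sym0)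

lemma Q1_P3_proj: "t \<in> T_Sym0 (Suc m) \<Longrightarrow> Q1 (Suc m) (P3_proj m t) l = 0"
  and trc_P3_proj: "t \<in> T_Sym0 (Suc m) \<Longrightarrow> trc (P3_proj m t) l = 0"
  for t :: "('n, 'e::real_inner) tensor"
proof -
  assume t: "t \<in> T_Sym0 (Suc m)"
  let ?N = "real CARD('n)"
  have pos: "?N + 2 * real m - 2 > 0" "?N + 2 * real m > 0" "?N + real m - 2 > 0" using n by linarith+
  show "Q1 (Suc m) (P3_proj m t) l = 0"
    unfolding P3_proj_def[abs_def]
  proof -
    have c: "(1 / (real m + 2)) * (real (Suc m) + 1) = 1" by (simp add: field_simps)
    show "Q1 (Suc m) (\<lambda>l. t l - (1 / (real m + 2)) *\<^sub>R Q1 (Suc m) t l - ((?N + 2 * real m - 2) / ((?N + 2 * real m) * (?N + real m - 2))) *\<^sub>R Q2_adj m (trc t) l) l = 0"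
      by (simp only: Q1_diff Q1_scale Q1_Sym0[OF Sym0_Q1[OF t]] Q1_Q2_adj[OF trc_T_Sym0[OF t]] scaleR_scaleR c) simp
  qed
  show "trc (P3_proj m t) l = 0"
    unfolding P3_proj_def[abs_def] using pos
    by (simp add: trc_diff trc_scale trc_Q2_adj[OF trc_T_Sym0[OF t]] Sym0D(2)[OF Sym0_Q1[OF t]])
qed

text \<open>The difference of \<open>z\<close> and its projection lies in the images of \<open>q\<^sub>1\<^sup>*\<close> and \<open>q\<^sub>2\<^sup>*\<close>, and \<open>q\<^sub>1\<close> and \<open>q\<^sub>2\<close> vanish on
  the projection of \<open>t\<close>.\<close>
lemma P3_proj_adjoint:
  fixes t z :: "('n, 'e::real_inner) tensor"
  assumes t: "t \<in> T_Sym0 (Suc m)" and z: "z \<in> T_Sym0 (Suc m)"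
  shows "T_Sym_inner (Suc m) (P3_proj m z) (P3_proj m t) = T_Sym_inner (Suc m) z (P3_proj m t)"
proof -
  let ?y = "P3_proj m t"
  note y = T_Sym0_P3_proj[OF t]
  have "T_Sym_inner (Suc m) (Q1 (Suc m) z) ?y = 0"
    using Q1_adjoint[OF y Sym0_Q1[OF z]] Q1_P3_proj[OF t] by (simp add: T_Sym_inner_commute sym_inner_def)
  moreover have "T_Sym_inner (Suc m) (Q2_adj m (trc z)) ?y = 0"
    using Q2_adjoint[OF y trc_T_Sym0[OF z]] trc_P3_proj[OF t] by (simp add: T_Sym_inner_commute sym_inner_def)
  ultimately show ?thesis
    unfolding P3_proj_def[of m z, abs_def] by (simp add: T_Sym_inner_diff T_Sym_inner_scale)
qed

subsection \<open>The algebraic identity\<close>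

text \<open>Here \<open>H\<close> stands for the second covariant derivative of a section, \<open>H\<^sub>i\<^sub>j = slot j (slot i H)\<close>, and the
  three sums on the right are \<open>- D\<^sub>0\<^sup>* D\<^sub>0\<close>, \<open>- D\<^sub>0 D\<^sub>0\<^sup>*\<close> and \<open>- P\<^sub>3\<^sup>* P\<^sub>3\<close>. All terms are combinations of
  the four invariants \<open>D = \<Sum>\<^sub>i H\<^sub>i\<^sub>i\<close>, \<open>X = \<Sum>\<^sub>i\<^sub>j e\<^sub>j \<cdot> (e\<^sub>i \<lrcorner> H\<^sub>i\<^sub>j)\<close>, \<open>Y = \<Sum>\<^sub>i\<^sub>j e\<^sub>i \<cdot> (e\<^sub>j \<lrcorner> H\<^sub>i\<^sub>j)\<close> and
  \<open>Z = \<Sum>\<^sub>i\<^sub>j L(e\<^sub>i \<lrcorner> e\<^sub>j \<lrcorner> H\<^sub>i\<^sub>j)\<close>, and the left-hand side is \<open>X - Y\<close>.\<close>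
lemma weitzenboeck_algebra:
  fixes H :: "('n, 'e::real_inner) tensor"
  assumes H: "\<And>i j. slot j (slot i H) \<in> Sym0 (Suc m)" and k: "k = Suc m"
  shows "(\<Sum>i\<in>UNIV. \<Sum>j\<in>UNIV. wedge_act k (std_basis i) (std_basis j) (slot j (slot i H)) l)
    = (real k / (real k + 1)) *\<^sub>R (\<Sum>i\<in>UNIV. Q1 k (slot i H) (i # l))
      - ((real CARD('n) + real k - 2) * (real CARD('n) + 2 * real k - 4) / ((real CARD('n) + 2 * real k - 2) * (real CARD('n) + real k - 3)))
        *\<^sub>R (\<Sum>i\<in>UNIV. tf_mult m (std_basis i) (trc (slot i H)) l)
      - (\<Sum>i\<in>UNIV. P3_proj m (slot i H) (i # l))"
proof -
  let ?N = "real CARD('n)"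
  let ?c = "1 / (?N + 2 * real m)" and ?c' = "1 / (?N + 2 * real m - 2)"
  let ?a = "(?N + 2 * real m - 2) / ((?N + 2 * real m) * (?N + real m - 2))"
  define X where "X = (\<Sum>i\<in>UNIV. \<Sum>j\<in>UNIV. sym_mult (std_basis j) (slot i (slot j (slot i H))) l)"
  define Y where "Y = (\<Sum>i\<in>UNIV. sym_mult (std_basis i) (trc (slot i H)) l)"
  define Z where "Z = (\<Sum>i\<in>UNIV. Lop (slot i (trc (slot i H))) l)"
  define D where "D = (\<Sum>i\<in>UNIV. H (i # i # l))"
  have pos: "?N + 2 * real m - 2 > 0" "?N + 2 * real m > 0" "?N + real m - 2 > 0" using n by linarith+
  have Q: "(\<Sum>i\<in>UNIV. Q1 k (slot i H) (i # l)) = D + X - ?c *\<^sub>R (2 *\<^sub>R Y + Z)"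
  proof -
    have "Q1 k (slot i H) (i # l) = H (i # i # l) + (\<Sum>j\<in>UNIV. sym_mult (std_basis j) (slot i (slot j (slot i H))) l)
      - ?c *\<^sub>R (2 *\<^sub>R sym_mult (std_basis i) (trc (slot i H)) l + Lop (slot i (trc (slot i H))) l)" for i
      by (simp add: Q1_def euler_def sym_mult_Cons sum.distrib sum_basis_scaleR(1) Lop_Cons k)
    then show ?thesis
      by (simp only: sum_subtractf sum.distrib scaleR_sum_right[symmetric] X_def Y_def Z_def D_def)
  qed
  have T: "(\<Sum>i\<in>UNIV. tf_mult m (std_basis i) (trc (slot i H)) l) = Y - ?c' *\<^sub>R Z"
    by (simp only: tf_mult_slot sum_subtractf scaleR_sum_right[symmetric] Y_def Z_def)
  have P: "(\<Sum>i\<in>UNIV. P3_proj m (slot i H) (i # l)) = D - (1 / (real m + 2)) *\<^sub>R (D + X - ?c *\<^sub>R (2 *\<^sub>R Y + Z)) - ?a *\<^sub>R (Y - ?c' *\<^sub>R Z)"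
    unfolding Q[symmetric] T[symmetric] P3_proj_def k
    by (simp only: sum_subtractf scaleR_sum_right[symmetric] D_def Q2_adj_simps)
  have W: "(\<Sum>i\<in>UNIV. \<Sum>j\<in>UNIV. wedge_act k (std_basis i) (std_basis j) (slot j (slot i H)) l) = X - Y"
  proof -
    have "wedge_act k (std_basis i) (std_basis j) (slot j (slot i H)) l
      = sym_mult (std_basis j) (slot i (slot j (slot i H))) l - sym_mult (std_basis i) (slot j (slot j (slot i H))) l" for i j
      unfolding k by (simp only: wedge_act_def contract_basis[OF Sym0D(1)[OF H]])
    then show ?thesis
      by (simp only: sum_subtractf X_def Y_def trc_def[abs_def] sym_mult_sum)
  qed
  have c1: "1 - 1 / (real m + 2) = real k / (real k + 1)" using k by (simp add: field_simps)
  \<comment> \<open>The first summand is the coefficient of \<open>p\<^sub>2\<close> and cancels against \<open>P\<^sub>3\<^sup>* P\<^sub>3\<close>; the second completes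
    the \<open>- 2 ?c Y\<close> that comes from \<open>D\<^sub>0\<^sup>* D\<^sub>0\<close> to \<open>- Y\<close> and cancels \<open>Z\<close>.\<close>
  have c2: "(?N + real k - 2) * (?N + 2 * real k - 4) / ((?N + 2 * real k - 2) * (?N + real k - 3)) = ?a + (1 - 2 * ?c)"
    using pos k by (simp add: divide_simps) (simp add: algebra_simps)
  have c3: "(1 - 2 * ?c) * ?c' = ?c" using pos by (simp add: divide_simps)
  have "(real k / (real k + 1)) *\<^sub>R (D + X - ?c *\<^sub>R (2 *\<^sub>R Y + Z)) - (?a + (1 - 2 * ?c)) *\<^sub>R (Y - ?c' *\<^sub>R Z)
      - (D - (1 / (real m + 2)) *\<^sub>R (D + X - ?c *\<^sub>R (2 *\<^sub>R Y + Z)) - ?a *\<^sub>R (Y - ?c' *\<^sub>R Z))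
    = (D + X - ?c *\<^sub>R (2 *\<^sub>R Y + Z)) - (1 - 2 * ?c) *\<^sub>R (Y - ?c' *\<^sub>R Z) - D"
    unfolding c1[symmetric] by (simp only: scaleR_left_diff_distrib scaleR_left_distrib scaleR_one) simp
  also have "\<dots> = X - Y + ((1 - 2 * ?c) * ?c' - ?c) *\<^sub>R Z"
    by (simp add: scaleR_left_diff_distrib scaleR_right_diff_distrib scaleR_right_distrib)
  also have "\<dots> = X - Y" unfolding c3 by simp
  finally show ?thesis unfolding W Q T P c2 by simp
qed

end

section \<open>Parallel operations on tensors\<close>

text \<open>The coefficients are real and constant. Operations whose components are such functionals therefore
  commute with linear maps of the values and with differentiation of the components.\<close>
inductive component_functional :: "((('n, 'e::real_vector) tensor) \<Rightarrow> 'e) \<Rightarrow> bool" where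
  component: "component_functional (\<lambda>t. t m)"
| zero: "component_functional (\<lambda>t. 0)"
| add: "component_functional \<phi> \<Longrightarrow> component_functional \<psi> \<Longrightarrow> component_functional (\<lambda>t. \<phi> t + \<psi> t)"
| scale: "component_functional \<phi> \<Longrightarrow> component_functional (\<lambda>t. c *\<^sub>R \<phi> t)"

lemma component_functional_sum:
  "(\<And>i. i \<in> I \<Longrightarrow> component_functional (\<phi> i)) \<Longrightarrow> component_functional (\<lambda>t. \<Sum>i\<in>I. \<phi> i t)"
  by (induction I rule: infinite_finite_induct) (auto intro: component_functional.intros)

lemma component_functional_diff:
  assumes "component_functional \<phi>" "component_functional \<psi>"
  shows "component_functional (\<lambda>t. \<phi> t - \<psi> t)"
  using component_functional.add[OF assms(1) component_functional.scale[OF assms(2), of "-1"]] by simp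

lemma component_functional_compose:
  "component_functional \<phi> \<Longrightarrow> (\<And>l. component_functional (\<lambda>t. \<Psi> t l)) \<Longrightarrow> component_functional (\<lambda>t. \<phi> (\<Psi> t))"
  by (induction rule: component_functional.induct) (auto intro: component_functional.intros)

lemma component_functional_additive:
  "component_functional \<phi> \<Longrightarrow> \<phi> (\<lambda>l. s l + t l) = \<phi> s + \<phi> t"
  by (induction rule: component_functional.induct) (auto simp: algebra_simps)

lemma component_functional_linear:
  "component_functional \<phi> \<Longrightarrow> linear L \<Longrightarrow> \<phi> (\<lambda>l. L (t l)) = L (\<phi> t)"
  by (induction rule: component_functional.induct) (auto simp: linear_add linear_cmul linear_0)

lemma component_functional_scale_arg:
  "component_functional \<phi> \<Longrightarrow> \<phi> (\<lambda>l. c *\<^sub>R t l) = c *\<^sub>R \<phi> t"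
  by (induction rule: component_functional.induct) (auto simp: algebra_simps)

lemma component_functional_sum_arg:
  "component_functional \<phi> \<Longrightarrow> \<phi> (\<lambda>l. \<Sum>i\<in>I. t i l) = (\<Sum>i\<in>I. \<phi> (t i))"
  by (induction rule: component_functional.induct) (auto simp: sum.distrib scaleR_sum_right)

text \<open>The covariant derivative differentiates the components and applies the derivation of a skew matrix, and
  a change of frame acts on the indices by an orthogonal matrix: an operation compatible with all three maps sections to
  sections and commutes with \<open>\<nabla>\<^sup>E\<close>.\<close>
definition parallel :: "(('n::finite, 'e::real_vector) tensor \<Rightarrow> ('n, 'e) tensor) \<Rightarrow> bool" where
  "parallel \<Phi> \<longleftrightarrow> (\<forall>l. component_functional (\<lambda>t. \<Phi> t l)) \<and>
    (\<forall>B t. (\<forall>i j. B i j = - B j i) \<longrightarrow> derivation_ext B (\<Phi> t) = \<Phi> (derivation_ext B t)) \<and>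
    (\<forall>b t. orthogonal_matrix b \<longrightarrow> index_act b (\<Phi> t) = \<Phi> (index_act b t))"

lemma parallelD:
  assumes "parallel \<Phi>"
  shows "component_functional (\<lambda>t. \<Phi> t l)"
    "(\<And>i j. B i j = - B j i) \<Longrightarrow> derivation_ext B (\<Phi> t) = \<Phi> (derivation_ext B t)"
    "orthogonal_matrix b \<Longrightarrow> index_act b (\<Phi> t) = \<Phi> (index_act b t)"
  using assms unfolding parallel_def by blast+

lemma parallel_id: "parallel (\<lambda>t. t)"
  by (auto simp: parallel_def intro: component_functional.intros)

lemma parallel_compose: "parallel \<Phi> \<Longrightarrow> parallel \<Psi> \<Longrightarrow> parallel (\<lambda>t. \<Phi> (\<Psi> t))"
  unfolding parallel_def
proof (intro conjI allI impI, goal_cases)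
  case (1 l)
  then show ?case by (intro component_functional_compose[of "\<lambda>t. \<Phi> t l" \<Psi>]) blast+
next
  case (2 B t)
  then have "derivation_ext B (\<Phi> (\<Psi> t)) = \<Phi> (derivation_ext B (\<Psi> t))" "derivation_ext B (\<Psi> t) = \<Psi> (derivation_ext B t)"
    by blast+
  then show ?case by simp
next
  case (3 b t)
  then have "index_act b (\<Phi> (\<Psi> t)) = \<Phi> (index_act b (\<Psi> t))" "index_act b (\<Psi> t) = \<Psi> (index_act b t)"
    by blast+
  then show ?case by simp
qed

lemma parallel_diff:
  assumes "parallel \<Phi>" "parallel \<Psi>"
  shows "parallel (\<lambda>t l. \<Phi> t l - \<Psi> t l)"
  unfolding parallel_def
proof (intro conjI allI impI)
  show "component_functional (\<lambda>t. \<Phi> t l - \<Psi> t l)" for l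
    by (intro component_functional_diff parallelD(1) assms)
  show "derivation_ext B (\<lambda>l. \<Phi> t l - \<Psi> t l) = (\<lambda>l. \<Phi> (derivation_ext B t) l - \<Psi> (derivation_ext B t) l)"
    if "\<forall>i j. B i j = - B j i" for B t
    using derivation_ext_add[of B "\<Phi> t" "\<lambda>l. (-1) *\<^sub>R \<Psi> t l"] derivation_ext_scale[of B "-1" "\<Psi> t"]
      parallelD(2)[OF assms(1) that[rule_format], where t = t] parallelD(2)[OF assms(2) that[rule_format], where t = t]
    by (simp add: fun_eq_iff)
  show "index_act b (\<lambda>l. \<Phi> t l - \<Psi> t l) = (\<lambda>l. \<Phi> (index_act b t) l - \<Psi> (index_act b t) l)"
    if "orthogonal_matrix b" for b t
    using index_act_add[of b "\<Phi> t" "\<lambda>l. (-1) *\<^sub>R \<Psi> t l"] index_act_scale[of b "-1" "\<Psi> t"]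
      parallelD(3)[OF assms(1) that, where t = t] parallelD(3)[OF assms(2) that, where t = t] by (simp add: fun_eq_iff)
qed

lemma parallel_scale:
  assumes "parallel \<Phi>"
  shows "parallel (\<lambda>t l. c *\<^sub>R \<Phi> t l)"
  unfolding parallel_def
proof (intro conjI allI impI)
  show "component_functional (\<lambda>t. c *\<^sub>R \<Phi> t l)" for l
    by (intro component_functional.scale parallelD(1) assms)
  show "derivation_ext B (\<lambda>l. c *\<^sub>R \<Phi> t l) = (\<lambda>l. c *\<^sub>R \<Phi> (derivation_ext B t) l)"
    if "\<forall>i j. B i j = - B j i" for B t
    using parallelD(2)[OF assms(1) that[rule_format], where t = t] by (simp add: derivation_ext_scale fun_eq_iff)
  show "index_act b (\<lambda>l. c *\<^sub>R \<Phi> t l) = (\<lambda>l. c *\<^sub>R \<Phi> (index_act b t) l)"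
    if "orthogonal_matrix b" for b t
    using parallelD(3)[OF assms(1) that, where t = t] by (simp add: index_act_scale fun_eq_iff)
qed

text \<open>The operation \<open>id\<^sub>T \<otimes> \<Phi>\<close>.\<close>
lemma parallel_slotwise:
  assumes "parallel \<Phi>"
  shows "parallel (\<lambda>t l. case l of [] \<Rightarrow> 0 | i # l' \<Rightarrow> \<Phi> (slot i t) l')"
  unfolding parallel_def
proof (intro conjI allI impI)
  note cf = parallelD(1)[OF assms]
  let ?L = "\<lambda>t l. case l of [] \<Rightarrow> 0 | i # l' \<Rightarrow> \<Phi> (slot i t) l'"
  show "component_functional (\<lambda>t. ?L t l)" for l
    by (cases l) (auto intro: component_functional.intros component_functional_compose[OF cf])
  show "derivation_ext B (?L t) = ?L (derivation_ext B t)" if "\<forall>i j. B i j = - B j i" for B t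
  proof
    fix l
    show "derivation_ext B (?L t) l = ?L (derivation_ext B t) l"
    proof (cases l)
      case (Cons i l')
      have "derivation_ext B (\<Phi> (slot i t)) = \<Phi> (derivation_ext B (slot i t))"
        by (rule parallelD(2)[OF assms that[rule_format]])
      then show ?thesis
        by (simp add: Cons derivation_ext_Cons component_functional_additive[OF cf] component_functional_sum_arg[OF cf]
            component_functional_scale_arg[OF cf])
    qed (simp add: derivation_ext_Nil)
  qed
  show "index_act b (?L t) = ?L (index_act b t)" if "orthogonal_matrix b" for b t
  proof
    fix l
    show "index_act b (?L t) l = ?L (index_act b t) l"
      by (cases l) (simp_all add: parallelD(3)[OF assms that] component_functional_sum_arg[OF cf] component_functional_scale_arg[OF cf])
  qed
qed

lemma component_functional_sym_mult: "component_functional (\<lambda>t. sym_mult v t l)"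
  unfolding sym_mult_def by (intro component_functional_sum component_functional.intros)

lemma derivation_ext_sym_mult:
  "derivation_ext B (sym_mult v K) l = sym_mult (\<chi> i. \<Sum>c\<in>UNIV. B i c * v $ c) K l + sym_mult v (derivation_ext B K) l"
proof (induction l arbitrary: K)
  case (Cons i l)
  have "sym_mult v (derivation_ext B K) (i # l) = v $ i *\<^sub>R derivation_ext B K l
      + (\<Sum>c\<in>UNIV. B i c *\<^sub>R sym_mult v (slot c K) l) + sym_mult v (derivation_ext B (slot i K)) l"
    by (simp add: sym_mult_Cons derivation_ext_Cons[abs_def] sym_mult_add sym_mult_sum sym_mult_scale derivation_ext_Cons)
  moreover have "derivation_ext B (sym_mult v K) (i # l) = (\<Sum>c\<in>UNIV. B i c * v $ c) *\<^sub>R K l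
      + (\<Sum>c\<in>UNIV. B i c *\<^sub>R sym_mult v (slot c K) l) + v $ i *\<^sub>R derivation_ext B K l + derivation_ext B (sym_mult v (slot i K)) l"
    by (simp add: derivation_ext_Cons sym_mult_Cons sym_mult_Cons[abs_def] derivation_ext_add derivation_ext_scale
        scaleR_right_distrib sum.distrib scaleR_sum_left)
  ultimately show ?case using Cons.IH[of "slot i K"] by (simp add: sym_mult_Cons)
qed (simp add: derivation_ext_Nil sym_mult_Nil)

lemma index_act_sym_mult:
  fixes K :: "('n::finite, 'e::real_vector) tensor"
  shows "index_act b (sym_mult v K) l = sym_mult (b *v v) (index_act b K) l"
proof (induction l arbitrary: K)
  case (Cons i l)
  have "sym_mult (b *v v) (slot i (index_act b K)) l = (\<Sum>j\<in>UNIV. b $ i $ j *\<^sub>R sym_mult (b *v v) (index_act b (slot j K)) l)"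
    by (simp add: sym_mult_sum sym_mult_scale)
  moreover have "(b *v v) $ i *\<^sub>R x = (\<Sum>j\<in>UNIV. b $ i $ j *\<^sub>R (v $ j *\<^sub>R x))" for x :: 'e
    by (simp add: matrix_vector_mult_def scaleR_sum_left)
  ultimately show ?case
    by (simp add: sym_mult_Cons sym_mult_Cons[abs_def] index_act_add index_act_scale Cons.IH scaleR_right_distrib sum.distrib)
qed (simp add: sym_mult_Nil)

lemma sym_mult_matrix_basis: "sym_mult (b *v std_basis j) K l = (\<Sum>i\<in>UNIV. b $ i $ j *\<^sub>R sym_mult (std_basis i) K l)"
  by (subst sym_mult_basis) (simp add: matrix_vector_mult_basis column_def)

lemma sym_mult_derivation_basis:
  fixes K :: "('n::finite, 'e::real_vector) tensor"
  shows "sym_mult (\<chi> i. \<Sum>c\<in>UNIV. B i c * (std_basis j :: real^'n) $ c) K l = (\<Sum>i\<in>UNIV. B i j *\<^sub>R sym_mult (std_basis i) K l)"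
proof -
  have "(\<Sum>c\<in>UNIV. B i c * (std_basis j :: real^'n) $ c) = B i j" for i
    using sum_basis_scaleR(2)[where F = "\<lambda>c. B i c" and j = j] by (simp add: mult.commute)
  then show ?thesis by (subst sym_mult_basis) simp
qed

text \<open>The two contributions of a skew matrix at the contracted pair of indices cancel, and an orthogonal matrix
  leaves the pair invariant.\<close>
lemma parallel_trc: "parallel trc"
  unfolding parallel_def
proof (intro conjI allI impI)
  show "component_functional (\<lambda>t. trc t l)" for l
    unfolding trc_def by (intro component_functional_sum component_functional.intros)
  show "derivation_ext B (trc t) = trc (derivation_ext B t)" if s: "\<forall>i j. B i j = - B j i" for B and t :: "('a, 'b) tensor"
  proof
    fix l
    have "(\<Sum>i\<in>UNIV. \<Sum>c\<in>UNIV. B i c *\<^sub>R t (c # i # l)) = (\<Sum>i\<in>UNIV. \<Sum>c\<in>UNIV. B c i *\<^sub>R t (i # c # l))"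
      by (rule sum.swap)
    also have "\<dots> = - (\<Sum>i\<in>UNIV. \<Sum>c\<in>UNIV. B i c *\<^sub>R t (i # c # l))"
      unfolding sum_negf[symmetric] scaleR_minus_left[symmetric] by (intro sum.cong refl) (subst s[rule_format], rule refl)
    finally have "(\<Sum>i\<in>UNIV. \<Sum>c\<in>UNIV. B i c *\<^sub>R t (c # i # l)) + (\<Sum>i\<in>UNIV. \<Sum>c\<in>UNIV. B i c *\<^sub>R t (i # c # l)) = 0" by simp
    then show "derivation_ext B (trc t) l = trc (derivation_ext B t) l"
      by (simp add: trc_def[abs_def] derivation_ext_sum derivation_ext_Cons sum.distrib add.assoc[symmetric])
  qed
  show "index_act b (trc t) = trc (index_act b t)" if o: "orthogonal_matrix b" for b and t :: "('a, 'b) tensor"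
  proof
    fix l
    have d: "(\<Sum>i\<in>UNIV. b $ i $ j * b $ i $ j') = (if j = j' then 1 else 0)" for j j'
      using o by (auto simp: orthogonal_matrix matrix_matrix_mult_def transpose_def mat_def vec_eq_iff)
    have "trc (index_act b t) l = (\<Sum>i\<in>UNIV. \<Sum>j\<in>UNIV. \<Sum>j'\<in>UNIV. (b $ i $ j * b $ i $ j') *\<^sub>R index_act b (slot j' (slot j t)) l)"
      by (simp add: trc_def scaleR_sum_right)
    also have "\<dots> = (\<Sum>j\<in>UNIV. \<Sum>j'\<in>UNIV. \<Sum>i\<in>UNIV. (b $ i $ j * b $ i $ j') *\<^sub>R index_act b (slot j' (slot j t)) l)"
      by (subst sum.swap, rule sum.cong[OF refl], rule sum.swap)
    also have "\<dots> = (\<Sum>j\<in>UNIV. \<Sum>j'\<in>UNIV. if j = j' then index_act b (slot j' (slot j t)) l else 0)"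
      unfolding scaleR_sum_left[symmetric] d by (intro sum.cong refl) simp
    also have "\<dots> = index_act b (trc t) l" by (simp add: trc_def[abs_def] index_act_sum)
    finally show "index_act b (trc t) l = trc (index_act b t) l" by simp
  qed
qed

lemma parallel_euler: "parallel euler"
  unfolding parallel_def
proof (intro conjI allI impI)
  show "component_functional (\<lambda>t. euler t l)" for l
    unfolding euler_def
    by (intro component_functional_sum component_functional_compose[OF component_functional_sym_mult] component_functional.intros)
  show "derivation_ext B (euler t) = euler (derivation_ext B t)" if s: "\<forall>i j. B i j = - B j i" for B and t :: "('a, 'b) tensor"
  proof
    fix l
    have "derivation_ext B (euler t) l = (\<Sum>j\<in>UNIV. \<Sum>i\<in>UNIV. B i j *\<^sub>R sym_mult (std_basis i) (slot j t) l)
        + (\<Sum>j\<in>UNIV. sym_mult (std_basis j) (derivation_ext B (slot j t)) l)"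
      by (simp add: euler_def[abs_def] derivation_ext_sum derivation_ext_sym_mult sym_mult_derivation_basis sum.distrib)
    also have "(\<Sum>j\<in>UNIV. \<Sum>i\<in>UNIV. B i j *\<^sub>R sym_mult (std_basis i) (slot j t) l)
        = (\<Sum>i\<in>UNIV. \<Sum>j\<in>UNIV. B i j *\<^sub>R sym_mult (std_basis i) (slot j t) l)" by (rule sum.swap)
    also have "\<dots> + (\<Sum>j\<in>UNIV. sym_mult (std_basis j) (derivation_ext B (slot j t)) l) = euler (derivation_ext B t) l"
      by (simp add: euler_def derivation_ext_Cons[abs_def] derivation_ext_Cons sym_mult_add sym_mult_sum sym_mult_scale sum.distrib)
    finally show "derivation_ext B (euler t) l = euler (derivation_ext B t) l" .
  qed
  show "index_act b (euler t) = euler (index_act b t)" if o: "orthogonal_matrix b" for b and t :: "('a, 'b) tensor"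
  proof
    fix l
    have "index_act b (euler t) l = (\<Sum>j\<in>UNIV. \<Sum>i\<in>UNIV. b $ i $ j *\<^sub>R sym_mult (std_basis i) (index_act b (slot j t)) l)"
      by (simp add: euler_def[abs_def] index_act_sum index_act_sym_mult sym_mult_matrix_basis)
    also have "\<dots> = (\<Sum>i\<in>UNIV. \<Sum>j\<in>UNIV. b $ i $ j *\<^sub>R sym_mult (std_basis i) (index_act b (slot j t)) l)" by (rule sum.swap)
    also have "\<dots> = euler (index_act b t) l" by (simp add: euler_def sym_mult_sum sym_mult_scale)
    finally show "index_act b (euler t) l = euler (index_act b t) l" .
  qed
qed

text \<open>\<open>u \<mapsto> \<Sum>\<^sub>i e\<^sub>i \<otimes> e\<^sub>i \<cdot> u\<close>\<close>
definition insert_basis :: "('n::finite, 'e::real_vector) tensor \<Rightarrow> ('n, 'e) tensor" where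
  "insert_basis u l = (case l of [] \<Rightarrow> 0 | i # l' \<Rightarrow> sym_mult (std_basis i) u l')"

lemma insert_basis_simps: "insert_basis u [] = 0" "insert_basis u (i # l) = sym_mult (std_basis i) u l"
  by (simp_all add: insert_basis_def)

lemma parallel_insert_basis: "parallel insert_basis"
  unfolding parallel_def
proof (intro conjI allI impI)
  show "component_functional (\<lambda>t. insert_basis t l)" for l
    by (cases l) (auto simp: insert_basis_simps intro: component_functional.intros component_functional_sym_mult)
  show "derivation_ext B (insert_basis t) = insert_basis (derivation_ext B t)" if s: "\<forall>i j. B i j = - B j i" for B and t :: "('a, 'b) tensor"
  proof
    fix l
    show "derivation_ext B (insert_basis t) l = insert_basis (derivation_ext B t) l"
    proof (cases l)
      case (Cons i l')
      have "(\<Sum>c\<in>UNIV. B c i *\<^sub>R sym_mult (std_basis c) t l') = - (\<Sum>c\<in>UNIV. B i c *\<^sub>R sym_mult (std_basis c) t l')"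
        unfolding sum_negf[symmetric] scaleR_minus_left[symmetric] by (intro sum.cong refl) (subst s[rule_format], rule refl)
      then show ?thesis
        by (simp add: Cons insert_basis_simps insert_basis_simps[abs_def] derivation_ext_Cons derivation_ext_sym_mult sym_mult_derivation_basis)
    qed (simp add: derivation_ext_Nil insert_basis_simps)
  qed
  show "index_act b (insert_basis t) = insert_basis (index_act b t)" if o: "orthogonal_matrix b" for b and t :: "('a, 'b) tensor"
  proof
    fix l
    show "index_act b (insert_basis t) l = insert_basis (index_act b t) l"
    proof (cases l)
      case (Cons i l')
      have d: "(\<Sum>j\<in>UNIV. b $ i $ j * b $ c $ j) = (if i = c then 1 else 0)" for c
        using o by (auto simp: orthogonal_matrix_def matrix_matrix_mult_def transpose_def mat_def vec_eq_iff)
      have "index_act b (insert_basis t) l = (\<Sum>j\<in>UNIV. \<Sum>c\<in>UNIV. (b $ i $ j * b $ c $ j) *\<^sub>R sym_mult (std_basis c) (index_act b t) l')"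
        by (simp add: Cons insert_basis_simps insert_basis_simps[abs_def] index_act_sym_mult sym_mult_matrix_basis scaleR_sum_right)
      also have "\<dots> = (\<Sum>c\<in>UNIV. (\<Sum>j\<in>UNIV. b $ i $ j * b $ c $ j) *\<^sub>R sym_mult (std_basis c) (index_act b t) l')"
        by (subst sum.swap) (simp add: scaleR_sum_left)
      also have "\<dots> = (\<Sum>c\<in>UNIV. if i = c then sym_mult (std_basis c) (index_act b t) l' else 0)"
        unfolding d by (intro sum.cong) auto
      finally show ?thesis by (simp add: Cons insert_basis_simps)
    qed (simp add: insert_basis_simps)
  qed
qed

lemma parallel_Lop: "parallel (Lop :: ('n::finite, 'e::real_vector) tensor \<Rightarrow> ('n, 'e) tensor)"
proof -
  have "(\<lambda>t. euler (insert_basis t)) = (Lop :: ('n, 'e) tensor \<Rightarrow> ('n, 'e) tensor)"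
    by (intro ext) (simp add: Lop_def euler_def insert_basis_simps)
  moreover have "parallel (\<lambda>t :: ('n, 'e) tensor. euler (insert_basis t))"
    by (rule parallel_compose[OF parallel_euler parallel_insert_basis])
  ultimately show ?thesis by (rule back_subst[of parallel, rotated])
qed

lemma parallel_Q1: "parallel (Q1 k)"
  unfolding Q1_def[abs_def]
  by (intro parallel_diff parallel_scale parallel_euler parallel_compose[OF parallel_Lop parallel_trc])

lemma parallel_Q2_adj: "parallel (Q2_adj m :: ('n::finite, 'e::real_vector) tensor \<Rightarrow> _)"
proof -
  have "(Q2_adj m :: ('n, 'e) tensor \<Rightarrow> _) = (\<lambda>u l. insert_basis u l - (1 / (real CARD('n) + 2 * real m - 2)) *\<^sub>R
      (case l of [] \<Rightarrow> 0 | i # l' \<Rightarrow> Lop (slot i u) l'))"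
    by (auto simp: fun_eq_iff Q2_adj_def insert_basis_def tf_mult_slot split: list.split)
  then show ?thesis
    by (simp only: parallel_diff[OF parallel_insert_basis parallel_scale[OF parallel_slotwise[OF parallel_Lop]]])
qed

lemma parallel_P3_proj: "parallel (P3_proj m)"
  unfolding P3_proj_def[abs_def]
  by (intro parallel_diff parallel_scale parallel_id parallel_Q1 parallel_compose[OF parallel_Q2_adj parallel_trc])

section \<open>Parallel operations commute with the covariant derivative\<close>

context twisted_manifold begin

lemma sectionsD: "s \<in> sections M E V \<Longrightarrow> s \<in> Secs" "s \<in> sections M E V \<Longrightarrow> f \<in> fr p \<Longrightarrow> s p f \<in> V"
  by (auto simp: sections_def)

lemma sectionsI: "s \<in> Secs \<Longrightarrow> (\<And>p f. f \<in> fr p \<Longrightarrow> s p f \<in> V) \<Longrightarrow> s \<in> sections M E V"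
  by (auto simp: sections_def)

lemma component_functional_smooth:
  assumes "component_functional \<phi>" "open U" "\<And>l. SF U (\<lambda>q. S q l)"
  shows "SF U (\<lambda>q. \<phi> (S q))"
  using assms(1)
proof (induction rule: component_functional.induct)
  case (component m)
  show ?case by (rule assms(3))
next
  case zero
  show ?case by (rule smooth_fun_const[OF assms(2)])
next
  case (add \<phi> \<psi>)
  then show ?case by (intro smooth_fun_add)
next
  case (scale \<phi> c)
  show ?case by (rule smooth_fun_scaleR[OF smooth_fun_const[OF assms(2)] scale.IH])
qed

lemma frame_conn_component_functional:
  assumes "component_functional \<phi>" and e: "local_frame M U e" and q: "q \<in> U" "v \<in> TS q"
    and S: "\<And>l. SF U (\<lambda>q. S q l)"
  shows "frame_conn e q v (\<lambda>q. \<phi> (S q)) = \<phi> (\<lambda>l. frame_conn e q v (\<lambda>q. S q l))"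
  using assms(1)
proof (induction rule: component_functional.induct)
  case (component m)
  show ?case by simp
next
  case zero
  show ?case by (rule frame_conn_zero[OF e q])
next
  case (add \<phi> \<psi>)
  have "SF U (\<lambda>q. \<phi> (S q))" "SF U (\<lambda>q. \<psi> (S q))"
    by (rule component_functional_smooth[OF add(1) local_frameD(3)[OF e] S],
        rule component_functional_smooth[OF add(2) local_frameD(3)[OF e] S])
  then show ?case using frame_conn_add[OF e q] add.IH by simp
next
  case (scale \<phi> c)
  have "SF U (\<lambda>q. \<phi> (S q))" using component_functional_smooth[OF scale(1) local_frameD(3)[OF e] S] .
  then show ?case
    using frame_conn_scale[OF e q smooth_fun_const[OF local_frameD(3)[OF e], of c]] scale.IH tangent_const[OF q(2)] by simp
qed

lemma parallel_zero: "parallel \<Phi> \<Longrightarrow> \<Phi> (\<lambda>l. 0) = (\<lambda>l. 0)"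
proof
  fix l assume "parallel \<Phi>"
  from component_functional_scale_arg[where c = 0 and t = "\<lambda>l. 0", OF parallelD(1)[where l = l, OF this]] show "\<Phi> (\<lambda>l. 0) l = 0" by simp
qed

lemma parallel_section:
  fixes \<Phi> :: "('n, 'e) tensor \<Rightarrow> ('n, 'e) tensor"
  assumes \<Phi>: "parallel \<Phi>" and s: "s \<in> Secs"
  shows "(\<lambda>p f. \<Phi> (s p f)) \<in> Secs"
  unfolding sections_def
proof (intro CollectI conjI allI ballI impI)
  fix p f and a :: "real^'n^'n" assume f: "f \<in> fr p" and a: "rotation_matrix a"
  let ?b = "transpose a"
  have b: "rotation_matrix ?b" using rotation_matrix_transpose[OF a] .
  have eq: "s p (frame_act f a) = tensor_act \<rho> ?b (s p f)" using s f a by (simp add: sections_def)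
  have "\<Phi> (s p (frame_act f a)) = index_act ?b (\<Phi> (\<lambda>l. \<rho> ?b (s p f l)))"
    unfolding eq tensor_act_eq by (rule parallelD(3)[OF \<Phi>, symmetric]) (use b in \<open>simp add: rotation_matrix_def\<close>)
  also have "\<Phi> (\<lambda>l. \<rho> ?b (s p f l)) = (\<lambda>l. \<rho> ?b (\<Phi> (s p f) l))"
    by (rule ext) (rule component_functional_linear[OF parallelD(1)[OF \<Phi>] rho_linear[OF b]])
  finally show "\<Phi> (s p (frame_act f a)) = tensor_act \<rho> ?b (\<Phi> (s p f))" by (simp add: tensor_act_eq)
next
  fix U e l assume e: "local_frame M U e"
  show "SF U (\<lambda>q. \<Phi> (s q (e q)) l)"
    by (rule component_functional_smooth[OF parallelD(1)[OF \<Phi>] local_frameD(3)[OF e] section_smooth[OF s e]])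
qed (use section_not_frame[OF s] parallel_zero[OF \<Phi>] in auto)

lemma tensor_deriv_parallel:
  assumes \<Phi>: "parallel \<Phi>" and e: "local_frame M U e" and q: "q \<in> U" "v \<in> TS q" and S: "\<And>l. SF U (\<lambda>q. S q l)"
  shows "tensor_deriv e q v (\<lambda>q. \<Phi> (S q)) = \<Phi> (tensor_deriv e q v S)"
proof
  fix l
  have "derivation_ext (christoffel e q v) (\<Phi> (S q)) = \<Phi> (derivation_ext (christoffel e q v) (S q))"
    by (rule parallelD(2)[OF \<Phi> christoffel_skew[OF e q]])
  then show "tensor_deriv e q v (\<lambda>q. \<Phi> (S q)) l = \<Phi> (tensor_deriv e q v S) l"
    unfolding tensor_deriv_def[abs_def]
    by (simp add: component_functional_additive[OF parallelD(1)[OF \<Phi>]] frame_conn_component_functional[OF parallelD(1)[OF \<Phi>] e q S])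
qed

lemma grad_parallel:
  fixes \<Phi> :: "('n, 'e) tensor \<Rightarrow> ('n, 'e) tensor"
  assumes \<Phi>: "parallel \<Phi>" and s: "s \<in> Secs" and f: "f \<in> fr p"
  shows "slot i (grad (\<lambda>p f. \<Phi> (s p f)) p f) = \<Phi> (slot i (grad s p f))"
proof -
  obtain e U where e: "e p = f" "p \<in> U" "local_frame M U e" using ex_local_frame[OF f] by blast
  have "slot i (grad (\<lambda>p f. \<Phi> (s p f)) p f) = tensor_deriv e p (f i) (\<lambda>q. \<Phi> (s q (e q)))"
    using grad_local[OF parallel_section[OF \<Phi> s] e(3,2)] e(1) by auto
  also have "\<dots> = \<Phi> (tensor_deriv e p (f i) (\<lambda>q. s q (e q)))"
    using tensor_deriv_parallel[OF \<Phi> e(3,2) eT[OF e(3,2)] section_smooth[OF s e(3)], of i] e(1) by simp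
  also have "tensor_deriv e p (f i) (\<lambda>q. s q (e q)) = slot i (grad s p f)"
    using grad_local[OF s e(3,2)] e(1) by auto
  finally show ?thesis .
qed

text \<open>Symmetry of the components is preserved by differentiation and by derivations, vanishing of the trace
  since the trace is parallel.\<close>
lemma tensor_deriv_Sym0:
  assumes e: "local_frame M U e" and q: "q \<in> U" "v \<in> TS q" and S: "\<And>l. SF U (\<lambda>q. S q l)"
    and V: "\<And>q. q \<in> U \<Longrightarrow> S q \<in> Sym0 k"
  shows "tensor_deriv e q v S \<in> Sym0 k"
proof -
  have cong: "frame_conn e q v (\<lambda>q. S q l) = frame_conn e q v (\<lambda>q. S q l')" if "mset l = mset l'" for l l'
    by (rule frame_conn_cong[OF e q S S]) (rule SymD(1)[OF Sym0D(1)[OF V] that])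
  have zero: "frame_conn e q v (\<lambda>q. S q l) = 0" if "length l \<noteq> k" for l
    using frame_conn_cong[OF e q S smooth_fun_const[OF local_frameD(3)[OF e], of 0], of l]
      SymD(2)[OF Sym0D(1)[OF V] that] frame_conn_zero[OF e q] by simp
  have "(\<lambda>l. frame_conn e q v (\<lambda>q. S q l)) \<in> Sym k"
    unfolding Sym_iff by (intro conjI index_symmetricI cong allI impI zero)
  then have "tensor_deriv e q v S \<in> Sym k"
    unfolding tensor_deriv_def[abs_def] by (rule Sym_add[OF _ Sym_derivation_ext[OF Sym0D(1)[OF V[OF q(1)]]]])
  moreover have "trc (tensor_deriv e q v S) = tensor_deriv e q v (\<lambda>q. trc (S q))"
    by (rule tensor_deriv_parallel[OF parallel_trc e q S, symmetric])
  moreover have "tensor_deriv e q v (\<lambda>q. trc (S q)) = tensor_deriv e q v (\<lambda>q l. 0)"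
    by (rule tensor_deriv_cong[OF e q component_functional_smooth[OF parallelD(1)[OF parallel_trc] local_frameD(3)[OF e] S]])
      (rule Sym0D(2)[OF V])
  moreover have "tensor_deriv e q v (\<lambda>q l. 0) l = 0" for l
    by (simp add: tensor_deriv_def frame_conn_zero[OF e q] derivation_ext_zero)
  ultimately show ?thesis by (simp add: Sym0_iff)
qed

lemma tensor_deriv_T_Sym0:
  assumes e: "local_frame M U e" and q: "q \<in> U" "v \<in> TS q" and S: "\<And>l. SF U (\<lambda>q. S q l)"
    and V: "\<And>q. q \<in> U \<Longrightarrow> S q \<in> T_Sym0 k"
  shows "slot j (tensor_deriv e q v S) \<in> Sym0 k"
proof -
  have "slot j (tensor_deriv e q v S) = (\<lambda>l. (\<Sum>c\<in>UNIV. christoffel e q v j c *\<^sub>R slot c (S q) l) + tensor_deriv e q v (\<lambda>q. slot j (S q)) l)"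
    by (simp add: tensor_deriv_def derivation_ext_Cons add_ac)
  moreover have "tensor_deriv e q v (\<lambda>q. slot j (S q)) \<in> Sym0 k"
    by (rule tensor_deriv_Sym0[OF e q S T_Sym0D(1)[OF V]])
  ultimately show ?thesis using T_Sym0D(1)[OF V[OF q(1)]] by (auto intro!: Sym0_add Sym0_sum Sym0_scale)
qed

lemma grad_T_Sym0:
  assumes s: "s \<in> sections M E (Sym0 k)"
  shows "grad s \<in> sections M E (T_Sym0 k)"
proof -
  have s': "s \<in> Secs" "\<And>p f. f \<in> fr p \<Longrightarrow> s p f \<in> Sym0 k" using sectionsD[OF s] .
  have "grad s p f \<in> T_Sym0 k" if f: "f \<in> fr p" for p f
  proof -
    obtain e U where e: "e p = f" "p \<in> U" "local_frame M U e" using ex_local_frame[OF f] by blast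
    have "slot i (grad s p f) \<in> Sym0 k" for i
    proof -
      have "slot i (grad s p (e p)) = tensor_deriv e p (e p i) (\<lambda>q. s q (e q))"
        by (rule ext) (rule grad_local[OF s'(1) e(3,2)])
      then show ?thesis
        using tensor_deriv_Sym0[OF e(3,2) eT[OF e(3,2)] section_smooth[OF s'(1) e(3)] s'(2)[OF local_frameD(1)[OF e(3)]], of i]
        unfolding e(1) by (simp only:)
    qed
    then show ?thesis by (simp add: T_Sym0_def grad_Nil)
  qed
  then show ?thesis by (rule sectionsI[OF grad_sections[OF s'(1)]])
qed

text \<open>Applied to \<open>t = \<nabla>\<^sup>E s\<close>, this puts all components \<open>\<nabla>\<^sup>2\<^bsub>f\<^sub>i,f\<^sub>j\<^esub> s\<close> into \<open>Sym\<^sup>k\<^sub>0 T \<otimes> E\<close>.\<close>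
lemma grad_T_Sym0_slots:
  assumes t: "t \<in> sections M E (T_Sym0 k)" and f: "f \<in> fr p"
  shows "slot j (slot i (grad t p f)) \<in> Sym0 k"
proof -
  have t': "t \<in> Secs" "\<And>p f. f \<in> fr p \<Longrightarrow> t p f \<in> T_Sym0 k" using sectionsD[OF t] .
  obtain e U where e: "e p = f" "p \<in> U" "local_frame M U e" using ex_local_frame[OF f] by blast
  have "slot i (grad t p (e p)) = tensor_deriv e p (e p i) (\<lambda>q. t q (e q))"
    by (rule ext) (rule grad_local[OF t'(1) e(3,2)])
  then have "slot j (slot i (grad t p (e p))) = slot j (tensor_deriv e p (e p i) (\<lambda>q. t q (e q)))"
    by (rule arg_cong[where f = "slot j"])
  then show ?thesis
    using tensor_deriv_T_Sym0[OF e(3,2) eT[OF e(3,2)] section_smooth[OF t'(1) e(3)] t'(2)[OF local_frameD(1)[OF e(3)]], of i j]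
    unfolding e(1) by (simp only:)
qed

lemma full_inner_smooth:
  assumes "open U" "\<And>l. SF U (\<lambda>q. S q l)" "\<And>l. SF U (\<lambda>q. T q l)"
  shows "SF U (\<lambda>q. full_inner m (S q) (T q))"
  unfolding full_inner_def by (intro smooth_fun_sum assms smooth_fun_inner)

text \<open>The Christoffel symbols are skew, so their contributions cancel.\<close>
lemma tensor_deriv_metric:
  assumes e: "local_frame M U e" and q: "q \<in> U" "v \<in> TS q"
    and S: "\<And>l. SF U (\<lambda>q. S q l)" and T: "\<And>l. SF U (\<lambda>q. T q l)"
  shows "v (\<lambda>q. full_inner m (S q) (T q)) = full_inner m (tensor_deriv e q v S) (T q) + full_inner m (S q) (tensor_deriv e q v T)"
proof -
  have "v (\<lambda>q. full_inner m (S q) (T q)) = (\<Sum>l | length l = m. v (\<lambda>q. S q l \<bullet> T q l))"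
    unfolding full_inner_def
    by (rule tangent_sum_fun[OF q(2)]) (rule smooth_nearI[OF smooth_fun_inner[OF S T] q(1)])
  also have "\<dots> = full_inner m (\<lambda>l. frame_conn e q v (\<lambda>q. S q l)) (T q) + full_inner m (S q) (\<lambda>l. frame_conn e q v (\<lambda>q. T q l))"
    by (simp add: full_inner_def frame_conn_metric[OF e q S T] sum.distrib)
  also have "\<dots> = full_inner m (tensor_deriv e q v S) (T q) + full_inner m (S q) (tensor_deriv e q v T)"
    using full_inner_derivation_ext[where m = m and B = "christoffel e q v" and K = "S q" and L = "T q", OF christoffel_skew[OF e q]]
    unfolding tensor_deriv_def[abs_def] full_inner_add_left full_inner_add_right by linarith
  finally show ?thesis .
qed

section \<open>Curvature\<close>

lemma derivation_ext_commutator: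
  "derivation_ext B (derivation_ext B' K) l - derivation_ext B' (derivation_ext B K) l
    = derivation_ext (\<lambda>a b. (\<Sum>c\<in>UNIV. B a c * B' c b) - (\<Sum>c\<in>UNIV. B' a c * B c b)) K l"
  for K :: "('k::finite, 'b::real_vector) tensor"
proof (induction l arbitrary: K)
  case (Cons i l)
  have exp: "derivation_ext B (derivation_ext B' K) (i # l)
     = (\<Sum>d\<in>UNIV. (\<Sum>c\<in>UNIV. B i c * B' c d) *\<^sub>R K (d # l)) + (\<Sum>c\<in>UNIV. B i c *\<^sub>R derivation_ext B' (slot c K) l)
       + (\<Sum>d\<in>UNIV. B' i d *\<^sub>R derivation_ext B (slot d K) l) + derivation_ext B (derivation_ext B' (slot i K)) l" for B B'
  proof -
    have "(\<Sum>c\<in>UNIV. \<Sum>d\<in>UNIV. (B i c * B' c d) *\<^sub>R K (d # l)) = (\<Sum>d\<in>UNIV. (\<Sum>c\<in>UNIV. B i c * B' c d) *\<^sub>R K (d # l))"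
      by (subst sum.swap) (simp add: scaleR_sum_left)
    then show ?thesis
      by (simp add: derivation_ext_Cons derivation_ext_Cons[abs_def] derivation_ext_add derivation_ext_sum derivation_ext_scale
          scaleR_right_distrib sum.distrib scaleR_sum_right add.assoc)
  qed
  show ?case
    using Cons.IH[of "slot i K"]
    by (simp add: exp derivation_ext_Cons[of "\<lambda>a b. _ a b - _ a b"] scaleR_left_diff_distrib sum_subtractf algebra_simps)
qed (simp add: derivation_ext_Nil)

context
  fixes U e p assumes e: "local_frame M U e" and p: "p \<in> U"
begin

lemmas feV = local_frameD(2)[OF e] and foU = local_frameD(3)[OF e] and feT = eT[OF e]

lemma frame_conn_derivation_ext:
  assumes v: "v \<in> TS p" and B: "\<And>a b. SF U (\<lambda>q. B q a b)" and S: "\<And>l. SF U (\<lambda>q. S q l)"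
  shows "frame_conn e p v (\<lambda>q. derivation_ext (B q) (S q) l)
    = derivation_ext (\<lambda>a b. v (\<lambda>q. B q a b)) (S p) l + derivation_ext (B p) (\<lambda>l. frame_conn e p v (\<lambda>q. S q l)) l"
  using S
proof (induction l arbitrary: S)
  case Nil
  show ?case by (simp add: derivation_ext_Nil frame_conn_zero[OF e p v])
next
  case (Cons i l)
  have s1: "SF U (\<lambda>q. \<Sum>c\<in>UNIV. B q i c *\<^sub>R S q (c # l))"
    by (intro smooth_fun_sum foU smooth_fun_scaleR B Cons.prems)
  have s2: "SF U (\<lambda>q. derivation_ext (B q) (slot i (S q)) l)"
    unfolding derivation_ext_def by (intro smooth_fun_sum foU smooth_fun_scaleR B Cons.prems)
  have "frame_conn e p v (\<lambda>q. \<Sum>c\<in>UNIV. B q i c *\<^sub>R S q (c # l))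
    = (\<Sum>c\<in>UNIV. v (\<lambda>q. B q i c) *\<^sub>R S p (c # l) + B p i c *\<^sub>R frame_conn e p v (\<lambda>q. S q (c # l)))"
    by (rule frame_conn_sum[OF e p v B Cons.prems])
  then show ?case
    unfolding derivation_ext_Cons
    by (simp add: frame_conn_add[OF e p v s1 s2] Cons.IH[of "\<lambda>q. slot i (S q)", OF Cons.prems] sum.distrib)
qed

text \<open>The coefficients of \<open>- [e\<^sub>i, e\<^sub>j] = \<nabla>\<^bsub>e\<^sub>j\<^esub> e\<^sub>i - \<nabla>\<^bsub>e\<^sub>i\<^esub> e\<^sub>j\<close> in the frame.\<close>
definition minus_bracket :: "'n \<Rightarrow> 'n \<Rightarrow> 'n \<Rightarrow> real" where
  "minus_bracket i j c = christoffel e p (e p i) j c - christoffel e p (e p j) i c"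

text \<open>The curvature of \<open>\<nabla>\<^sup>E\<close> in the directions \<open>e\<^sub>i, e\<^sub>j\<close>, applied to a section with components \<open>F\<close>.\<close>
definition frame_curv :: "'n \<Rightarrow> 'n \<Rightarrow> ('m \<Rightarrow> 'e) \<Rightarrow> 'e" where
  "frame_curv i j F = frame_conn e p (e p i) (\<lambda>q. frame_conn e q (e q j) F)
    - frame_conn e p (e p j) (\<lambda>q. frame_conn e q (e q i) F)
    + (\<Sum>c\<in>UNIV. minus_bracket i j c *\<^sub>R frame_conn e p (e p c) F)"

lemma nabla_frame_frame: "nabla M p (e p i) (\<lambda>q. e q j) = (\<lambda>h. \<Sum>c\<in>UNIV. (- christoffel e p (e p i) j c) * e p c h)"
proof -
  have "christoffel e p (e p i) c j = - christoffel e p (e p i) j c" for c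
    by (rule christoffel_skew[OF e p feT[OF p]])
  then show ?thesis using nabla_frame[OF e p feT[OF p], of i j] by simp
qed

lemma frame_bracket:
  assumes h: "SF U h"
  shows "e p i (\<lambda>q. e q j h) - e p j (\<lambda>q. e q i h) + (\<Sum>c\<in>UNIV. minus_bracket i j c * e p c h) = 0"
proof -
  have "nabla M p (e p i) (\<lambda>q. e q j) h - nabla M p (e p j) (\<lambda>q. e q i) h = e p i (\<lambda>q. e q j h) - e p j (\<lambda>q. e q i h)"
    by (rule lc_torsion_free[OF feV feV p h])
  then show ?thesis
    by (simp add: nabla_frame_frame minus_bracket_def left_diff_distrib sum_subtractf sum_negf)
qed

lemma curvature_conn_frame:
  assumes F: "SF U F"
  shows "curvature M (conn E) (\<lambda>q. e q i) (\<lambda>q. e q j) (\<lambda>q. fc (e q) (F q)) p (e p) = frame_curv i j F"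
proof -
  have "conn E p (nabla M p (e p i) (\<lambda>q. e q j)) (\<lambda>q. fc (e q) (F q)) (e p)
    = (\<Sum>c\<in>UNIV. (- christoffel e p (e p i) j c) *\<^sub>R frame_conn e p (e p c) F)" for i j
    unfolding nabla_frame_frame frame_conn_def[symmetric] by (rule frame_conn_sum_vector[OF e p feT[OF p] F])
  then show ?thesis
    by (simp add: curvature_def nabla2_def conn_conn_frame[OF e p feT[OF p] feV F] frame_curv_def minus_bracket_def
        scaleR_left_diff_distrib sum_subtractf sum_negf)
qed

text \<open>The curvature is tensorial: all derivatives of the coefficients cancel, as the connection on
  the tangent bundle is torsion free.\<close>
lemma frame_curv_tensorial:
  assumes F: "SF U F"
  shows "frame_curv i j F = (\<Sum>b\<in>Basis. (F p \<bullet> b) *\<^sub>R frame_curv i j (\<lambda>_. b))"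
proof -
  let ?h = "\<lambda>b q. F q \<bullet> b" and ?C = "\<lambda>i b q. frame_conn e q (e q i) (\<lambda>_. b)"
  have h: "SF U (?h b)" for b by (rule smooth_fun_inner[OF F smooth_fun_const[OF foU]])
  have c: "SF U (\<lambda>q. b)" for b :: 'e by (rule smooth_fun_const[OF foU])
  have C: "SF U (?C i b)" for i b by (rule frame_conn_smooth[OF e feV c])
  have dh: "SF U (\<lambda>q. e q i (?h b))" for i b by (rule smooth_vfieldD(3)[OF feV subset_refl h])
  have F_eq: "F = (\<lambda>q. \<Sum>b\<in>Basis. ?h b q *\<^sub>R b)" by (simp add: euclidean_representation)
  have 1: "frame_conn e q (e q i) F = (\<Sum>b\<in>Basis. e q i (?h b) *\<^sub>R b + ?h b q *\<^sub>R ?C i b q)" if q: "q \<in> U" for q i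
    by (subst F_eq) (rule frame_conn_sum[OF e q feT[OF q] h c])
  have 2: "frame_conn e p (e p i) (\<lambda>q. frame_conn e q (e q j) F)
    = (\<Sum>b\<in>Basis. e p i (\<lambda>q. e q j (?h b)) *\<^sub>R b + e p j (?h b) *\<^sub>R ?C i b p)
      + (\<Sum>b\<in>Basis. e p i (?h b) *\<^sub>R ?C j b p + ?h b p *\<^sub>R frame_conn e p (e p i) (?C j b))" for i j
  proof -
    have s1: "SF U (\<lambda>q. \<Sum>b\<in>Basis. e q j (?h b) *\<^sub>R b)" and s2: "SF U (\<lambda>q. \<Sum>b\<in>Basis. ?h b q *\<^sub>R ?C j b q)"
      by (intro smooth_fun_sum foU smooth_fun_scaleR dh c h C)+
    have "frame_conn e p (e p i) (\<lambda>q. frame_conn e q (e q j) F)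
      = frame_conn e p (e p i) (\<lambda>q. (\<Sum>b\<in>Basis. e q j (?h b) *\<^sub>R b) + (\<Sum>b\<in>Basis. ?h b q *\<^sub>R ?C j b q))"
      by (rule frame_conn_cong[OF e p feT[OF p] frame_conn_smooth[OF e feV F] smooth_fun_add[OF s1 s2]])
        (simp add: 1 sum.distrib)
    then show ?thesis
      by (simp only: frame_conn_add[OF e p feT[OF p] s1 s2] frame_conn_sum[OF e p feT[OF p] dh c] frame_conn_sum[OF e p feT[OF p] h C])
  qed
  have "frame_curv i j F = (\<Sum>b\<in>Basis. (e p i (\<lambda>q. e q j (?h b)) - e p j (\<lambda>q. e q i (?h b))) *\<^sub>R b
       + ?h b p *\<^sub>R (frame_conn e p (e p i) (?C j b) - frame_conn e p (e p j) (?C i b)))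
     + (\<Sum>c\<in>UNIV. \<Sum>b\<in>Basis. (minus_bracket i j c * e p c (?h b)) *\<^sub>R b + ?h b p *\<^sub>R minus_bracket i j c *\<^sub>R ?C c b p)"
  proof -
    have "(\<Sum>c\<in>UNIV. minus_bracket i j c *\<^sub>R frame_conn e p (e p c) F)
      = (\<Sum>c\<in>UNIV. \<Sum>b\<in>Basis. (minus_bracket i j c * e p c (?h b)) *\<^sub>R b + ?h b p *\<^sub>R minus_bracket i j c *\<^sub>R ?C c b p)"
      by (simp add: 1[OF p] scaleR_sum_right scaleR_right_distrib mult.commute)
    then show ?thesis
      by (simp add: frame_curv_def 2 sum.distrib scaleR_left_diff_distrib scaleR_right_diff_distrib sum_subtractf)
  qed
  also have "(\<Sum>c\<in>UNIV. \<Sum>b\<in>Basis. (minus_bracket i j c * e p c (?h b)) *\<^sub>R b + ?h b p *\<^sub>R minus_bracket i j c *\<^sub>R ?C c b p)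
     = (\<Sum>b\<in>Basis. (\<Sum>c\<in>UNIV. minus_bracket i j c * e p c (?h b)) *\<^sub>R b + ?h b p *\<^sub>R (\<Sum>c\<in>UNIV. minus_bracket i j c *\<^sub>R ?C c b p))"
    by (subst sum.swap) (simp add: sum.distrib scaleR_sum_left scaleR_sum_right)
  finally have "frame_curv i j F = (\<Sum>b\<in>Basis. (e p i (\<lambda>q. e q j (?h b)) - e p j (\<lambda>q. e q i (?h b)) + (\<Sum>c\<in>UNIV. minus_bracket i j c * e p c (?h b))) *\<^sub>R b
       + ?h b p *\<^sub>R frame_curv i j (\<lambda>_. b))"
    by (simp add: frame_curv_def sum.distrib scaleR_left_distrib scaleR_right_distrib add_ac)
  then show ?thesis by (simp only: frame_bracket[OF h]) simp
qed

lemma g_diff: "u \<in> TS q \<Longrightarrow> v \<in> TS q \<Longrightarrow> w \<in> TS q \<Longrightarrow> g q (\<lambda>h. u h - v h) w = g q u w - g q v w"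
  using g_lin[of u q v w 1 "-1"] by simp

lemma tangent_diff: "u \<in> TS q \<Longrightarrow> v \<in> TS q \<Longrightarrow> (\<lambda>h. u h - v h) \<in> TS q"
  using tangent_lincomb[of u q v 1 "-1"] by simp

text \<open>The structure equation \<open>\<Omega> = d\<omega> + \<omega> \<and> \<omega>\<close> for the connection form \<open>\<omega>\<close> given by the Christoffel
  symbols.\<close>
lemma riemann_frame:
  "g p (curvature M (nabla M) (\<lambda>q. e q i) (\<lambda>q. e q j) (\<lambda>q. e q b) p) (e p a)
    = e p i (\<lambda>q. christoffel e q (e q j) a b) - e p j (\<lambda>q. christoffel e q (e q i) a b)
      + ((\<Sum>c\<in>UNIV. christoffel e p (e p i) a c * christoffel e p (e p j) c b)
        - (\<Sum>c\<in>UNIV. christoffel e p (e p j) a c * christoffel e p (e p i) c b))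
      + (\<Sum>c\<in>UNIV. minus_bracket i j c * christoffel e p (e p c) a b)"
proof -
  let ?w = "\<lambda>i. christoffel e p (e p i)"
  note T = feT[OF p]
  have V2: "VF U (\<lambda>q. nabla M q (e q j) (\<lambda>q. e q b))" for j by (rule lc_smooth[OF feV feV])
  have t2: "nabla M p (e p i) (\<lambda>q. nabla M q (e q j) (\<lambda>q. e q b)) \<in> TS p" for i j
    by (rule nabla_tangent[OF V2 p T])
  have t1: "nabla M p (e p j) (\<lambda>q. e q b) \<in> TS p" for j b by (rule nabla_tangent[OF feV p T])
  have t3: "nabla M p (nabla M p (e p i) (\<lambda>q. e q j)) (\<lambda>q. e q b) \<in> TS p" for i j
    by (rule nabla_tangent[OF feV p t1])
  have 1: "g p (nabla M p (e p i) (\<lambda>q. nabla M q (e q j) (\<lambda>q. e q b))) (e p a)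
     = e p i (\<lambda>q. christoffel e q (e q j) a b) + (\<Sum>c\<in>UNIV. ?w i a c * ?w j c b)" for i j
  proof -
    have "e p i (\<lambda>q. christoffel e q (e q j) a b)
       = g p (nabla M p (e p i) (\<lambda>q. nabla M q (e q j) (\<lambda>q. e q b))) (e p a)
         + g p (nabla M p (e p j) (\<lambda>q. e q b)) (nabla M p (e p i) (\<lambda>q. e q a))"
      unfolding christoffel_def by (rule lc_product_rule[OF p foU V2 T feV])
    also have "g p (nabla M p (e p j) (\<lambda>q. e q b)) (nabla M p (e p i) (\<lambda>q. e q a))
       = (\<Sum>c\<in>UNIV. ?w j c b * g p (e p c) (nabla M p (e p i) (\<lambda>q. e q a)))"
      unfolding nabla_frame[OF e p T, of j b] by (rule g_sum_left[OF T t1])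
    also have "\<dots> = (\<Sum>c\<in>UNIV. ?w j c b * ?w i c a)"
      by (intro sum.cong refl arg_cong2[where f = "(*)"]) (simp add: christoffel_def g_sym[OF T t1])
    also have "\<dots> = - (\<Sum>c\<in>UNIV. ?w i a c * ?w j c b)"
      unfolding sum_negf[symmetric]
      by (intro sum.cong refl) (subst christoffel_skew[OF e p T, of i _ a], simp)
    finally show ?thesis by simp
  qed
  have 2: "g p (nabla M p (nabla M p (e p i) (\<lambda>q. e q j)) (\<lambda>q. e q b)) (e p a) = (\<Sum>c\<in>UNIV. (- ?w i j c) * ?w c a b)" for i j
    unfolding nabla_frame_frame christoffel_def[symmetric] by (rule christoffel_sum_vector[OF e p T])
  have "g p (curvature M (nabla M) (\<lambda>q. e q i) (\<lambda>q. e q j) (\<lambda>q. e q b) p) (e p a)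
    = (g p (nabla M p (e p i) (\<lambda>q. nabla M q (e q j) (\<lambda>q. e q b))) (e p a) - g p (nabla M p (nabla M p (e p i) (\<lambda>q. e q j)) (\<lambda>q. e q b)) (e p a))
     - (g p (nabla M p (e p j) (\<lambda>q. nabla M q (e q i) (\<lambda>q. e q b))) (e p a) - g p (nabla M p (nabla M p (e p j) (\<lambda>q. e q i)) (\<lambda>q. e q b)) (e p a))"
    unfolding curvature_def nabla2_def
    by (simp only: g_diff[OF tangent_diff[OF t2 t3] tangent_diff[OF t2 t3] T] g_diff[OF t2 t3 T])
  then show ?thesis
    unfolding 1 2 by (simp add: minus_bracket_def left_diff_distrib sum_subtractf sum_negf)
qed

text \<open>The mixed terms, with one derivative of the components and one Christoffel symbol, are symmetric in
  \<open>i\<close> and \<open>j\<close>. There remain the curvature of \<open>\<nabla>\<^sup>E\<close> on the components and, for the indices, the derivation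
  by derivatives and commutators of the Christoffel symbols, which \<open>riemann_frame\<close> identifies as the
  curvature of \<open>M\<close>.\<close>
lemma ricci_frame:
  assumes S: "\<And>l. SF U (\<lambda>q. S q l)"
    and G: "\<And>q i l. q \<in> U \<Longrightarrow> G q (i # l) = tensor_deriv e q (e q i) S l" "\<And>l. SF U (\<lambda>q. G q l)"
  shows "tensor_deriv e p (e p i) G (j # l) - tensor_deriv e p (e p j) G (i # l)
    = frame_curv i j (\<lambda>q. S q l)
      + derivation_ext (\<lambda>a b. g p (curvature M (nabla M) (\<lambda>q. e q i) (\<lambda>q. e q j) (\<lambda>q. e q b) p) (e p a)) (S p) l"
proof -
  let ?w = "\<lambda>i. christoffel e p (e p i)" and ?dw = "\<lambda>i j a b. e p i (\<lambda>q. christoffel e q (e q j) a b)"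
  let ?C = "\<lambda>i l. frame_conn e p (e p i) (\<lambda>q. S q l)"
  let ?A = "\<lambda>i j. frame_conn e p (e p i) (\<lambda>q. frame_conn e q (e q j) (\<lambda>q. S q l))"
  note T = feT[OF p]
  have N: "G p (j # l) = ?C j l + derivation_ext (?w j) (S p) l" for j l
    by (simp add: G(1)[OF p] tensor_deriv_def)
  have 1: "frame_conn e p (e p i) (\<lambda>q. G q (j # l))
     = ?A i j + (derivation_ext (?dw i j) (S p) l + derivation_ext (?w j) (?C i) l)" for i j
  proof -
    have c: "SF U (\<lambda>q. frame_conn e q (e q j) (\<lambda>q. S q l))" by (rule frame_conn_smooth[OF e feV S])
    have d: "SF U (\<lambda>q. derivation_ext (christoffel e q (e q j)) (S q) l)" by (rule derivation_ext_smooth[OF e feV S])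
    have "frame_conn e p (e p i) (\<lambda>q. G q (j # l))
      = frame_conn e p (e p i) (\<lambda>q. frame_conn e q (e q j) (\<lambda>q. S q l) + derivation_ext (christoffel e q (e q j)) (S q) l)"
      by (rule frame_conn_cong[OF e p T G(2) smooth_fun_add[OF c d]]) (simp add: G(1) tensor_deriv_def)
    then show ?thesis
      by (simp only: frame_conn_add[OF e p T c d] frame_conn_derivation_ext[OF T christoffel_smooth[OF e feV] S])
  qed
  have 2: "tensor_deriv e p (e p i) G (j # l)
    = ?A i j + derivation_ext (?dw i j) (S p) l + derivation_ext (?w j) (?C i) l
      + (\<Sum>c\<in>UNIV. ?w i j c *\<^sub>R (?C c l + derivation_ext (?w c) (S p) l))
      + derivation_ext (?w i) (?C j) l + derivation_ext (?w i) (derivation_ext (?w j) (S p)) l" for i j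
    by (simp add: tensor_deriv_def[of e p "e p i" G] 1 derivation_ext_Cons N derivation_ext_add)
  have D: "derivation_ext (\<lambda>a b. g p (curvature M (nabla M) (\<lambda>q. e q i) (\<lambda>q. e q j) (\<lambda>q. e q b) p) (e p a)) (S p) l
    = derivation_ext (?dw i j) (S p) l - derivation_ext (?dw j i) (S p) l
      + (derivation_ext (?w i) (derivation_ext (?w j) (S p)) l - derivation_ext (?w j) (derivation_ext (?w i) (S p)) l)
      + (\<Sum>c\<in>UNIV. minus_bracket i j c *\<^sub>R derivation_ext (?w c) (S p) l)"
  proof -
    have add: "derivation_ext (\<lambda>a b. X a b + Y a b) K l = derivation_ext X K l + derivation_ext Y K l"
      and diff: "derivation_ext (\<lambda>a b. X a b - Y a b) K l = derivation_ext X K l - derivation_ext Y K l"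
      for X Y and K :: "('n, 'e) tensor"
      by (simp_all add: derivation_ext_def scaleR_left_distrib scaleR_left_diff_distrib sum.distrib sum_subtractf)
    have com: "derivation_ext (\<lambda>a b. (\<Sum>c\<in>UNIV. ?w i a c * ?w j c b) - (\<Sum>c\<in>UNIV. ?w j a c * ?w i c b)) (S p) l
      = derivation_ext (?w i) (derivation_ext (?w j) (S p)) l - derivation_ext (?w j) (derivation_ext (?w i) (S p)) l"
      by (rule derivation_ext_commutator[symmetric])
    show ?thesis
      unfolding riemann_frame add com derivation_ext_matrix_sum unfolding diff by simp
  qed
  show ?thesis
    unfolding 2 D frame_curv_def
    by (simp add: minus_bracket_def scaleR_right_distrib scaleR_left_diff_distrib sum.distrib sum_subtractf)
qed

end

lemma ricci_identity:
  assumes s: "s \<in> Secs" and f: "f \<in> fr p"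
  shows "grad (grad s) p f (i # j # l) - grad (grad s) p f (j # i # l)
    = curv_E M E p f i j (s p f l) + derivation_ext (riem_matrix M p f i j) (s p f) l"
proof -
  define e where "e = frame_ext M p f"
  obtain U where U: "p \<in> U" "local_frame M U e" and ep: "e p = f"
    using frame_ext[OF f] unfolding e_def by blast
  note sm = section_smooth[OF s U(2)] and gs = grad_sections[OF s]
  have "grad (grad s) p f (i # j # l) - grad (grad s) p f (j # i # l)
    = frame_curv e p i j (\<lambda>q. s q (e q) l)
      + derivation_ext (\<lambda>a b. g p (curvature M (nabla M) (\<lambda>q. e q i) (\<lambda>q. e q j) (\<lambda>q. e q b) p) (e p a)) (s p (e p)) l"
    using ricci_frame[OF U(2,1) sm grad_local[OF s U(2)] section_smooth[OF gs U(2)]]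
      grad_local[OF gs U(2,1)] ep by simp
  also have "frame_curv e p i j (\<lambda>q. s q (e q) l) = frame_curv e p i j (\<lambda>_. s p f l)"
    using frame_curv_tensorial[OF U(2,1) sm, of i j l] frame_curv_tensorial[OF U(2,1) smooth_fun_const[OF local_frameD(3)[OF U(2)]], of i j "s p f l"]
      ep by simp
  also have "frame_curv e p i j (\<lambda>_. s p f l) = curv_E M E p f i j (s p f l)"
    using curvature_conn_frame[OF U(2,1) smooth_fun_const[OF local_frameD(3)[OF U(2)]], of i j "s p f l"] ep
    by (simp add: curv_E_def Let_def e_def)
  also have "(\<lambda>a b. g p (curvature M (nabla M) (\<lambda>q. e q i) (\<lambda>q. e q j) (\<lambda>q. e q b) p) (e p a)) = riem_matrix M p f i j"
    by (intro ext) (simp only: riem_matrix_def Let_def e_def[symmetric] ep)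
  finally show ?thesis using ep by simp
qed

text \<open>By the Ricci identity \<open>q(R)\<^sup>E s\<close> is \<open>1/2 \<Sum>\<^sub>i\<^sub>j (e\<^sub>i \<and> e\<^sub>j)\<^sub>* (\<nabla>\<^sup>2\<^sub>i\<^sub>j - \<nabla>\<^sup>2\<^sub>j\<^sub>i) s\<close>, and the two halves agree
  as \<open>e\<^sub>i \<and> e\<^sub>j\<close> is skew.\<close>
lemma qR_E_grad:
  assumes s: "s \<in> sections M E (Sym0 k)" and f: "f \<in> fr p"
  shows "qR_E M E k s p f l
    = (\<Sum>i\<in>UNIV. \<Sum>j\<in>UNIV. wedge_act k (std_basis i) (std_basis j) (slot j (slot i (grad (grad s) p f))) l)"
proof -
  have s': "s \<in> Secs" "s p f \<in> Sym0 k" using sectionsD[OF s] f by auto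
  define H where "H i j = slot j (slot i (grad (grad s) p f))" for i j
  have H: "H i j \<in> Sym k" for i j
    unfolding H_def by (rule Sym0D(1)[OF grad_T_Sym0_slots[OF grad_T_Sym0[OF s] f]])
  define D where "D i j = derivation_ext (riem_matrix M p f i j) (s p f)" for i j
  define R where "R i j = (\<lambda>l. curv_E M E p f i j (s p f l))" for i j
  have ric: "R i j = (\<lambda>l. H i j l - H j i l - D i j l)" for i j
    using ricci_identity[OF s'(1) f, of i j] by (auto simp: R_def H_def D_def fun_eq_iff algebra_simps)
  have D: "D i j \<in> Sym k" for i j unfolding D_def by (rule Sym_derivation_ext[OF Sym0D(1)[OF s'(2)]])
  have R: "R i j \<in> Sym k" for i j unfolding ric by (intro Sym_diff H D)
  let ?W = "\<lambda>i j K. sym_mult (std_basis j) (slot i K) l - sym_mult (std_basis i) (slot j K) l"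
  have W: "wedge_act k (std_basis i) (std_basis j) K l = ?W i j K" if "K \<in> Sym k" for i j and K :: "('n, 'e) tensor"
    using that by (simp add: wedge_act_def contract_basis)
  have lin: "?W i j (D i j) + ?W i j (R i j) = ?W i j (H i j) + ?W j i (H j i)" for i j
    unfolding ric by (simp add: sym_mult_diff)
  have "qR_E M E k s p f l = (1/2) *\<^sub>R (\<Sum>i\<in>UNIV. \<Sum>j\<in>UNIV. ?W i j (D i j) + ?W i j (R i j))"
    using f W[OF D] W[OF R] by (simp add: qR_E_def qR_def D_def R_def scaleR_right_distrib sum.distrib)
  also have "\<dots> = (1/2) *\<^sub>R ((\<Sum>i\<in>UNIV. \<Sum>j\<in>UNIV. ?W i j (H i j)) + (\<Sum>i\<in>UNIV. \<Sum>j\<in>UNIV. ?W j i (H j i)))"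
    unfolding lin sum.distrib ..
  also have "(\<Sum>i\<in>UNIV. \<Sum>j\<in>UNIV. ?W j i (H j i)) = (\<Sum>i\<in>UNIV. \<Sum>j\<in>UNIV. ?W i j (H i j))"
    by (rule sum.swap)
  also have "(1/2) *\<^sub>R ((\<Sum>i\<in>UNIV. \<Sum>j\<in>UNIV. ?W i j (H i j)) + (\<Sum>i\<in>UNIV. \<Sum>j\<in>UNIV. ?W i j (H i j))) = (\<Sum>i\<in>UNIV. \<Sum>j\<in>UNIV. ?W i j (H i j))"
    by (simp add: scaleR_2[symmetric])
  finally show ?thesis using W[OF H] by (simp add: H_def)
qed

end

section \<open>Integrals of derivatives of compactly supported functions\<close>

lemma continuous_compact_support_bounded:
  fixes f :: "'a::topological_space \<Rightarrow> real"
  assumes "continuous_on UNIV f" "compact K" "\<And>x. x \<notin> K \<Longrightarrow> f x = 0"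
  obtains B where "B \<ge> 0" "\<And>x. \<bar>f x\<bar> \<le> B"
proof -
  have "compact (f ` K)" using assms by (intro compact_continuous_image) (auto intro: continuous_on_subset)
  then obtain B where B: "\<forall>y\<in>f ` K. norm y \<le> B" using compact_imp_bounded bounded_iff by blast
  have "\<bar>f x\<bar> \<le> max B 0" for x using B assms(3)[of x] by (cases "x \<in> K") auto
  then show thesis using that[of "max B 0"] by simp
qed

lemma continuous_compact_support_integrable_lborel:
  fixes f :: "'a::euclidean_space \<Rightarrow> real"
  assumes "continuous_on UNIV f" "compact K" "\<And>x. x \<notin> K \<Longrightarrow> f x = 0"
  shows "integrable lborel f"
proof -
  obtain B where B: "\<And>x. \<bar>f x\<bar> \<le> B" using continuous_compact_support_bounded[OF assms] by blast
  have "f \<in> borel_measurable lborel" using borel_measurable_continuous_onI[OF assms(1)] by simp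
  then show ?thesis
    using assms(2,3) B emeasure_compact_finite[OF assms(2)]
    by (intro integrableI_bounded_set[where A = K and B = B]) (auto intro: borel_compact)
qed

text \<open>Since Lebesgue measure is translation invariant, the integral of all difference quotients
  vanishes; by dominated convergence, so does the integral of the derivative.\<close>
lemma integral_derivative_compact_support:
  fixes f :: "'a::euclidean_space \<Rightarrow> real"
  assumes f: "smooth_on UNIV f" and K: "compact K" "\<And>x. x \<notin> K \<Longrightarrow> f x = 0"
  shows "integral\<^sup>L lborel (\<lambda>x. frechet_derivative f (at x) v) = 0"
    and "integrable lborel (\<lambda>x. frechet_derivative f (at x) v)"
proof -
  let ?D = "\<lambda>x. frechet_derivative f (at x) v"
  have cf: "continuous_on UNIV f" using smooth_on_continuous_on[OF f] .
  have cD: "continuous_on UNIV ?D" using smooth_on_continuous_on[OF smooth_on_frechet_derivative[OF f]] .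
  have D0: "?D x = 0" if "x \<notin> K" for x
  proof -
    have "frechet_derivative f (at x) = frechet_derivative (\<lambda>x. 0) (at x)"
      by (rule frechet_derivative_cong_open(2)[of "- K"]) (use K that in \<open>auto simp: compact_imp_closed open_Compl\<close>)
    then show ?thesis by simp
  qed
  obtain C where C: "C \<ge> 0" "\<And>x. \<bar>?D x\<bar> \<le> C"
    using continuous_compact_support_bounded[OF cD K(1) D0] by blast
  show int: "integrable lborel ?D" by (rule continuous_compact_support_integrable_lborel[OF cD K(1) D0])
  obtain R where R: "\<And>x. x \<in> K \<Longrightarrow> norm x \<le> R" using compact_imp_bounded[OF K(1)] bounded_iff by blast
  define t where "t n = inverse (real (Suc n))" for n
  have t: "0 < t n" "t n \<le> 1" for n by (simp_all add: t_def inverse_le_1_iff)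
  have t0: "t \<longlonglongrightarrow> 0" unfolding t_def[abs_def] by (rule LIMSEQ_inverse_real_of_nat)
  define F where "F n x = (f (t n *\<^sub>R v + x) - f x) / t n" for n x
  have der: "((\<lambda>s. f (s *\<^sub>R v + x)) has_real_derivative ?D (s *\<^sub>R v + x)) (at s)" for s x
  proof -
    have "(f has_derivative frechet_derivative f (at (s *\<^sub>R v + x))) (at (s *\<^sub>R v + x))"
      using smooth_on_differentiable[OF f] frechet_derivative_works by blast
    then have "((\<lambda>s. f (s *\<^sub>R v + x)) has_derivative (\<lambda>h. frechet_derivative f (at (s *\<^sub>R v + x)) (h *\<^sub>R v))) (at s)"
      by (rule has_derivative_compose[rotated]) (auto intro!: derivative_eq_intros)
    moreover have "linear (frechet_derivative f (at (s *\<^sub>R v + x)))"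
      using linear_frechet_derivative[OF smooth_on_differentiable[OF f]] by simp
    ultimately show ?thesis
      unfolding has_field_derivative_def by (auto simp: linear_cmul mult.commute elim!: has_derivative_eq_rhs)
  qed
  have bound: "\<bar>F n x\<bar> \<le> C" for n x
  proof -
    obtain z where "f (t n *\<^sub>R v + x) - f (0 *\<^sub>R v + x) = (t n - 0) * ?D (z *\<^sub>R v + x)"
      using MVT2[OF t(1)[of n], of "\<lambda>s. f (s *\<^sub>R v + x)" "\<lambda>s. ?D (s *\<^sub>R v + x)"] der by blast
    then have "F n x = ?D (z *\<^sub>R v + x)" using t(1)[of n] by (simp add: F_def)
    then show ?thesis using C(2) by simp
  qed
  let ?w = "\<lambda>x::'a. C * indicator (cball 0 (R + norm v)) x :: real"
  have dom: "norm (F n x) \<le> ?w x" for n x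
  proof (cases "x \<in> cball 0 (R + norm v)")
    case False
    then have n: "norm x > R + norm v" by simp
    have "norm x \<le> norm (t n *\<^sub>R v + x) + norm (t n *\<^sub>R v)"
      using norm_triangle_ineq4[of "t n *\<^sub>R v + x" "t n *\<^sub>R v"] by simp
    moreover have "norm (t n *\<^sub>R v) \<le> norm v" using t[of n] by (simp add: mult_left_le_one_le)
    ultimately have "norm (t n *\<^sub>R v + x) > R" using n by linarith
    then have "f (t n *\<^sub>R v + x) = 0" "f x = 0" using R K(2) n norm_ge_zero[of v] by fastforce+
    then show ?thesis using C by (simp add: F_def)
  qed (use bound in simp)
  have intf: "integrable lborel f" by (rule continuous_compact_support_integrable_lborel[OF cf K])
  have meas: "f \<in> borel_measurable borel" using borel_measurable_continuous_onI[OF cf] .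
  have shift: "integrable lborel (\<lambda>x. f (a + x))" "integral\<^sup>L lborel (\<lambda>x. f (a + x)) = integral\<^sup>L lborel f" for a
  proof -
    have m: "(+) a \<in> measurable lborel borel" by simp
    show "integrable lborel (\<lambda>x. f (a + x))"
      using integrable_distr[OF m, of f] intf by (simp add: lborel_distr_plus)
    show "integral\<^sup>L lborel (\<lambda>x. f (a + x)) = integral\<^sup>L lborel f"
      using integral_distr[OF m meas] by (simp add: lborel_distr_plus)
  qed
  have zero: "integral\<^sup>L lborel (F n) = 0" for n
    unfolding F_def[abs_def] by (simp add: shift intf)
  have "(\<lambda>n. integral\<^sup>L lborel (F n)) \<longlonglongrightarrow> integral\<^sup>L lborel ?D"
  proof (rule integral_dominated_convergence[where w = ?w])
    show "integrable lborel ?w"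
      using emeasure_compact_finite[OF compact_cball, of "0::'a" "R + norm v"]
      by (intro integrable_mult_right integrable_real_indicator) auto
    show "?D \<in> borel_measurable lborel" using int by auto
    show "F n \<in> borel_measurable lborel" for n
      unfolding F_def[abs_def] by (intro borel_measurable_divide borel_measurable_diff borel_measurable_const borel_measurable_integrable shift intf)
    show "AE x in lborel. (\<lambda>n. F n x) \<longlonglongrightarrow> ?D x"
    proof (rule AE_I2)
      fix x
      have "((\<lambda>h. (f (h *\<^sub>R v + x) - f x) / h) \<longlongrightarrow> ?D x) (at 0)"
        using der[of x 0] by (simp add: DERIV_def)
      moreover have "filterlim t (at 0) sequentially"
        using t0 t(1) by (auto simp: filterlim_at intro!: eventuallyI) (metis less_irrefl)
      ultimately show "(\<lambda>n. F n x) \<longlonglongrightarrow> ?D x"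
        unfolding F_def by (rule filterlim_compose)
    qed
    show "AE x in lborel. norm (F n x) \<le> ?w x" for n by (rule AE_I2) (rule dom)
  qed
  then have "(\<lambda>n. 0) \<longlonglongrightarrow> integral\<^sup>L lborel ?D" by (simp add: zero)
  then show "integral\<^sup>L lborel ?D = 0" by (simp add: LIMSEQ_const_iff)
qed

section \<open>The derivative of the determinant\<close>

text \<open>Only the identity contributes: a product of entries for any other permutation has, even with one factor
  removed, an off-diagonal entry of the identity matrix as a factor.\<close>
lemma has_derivative_det_at_one:
  fixes B :: "'a::real_normed_vector \<Rightarrow> real ^ 'n ^ 'n"
  assumes B: "\<And>i j. ((\<lambda>x. B x $ i $ j) has_derivative (\<lambda>h. B' h $ i $ j)) (at x)" and 1: "B x = mat 1"
  shows "((\<lambda>x. det (B x)) has_derivative (\<lambda>h. trace (B' h))) (at x)"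
proof -
  let ?S = "{\<sigma>. \<sigma> permutes (UNIV :: 'n set)}"
  have "((\<lambda>x. det (B x)) has_derivative
    (\<lambda>h. \<Sum>\<sigma>\<in>?S. of_int (sign \<sigma>) * (\<Sum>i\<in>UNIV. B' h $ i $ \<sigma> i * (\<Prod>j\<in>UNIV - {i}. B x $ j $ \<sigma> j)))) (at x)"
    unfolding det_def by (intro has_derivative_sum has_derivative_mult_right has_derivative_prod B)
  moreover have "(\<Sum>\<sigma>\<in>?S. of_int (sign \<sigma>) * (\<Sum>i\<in>UNIV. B' h $ i $ \<sigma> i * (\<Prod>j\<in>UNIV - {i}. B x $ j $ \<sigma> j))) = trace (B' h)" for h
  proof -
    have z: "(\<Prod>j\<in>UNIV - {i}. B x $ j $ \<sigma> j) = 0" if s: "\<sigma> \<in> ?S" "\<sigma> \<noteq> id" for \<sigma> i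
    proof -
      obtain k where k: "\<sigma> k \<noteq> k" using s(2) by (auto simp: fun_eq_iff)
      have inj: "inj \<sigma>" using s(1) permutes_inj by blast
      have "\<exists>j. j \<noteq> i \<and> \<sigma> j \<noteq> j"
      proof (cases "k = i")
        case True
        have "\<sigma> (\<sigma> k) \<noteq> \<sigma> k" using k injD[OF inj, of "\<sigma> k" k] by auto
        then show ?thesis using k True by auto
      qed (use k in auto)
      then obtain j where "j \<noteq> i" "\<sigma> j \<noteq> j" by blast
      then show ?thesis by (intro prod_zero) (auto simp: 1 mat_def intro!: bexI[of _ j])
    qed
    have "(\<Sum>\<sigma>\<in>?S. of_int (sign \<sigma>) * (\<Sum>i\<in>UNIV. B' h $ i $ \<sigma> i * (\<Prod>j\<in>UNIV - {i}. B x $ j $ \<sigma> j)))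
      = (\<Sum>\<sigma>\<in>{id}. of_int (sign \<sigma>) * (\<Sum>i\<in>UNIV. B' h $ i $ \<sigma> i * (\<Prod>j\<in>UNIV - {i}. B x $ j $ \<sigma> j)))"
      by (rule sum.mono_neutral_right) (auto simp: z permutes_id)
    also have "\<dots> = trace (B' h)" by (simp add: 1 mat_def trace_def)
    finally show ?thesis .
  qed
  ultimately show ?thesis by simp
qed

text \<open>Jacobi's formula; multiplication by the inverse matrix \<open>A\<close> reduces it to the identity matrix.\<close>
lemma has_derivative_det:
  fixes B :: "'a::real_normed_vector \<Rightarrow> real ^ 'n ^ 'n"
  assumes B: "\<And>i j. ((\<lambda>x. B x $ i $ j) has_derivative (\<lambda>h. B' h $ i $ j)) (at x)" and A: "A ** B x = mat 1"
  shows "((\<lambda>x. det (B x)) has_derivative (\<lambda>h. det (B x) * trace (A ** B' h))) (at x)"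
proof -
  have "((\<lambda>x. (A ** B x) $ i $ j) has_derivative (\<lambda>h. (A ** B' h) $ i $ j)) (at x)" for i j
    unfolding matrix_matrix_mult_def by (simp, intro has_derivative_sum has_derivative_mult_right B)
  from has_derivative_det_at_one[OF this A]
  have "((\<lambda>y. det (B x) * det (A ** B y)) has_derivative (\<lambda>h. det (B x) * trace (A ** B' h))) (at x)"
    by (rule has_derivative_mult_right)
  moreover have "det (B x) * det (A ** B y) = det (B y)" for y
  proof -
    have "det A * det (B x) = 1" using arg_cong[OF A, of det] by (simp add: det_mul)
    then show ?thesis by (simp add: det_mul mult.assoc[symmetric] mult.commute[of "det (B x)"])
  qed
  ultimately show ?thesis by simp
qed

section \<open>The divergence theorem\<close>

context riemannian_manifold begin

subsection \<open>The divergence in coordinates\<close>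

definition divergence :: "('m \<Rightarrow> 'm tvec) \<Rightarrow> 'm \<Rightarrow> real" where
  "divergence X p = (let f = (SOME f. f \<in> fr p) in \<Sum>i\<in>UNIV. g p (nabla M p (f i) X) (f i))"

abbreviation coord :: "'m set \<Rightarrow> ('m \<Rightarrow> real ^ 'n) \<Rightarrow> 'n \<Rightarrow> 'm \<Rightarrow> 'm tvec" where
  "coord U \<phi> i \<equiv> \<lambda>q. chart_tvec (charts M) (U, \<phi>) q (axis i 1)"

text \<open>Both sides are the trace of the endomorphism \<open>v \<mapsto> \<nabla>\<^sub>v X\<close>.\<close>
lemma trace_frame_coord:
  assumes c: "(U, \<phi>) \<in> charts M" "p \<in> U" and X: "VF W X" "p \<in> W" and f: "f \<in> fr p"
  shows "(\<Sum>i\<in>UNIV. g p (nabla M p (f i) X) (f i)) = (\<Sum>b\<in>UNIV. nabla M p (coord U \<phi> b p) X (\<lambda>q. \<phi> q $ b))"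
proof -
  let ?d = "\<lambda>b. coord U \<phi> b p"
  have dT: "?d b \<in> TS p" for b by (rule tangent_spaceI[OF c])
  have nT: "nabla M p (?d b) X \<in> TS p" for b by (rule nabla_tangent[OF X dT])
  have "nabla M p (f i) X = (\<lambda>h. \<Sum>b\<in>UNIV. f i (\<lambda>q. \<phi> q $ b) * nabla M p (?d b) X h)" for i
  proof -
    have "f i = (\<lambda>h. \<Sum>b\<in>UNIV. f i (\<lambda>q. \<phi> q $ b) * ?d b h)"
      by (rule ext) (rule tangent_expand[OF c fr_tangent[OF f]])
    then have "nabla M p (f i) X = nabla M p (\<lambda>h. \<Sum>b\<in>UNIV. f i (\<lambda>q. \<phi> q $ b) * ?d b h) X" by simp
    also have "\<dots> = (\<lambda>h. \<Sum>b\<in>UNIV. f i (\<lambda>q. \<phi> q $ b) *\<^sub>R nabla M p (?d b) X h)"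
      by (rule lc_sum_vector[OF X(2) smooth_vfieldD(1)[OF X(1)] X(1) dT])
    finally show ?thesis by simp
  qed
  then have "(\<Sum>i\<in>UNIV. g p (nabla M p (f i) X) (f i)) = (\<Sum>i\<in>UNIV. \<Sum>b\<in>UNIV. f i (\<lambda>q. \<phi> q $ b) * g p (nabla M p (?d b) X) (f i))"
    by (simp add: g_sum_left[OF nT fr_tangent[OF f]])
  also have "\<dots> = (\<Sum>b\<in>UNIV. \<Sum>i\<in>UNIV. g p (nabla M p (?d b) X) (f i) * f i (\<lambda>q. \<phi> q $ b))"
    by (subst sum.swap) (simp add: mult.commute)
  also have "\<dots> = (\<Sum>b\<in>UNIV. nabla M p (?d b) X (\<lambda>q. \<phi> q $ b))"
    by (simp add: fr_expand_apply[OF f nT, symmetric])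
  finally show ?thesis .
qed

lemma some_frame: "(SOME f. f \<in> fr p) \<in> fr p"
  using fr_nonempty[of p] by (simp add: some_in_eq)

lemma divergence_frame:
  assumes X: "VF W X" "p \<in> W" and f: "f \<in> fr p"
  shows "divergence X p = (\<Sum>i\<in>UNIV. g p (nabla M p (f i) X) (f i))"
proof -
  obtain U \<phi> where c: "(U, \<phi>) \<in> charts M" "p \<in> U" using ex_chart by blast
  show ?thesis
    unfolding divergence_def Let_def trace_frame_coord[OF c X some_frame] trace_frame_coord[OF c X f] ..
qed

lemma divergence_smooth:
  assumes X: "VF W X"
  shows "SF W (divergence X)"
proof (rule smooth_fun_local)
  fix p assume p: "p \<in> W"
  obtain f where f: "f \<in> fr p" using fr_nonempty by blast
  obtain e U where e: "e p = f" "p \<in> U" "local_frame M U e" using ex_local_frame[OF f] by blast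
  have o: "open (U \<inter> W)" using local_frameD(3)[OF e(3)] smooth_vfieldD(1)[OF X] by auto
  have eW: "local_frame M (U \<inter> W) e" by (rule local_frame_subset[OF e(3) o]) simp
  have XW: "VF (U \<inter> W) X" by (rule smooth_vfield_subset[OF X o]) simp
  have "SF (U \<inter> W) (\<lambda>q. \<Sum>i\<in>UNIV. g q (nabla M q (e q i) X) (e q i))"
    by (intro smooth_fun_sum o g_smooth lc_smooth XW local_frameD(2)[OF eW])
  then have "SF (U \<inter> W) (divergence X)"
    by (rule smooth_fun_cong) (rule divergence_frame[OF XW _ local_frameD(1)[OF eW], symmetric])
  then show "\<exists>W. p \<in> W \<and> SF W (divergence X)" using p e(2) by blast
qed (rule smooth_vfieldD(1)[OF X])

lemma divergence_add:
  assumes X: "VF W X" and Y: "VF W Y" and p: "p \<in> W"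
  shows "divergence (\<lambda>q h. X q h + Y q h) p = divergence X p + divergence Y p"
proof -
  have o: "open W" using smooth_vfieldD(1)[OF X] .
  have n: "nabla M p v (\<lambda>q h. X q h + Y q h) = (\<lambda>h. 1 * nabla M p v X h + 1 * nabla M p v Y h)" if "v \<in> TS p" for v
    using lc_add[OF p o X that Y] by simp
  note f = some_frame[of p]
  have "g p (nabla M p (f i) (\<lambda>q h. X q h + Y q h)) (f i) = g p (nabla M p (f i) X) (f i) + g p (nabla M p (f i) Y) (f i)"
    if f: "f \<in> fr p" for f i
    unfolding n[OF fr_tangent[OF f]]
    by (subst g_lin[OF nabla_tangent[OF X p fr_tangent[OF f]] nabla_tangent[OF Y p fr_tangent[OF f]] fr_tangent[OF f]]) simp
  then show ?thesis
    unfolding divergence_def Let_def by (simp only: some_frame sum.distrib)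
qed

lemma divergence_zero:
  assumes X: "VF W X" and p: "p \<in> V" "open V" "V \<subseteq> W" and z: "\<And>q. q \<in> V \<Longrightarrow> X q = (\<lambda>h. 0)"
  shows "divergence X p = 0"
proof -
  note f = some_frame[of p]
  have XV: "VF V X" by (rule smooth_vfield_subset[OF X p(2,3)])
  have ZV: "VF V (\<lambda>q h. 0 * X q h)" by (rule smooth_vfield_scale[OF smooth_fun_const[OF p(2)] XV])
  have "nabla M p v X = (\<lambda>h. 0)" if v: "v \<in> TS p" for v
  proof -
    have "nabla M p v X = nabla M p v (\<lambda>q h. 0 * X q h)"
      by (rule lc_local[OF p(1,2) XV ZV v]) (simp add: z)
    also have "\<dots> = (\<lambda>h. 0)"
      using lc_zero[OF p(1,2) XV v] by simp
    finally show ?thesis .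
  qed
  then show ?thesis by (simp add: divergence_def Let_def fr_tangent[OF f] g_zero)
qed

definition density_fun :: "'m set \<Rightarrow> ('m \<Rightarrow> real ^ 'n) \<Rightarrow> 'm \<Rightarrow> real" where
  "density_fun U \<phi> q = sqrt (det (gram_matrix (charts M) g (U, \<phi>) q))"

context
  fixes U \<phi> assumes c: "(U, \<phi>) \<in> charts M"
begin

abbreviation G where "G \<equiv> gram_matrix (charts M) g (U, \<phi>)"

lemma G_nth: "G q $ a $ b = g q (coord U \<phi> a q) (coord U \<phi> b q)"
  by (simp add: gram_matrix_def)

lemma coord_VF: "VF U (coord U \<phi> b)" by (rule smooth_vfield_coord[OF c])
lemma coord_TS: "q \<in> U \<Longrightarrow> coord U \<phi> b q \<in> TS q" by (rule tangent_spaceI[OF c])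
lemma cU: "open U" by (rule chart_open[OF c])

lemma G_det_pos:
  assumes q: "q \<in> U" shows "det (G q) > 0"
proof -
  obtain f where f: "f \<in> fr q" using fr_nonempty by blast
  let ?F = "frame_matrix \<phi> f"
  have "transpose ?F ** G q ** ?F = mat 1"
  proof -
    have fe: "f i = (\<lambda>h. \<Sum>b\<in>UNIV. ?F $ b $ i * coord U \<phi> b q h)" for i
      by (rule ext) (simp add: frame_matrix_def tangent_expand[OF c q fr_tangent[OF f], symmetric])
    have "(if i = j then 1 else 0) = (\<Sum>b\<in>UNIV. (\<Sum>a\<in>UNIV. ?F $ a $ i * G q $ a $ b) * ?F $ b $ j)" for i j
    proof -
      have "(if i = j then 1 else 0) = g q (f i) (f j)" using fr_orth[OF f] by simp
      also have "\<dots> = (\<Sum>b\<in>UNIV. ?F $ b $ j * g q (f i) (coord U \<phi> b q))"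
        by (subst (2) fe) (rule g_sum_right[OF coord_TS[OF q] fr_tangent[OF f]])
      also have "\<dots> = (\<Sum>b\<in>UNIV. ?F $ b $ j * (\<Sum>a\<in>UNIV. ?F $ a $ i * g q (coord U \<phi> a q) (coord U \<phi> b q)))"
        by (subst fe) (simp add: g_sum_left[OF coord_TS[OF q] coord_TS[OF q]])
      finally show ?thesis by (simp add: G_nth mult.commute)
    qed
    then show ?thesis by (simp add: matrix_matrix_mult_def transpose_def mat_def vec_eq_iff)
  qed
  then have "det (transpose ?F ** G q ** ?F) = det (mat 1 :: real^'n^'n)" by (rule arg_cong)
  then have d: "det ?F * det (G q) * det ?F = 1" by (simp add: det_mul)
  have F: "det ?F > 0" using fr_det[OF f c q] .
  show ?thesis
  proof (rule ccontr)
    assume "\<not> det (G q) > 0"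
    then have "det ?F * det (G q) \<le> 0" using F by (simp add: mult_nonneg_nonpos)
    then have "det ?F * det (G q) * det ?F \<le> 0" using F by (simp add: mult_nonpos_nonneg)
    then show False using d by simp
  qed
qed

lemma G_smooth: "SF U (\<lambda>q. G q $ a $ b)"
  unfolding G_nth by (rule g_smooth[OF coord_VF coord_VF])

lemma density_smooth: "SF U (density_fun U \<phi>)" and density_pos: "q \<in> U \<Longrightarrow> density_fun U \<phi> q > 0"
proof -
  have prod: "SF U (\<lambda>q. \<Prod>i\<in>I. G q $ i $ \<sigma> i)" if "finite I" for I \<sigma>
    using that by (induction I) (auto intro!: smooth_fun_const cU smooth_fun_mult G_smooth)
  have "SF U (\<lambda>q. det (G q))"
    unfolding det_def by (rule smooth_fun_sum[OF cU smooth_fun_mult[OF smooth_fun_const[OF cU] prod]]) simp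
  then have "SF U (\<lambda>q. det (G q) * rsqrt (det (G q)))"
    by (intro smooth_fun_mult, assumption, rule smooth_fun_compose[OF _ smooth_on_rsqrt]) (auto intro: G_det_pos)
  then show "SF U (density_fun U \<phi>)"
  proof (rule smooth_fun_cong)
    show "det (G q) * rsqrt (det (G q)) = density_fun U \<phi> q" if "q \<in> U" for q
      using G_det_pos[OF that] by (simp add: density_fun_def rsqrt_def divide_inverse[symmetric] real_div_sqrt)
  qed
  show "q \<in> U \<Longrightarrow> density_fun U \<phi> q > 0" using G_det_pos by (simp add: density_fun_def)
qed

text \<open>With \<open>N\<close> the matrix of \<open>\<nabla>\<^bsub>\<partial>\<^sub>a\<^esub>\<close> on the coordinate fields, the connection being metric gives
  \<open>\<partial>\<^sub>a G = N\<^sup>T G + G N\<close>. Jacobi's formula then yields \<open>2 tr N\<close> for the logarithmic derivative of \<open>det G\<close>.\<close>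
lemma coord_density:
  assumes q: "q \<in> U"
  shows "coord U \<phi> a q (density_fun U \<phi>) = density_fun U \<phi> q * (\<Sum>b\<in>UNIV. nabla M q (coord U \<phi> a q) (coord U \<phi> b) (\<lambda>q. \<phi> q $ b))"
proof -
  let ?d = "coord U \<phi>" and ?v = "coord U \<phi> a q"
  define N :: "real^'n^'n" where "N = (\<chi> d b. nabla M q ?v (?d b) (\<lambda>q. \<phi> q $ d))"
  define x where "x = \<phi> q"
  let ?B = "\<lambda>x. G (inv_into U \<phi> x)"
  have invx: "inv_into U \<phi> x = q" using chart_inv[OF c q] by (simp add: x_def)
  have dB: "((\<lambda>x. ?B x $ i $ j) has_derivative (\<lambda>h. chart_tvec (charts M) (U, \<phi>) q h (\<lambda>q. G q $ i $ j))) (at x)" for i j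
  proof -
    have n: "smooth_near (charts M) q (\<lambda>q. G q $ i $ j)" by (rule smooth_nearI[OF G_smooth q])
    from chart_differentiable[OF c q n] show ?thesis
      by (simp add: x_def chart_tvec_apply[OF n] frechet_derivative_works)
  qed
  have "invertible (?B x)" using G_det_pos[OF q] by (simp add: invx invertible_det_nz)
  then obtain A where A: "A ** ?B x = mat 1" by (auto simp: invertible_left_inverse)
  have dB': "((\<lambda>x. ?B x $ i $ j) has_derivative (\<lambda>h. (\<chi> i j. chart_tvec (charts M) (U, \<phi>) q h (\<lambda>q. G q $ i $ j)) $ i $ j)) (at x)" for i j
    using dB by simp
  from has_derivative_det[OF dB' A]
  have det: "((\<lambda>x. det (?B x)) has_derivative
      (\<lambda>h. det (?B x) * trace (A ** (\<chi> i j. chart_tvec (charts M) (U, \<phi>) q h (\<lambda>q. G q $ i $ j))))) (at x)" .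
  have pos: "det (?B x) > 0" using G_det_pos[OF q] by (simp add: invx)
  have "((\<lambda>x. sqrt (det (?B x))) has_derivative
      (\<lambda>h. det (?B x) * trace (A ** (\<chi> i j. chart_tvec (charts M) (U, \<phi>) q h (\<lambda>q. G q $ i $ j))) * (inverse (sqrt (det (?B x))) / 2))) (at x)"
    using has_derivative_real_sqrt[OF pos det] by simp
  then have "((\<lambda>x. density_fun U \<phi> (inv_into U \<phi> x)) has_derivative
      (\<lambda>h. det (?B x) * trace (A ** (\<chi> i j. chart_tvec (charts M) (U, \<phi>) q h (\<lambda>q. G q $ i $ j))) * (inverse (sqrt (det (?B x))) / 2))) (at x)"
    by (simp add: density_fun_def)
  from frechet_derivative_at[OF this, symmetric]
  have 1: "?v (density_fun U \<phi>) = det (G q) * trace (A ** (\<chi> i j. ?v (\<lambda>q. G q $ i $ j))) * (inverse (sqrt (det (G q))) / 2)"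
    using chart_tvec_apply[OF smooth_nearI[OF density_smooth q]] by (simp add: x_def[symmetric] invx)
  have dG: "?v (\<lambda>q. G q $ i $ j) = (transpose N ** G q + G q ** N) $ i $ j" for i j
  proof -
    have nT: "nabla M q ?v (?d i) \<in> TS q" for i by (rule nabla_tangent[OF coord_VF q coord_TS[OF q]])
    have ne: "nabla M q ?v (?d i) = (\<lambda>h. \<Sum>d\<in>UNIV. N $ d $ i * ?d d q h)" for i
      by (rule ext) (simp add: N_def tangent_expand[OF c q nT, symmetric])
    have "?v (\<lambda>q. G q $ i $ j) = g q (nabla M q ?v (?d i)) (?d j q) + g q (?d i q) (nabla M q ?v (?d j))"
      unfolding G_nth by (rule lc_product_rule[OF q cU coord_VF coord_TS[OF q] coord_VF])
    also have "\<dots> = (\<Sum>d\<in>UNIV. N $ d $ i * G q $ d $ j) + (\<Sum>d\<in>UNIV. N $ d $ j * G q $ i $ d)"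
      unfolding ne G_nth by (simp add: g_sum_left[OF coord_TS[OF q] coord_TS[OF q]] g_sum_right[OF coord_TS[OF q] coord_TS[OF q]])
    finally show ?thesis by (simp add: matrix_matrix_mult_def transpose_def mult.commute)
  qed
  have "(\<chi> i j. ?v (\<lambda>q. G q $ i $ j)) = transpose N ** G q + G q ** N"
    by (simp add: vec_eq_iff dG)
  moreover have "trace (A ** (transpose N ** G q + G q ** N)) = 2 * trace N"
  proof -
    have AG: "A ** G q = mat 1" using A invx by simp
    then have GA: "G q ** A = mat 1" by (simp add: matrix_left_right_inverse)
    have "trace (A ** (transpose N ** G q)) = trace ((transpose N ** G q) ** A)" by (rule trace_mul_sym)
    also have "\<dots> = trace (transpose N)" by (simp add: matrix_mul_assoc[symmetric] GA)
    finally have "trace (A ** (transpose N ** G q)) = trace N" by (simp add: trace_def transpose_def)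
    moreover have "A ** (G q ** N) = N" by (simp add: matrix_mul_assoc AG)
    ultimately show ?thesis by (simp add: matrix_add_ldistrib trace_add)
  qed
  ultimately have "?v (density_fun U \<phi>) = (det (G q) * inverse (sqrt (det (G q)))) * trace N" using 1 by simp
  also have "det (G q) * inverse (sqrt (det (G q))) = density_fun U \<phi> q"
    using G_det_pos[OF q] by (simp add: density_fun_def divide_inverse[symmetric] real_div_sqrt)
  finally show ?thesis by (simp add: trace_def N_def)
qed

text \<open>Coordinate fields commute and the connection is torsion free.\<close>
lemma coord_christoffel_symmetric:
  assumes q: "q \<in> U"
  shows "nabla M q (coord U \<phi> a q) (coord U \<phi> b) (\<lambda>q. \<phi> q $ d) = nabla M q (coord U \<phi> b q) (coord U \<phi> a) (\<lambda>q. \<phi> q $ d)"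
proof -
  have k: "coord U \<phi> a q (\<lambda>q. coord U \<phi> b q (\<lambda>q. \<phi> q $ d)) = 0" for a b
  proof -
    have "coord U \<phi> a q (\<lambda>q. coord U \<phi> b q (\<lambda>q. \<phi> q $ d)) = coord U \<phi> a q (\<lambda>q. axis b 1 $ d)"
      by (rule tangent_local[OF coord_TS[OF q] cU q]) (rule chart_tvec_coord[OF c])
    then show ?thesis by (simp add: tangent_const[OF coord_TS[OF q]])
  qed
  show ?thesis
    using lc_torsion_free[OF coord_VF[of a] coord_VF[of b] q smooth_fun_coord_nth[OF c, of d]] by (simp add: k)
qed

text \<open>The divergence in coordinates is \<open>\<Sum>\<^sub>b \<partial>\<^sub>b X\<^sup>b + \<Sum>\<^sub>a X\<^sup>a (\<Sum>\<^sub>b \<Gamma>\<^sup>b\<^sub>b\<^sub>a)\<close>; by symmetry of the Christoffel symbols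
  \<open>\<Gamma>\<close> and \<open>coord_density\<close>, the inner sum is the logarithmic derivative of the density.\<close>
lemma divergence_coord:
  assumes X: "VF U X" and q: "q \<in> U"
  shows "density_fun U \<phi> q * divergence X q
    = (\<Sum>b\<in>UNIV. coord U \<phi> b q (\<lambda>q. X q (\<lambda>q. \<phi> q $ b) * density_fun U \<phi> q))"
proof -
  let ?d = "coord U \<phi>" and ?X = "\<lambda>b q. X q (\<lambda>q. \<phi> q $ b)" and ?J = "density_fun U \<phi>"
  obtain f where f: "f \<in> fr q" using fr_nonempty by blast
  have Xs: "SF U (?X b)" for b by (rule smooth_vfieldD(3)[OF X subset_refl smooth_fun_coord_nth[OF c]])
  have XV: "VF U (\<lambda>q h. \<Sum>b\<in>J. ?X b q *\<^sub>R ?d b q h)" for J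
    using smooth_vfield_sum[where I = J and f = ?X and X = "\<lambda>b. coord U \<phi> b", OF cU Xs coord_VF] by simp
  have dT: "?d b q \<in> TS q" for b by (rule coord_TS[OF q])
  have nX: "nabla M q (?d b q) X (\<lambda>q. \<phi> q $ b) = ?d b q (?X b) + (\<Sum>a\<in>UNIV. ?X a q * nabla M q (?d b q) (?d a) (\<lambda>q. \<phi> q $ b))" for b
  proof -
    have "nabla M q (?d b q) X = nabla M q (?d b q) (\<lambda>q h. \<Sum>a\<in>UNIV. ?X a q *\<^sub>R ?d a q h)"
      by (rule lc_local[OF q cU X XV dT]) (rule ext, simp add: tangent_expand[OF c _ smooth_vfieldD(2)[OF X], symmetric])
    also have "\<dots> = (\<lambda>h. \<Sum>a\<in>UNIV. ?d b q (?X a) *\<^sub>R ?d a q h + ?X a q *\<^sub>R nabla M q (?d b q) (?d a) h)"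
      by (rule lc_sum[OF q cU X dT Xs coord_VF XV])
    finally have "nabla M q (?d b q) X (\<lambda>q. \<phi> q $ b)
      = (\<Sum>a\<in>UNIV. ?d b q (?X a) * axis a 1 $ b) + (\<Sum>a\<in>UNIV. ?X a q * nabla M q (?d b q) (?d a) (\<lambda>q. \<phi> q $ b))"
      by (simp add: sum.distrib chart_tvec_coord[OF c q])
    moreover have "(\<Sum>a\<in>UNIV. ?d b q (?X a) * axis a 1 $ b) = ?d b q (?X b)"
      using sum_basis_scaleR(1)[where F = "\<lambda>a. ?d b q (?X a)" and j = b] by (simp add: mult.commute)
    ultimately show ?thesis by simp
  qed
  have J: "?d a q ?J = ?J q * (\<Sum>b\<in>UNIV. nabla M q (?d a q) (?d b) (\<lambda>q. \<phi> q $ b))" for a by (rule coord_density[OF q])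
  have "divergence X q = (\<Sum>b\<in>UNIV. ?d b q (?X b)) + (\<Sum>b\<in>UNIV. \<Sum>a\<in>UNIV. ?X a q * nabla M q (?d b q) (?d a) (\<lambda>q. \<phi> q $ b))"
    unfolding divergence_frame[OF X q f] trace_frame_coord[OF c q X q f] nX sum.distrib ..
  also have "(\<Sum>b\<in>UNIV. \<Sum>a\<in>UNIV. ?X a q * nabla M q (?d b q) (?d a) (\<lambda>q. \<phi> q $ b))
     = (\<Sum>a\<in>UNIV. ?X a q * (\<Sum>b\<in>UNIV. nabla M q (?d a q) (?d b) (\<lambda>q. \<phi> q $ b)))"
    by (subst sum.swap) (simp add: sum_distrib_left coord_christoffel_symmetric[OF q, of _ _ "_"])
  finally have "?J q * divergence X q = (\<Sum>b\<in>UNIV. ?d b q (?X b) * ?J q + ?X b q * ?d b q ?J)"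
    by (simp add: J sum.distrib distrib_left sum_distrib_left mult_ac)
  also have "\<dots> = (\<Sum>b\<in>UNIV. ?d b q (\<lambda>q. ?X b q * ?J q))"
    by (intro sum.cong refl tangent_mult[symmetric] dT smooth_nearI[OF Xs q] smooth_nearI[OF density_smooth q])
  finally show ?thesis .
qed

end

subsection \<open>Integration in a chart\<close>

abbreviation \<mu> where "\<mu> \<equiv> volume M"

lemma sets_volume: "sets \<mu> = sets borel" and space_volume: "space \<mu> = UNIV"
proof -
  show "sets \<mu> = sets borel" using M by (simp add: oriented_riemannian_manifold_def riemannian_volume_def)
  then show "space \<mu> = UNIV" using sets_eq_imp_space_eq[of \<mu> borel] by simp
qed

lemma measurable_volume: "h \<in> borel_measurable borel \<Longrightarrow> h \<in> borel_measurable \<mu>"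
  by (simp add: measurable_cong_sets[OF sets_volume refl])

lemma SF_measurable: "SF UNIV h \<Longrightarrow> (h :: 'm \<Rightarrow> real) \<in> borel_measurable borel"
  by (rule borel_measurable_continuous_onI[OF smooth_fun_continuous])

context
  fixes U \<phi> assumes c: "(U, \<phi>) \<in> charts M"
begin

definition chart_density :: "real ^ 'n \<Rightarrow> real" where
  "chart_density x = indicator (\<phi> ` U) x *\<^sub>R density_fun U \<phi> (inv_into U \<phi> x)"

text \<open>The value outside \<open>\<phi> ` U\<close> only has to be constant, for measurability; the density vanishes there.\<close>
definition chart_param :: "real ^ 'n \<Rightarrow> 'm" where
  "chart_param x = (if x \<in> \<phi> ` U then inv_into U \<phi> x else undefined)"

lemma chart_density_pos: "x \<in> \<phi> ` U \<Longrightarrow> chart_density x > 0"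
  using density_pos[OF c chart_inv_in[of x \<phi> U]] by (simp add: chart_density_def)

lemma chart_density_nonneg: "chart_density x \<ge> 0"
  using chart_density_pos[of x] by (cases "x \<in> \<phi> ` U") (simp_all add: chart_density_def)

lemma chart_density_continuous: "continuous_on (\<phi> ` U) chart_density"
proof -
  have "continuous_on (\<phi> ` U) (\<lambda>x. density_fun U \<phi> (inv_into U \<phi> x))"
    using smooth_on_continuous_on[OF smooth_funD[OF density_smooth[OF c] c]] by simp
  then show ?thesis by (rule continuous_on_eq) (simp add: chart_density_def)
qed

lemma chart_density_measurable: "chart_density \<in> borel_measurable borel"
proof -
  have "continuous_on (\<phi> ` U) (\<lambda>x. density_fun U \<phi> (inv_into U \<phi> x))"
    using smooth_on_continuous_on[OF smooth_funD[OF density_smooth[OF c] c]] by simp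
  then show ?thesis
    unfolding chart_density_def[abs_def]
    by (intro borel_measurable_continuous_on_indicator) (auto intro: borel_open chart_image_open[OF c])
qed

lemma chart_param_measurable: "chart_param \<in> measurable borel borel"
  unfolding chart_param_def[abs_def]
  by (intro borel_measurable_continuous_on_if borel_open chart_image_open[OF c] chart_inv_continuous[OF c] continuous_on_const)

lemma chart_emeasure:
  assumes "B \<in> sets borel" "B \<subseteq> U"
  shows "emeasure \<mu> B = (\<integral>\<^sup>+x. ennreal (chart_density x) * indicator (\<phi> ` B) x \<partial>lborel)"
proof -
  have "riemannian_volume (charts M) g \<mu>" using M by (simp add: oriented_riemannian_manifold_def)
  then have "emeasure \<mu> B = (\<integral>\<^sup>+x. ennreal (sqrt (det (gram_matrix (charts M) g (U, \<phi>) (inv_into U \<phi> x)))) * indicator (\<phi> ` B) x \<partial>lborel)"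
    using c assms unfolding riemannian_volume_def by fast
  also have "\<dots> = (\<integral>\<^sup>+x. ennreal (chart_density x) * indicator (\<phi> ` B) x \<partial>lborel)"
  proof (rule nn_integral_cong)
    fix x
    show "ennreal (sqrt (det (gram_matrix (charts M) g (U, \<phi>) (inv_into U \<phi> x)))) * indicator (\<phi> ` B) x
      = ennreal (chart_density x) * indicator (\<phi> ` B) x"
      using assms(2) by (cases "x \<in> \<phi> ` B") (auto simp: chart_density_def density_fun_def)
  qed
  finally show ?thesis .
qed

text \<open>The defining property of the volume, which concerns measures of Borel sets in \<open>U\<close>, as an equality of
  measures, so that integrals can be transformed.\<close>
lemma chart_measure:
  "density \<mu> (\<lambda>q. ennreal (indicator U q)) = distr (density lborel (\<lambda>x. ennreal (chart_density x))) borel chart_param"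
proof (rule measure_eqI)
  show "sets (density \<mu> (\<lambda>q. ennreal (indicator U q))) = sets (distr (density lborel (\<lambda>x. ennreal (chart_density x))) borel chart_param)"
    by (simp add: sets_volume)
  fix B assume "B \<in> sets (density \<mu> (\<lambda>q. ennreal (indicator U q)))"
  then have B: "B \<in> sets borel" by (simp add: sets_volume)
  have U: "U \<in> sets borel" using borel_open[OF chart_open[OF c]] .
  have mp: "chart_param \<in> measurable (density lborel (\<lambda>x. ennreal (chart_density x))) borel"
    using chart_param_measurable by simp
  have "(\<lambda>q. ennreal (indicator U q)) \<in> borel_measurable \<mu>"
    using U by (intro measurable_volume) simp
  then have "emeasure (density \<mu> (\<lambda>q. ennreal (indicator U q))) B = (\<integral>\<^sup>+q. ennreal (indicator U q) * indicator B q \<partial>\<mu>)"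
    using B by (intro emeasure_density) (auto simp: sets_volume)
  also have "\<dots> = (\<integral>\<^sup>+q. indicator (B \<inter> U) q \<partial>\<mu>)"
    by (intro nn_integral_cong) (auto split: split_indicator)
  also have "\<dots> = emeasure \<mu> (B \<inter> U)" using B U by (intro nn_integral_indicator) (auto simp: sets_volume)
  also have "\<dots> = (\<integral>\<^sup>+x. ennreal (chart_density x) * indicator (\<phi> ` (B \<inter> U)) x \<partial>lborel)"
    using B U by (intro chart_emeasure) auto
  also have "\<dots> = (\<integral>\<^sup>+x. ennreal (chart_density x) * indicator (chart_param -` B) x \<partial>lborel)"
  proof (rule nn_integral_cong)
    fix x
    show "ennreal (chart_density x) * indicator (\<phi> ` (B \<inter> U)) x = ennreal (chart_density x) * indicator (chart_param -` B) x"
    proof (cases "x \<in> \<phi> ` U")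
      case True
      then have "x \<in> \<phi> ` (B \<inter> U) \<longleftrightarrow> chart_param x \<in> B"
        using chart_inv[OF c] by (auto simp: chart_param_def)
      then show ?thesis by (simp add: indicator_def)
    qed (simp add: chart_density_def)
  qed
  also have "\<dots> = emeasure (density lborel (\<lambda>x. ennreal (chart_density x))) (chart_param -` B)"
    using chart_density_measurable measurable_sets[OF chart_param_measurable B]
    by (intro emeasure_density[symmetric]) auto
  also have "\<dots> = emeasure (distr (density lborel (\<lambda>x. ennreal (chart_density x))) borel chart_param) B"
    using emeasure_distr[OF mp B] by simp
  finally show "emeasure (density \<mu> (\<lambda>q. ennreal (indicator U q))) B
    = emeasure (distr (density lborel (\<lambda>x. ennreal (chart_density x))) borel chart_param) B" .
qed

lemma chart_integral:
  fixes h :: "'m \<Rightarrow> real"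
  assumes h: "h \<in> borel_measurable borel" and z: "\<And>q. q \<notin> U \<Longrightarrow> h q = 0"
  shows "integral\<^sup>L \<mu> h = integral\<^sup>L lborel (\<lambda>x. chart_density x * h (chart_param x))"
proof -
  have U: "U \<in> sets borel" using borel_open[OF chart_open[OF c]] .
  have mp: "chart_param \<in> measurable (density lborel (\<lambda>x. ennreal (chart_density x))) borel"
    using chart_param_measurable by simp
  have hp: "(\<lambda>x. h (chart_param x)) \<in> borel_measurable lborel"
    using measurable_compose[OF chart_param_measurable h] by simp
  have "(\<lambda>q. indicator U q *\<^sub>R h q) = h" using z by (auto split: split_indicator)
  then have "integral\<^sup>L \<mu> h = integral\<^sup>L \<mu> (\<lambda>q. indicator U q *\<^sub>R h q)" by simp
  also have "\<dots> = integral\<^sup>L (density \<mu> (\<lambda>q. ennreal (indicator U q))) h"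
    using U by (intro integral_density[symmetric] measurable_volume h) auto
  also have "\<dots> = integral\<^sup>L (density lborel (\<lambda>x. ennreal (chart_density x))) (\<lambda>x. h (chart_param x))"
    unfolding chart_measure by (rule integral_distr[OF mp h])
  also have "\<dots> = integral\<^sup>L lborel (\<lambda>x. chart_density x *\<^sub>R h (chart_param x))"
    using chart_density_measurable chart_density_nonneg by (intro integral_density hp) auto
  finally show ?thesis by simp
qed

text \<open>By \<open>divergence_coord\<close> the integral is that of a sum of partial derivatives of functions with compact support
  in \<open>\<phi> ` U\<close>, which extend by \<open>0\<close> to all of space.\<close>
lemma divergence_theorem_chart:
  assumes X: "VF UNIV X" and C: "compact C" "C \<subseteq> U" "\<And>q. q \<notin> C \<Longrightarrow> X q = (\<lambda>h. 0)"
  shows "integral\<^sup>L \<mu> (divergence X) = 0"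
proof -
  have XU: "VF U X" by (rule smooth_vfield_subset[OF X chart_open[OF c]]) simp
  have oC: "open (- C)" using C(1) by (simp add: compact_imp_closed open_Compl)
  have z: "divergence X q = 0" if "q \<notin> C" for q
    by (rule divergence_zero[OF X _ oC]) (use that C(3) in auto)
  have \<phi>C: "compact (\<phi> ` C)"
    by (rule compact_continuous_image[OF continuous_on_subset[OF chart_continuous[OF c] C(2)] C(1)])
  then have o\<phi>C: "open (- (\<phi> ` C))" by (simp add: compact_imp_closed open_Compl)
  let ?Y = "\<lambda>b q. X q (\<lambda>q. \<phi> q $ b) * density_fun U \<phi> q"
  define F where "F b x = (if x \<in> \<phi> ` U then ?Y b (inv_into U \<phi> x) else 0)" for b x
  have Y: "SF U (?Y b)" for b
    by (intro smooth_fun_mult density_smooth[OF c] smooth_vfieldD(3)[OF XU subset_refl smooth_fun_coord_nth[OF c]])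
  have F0: "F b x = 0" if "x \<notin> \<phi> ` C" for b x
  proof (cases "x \<in> \<phi> ` U")
    case True
    then have "inv_into U \<phi> x \<notin> C" using that f_inv_into_f[of x \<phi> U] by (metis imageI)
    then show ?thesis using C(3) by (simp add: F_def)
  qed (simp add: F_def)
  have smooth: "smooth_on UNIV (F b)" for b
  proof (rule smooth_on_local)
    fix x :: "real^'n"
    show "\<exists>T. open T \<and> x \<in> T \<and> smooth_on T (F b)"
    proof (cases "x \<in> \<phi> ` U")
      case True
      have "smooth_on (\<phi> ` U) (F b)"
        by (rule smooth_on_cong[OF chart_image_open[OF c] _ smooth_funD[OF Y c, of b, simplified]]) (simp add: F_def)
      then show ?thesis using True chart_image_open[OF c] by blast
    next
      case False
      have "smooth_on (- (\<phi> ` C)) (F b)"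
        by (rule smooth_on_cong[OF o\<phi>C _ smooth_on_const[of _ 0]]) (simp add: F0)
      moreover have "x \<in> - (\<phi> ` C)" using False C(2) by auto
      ultimately show ?thesis using o\<phi>C by blast
    qed
  qed
  have "chart_density x * divergence X (chart_param x) = (\<Sum>b\<in>UNIV. frechet_derivative (F b) (at x) (axis b 1))" for x
  proof (cases "x \<in> \<phi> ` U")
    case True
    then obtain q where q: "q \<in> U" "x = \<phi> q" by auto
    have "frechet_derivative (F b) (at x) = frechet_derivative (\<lambda>x. ?Y b (inv_into U \<phi> x)) (at (\<phi> q))" for b
      unfolding q(2)
      by (rule frechet_derivative_cong_open(2)[OF chart_image_open[OF c]])
        (use q chart_differentiable[OF c q(1) smooth_nearI[OF Y q(1)]] in \<open>auto simp: F_def\<close>)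
    then have "(\<Sum>b\<in>UNIV. frechet_derivative (F b) (at x) (axis b 1)) = (\<Sum>b\<in>UNIV. coord U \<phi> b q (?Y b))"
      by (simp add: chart_tvec_apply[OF smooth_nearI[OF Y q(1)]])
    then show ?thesis
      using divergence_coord[OF c XU q(1)] q chart_inv[OF c q(1)] by (simp add: chart_density_def chart_param_def)
  next
    case False
    then have x: "x \<in> - (\<phi> ` C)" using C(2) by auto
    have "frechet_derivative (F b) (at x) = frechet_derivative (\<lambda>x. 0) (at x)" for b
      by (rule frechet_derivative_cong_open(2)[OF o\<phi>C x]) (simp_all add: F0)
    then show ?thesis using False by (simp add: chart_density_def)
  qed
  then have "integral\<^sup>L \<mu> (divergence X) = integral\<^sup>L lborel (\<lambda>x. \<Sum>b\<in>UNIV. frechet_derivative (F b) (at x) (axis b 1))"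
    using chart_integral[OF SF_measurable[OF divergence_smooth[OF X]]] z C(2) by (auto simp: subset_iff)
  also have "\<dots> = (\<Sum>b\<in>UNIV. integral\<^sup>L lborel (\<lambda>x. frechet_derivative (F b) (at x) (axis b 1)))"
    by (rule Bochner_Integration.integral_sum) (rule integral_derivative_compact_support(2)[OF smooth \<phi>C F0])
  also have "\<dots> = 0"
    by (simp add: integral_derivative_compact_support(1)[OF smooth \<phi>C F0])
  finally show ?thesis .
qed

end

text \<open>The density is positive, and open sets have positive Lebesgue measure.\<close>
lemma volume_open_pos:
  assumes "open W" "W \<noteq> {}"
  shows "emeasure \<mu> W \<noteq> 0"
proof
  assume 0: "emeasure \<mu> W = 0"
  obtain p where p: "p \<in> W" using assms by auto
  obtain U \<phi> where c: "(U, \<phi>) \<in> charts M" "p \<in> U" using ex_chart by blast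
  let ?B = "W \<inter> U"
  have B: "open ?B" "?B \<in> sets borel" using assms chart_open[OF c(1)] by auto
  have oB: "open (\<phi> ` ?B)" by (rule chart_open_image[OF c(1) B(1)]) simp
  have "emeasure \<mu> ?B \<le> emeasure \<mu> W" using assms by (intro emeasure_mono) (auto simp: sets_volume)
  then have "(\<integral>\<^sup>+x. ennreal (chart_density U \<phi> x) * indicator (\<phi> ` ?B) x \<partial>lborel) = 0"
    using chart_emeasure[OF c(1) B(2)] 0 by simp
  then have "emeasure lborel {x \<in> space lborel. ennreal (chart_density U \<phi> x) * indicator (\<phi> ` ?B) x \<noteq> 0} = 0"
    using chart_density_measurable[OF c(1)] borel_open[OF oB] by (subst (asm) nn_integral_0_iff) auto
  also have "{x \<in> space lborel. ennreal (chart_density U \<phi> x) * indicator (\<phi> ` ?B) x \<noteq> 0} = \<phi> ` ?B"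
  proof -
    have "ennreal (chart_density U \<phi> x) \<noteq> 0" if "x \<in> \<phi> ` ?B" for x
      using chart_density_pos[OF c(1), of x] that by (auto simp: ennreal_eq_0_iff not_le)
    then show ?thesis by (auto split: split_indicator)
  qed
  finally have n: "emeasure lborel (\<phi> ` ?B) = 0" .
  have "\<phi> p \<in> \<phi> ` ?B" using p c(2) by auto
  then obtain r where r: "r > 0" "ball (\<phi> p) r \<subseteq> \<phi> ` ?B" using oB open_contains_ball by blast
  have "emeasure lborel (ball (\<phi> p) r) \<le> emeasure lborel (\<phi> ` ?B)"
    using r(2) borel_open[OF oB] by (intro emeasure_mono) auto
  then have "emeasure lborel (ball (\<phi> p) r) = 0" using n by simp
  then show False using r(1) unit_ball_vol_pos[of "real CARD('n)"] by (simp add: emeasure_ball)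
qed

text \<open>The density is bounded on a closed coordinate ball.\<close>
lemma volume_locally_finite:
  "\<exists>V. open V \<and> p \<in> V \<and> emeasure \<mu> V < \<infinity>"
proof -
  obtain U \<phi> where c: "(U, \<phi>) \<in> charts M" "p \<in> U" using ex_chart by blast
  have "\<phi> p \<in> \<phi> ` U" using c(2) by simp
  then obtain r where r: "r > 0" "cball (\<phi> p) r \<subseteq> \<phi> ` U" using chart_image_open[OF c(1)] unfolding open_contains_cball by blast
  define V where "V = U \<inter> \<phi> -` ball (\<phi> p) r"
  have oV: "open V" unfolding V_def Int_commute[of U]
    using chart_continuous[OF c(1)] continuous_on_open_vimage[OF chart_open[OF c(1)]] by blast
  have pV: "p \<in> V" using c r by (simp add: V_def)
  have \<phi>V: "\<phi> ` V \<subseteq> ball (\<phi> p) r" by (auto simp: V_def)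
  have "compact (chart_density U \<phi> ` cball (\<phi> p) r)"
    by (intro compact_continuous_image continuous_on_subset[OF chart_density_continuous[OF c(1)] r(2)] compact_cball)
  then obtain B where B: "\<forall>y\<in>chart_density U \<phi> ` cball (\<phi> p) r. norm y \<le> B" using compact_imp_bounded bounded_iff by blast
  have "emeasure \<mu> V = (\<integral>\<^sup>+x. ennreal (chart_density U \<phi> x) * indicator (\<phi> ` V) x \<partial>lborel)"
    using borel_open[OF oV] by (intro chart_emeasure[OF c(1)]) (auto simp: V_def)
  also have "\<dots> \<le> (\<integral>\<^sup>+x. ennreal B * indicator (ball (\<phi> p) r) x \<partial>lborel)"
  proof (rule nn_integral_mono)
    fix x
    show "ennreal (chart_density U \<phi> x) * indicator (\<phi> ` V) x \<le> ennreal B * indicator (ball (\<phi> p) r) x"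
    proof (cases "x \<in> \<phi> ` V")
      case True
      then have x: "x \<in> ball (\<phi> p) r" using \<phi>V by blast
      then have "\<bar>chart_density U \<phi> x\<bar> \<le> B" using B by simp
      then show ?thesis using True x by (simp add: ennreal_leI del: mem_ball)
    qed simp
  qed
  also have "\<dots> = ennreal B * emeasure lborel (ball (\<phi> p) r)" by (intro nn_integral_cmult_indicator) simp
  also have "\<dots> < \<infinity>" using emeasure_bounded_finite[OF bounded_ball, of "\<phi> p" r] by (simp add: ennreal_mult_less_top)
  finally show ?thesis using oV pV by blast
qed

lemma volume_compact_finite:
  assumes K: "compact K"
  shows "emeasure \<mu> K < \<infinity>"
proof -
  obtain V where V: "\<And>p. open (V p) \<and> p \<in> V p \<and> emeasure \<mu> (V p) < \<infinity>"
    using volume_locally_finite by metis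
  obtain S where S: "S \<subseteq> K" "finite S" "K \<subseteq> (\<Union>p\<in>S. V p)"
    by (rule compactE_image[OF K, of K V]) (use V in auto)
  have "emeasure \<mu> K \<le> emeasure \<mu> (\<Union>p\<in>S. V p)" using S V by (intro emeasure_mono) (auto simp: sets_volume)
  also have "\<dots> \<le> (\<Sum>p\<in>S. emeasure \<mu> (V p))" using S V by (intro emeasure_subadditive_finite) (auto simp: sets_volume)
  also have "\<dots> < \<infinity>" using S(2) by (induction S) (use V in auto)
  finally show ?thesis .
qed

lemma smooth_compact_support_integrable:
  fixes h :: "'m \<Rightarrow> real"
  assumes h: "SF UNIV h" and K: "compact K" "\<And>q. q \<notin> K \<Longrightarrow> h q = 0"
  shows "integrable \<mu> h"
proof -
  obtain B where B: "\<And>x. \<bar>h x\<bar> \<le> B"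
    using continuous_compact_support_bounded[OF smooth_fun_continuous[OF h] K] by blast
  show ?thesis
    using K(2) B volume_compact_finite[OF K(1)] measurable_volume[OF SF_measurable[OF h]]
    by (intro integrableI_bounded_set[where A = K and B = B]) (auto simp: sets_volume intro: borel_compact K(1))
qed

lemma smooth_nonneg_integral_zero:
  fixes h :: "'m \<Rightarrow> real"
  assumes h: "SF UNIV h" and K: "compact K" "\<And>q. q \<notin> K \<Longrightarrow> h q = 0" and nn: "\<And>q. h q \<ge> 0"
    and z: "integral\<^sup>L \<mu> h = 0"
  shows "h p = 0"
proof (rule ccontr)
  assume "h p \<noteq> 0"
  let ?W = "h -` {0<..}"
  have W: "open ?W" using smooth_fun_continuous[OF h] open_vimage[OF open_greaterThan] by blast
  have "AE q in \<mu>. h q = 0"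
    using integral_nonneg_eq_0_iff_AE[OF smooth_compact_support_integrable[OF h K]] nn z by simp
  then have "AE q in \<mu>. q \<notin> ?W" by eventually_elim simp
  then have "emeasure \<mu> ?W = 0" using W by (subst (asm) AE_iff_measurable[of ?W]) (auto simp: sets_volume space_volume)
  moreover have "p \<in> ?W" using nn[of p] \<open>h p \<noteq> 0\<close> by simp
  ultimately show False using volume_open_pos[OF W] by blast
qed

text \<open>Multiplication by bump functions reduces the theorem to fields supported in a chart: if \<open>\<psi>\<close>
  is one of the bump functions, then \<open>X = \<psi> X + (1 - \<psi>) X\<close>, and \<open>(1 - \<psi>) X\<close> vanishes where
  \<open>\<psi> = 1\<close>, so that its support is covered by fewer charts.\<close>
theorem divergence_theorem:
  assumes X: "VF UNIV X" and K: "compact K" "\<And>q. q \<notin> K \<Longrightarrow> X q = (\<lambda>h. 0)"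
  shows "integral\<^sup>L \<mu> (divergence X) = 0"
proof -
  have "\<exists>\<psi> B C U \<phi>. SF UNIV \<psi> \<and> open B \<and> p \<in> B \<and> compact C \<and> (U, \<phi>) \<in> charts M \<and> C \<subseteq> U \<and>
    (\<forall>q\<in>B. \<psi> q = (1::real)) \<and> (\<forall>q. \<psi> q \<noteq> 0 \<longrightarrow> q \<in> C)" for p
  proof -
    obtain U \<phi> where c: "(U, \<phi>) \<in> charts M" "p \<in> U" using ex_chart by blast
    show ?thesis by (rule ex_bump[OF chart_open[OF c(1)] c(2)]) (use c in blast)
  qed
  then obtain \<psi> B C U \<phi> where \<psi>: "\<And>p. SF UNIV (\<psi> p)" and B: "\<And>p. open (B p)" "\<And>p. p \<in> B p"
    and C: "\<And>p. compact (C p)" and c: "\<And>p. (U p, \<phi> p) \<in> charts M" and CU: "\<And>p. C p \<subseteq> U p"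
    and one: "\<And>p q. q \<in> B p \<Longrightarrow> \<psi> p q = (1::real)" and supp: "\<And>p q. \<psi> p q \<noteq> 0 \<Longrightarrow> q \<in> C p"
    by metis
  obtain S where S: "S \<subseteq> K" "finite S" "K \<subseteq> (\<Union>p\<in>S. B p)"
    by (rule compactE_image[OF K(1), of K B]) (use B in auto)
  have "integral\<^sup>L \<mu> (divergence X) = 0"
    if "finite S" "VF UNIV X" "\<And>q. q \<notin> K \<Longrightarrow> X q = (\<lambda>h. 0)" "\<And>q. q \<notin> (\<Union>p\<in>S. B p) \<Longrightarrow> X q = (\<lambda>h. 0)" for S X
    using that
  proof (induction S arbitrary: X rule: finite_induct)
    case empty
    have "divergence X q = 0" for q
      by (rule divergence_zero[OF empty(1), of q UNIV]) (use empty in auto)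
    then show ?case by (simp cong: Bochner_Integration.integral_cong)
  next
    case (insert p S)
    let ?Y = "\<lambda>q h. \<psi> p q * X q h" and ?Z = "\<lambda>q h. (1 - \<psi> p q) * X q h"
    have Y: "VF UNIV ?Y" by (rule smooth_vfield_scale[OF \<psi> insert.prems(1)])
    have Z: "VF UNIV ?Z"
      by (rule smooth_vfield_scale[OF smooth_fun_diff[OF smooth_fun_const[OF open_UNIV] \<psi>] insert.prems(1)])
    have YK: "?Y q = (\<lambda>h. 0)" and ZK: "?Z q = (\<lambda>h. 0)" if "q \<notin> K" for q
      using insert.prems(2)[OF that] by (simp_all add: fun_eq_iff)
    have YC: "?Y q = (\<lambda>h. 0)" if "q \<notin> C p" for q
    proof -
      have "\<psi> p q = 0" using supp that by blast
      then show ?thesis by simp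
    qed
    have ZS: "?Z q = (\<lambda>h. 0)" if "q \<notin> (\<Union>p\<in>S. B p)" for q
    proof (cases "q \<in> B p")
      case True
      then show ?thesis using one by simp
    next
      case False
      then show ?thesis using insert.prems(3)[of q] that by (simp add: fun_eq_iff)
    qed
    have oK: "open (- K)" using K(1) by (simp add: compact_imp_closed open_Compl)
    have int: "integrable \<mu> (divergence V)" if V: "VF UNIV V" "\<And>q. q \<notin> K \<Longrightarrow> V q = (\<lambda>h. 0)" for V
      by (rule smooth_compact_support_integrable[OF divergence_smooth[OF V(1)] K(1)], rule divergence_zero[OF V(1) _ oK])
        (use V(2) in auto)
    have "X = (\<lambda>q h. ?Y q h + ?Z q h)" by (simp add: fun_eq_iff algebra_simps)
    then have "divergence X = divergence (\<lambda>q h. ?Y q h + ?Z q h)" by (rule arg_cong)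
    also have "\<dots> = (\<lambda>q. divergence ?Y q + divergence ?Z q)"
      by (rule ext, rule divergence_add[OF Y Z UNIV_I])
    finally have dX: "divergence X = (\<lambda>q. divergence ?Y q + divergence ?Z q)" .
    have "integral\<^sup>L \<mu> (divergence X) = integral\<^sup>L \<mu> (divergence ?Y) + integral\<^sup>L \<mu> (divergence ?Z)"
      unfolding dX by (rule Bochner_Integration.integral_add[OF int[OF Y YK] int[OF Z ZK]])
    also have "integral\<^sup>L \<mu> (divergence ?Y) = 0" by (rule divergence_theorem_chart[OF c Y C CU YC])
    also have "integral\<^sup>L \<mu> (divergence ?Z) = 0" by (rule insert.IH[OF Z ZK ZS])
    finally show ?case by simp
  qed
  note all = this
  show ?thesis
  proof (rule all[OF S(2) X K(2)])
    fix q assume "q \<notin> (\<Union>p\<in>S. B p)"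
    then have "q \<notin> K" using S(3) by (rule contra_subsetD[rotated])
    then show "X q = (\<lambda>h. 0)" by (rule K(2))
  qed
qed

end

section \<open>Integration by parts for sections\<close>

context twisted_manifold begin

text \<open>A change of frame acts by orthogonal maps on the indices and on the values.\<close>
lemma full_inner_frame_independent:
  assumes s: "s \<in> Secs" and t: "t \<in> Secs" and f: "f \<in> fr p" "f' \<in> fr p"
  shows "full_inner m (s p f') (t p f') = full_inner m (s p f) (t p f)"
proof -
  let ?b = "tr p f' f"
  have b: "rotation_matrix ?b" by (rule frame_transition_rotation[OF f(2,1)])
  have "full_inner m (s p f') (t p f') = full_inner m (\<lambda>l. \<rho> ?b (s p f l)) (\<lambda>l. \<rho> ?b (t p f l))"
    unfolding section_transform[OF s f] section_transform[OF t f] tensor_act_eq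
    by (rule full_inner_index_act[OF rotation_matrix_mult(1)[OF b]])
  then show ?thesis by (simp add: full_inner_def rho_inner[OF b])
qed

lemma full_inner_section_smooth:
  assumes s: "s \<in> Secs" and t: "t \<in> Secs"
  shows "SF UNIV (\<lambda>p. full_inner m (s p (SOME f. f \<in> fr p)) (t p (SOME f. f \<in> fr p)))" (is "SF UNIV ?h")
proof (rule smooth_fun_local)
  fix p
  obtain f where f: "f \<in> fr p" using fr_nonempty by blast
  obtain e U where e: "e p = f" "p \<in> U" "local_frame M U e" using ex_local_frame[OF f] by blast
  have "SF U (\<lambda>q. full_inner m (s q (e q)) (t q (e q)))"
    by (rule full_inner_smooth[OF local_frameD(3)[OF e(3)] section_smooth[OF s e(3)] section_smooth[OF t e(3)]])
  then have "SF U ?h"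
    by (rule smooth_fun_cong) (rule full_inner_frame_independent[OF s t some_frame local_frameD(1)[OF e(3)]])
  then show "\<exists>W. p \<in> W \<and> SF W ?h" using e(2) by blast
qed simp

definition pairing :: "nat \<Rightarrow> ('m \<Rightarrow> ('m, 'n) frame \<Rightarrow> ('n, 'e) tensor) \<Rightarrow> ('m \<Rightarrow> ('m, 'n) frame \<Rightarrow> ('n, 'e) tensor) \<Rightarrow> 'm \<Rightarrow> real" where
  "pairing m s t p = (let f = (SOME f. f \<in> fr p) in full_inner m (s p f) (t p f))"

lemma pairing_frame: "s \<in> Secs \<Longrightarrow> t \<in> Secs \<Longrightarrow> f \<in> fr p \<Longrightarrow> pairing m s t p = full_inner m (s p f) (t p f)"
  unfolding pairing_def Let_def by (rule full_inner_frame_independent[OF _ _ _ some_frame])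

lemma pairing_smooth: "s \<in> Secs \<Longrightarrow> t \<in> Secs \<Longrightarrow> SF UNIV (pairing m s t)"
  using full_inner_section_smooth by (simp add: pairing_def[abs_def] Let_def)

text \<open>The vector field with components \<open>\<langle>z, w\<^sub>i\<rangle>\<close>, where \<open>w = \<Sum>\<^sub>i e\<^sub>i \<otimes> w\<^sub>i\<close>.\<close>
definition pairing_field :: "nat \<Rightarrow> ('m \<Rightarrow> ('m, 'n) frame \<Rightarrow> ('n, 'e) tensor) \<Rightarrow> ('m \<Rightarrow> ('m, 'n) frame \<Rightarrow> ('n, 'e) tensor) \<Rightarrow> 'm \<Rightarrow> 'm tvec" where
  "pairing_field m z w p = (let f = (SOME f. f \<in> fr p) in (\<lambda>h. \<Sum>i\<in>UNIV. full_inner m (z p f) (slot i (w p f)) * f i h))"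

lemma pairing_field_frame:
  assumes z: "z \<in> Secs" and w: "w \<in> Secs" and f: "f \<in> fr p"
  shows "pairing_field m z w p = (\<lambda>h. \<Sum>i\<in>UNIV. full_inner m (z p f) (slot i (w p f)) * f i h)"
proof
  fix h
  define f' where "f' = (SOME f. f \<in> fr p)"
  have f': "f' \<in> fr p" unfolding f'_def by (rule some_frame)
  let ?b = "tr p f' f"
  have b: "rotation_matrix ?b" by (rule frame_transition_rotation[OF f' f])
  have lin: "linear (\<rho> ?b)" by (rule rho_linear[OF b])
  let ?X = "\<lambda>i. full_inner m (z p f) (slot i (w p f))"
  have comp: "full_inner m (z p f') (slot i (w p f')) = (\<Sum>j\<in>UNIV. ?b $ i $ j * ?X j)" for i
  proof -
    have "slot i (w p f') = (\<lambda>l. \<Sum>j\<in>UNIV. ?b $ i $ j *\<^sub>R index_act ?b (\<lambda>l. \<rho> ?b (w p f (j # l))) l)"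
      by (simp add: section_transform[OF w f f'] tensor_act_eq)
    then have "full_inner m (z p f') (slot i (w p f'))
      = (\<Sum>j\<in>UNIV. ?b $ i $ j * full_inner m (index_act ?b (\<lambda>l. \<rho> ?b (z p f l))) (index_act ?b (\<lambda>l. \<rho> ?b (w p f (j # l)))))"
      by (simp add: section_transform[OF z f f'] tensor_act_eq full_inner_sum_right full_inner_scale_right)
    also have "\<dots> = (\<Sum>j\<in>UNIV. ?b $ i $ j * ?X j)"
      by (simp add: full_inner_index_act[OF rotation_matrix_mult(1)[OF b]]) (simp add: full_inner_def rho_inner[OF b])
    finally show ?thesis .
  qed
  have fj: "(\<Sum>i\<in>UNIV. ?b $ i $ j * f' i h) = f j h" for j
    using fun_cong[OF fun_cong[OF frame_act_transition[OF f' f]], of j h] by (simp add: frame_act_def)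
  have "pairing_field m z w p h = (\<Sum>i\<in>UNIV. \<Sum>j\<in>UNIV. ?X j * (?b $ i $ j * f' i h))"
    by (simp add: pairing_field_def Let_def f'_def[symmetric] comp sum_distrib_right sum_distrib_left mult_ac)
  also have "\<dots> = (\<Sum>j\<in>UNIV. ?X j * (\<Sum>i\<in>UNIV. ?b $ i $ j * f' i h))"
    by (subst sum.swap) (simp add: sum_distrib_left)
  finally show "pairing_field m z w p h = (\<Sum>i\<in>UNIV. ?X i * f i h)" by (simp add: fj)
qed

lemma pairing_field_smooth:
  assumes z: "z \<in> Secs" and w: "w \<in> Secs"
  shows "VF UNIV (pairing_field m z w)"
proof (rule smooth_vfield_local)
  fix p
  obtain f where f: "f \<in> fr p" using fr_nonempty by blast
  obtain e U where e: "e p = f" "p \<in> U" "local_frame M U e" using ex_local_frame[OF f] by blast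
  have "SF U (\<lambda>q. full_inner m (z q (e q)) (slot i (w q (e q))))" for i
    by (rule full_inner_smooth[OF local_frameD(3)[OF e(3)] section_smooth[OF z e(3)] section_smooth[OF w e(3)]])
  then have "VF U (\<lambda>q h. \<Sum>i\<in>UNIV. full_inner m (z q (e q)) (slot i (w q (e q))) * e q i h)"
    by (rule smooth_vfield_sum[OF local_frameD(3)[OF e(3)] _ local_frameD(2)[OF e(3)]])
  then have "VF U (pairing_field m z w)"
    by (rule smooth_vfield_cong) (rule pairing_field_frame[OF z w local_frameD(1)[OF e(3)], symmetric])
  then show "\<exists>W. p \<in> W \<and> VF W (pairing_field m z w)" using e(2) by blast
qed simp

text \<open>In a local frame \<open>V = \<Sum>\<^sub>i \<langle>z, w\<^sub>i\<rangle> e\<^sub>i\<close>, and the divergence differentiates both the coefficients and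
  the \<open>e\<^sub>i\<close>; the latter gives the Christoffel symbols that are in \<open>tr \<nabla>w\<close> due to its first index.\<close>
lemma divergence_pairing_field:
  assumes z: "z \<in> Secs" and w: "w \<in> Secs"
  shows "divergence (pairing_field m z w) p = pairing (Suc m) (grad z) w p + pairing m z (\<lambda>p f. trc (grad w p f)) p"
proof -
  obtain f where f: "f \<in> fr p" using fr_nonempty by blast
  obtain e U where ep: "e p = f" and p: "p \<in> U" and e: "local_frame M U e" using ex_local_frame[OF f] by blast
  note eT = eT[OF e p] and oU = local_frameD(3)[OF e] and eV = local_frameD(2)[OF e] and eU = local_frameD(1)[OF e]
  note zs = section_smooth[OF z e] and ws = section_smooth[OF w e]
  let ?S = "\<lambda>q. z q (e q)" and ?T = "\<lambda>q. w q (e q)" and ?\<omega> = "\<lambda>i. christoffel e p (e p i)"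
  let ?X = "\<lambda>j q. full_inner m (?S q) (slot j (?T q))" and ?V = "pairing_field m z w"
  have Xs: "SF U (?X j)" for j by (rule full_inner_smooth[OF oU zs ws])
  have V: "VF UNIV ?V" by (rule pairing_field_smooth[OF z w])
  have VU: "VF U ?V" by (rule smooth_vfield_subset[OF V oU]) simp
  have XV: "VF U (\<lambda>q h. \<Sum>j\<in>J. ?X j q *\<^sub>R e q j h)" for J
    using smooth_vfield_sum[where I = J and f = ?X and X = "\<lambda>j q. e q j", OF oU Xs eV] by simp
  have nV: "g p (nabla M p (e p i) ?V) (e p i) = e p i (?X i) + (\<Sum>j\<in>UNIV. ?X j p * ?\<omega> i i j)" for i
  proof -
    have "nabla M p (e p i) ?V = nabla M p (e p i) (\<lambda>q h. \<Sum>j\<in>UNIV. ?X j q *\<^sub>R e q j h)"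
      by (rule lc_local[OF p oU VU XV eT]) (simp add: pairing_field_frame[OF z w eU])
    also have "\<dots> = (\<lambda>h. \<Sum>j\<in>UNIV. e p i (?X j) *\<^sub>R e p j h + ?X j p *\<^sub>R nabla M p (e p i) (\<lambda>q. e q j) h)"
      by (rule lc_sum[OF p oU eV eT Xs eV XV])
    \<comment> \<open>The factors \<open>1\<close> bring the vector into the form of \<open>g_lin\<close>.\<close>
    also have "\<dots> = (\<lambda>h. 1 * (\<Sum>j\<in>UNIV. e p i (?X j) * e p j h) + 1 * (\<Sum>j\<in>UNIV. ?X j p * nabla M p (e p i) (\<lambda>q. e q j) h))"
      by (simp add: sum.distrib)
    finally have nab: "nabla M p (e p i) ?V = (\<lambda>h. 1 * (\<Sum>j\<in>UNIV. e p i (?X j) * e p j h) + 1 * (\<Sum>j\<in>UNIV. ?X j p * nabla M p (e p i) (\<lambda>q. e q j) h))" .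
    note nT = nabla_tangent[OF eV p eT]
    have "g p (nabla M p (e p i) ?V) (e p i) = g p (\<lambda>h. \<Sum>j\<in>UNIV. e p i (?X j) * e p j h) (e p i)
        + g p (\<lambda>h. \<Sum>j\<in>UNIV. ?X j p * nabla M p (e p i) (\<lambda>q. e q j) h) (e p i)"
      unfolding nab by (subst g_lin[OF tangent_sum[OF eT] tangent_sum[OF nT] eT]) simp
    also have "\<dots> = e p i (?X i) + (\<Sum>j\<in>UNIV. ?X j p * ?\<omega> i i j)"
      by (simp add: g_orthonormal_sum(1)[OF fr_orthonormal_at[OF eU[OF p]]] g_sum_left[OF nT eT] christoffel_def)
    finally show ?thesis .
  qed
  have dX: "e p i (?X i) = full_inner m (slot i (grad z p f)) (slot i (w p f)) + full_inner m (z p f) (tensor_deriv e p (e p i) (\<lambda>q. slot i (?T q)))" for i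
  proof -
    have "slot i (grad z p f) = tensor_deriv e p (e p i) ?S" using grad_local[OF z e p] ep by auto
    then show ?thesis using tensor_deriv_metric[OF e p eT zs, where T = "\<lambda>q. slot i (?T q)" and m = m, OF ws] ep by simp
  qed
  have T: "trc (grad w p f) = (\<lambda>l. (\<Sum>i\<in>UNIV. \<Sum>j\<in>UNIV. ?\<omega> i i j *\<^sub>R slot j (w p f) l) + (\<Sum>i\<in>UNIV. tensor_deriv e p (e p i) (\<lambda>q. slot i (?T q)) l))"
  proof
    fix l
    have "grad w p f (i # i # l) = (\<Sum>j\<in>UNIV. ?\<omega> i i j *\<^sub>R slot j (w p f) l) + tensor_deriv e p (e p i) (\<lambda>q. slot i (?T q)) l" for i
      using grad_local[OF w e p, of i "i # l"] ep by (simp add: tensor_deriv_def derivation_ext_Cons add_ac)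
    then show "trc (grad w p f) l = (\<Sum>i\<in>UNIV. \<Sum>j\<in>UNIV. ?\<omega> i i j *\<^sub>R slot j (w p f) l) + (\<Sum>i\<in>UNIV. tensor_deriv e p (e p i) (\<lambda>q. slot i (?T q)) l)"
      by (simp add: trc_def sum.distrib)
  qed
  have "divergence ?V p = (\<Sum>i\<in>UNIV. e p i (?X i)) + (\<Sum>i\<in>UNIV. \<Sum>j\<in>UNIV. ?X j p * ?\<omega> i i j)"
    unfolding divergence_frame[OF V UNIV_I eU[OF p]] nV sum.distrib ..
  also have "\<dots> = full_inner (Suc m) (grad z p f) (w p f) + full_inner m (z p f) (trc (grad w p f))"
    unfolding T full_inner_Suc
    by (simp add: dX[unfolded ep] sum.distrib full_inner_add_right full_inner_sum_right full_inner_scale_right ep mult.commute)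
  finally show ?thesis
    using pairing_frame[OF grad_sections[OF z] w f] pairing_frame[OF z parallel_section[OF parallel_trc grad_sections[OF w]] f] by simp
qed

lemma section_vanishing:
  assumes s: "s \<in> Secs" and K: "closed K" "\<And>p. p \<notin> K \<Longrightarrow> s p = (\<lambda>f l. 0)" and p: "p \<notin> K"
  shows "grad s p f l = 0"
proof (cases "f \<in> fr p")
  case True
  obtain e U where e: "e p = f" "p \<in> U" "local_frame M U e" using ex_local_frame[OF True] by blast
  have o: "open (U \<inter> - K)" using local_frameD(3)[OF e(3)] K(1) by auto
  have eW: "local_frame M (U \<inter> - K) e" by (rule local_frame_subset[OF e(3) o]) simp
  have pW: "p \<in> U \<inter> - K" using p e(2) by simp
  show ?thesis
  proof (cases l)
    case (Cons i l')
    have "grad s p f l = tensor_deriv e p (e p i) (\<lambda>q. s q (e q)) l'"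
      using grad_local[OF s eW pW] e(1) Cons by simp
    also have "tensor_deriv e p (e p i) (\<lambda>q. s q (e q)) = tensor_deriv e p (e p i) (\<lambda>q l. 0)"
      by (rule tensor_deriv_cong[OF eW pW eT[OF eW pW] section_smooth[OF s eW]]) (use K(2) in auto)
    also have "\<dots> l' = 0"
      by (simp add: tensor_deriv_def frame_conn_zero[OF eW pW eT[OF eW pW]] derivation_ext_zero)
    finally show ?thesis .
  qed (simp add: grad_Nil)
qed (simp add: grad_def)

lemma pairing_integrable:
  assumes s: "s \<in> Secs" and t: "t \<in> Secs" and K: "compact K" "\<And>p f l. p \<notin> K \<Longrightarrow> s p f l = 0"
  shows "integrable \<mu> (pairing m s t)"
  by (rule smooth_compact_support_integrable[OF pairing_smooth[OF s t] K(1)])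
    (simp add: pairing_def Let_def full_inner_def K(2))

text \<open>The divergence theorem for the field \<open>\<Sum>\<^sub>i \<langle>z, w\<^sub>i\<rangle> e\<^sub>i\<close>, which has compact support if \<open>z\<close> has.\<close>
lemma integration_by_parts:
  assumes z: "z \<in> Secs" and w: "w \<in> Secs" and K: "compact K" "\<And>p. p \<notin> K \<Longrightarrow> z p = (\<lambda>f l. 0)"
  shows "integral\<^sup>L \<mu> (pairing (Suc m) (grad z) w) = - integral\<^sup>L \<mu> (pairing m z (\<lambda>p f. trc (grad w p f)))"
proof -
  have i1: "integrable \<mu> (pairing (Suc m) (grad z) w)"
    by (rule pairing_integrable[OF grad_sections[OF z] w K(1)])
      (rule section_vanishing[OF z compact_imp_closed[OF K(1)] K(2)])
  have i2: "integrable \<mu> (pairing m z (\<lambda>p f. trc (grad w p f)))"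
    by (rule pairing_integrable[OF z parallel_section[OF parallel_trc grad_sections[OF w]] K(1)]) (simp add: K(2))
  have "integral\<^sup>L \<mu> (divergence (pairing_field m z w)) = 0"
    by (rule divergence_theorem[OF pairing_field_smooth[OF z w] K(1)])
      (simp add: pairing_field_def Let_def full_inner_def K(2))
  then have "integral\<^sup>L \<mu> (pairing (Suc m) (grad z) w) + integral\<^sup>L \<mu> (pairing m z (\<lambda>p f. trc (grad w p f))) = 0"
    by (simp add: divergence_pairing_field[OF z w, abs_def] Bochner_Integration.integral_add[OF i1 i2])
  then show ?thesis by simp
qed

section \<open>Formal adjoints\<close>

lemma L2_inner_sym: "L2_inner M (sym_inner k) s t = integral\<^sup>L \<mu> (pairing k s t) / fact k"
  by (simp add: L2_inner_def pairing_def[abs_def] Let_def sym_inner_full)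

lemma T_Sym_inner_full: "T_Sym_inner k s t = full_inner (Suc k) s t / fact k"
  by (simp add: T_Sym_inner_def sym_inner_full full_inner_Suc sum_divide_distrib)

lemma compact_sectionsD:
  assumes "z \<in> compact_sections M E V"
  obtains K where "z \<in> sections M E V" "compact K" "\<And>p. p \<notin> K \<Longrightarrow> z p = (\<lambda>f l. 0)"
proof -
  have z: "z \<in> sections M E V" and C: "compact (closure {p. z p \<noteq> (\<lambda>f l. 0)})"
    using assms unfolding compact_sections_def by blast+
  show thesis
  proof (rule that[OF z C])
    show "z p = (\<lambda>f l. 0)" if "p \<notin> closure {p. z p \<noteq> (\<lambda>f l. 0)}" for p
      using that closure_subset[of "{p. z p \<noteq> (\<lambda>f l. 0)}"] by blast
  qed
qed

lemma section_scale_fun: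
  assumes s: "s \<in> Secs" and h: "SF UNIV h"
  shows "(\<lambda>p f l. h p *\<^sub>R s p f l) \<in> Secs"
  unfolding sections_def
proof (intro CollectI conjI allI ballI impI)
  fix p f and a :: "real^'n^'n" assume f: "f \<in> fr p" and a: "rotation_matrix a"
  have "s p (frame_act f a) = tensor_act \<rho> (transpose a) (s p f)" using s f a by (simp add: sections_def)
  then show "(\<lambda>l. h p *\<^sub>R s p (frame_act f a) l) = tensor_act \<rho> (transpose a) (\<lambda>l. h p *\<^sub>R s p f l)"
    by (intro ext) (simp only: tensor_act_eq linear_cmul[OF rho_linear[OF rotation_matrix_transpose[OF a]]] index_act_scale)
next
  fix U e l assume e: "local_frame M U e"
  show "SF U (\<lambda>q. h q *\<^sub>R s q (e q) l)"
    by (rule smooth_fun_scaleR[OF smooth_fun_subset[OF h local_frameD(3)[OF e]] section_smooth[OF s e]]) simp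
qed (use section_not_frame[OF s] in auto)

lemma section_diff:
  assumes s: "s \<in> Secs" and t: "t \<in> Secs"
  shows "(\<lambda>p f l. s p f l - t p f l) \<in> Secs"
  unfolding sections_def
proof (intro CollectI conjI allI ballI impI)
  fix p f and a :: "real^'n^'n" assume f: "f \<in> fr p" and a: "rotation_matrix a"
  let ?b = "transpose a"
  have e: "s p (frame_act f a) = tensor_act \<rho> ?b (s p f)" "t p (frame_act f a) = tensor_act \<rho> ?b (t p f)"
    using s t f a by (simp_all add: sections_def)
  have "index_act ?b (\<lambda>l. K l - L l) l = index_act ?b K l - index_act ?b L l" for K L :: "('n, 'e) tensor" and l
    using index_act_add[of ?b K "\<lambda>l. (-1) *\<^sub>R L l" l] index_act_scale[of ?b "-1" L l] by simp
  then show "(\<lambda>l. s p (frame_act f a) l - t p (frame_act f a) l) = tensor_act \<rho> ?b (\<lambda>l. s p f l - t p f l)"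
    by (intro ext) (simp only: e tensor_act_eq linear_diff[OF rho_linear[OF rotation_matrix_transpose[OF a]]])
next
  fix U e l assume e: "local_frame M U e"
  show "SF U (\<lambda>q. s q (e q) l - t q (e q) l)"
    by (rule smooth_fun_diff[OF section_smooth[OF s e] section_smooth[OF t e]])
qed (use section_not_frame[OF s] section_not_frame[OF t] in auto)

text \<open>A section is determined by its products with sections of compact support: test the difference
  \<open>d\<close> of two candidates against \<open>\<psi> d\<close> with bump functions \<open>\<psi>\<close>.\<close>
lemma formal_adjointI:
  assumes x: "x \<in> sections M E (Sym0 k)"
    and adj: "\<And>z. z \<in> compact_sections M E (Sym0 k) \<Longrightarrow> L2_inner M ip' (F z) y = L2_inner M (sym_inner k) z x"
  shows "adjoint_wrt (compact_sections M E (Sym0 k)) (sections M E (Sym0 k))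
     (L2_inner M (sym_inner k)) (L2_inner M ip') F y = x"
  unfolding adjoint_wrt_def
proof (rule the_equality)
  show "x \<in> sections M E (Sym0 k) \<and> (\<forall>z\<in>compact_sections M E (Sym0 k). L2_inner M ip' (F z) y = L2_inner M (sym_inner k) z x)"
    using x adj by blast
  fix x' assume x': "x' \<in> sections M E (Sym0 k) \<and> (\<forall>z\<in>compact_sections M E (Sym0 k). L2_inner M ip' (F z) y = L2_inner M (sym_inner k) z x')"
  define d where "d = (\<lambda>p f l. x' p f l - x p f l)"
  have xS: "x \<in> Secs" and x'S: "x' \<in> Secs" using sectionsD(1) x x' by blast+
  have dS: "d \<in> Secs" unfolding d_def by (rule section_diff[OF x'S xS])
  have d0: "d p f \<in> Sym0 k" if "f \<in> fr p" for p f
    unfolding d_def by (rule Sym0_diff[OF sectionsD(2)[OF conjunct1[OF x'] that] sectionsD(2)[OF x that]])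
  have "d p f = (\<lambda>l. 0)" for p f
  proof (cases "f \<in> fr p")
    case True
    obtain \<psi> B C where \<psi>: "SF UNIV \<psi>" "open B" "p \<in> B" "compact C"
      "\<And>q. q \<in> B \<Longrightarrow> \<psi> q = (1::real)" "\<And>q. \<psi> q \<noteq> 0 \<Longrightarrow> q \<in> C" "\<And>q. \<psi> q \<ge> 0"
      using ex_bump[OF open_UNIV UNIV_I[of p]] by metis
    define z where "z = (\<lambda>p f l. \<psi> p *\<^sub>R d p f l)"
    have zS: "z \<in> Secs" unfolding z_def by (rule section_scale_fun[OF dS \<psi>(1)])
    have z0: "z q = (\<lambda>f l. 0)" if "q \<notin> C" for q
    proof -
      have "\<psi> q = 0" using \<psi>(6) that by blast
      then show ?thesis by (simp add: z_def)
    qed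
    have "z \<in> sections M E (Sym0 k)"
      by (rule sectionsI[OF zS]) (simp add: z_def Sym0_scale d0)
    moreover have "compact (closure {q. z q \<noteq> (\<lambda>f l. 0)})"
    proof -
      have "closure {q. z q \<noteq> (\<lambda>f l. 0)} \<subseteq> C"
        by (rule closure_minimal) (use z0 compact_imp_closed[OF \<psi>(4)] in auto)
      then have e: "C \<inter> closure {q. z q \<noteq> (\<lambda>f l. 0)} = closure {q. z q \<noteq> (\<lambda>f l. 0)}" by blast
      show ?thesis using compact_Int_closed[OF \<psi>(4) closed_closure[of "{q. z q \<noteq> (\<lambda>f l. 0)}"]]
        unfolding e .
    qed
    ultimately have zc: "z \<in> compact_sections M E (Sym0 k)" by (simp add: compact_sections_def)
    have "L2_inner M (sym_inner k) z x' = L2_inner M (sym_inner k) z x"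
      using adj[OF zc] x' zc by auto
    then have "integral\<^sup>L \<mu> (pairing k z x') = integral\<^sup>L \<mu> (pairing k z x)" by (simp add: L2_inner_sym)
    moreover have int: "integrable \<mu> (pairing k z t)" if "t \<in> Secs" for t
      by (rule pairing_integrable[OF zS that \<psi>(4)]) (simp add: z0)
    moreover have "pairing k z d = (\<lambda>q. pairing k z x' q - pairing k z x q)"
      by (auto simp: pairing_def Let_def full_inner_def d_def inner_diff_right sum_subtractf fun_eq_iff)
    ultimately have 0: "integral\<^sup>L \<mu> (pairing k z d) = 0"
      using Bochner_Integration.integral_diff[OF int[OF x'S] int[OF xS]] by simp
    have zd: "pairing k z d q = \<psi> q * pairing k d d q" for q
      by (simp add: pairing_def Let_def z_def full_inner_scale_left)
    have "pairing k z d p = 0"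
    proof (rule smooth_nonneg_integral_zero[OF pairing_smooth[OF zS dS] \<psi>(4)])
      show "pairing k z d q = 0" if "q \<notin> C" for q
        by (simp add: pairing_def Let_def z0[OF that] full_inner_def)
      show "pairing k z d q \<ge> 0" for q
        unfolding zd using \<psi>(7) by (auto intro!: mult_nonneg_nonneg simp: pairing_def Let_def full_inner_def sum_nonneg)
    qed (rule 0)
    then have "full_inner k (d p f) (d p f) = 0"
      using zd[of p] \<psi>(5)[OF \<psi>(3)] pairing_frame[OF dS dS True] by simp
    then show ?thesis by (rule full_inner_nondegenerate[OF Sym0D(1)[OF d0[OF True]]])
  qed (rule section_not_frame[OF dS])
  then show "x' = x" by (simp add: d_def fun_eq_iff)
qed

context
  assumes n: "CARD('n) \<ge> 3"
begin

lemma D0_grad: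
  assumes s: "s \<in> sections M E (Sym0 k)"
  shows "D0 M E k s = (\<lambda>p f. Q1 k (grad s p f))"
proof (intro ext)
  fix p f l
  show "D0 M E k s p f l = Q1 k (grad s p f) l"
  proof (cases "f \<in> fr p")
    case True
    have t: "grad s p f \<in> T_Sym0 k" by (rule sectionsD(2)[OF grad_T_Sym0[OF s] True])
    have "D0 M E k s p f l = q1 k (grad s p f) l" using True by (simp add: D0_def q1_def grad_def)
    then show ?thesis by (simp add: q1_eq[OF n t])
  next
    case False
    then show ?thesis using fun_cong[OF parallel_zero[OF parallel_Q1]] by (simp add: D0_def grad_def)
  qed
qed

lemma D0_sections:
  assumes s: "s \<in> sections M E (Sym0 k)"
  shows "D0 M E k s \<in> sections M E (Sym0 (Suc k))"
  unfolding D0_grad[OF s]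
  by (rule sectionsI[OF parallel_section[OF parallel_Q1 grad_sections[OF sectionsD(1)[OF s]]]])
    (rule Sym0_Q1[OF n sectionsD(2)[OF grad_T_Sym0[OF s]]])

lemma neg_trc_sections:
  assumes t: "t \<in> Secs" and "\<And>p f. f \<in> fr p \<Longrightarrow> trc (grad t p f) \<in> Sym0 k"
  shows "(\<lambda>p f l. (-1) *\<^sub>R trc (grad t p f) l) \<in> sections M E (Sym0 k)"
  by (rule sectionsI[OF parallel_section[OF parallel_scale[OF parallel_trc] grad_sections[OF t]]])
    (intro Sym0_scale assms(2))

lemma L2_inner_neg_trc:
  assumes z: "z \<in> compact_sections M E (Sym0 k)" and t: "t \<in> Secs"
  shows "integral\<^sup>L \<mu> (pairing (Suc k) (grad z) t) / fact k = L2_inner M (sym_inner k) z (\<lambda>p f l. (-1) *\<^sub>R trc (grad t p f) l)"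
proof -
  obtain K where K: "z \<in> sections M E (Sym0 k)" "compact K" "\<And>p. p \<notin> K \<Longrightarrow> z p = (\<lambda>f l. 0)"
    by (rule compact_sectionsD[OF z]) blast
  have "pairing k z (\<lambda>p f l. (-1) *\<^sub>R trc (grad t p f) l) = (\<lambda>p. - pairing k z (\<lambda>p f. trc (grad t p f)) p)"
    unfolding pairing_def[abs_def] Let_def full_inner_scale_right by simp
  then show ?thesis
    using integration_by_parts[OF sectionsD(1)[OF K(1)] t K(2,3), of k] by (simp add: L2_inner_sym)
qed

text \<open>Formally \<open>(q\<^sub>1 \<nabla>)\<^sup>* = \<nabla>\<^sup>* q\<^sub>1\<^sup>*\<close>, where \<open>q\<^sub>1\<^sup>*\<close> is the inclusion.\<close>
lemma D0_adj_grad: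
  assumes t: "t \<in> sections M E (Sym0 (Suc k))"
  shows "D0_adj M E k t = (\<lambda>p f l. (-1) *\<^sub>R trc (grad t p f) l)"
  unfolding D0_adj_def
proof (rule formal_adjointI)
  note tS = sectionsD(1)[OF t]
  show "(\<lambda>p f l. (-1) *\<^sub>R trc (grad t p f) l) \<in> sections M E (Sym0 k)"
    by (rule neg_trc_sections[OF tS]) (rule trc_T_Sym0[OF sectionsD(2)[OF grad_T_Sym0[OF t]]])
  fix z assume z: "z \<in> compact_sections M E (Sym0 k)"
  then have zs: "z \<in> sections M E (Sym0 k)" by (simp add: compact_sections_def)
  have "sym_inner (Suc k) (D0 M E k z p f) (t p f) = full_inner (Suc k) (grad z p f) (t p f) / fact k" if f: "f \<in> fr p" for p f
    using Q1_adjoint[OF n sectionsD(2)[OF grad_T_Sym0[OF zs] f] sectionsD(2)[OF t f]]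
    by (simp add: D0_grad[OF zs] T_Sym_inner_full)
  then have "L2_inner M (sym_inner (Suc k)) (D0 M E k z) t = integral\<^sup>L \<mu> (pairing (Suc k) (grad z) t) / fact k"
    by (simp add: L2_inner_def Let_def some_frame pairing_def[abs_def])
  also have "\<dots> = L2_inner M (sym_inner k) z (\<lambda>p f l. (-1) *\<^sub>R trc (grad t p f) l)"
    by (rule L2_inner_neg_trc[OF z tS])
  finally show "L2_inner M (sym_inner (Suc k)) (D0 M E k z) t = L2_inner M (sym_inner k) z (\<lambda>p f l. (-1) *\<^sub>R trc (grad t p f) l)" .
qed

lemma P3_grad:
  assumes s: "s \<in> sections M E (Sym0 (Suc m))"
  shows "P3 M E (Suc m) s = (\<lambda>p f. P3_proj m (grad s p f))"
proof (intro ext)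
  fix p f l
  show "P3 M E (Suc m) s p f l = P3_proj m (grad s p f) l"
  proof (cases "f \<in> fr p")
    case True
    have t: "grad s p f \<in> T_Sym0 (Suc m)" by (rule sectionsD(2)[OF grad_T_Sym0[OF s] True])
    have "P3 M E (Suc m) s p f l = p3 (Suc m) (grad s p f) l" using True by (simp add: P3_def grad_def)
    then show ?thesis by (simp add: p3_eq[OF n t])
  next
    case False
    then show ?thesis using fun_cong[OF parallel_zero[OF parallel_P3_proj]] by (simp add: P3_def grad_def)
  qed
qed

text \<open>Formally \<open>(p\<^sub>3 \<nabla>)\<^sup>* p\<^sub>3 \<nabla> = \<nabla>\<^sup>* p\<^sub>3\<^sup>* p\<^sub>3 \<nabla> = \<nabla>\<^sup>* p\<^sub>3 \<nabla>\<close>.\<close>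
lemma P3_adj_P3_grad:
  assumes s: "s \<in> sections M E (Sym0 (Suc m))"
  shows "P3_adj M E (Suc m) (P3 M E (Suc m) s) = (\<lambda>p f l. (-1) *\<^sub>R trc (grad (\<lambda>p f. P3_proj m (grad s p f)) p f) l)"
  unfolding P3_adj_def P3_grad[OF s]
proof (rule formal_adjointI)
  let ?t = "\<lambda>p f. P3_proj m (grad s p f)"
  have tS: "?t \<in> Secs" by (rule parallel_section[OF parallel_P3_proj grad_sections[OF sectionsD(1)[OF s]]])
  have t: "?t \<in> sections M E (T_Sym0 (Suc m))"
    by (rule sectionsI[OF tS]) (rule T_Sym0_P3_proj[OF n sectionsD(2)[OF grad_T_Sym0[OF s]]])
  show "(\<lambda>p f l. (-1) *\<^sub>R trc (grad ?t p f) l) \<in> sections M E (Sym0 (Suc m))"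
  proof (rule neg_trc_sections[OF tS])
    show "trc (grad ?t p f) \<in> Sym0 (Suc m)" if "f \<in> fr p" for p f
      unfolding trc_def[abs_def] by (rule Sym0_sum) (rule grad_T_Sym0_slots[OF t that])
  qed
  fix z assume z: "z \<in> compact_sections M E (Sym0 (Suc m))"
  then have zs: "z \<in> sections M E (Sym0 (Suc m))" by (simp add: compact_sections_def)
  have "T_Sym_inner (Suc m) (P3 M E (Suc m) z p f) (?t p f) = full_inner (Suc (Suc m)) (grad z p f) (?t p f) / fact (Suc m)" if f: "f \<in> fr p" for p f
    using P3_proj_adjoint[OF n sectionsD(2)[OF grad_T_Sym0[OF s] f] sectionsD(2)[OF grad_T_Sym0[OF zs] f]]
    by (simp add: P3_grad[OF zs] T_Sym_inner_full)
  then have "L2_inner M (T_Sym_inner (Suc m)) (P3 M E (Suc m) z) ?t = integral\<^sup>L \<mu> (pairing (Suc (Suc m)) (grad z) ?t) / fact (Suc m)"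
    by (simp add: L2_inner_def Let_def some_frame pairing_def[abs_def])
  also have "\<dots> = L2_inner M (sym_inner (Suc m)) z (\<lambda>p f l. (-1) *\<^sub>R trc (grad ?t p f) l)"
    by (rule L2_inner_neg_trc[OF z tS])
  finally show "L2_inner M (T_Sym_inner (Suc m)) (P3 M E (Suc m) z) ?t
    = L2_inner M (sym_inner (Suc m)) z (\<lambda>p f l. (-1) *\<^sub>R trc (grad ?t p f) l)" .
qed

text \<open>With all operators expressed by \<open>\<nabla>\<close>, the parallel operations move past the outer derivative, and
  \<open>weitzenboeck_algebra\<close> applies to the second covariant derivative in each frame. Outside the frame
  bundle all sections vanish by convention.\<close>
lemma weitzenboeck:
  assumes s: "s \<in> sections M E (Sym0 k)" and k: "k \<ge> 1"
  shows "qR_E M E k s p f l = - (real k / (real k + 1)) *\<^sub>R D0_adj M E k (D0 M E k s) p f l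
      + ((real CARD('n) + real k - 2) * (real CARD('n) + 2 * real k - 4) / ((real CARD('n) + 2 * real k - 2) * (real CARD('n) + real k - 3)))
          *\<^sub>R D0 M E (k - 1) (D0_adj M E (k - 1) s) p f l
      + P3_adj M E k (P3 M E k s) p f l"
proof -
  obtain m where m: "k = Suc m" using k by (cases k) auto
  have s': "s \<in> sections M E (Sym0 (Suc m))" using s m by simp
  note sS = sectionsD(1)[OF s] and gS = grad_sections[OF sectionsD(1)[OF s]]
  let ?t = "\<lambda>p f l. (-1) *\<^sub>R trc (grad s p f) l"
  have t: "?t \<in> sections M E (Sym0 m)"
    by (rule neg_trc_sections[OF sS]) (rule trc_T_Sym0[OF sectionsD(2)[OF grad_T_Sym0[OF s']]])
  have A: "D0_adj M E k (D0 M E k s) = (\<lambda>p f l. (-1) *\<^sub>R trc (grad (\<lambda>p f. Q1 k (grad s p f)) p f) l)"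
    using D0_adj_grad[OF D0_sections[OF s]] unfolding D0_grad[OF s] .
  have B: "D0 M E (k - 1) (D0_adj M E (k - 1) s) = (\<lambda>p f. Q1 m (grad ?t p f))"
    using D0_adj_grad[OF s'] D0_grad[OF t] m by simp
  have C: "P3_adj M E k (P3 M E k s) = (\<lambda>p f l. (-1) *\<^sub>R trc (grad (\<lambda>p f. P3_proj m (grad s p f)) p f) l)"
    using P3_adj_P3_grad[OF s'] m by simp
  show ?thesis
  proof (cases "f \<in> fr p")
    case False
    then show ?thesis
      unfolding A B C
      by (simp add: qR_E_def grad_def trc_zero fun_cong[OF parallel_zero[OF parallel_Q1]])
  next
    case True
    let ?H = "grad (grad s) p f"
    have H: "slot j (slot i ?H) \<in> Sym0 (Suc m)" for i j
      by (rule grad_T_Sym0_slots[OF grad_T_Sym0[OF s'] True])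
    have 1: "trc (grad (\<lambda>p f. Q1 k (grad s p f)) p f) l = (\<Sum>i\<in>UNIV. Q1 k (slot i ?H) (i # l))"
      unfolding trc_def using fun_cong[OF grad_parallel[OF parallel_Q1 gS True]] by simp
    have 2: "Q1 m (grad ?t p f) l = - (\<Sum>i\<in>UNIV. tf_mult m (std_basis i) (trc (slot i ?H)) l)"
    proof -
      have "slot i (grad ?t p f) = (\<lambda>l. (-1) *\<^sub>R trc (slot i ?H) l)" for i
        by (rule grad_parallel[OF parallel_scale[OF parallel_trc] gS True])
      moreover have "tf_mult m (std_basis i) (\<lambda>l. (-1) *\<^sub>R K l) l = - tf_mult m (std_basis i) K l" for i and K :: "('n, 'e) tensor"
        using sym_mult_scale[of "std_basis i" "-1" K l] Lop_scale[of "-1" "slot i K" l] by (simp add: tf_mult_slot)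
      ultimately show ?thesis unfolding Q1_tf_mult by (simp only: sum_negf)
    qed
    have 3: "trc (grad (\<lambda>p f. P3_proj m (grad s p f)) p f) l = (\<Sum>i\<in>UNIV. P3_proj m (slot i ?H) (i # l))"
      unfolding trc_def using fun_cong[OF grad_parallel[OF parallel_P3_proj gS True]] by simp
    show ?thesis
      unfolding A B C qR_E_grad[OF s True] 1 2 3 weitzenboeck_algebra[OF n H m] by simp
  qed
qed

end

end

theorem proposition3p3:
  fixes M :: "('m::{t2_space, second_countable_topology}, 'n::finite) oriented_riemannian_data"
    and E :: "('m, 'n, 'e::euclidean_space) associated_bundle_data"
    and k :: nat
    and s :: "'m \<Rightarrow> ('m, 'n) frame \<Rightarrow> ('n, 'e) tensor"
  assumes "CARD('n) \<ge> 3" and "k \<ge> 1"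
    and "oriented_riemannian_manifold M"
    and "associated_bundle_with_connection M E"
    and "s \<in> sections M E (Sym0 k)"
  shows "let n = real CARD('n) in qR_E M E k s = (\<lambda>p f l.
      - (real k / (real k + 1)) *\<^sub>R D0_adj M E k (D0 M E k s) p f l
      + ((n + real k - 2) * (n + 2 * real k - 4) / ((n + 2 * real k - 2) * (n + real k - 3)))
          *\<^sub>R D0 M E (k - 1) (D0_adj M E (k - 1) s) p f l
      + P3_adj M E k (P3 M E k s) p f l)"
proof -
  interpret twisted_manifold M E
    by unfold_locales (use assms in auto)
  show ?thesis
    unfolding Let_def by (intro ext) (rule weitzenboeck[OF assms(1,5,2)])
qed

end
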